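(* Assume (A1)–(A4) and step sizes satisfying (i) $\sum_k\alpha_{ij,k}^2<\infty$ and $\sup_k\alpha_{ij,k+1}/\alpha_{ij,k}<\infty$ for all $(i,j)\in\mathcal{E}$; (ii) $\sum_k\beta_{i,k}^2<\infty$ and $\sup_k\beta_{i,k+1}/\beta_{i,k}<\infty$ for all $i$; (iii) $\sum_k z_k=\infty$ with $z_k=\min\{\alpha_{ij,k}/k^{\nu_{ij}},(i,j)\in\mathcal{E};\beta_{i,k},i\in\mathcal{V}\}$. Then for every $(i,j)\in\mathcal{E}$ the local average data rate of Algorithm SC satisfies $\mathtt{B}_{ij}(k)=O(k^{-\nu_{ij}})$ almost surely. Moreover, if $\nu_{ij}=0$ then $\mathtt{B}_{ij}(k)=1$ for all $k$ almost surely. Finally, if $\nu_{ij}>0$ and the step sizes are $\alpha_{ij,k}=\alpha_{ij,1}/k^{\gamma_{ij}}$, $\beta_{i,k}=\beta_{i,1}/k$ with $\alpha_{ij,1}=\alpha_{ji,1}>0$, $\beta_{i,1}>0$, $1/2<\gamma_{ij}=\gamma_{ji}\le1$, $\nu_{ij}+\gamma_{ij}\le1$ for all edges, and $a>h-1/2$ (with $h,a$ as defined in the context), then almost surely $\mathtt{B}_{ij}(k)\le\dfrac{\exp(\|\theta\|_1/b_{ij})}{(1-\nu_{ij})k^{\nu_{ij}}}+O\!\left(\dfrac{\sqrt{\ln k}}{k^{h-1/2+\nu_{ij}}}\right).$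
   Context: Network: undirected weighted graph with sensor set $\mathcal{V}=\{1,\dots,N\}$, symmetric nonnegative weights $a_{ij}=a_{ji}$, with $a_{ij}>0$ iff $(i,j)\in\mathcal{E}$; the edge set $\mathcal{E}$ is regarded as a set of ordered pairs that is symmetric ($(i,j)\in\mathcal{E}\iff(j,i)\in\mathcal{E}$), $M=|\mathcal{E}|/2$ is the number of undirected edges, and $\mathcal{N}_i=\{j:(i,j)\in\mathcal{E}\}$. The Laplacian is $\mathcal{L}=\mathcal{D}-\mathcal{A}$ with $\mathcal{A}=(a_{ij})$, $\mathcal{D}=\mathrm{diag}(\sum_{j\in\mathcal{N}_i}a_{ij})$; $\lambda_2(\mathcal{L})$ is its second smallest eigenvalue. Observations: unknown $\theta\in\mathbb{R}^n$; sensor $i$ observes $y_{i,k}=H_{i,k}\theta+w_{i,k}$, $k\ge1$, with deterministic $H_{i,k}\in\mathbb{R}^{m_i\times n}$ and noise $w_{i,k}\in\mathbb{R}^{m_i}$. Let $d_{i,k}$ ($i\in\mathcal{V},k\ge1$) be the dithering noises used below, $\mathcal{F}_k=\sigma(w_{i,t},d_{i,t}: i\in\mathcal{V},1\le t\le k)$ and $\mathcal{F}^w_k=\sigma(w_{i,t}: i\in\mathcal{V},1\le t\le k)$. Assumptions. (A1) There is $\bar H>0$ with $\|H_{i,k}\|\le\bar H$ for all $i,k$, and there are a positive integer $p$ and $\delta>0$ with $\frac1p\sum_{t=k}^{k+p-1}\sum_{i=1}^N H_{i,t}^\top H_{i,t}\ge\delta I_n$ for all $k\ge1$. (A2) $\{w_{i,k},\mathcal{F}_k\}$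 is a martingale difference sequence and $\sup_{i,k}\mathbb{E}[\|w_{i,k}\|^\rho\mid\mathcal{F}^w_{k-1}]<\infty$ a.s. for some $\rho>2$. (A3) The graph is connected, i.e. $\mathrm{rank}(\mathcal{L})=N-1$. (A4) The $d_{i,k}$ are i.i.d. with the Laplace distribution $\mathrm{Lap}(0,1)$ (density $f(x)=\frac12e^{-|x|}$, distribution function $F$), mutually independent over all $(i,k)$, and independent of all $w_{j,t}$. Algorithm SC. Inputs: deterministic initial estimates $\hat\theta_{i,0}\in\mathbb{R}^n$; event-triggered coefficients $\nu_{ij}=\nu_{ji}\ge0$; noise coefficients $b_{ij}=b_{ji}>0$; step sizes $\alpha_{ij,k}=\alpha_{ji,k}>0$ ($(i,j)\in\mathcal{E}$) and $\beta_{i,k}>0$. For $k=1,2,\dots$: let $\varphi_k\in\mathbb{R}^n$ be the $l$-th standard basis vector, where $k=nq+l$ with $q\in\mathbb{N}\cup\{0\}$, $l\in\{1,\dots,n\}$; set $x_{i,k}=\varphi_k^\top\hat\theta_{i,k-1}$; set $C_{ij,k}=\nu_{ij}b_{ij}\ln k$; set $s_{ij,k}=1$ if $x_{i,k}+b_{ij}d_{i,k}>0$ and $s_{ij,k}=-1$ otherwise. Sensor $i$ sends the one-bit message $s_{ij,k}$ to neighbor $j$ iff $|x_{i,k}+b_{ij}d_{i,k}|>C_{ij,k}$; sensor $i$ sets $\hat s_{ji,k}=s_{ji,k}$ if it received $s_{ji,k}$ from $j$, and $\hat s_{ji,k}=0$ otherwise. With $G_{ij,k}(x)=F((x-C_{ij,k})/b_{ij})-F((-x-C_{ij,k})/b_{ij})$,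 update $\check\theta_{i,k}=\hat\theta_{i,k-1}+\varphi_k\sum_{j\in\mathcal{N}_i}\alpha_{ij,k}a_{ij}(\hat s_{ji,k}-G_{ij,k}(x_{i,k}))$, $\hat\theta_{i,k}=\check\theta_{i,k}+\beta_{i,k}H_{i,k}^\top(y_{i,k}-H_{i,k}\hat\theta_{i,k-1})$. Data rates: $\zeta_{ij}(t)\in\{0,1\}$ is the number of bits sensor $i$ sends to $j$ at time $t$ (i.e. $1$ iff $|x_{i,t}+b_{ij}d_{i,t}|>C_{ij,t}$). Local average data rate $\mathtt{B}_{ij}(k)=\frac1k\sum_{t=1}^k\zeta_{ij}(t)$; global average data rate $\mathtt{B}(k)=\frac{1}{2kM}\sum_{(i,j)\in\mathcal{E}}\sum_{t=1}^k\zeta_{ij}(t)$. Constants for the polynomial step-size case: $h=\min_{(i,j)\in\mathcal{E}}(\nu_{ij}/2+\gamma_{ij})$, $\mathcal{E}'=\{(i,j)\in\mathcal{E}:\nu_{ij}+\gamma_{ij}=1\}$, $\underline\beta=\min_i\beta_{i,1}$, $m'=\min_{(i,j)\in\mathcal{E}'}\alpha_{ij,1}e^{-\|\theta\|_1/b_{ij}}/b_{ij}$, and $a=\delta\underline\beta/N$ if $\mathcal{E}'=\varnothing$, $a=\frac{\delta\lambda_2(\mathcal{L})\underline\beta m'}{2Nn\bar H^2\underline\beta+N\lambda_2(\mathcal{L})m'}$ otherwise. For random $X_k$ and positive $r_k$, "$X_k=O(r_k)$ a.s." means $\sup_k|X_k|/r_k<\infty$ almost surely. *)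

theory Defs
  imports "HOL-Probability.Probability" "Jordan_Normal_Form.Char_Poly"
begin

text \<open>Sensors are indexed 0..N-1; vectors in R^n are functions nat => real used on
  the coordinates 0..n-1; an m x n matrix is a function row => column => real.\<close>

definition edges :: "nat \<Rightarrow> (nat \<Rightarrow> nat \<Rightarrow> real) \<Rightarrow> (nat \<times> nat) set" where
  "edges N a = {(i, j). i < N \<and> j < N \<and> 0 < a i j}"

definition nbrs :: "nat \<Rightarrow> (nat \<Rightarrow> nat \<Rightarrow> real) \<Rightarrow> nat \<Rightarrow> nat set" where
  "nbrs N a i = {j. (i, j) \<in> edges N a}"

definition graph_connected :: "nat \<Rightarrow> (nat \<Rightarrow> nat \<Rightarrow> real) \<Rightarrow> bool" where
  "graph_connected N a \<longleftrightarrow>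
     (\<forall>i<N. \<forall>j<N. (\<lambda>x y. (x, y) \<in> edges N a)\<^sup>*\<^sup>* i j)"

definition laplacian :: "nat \<Rightarrow> (nat \<Rightarrow> nat \<Rightarrow> real) \<Rightarrow> real mat" where
  "laplacian N a = Matrix.mat N N (\<lambda>(i, j).
      (if i = j then (\<Sum>l\<in>nbrs N a i. a i l) else 0) - a i j)"

text \<open>Eigenvalues (with multiplicity, in increasing order) of a real matrix whose
  characteristic polynomial splits over the reals (e.g. a symmetric one).\<close>
definition sorted_eigenvalues :: "real mat \<Rightarrow> real list" where
  "sorted_eigenvalues L = (SOME xs. sorted xs \<and> char_poly L = (\<Prod>x\<leftarrow>xs. [:-x, 1:]))"

definition lambda2 :: "real mat \<Rightarrow> real" where
  "lambda2 L = sorted_eigenvalues L ! 1"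

text \<open>phi_k = e_l with k = n q + l, l in {1..n}; as a 0-based coordinate index this is (k-1) mod n.\<close>
definition coord :: "nat \<Rightarrow> nat \<Rightarrow> nat" where
  "coord n k = (k - 1) mod n"

definition lap_cdf :: "real \<Rightarrow> real" where
  "lap_cdf x = (if x < 0 then exp x / 2 else 1 - exp (- x) / 2)"

definition obs :: "nat \<Rightarrow> (nat \<Rightarrow> nat \<Rightarrow> nat \<Rightarrow> nat \<Rightarrow> real) \<Rightarrow> (nat \<Rightarrow> real)
    \<Rightarrow> (nat \<Rightarrow> nat \<Rightarrow> nat \<Rightarrow> real) \<Rightarrow> nat \<Rightarrow> nat \<Rightarrow> nat \<Rightarrow> real" where
  "obs n H theta wr = (\<lambda>i k r. (\<Sum>c<n. H i k r c * theta c) + wr i k r)"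

text \<open>One step (time k >= 1) of Algorithm SC: maps the estimates hat theta_{.,k-1}
  (P i c = c-th coordinate of sensor i's estimate) to hat theta_{.,k}.
  Arguments: N n a nu b alpha beta m H y d, where y i k r are the observations and
  d i k the (realised) dithering noises.\<close>
definition sc_step :: "nat \<Rightarrow> nat \<Rightarrow> (nat \<Rightarrow> nat \<Rightarrow> real) \<Rightarrow> (nat \<Rightarrow> nat \<Rightarrow> real)
    \<Rightarrow> (nat \<Rightarrow> nat \<Rightarrow> real) \<Rightarrow> (nat \<Rightarrow> nat \<Rightarrow> nat \<Rightarrow> real) \<Rightarrow> (nat \<Rightarrow> nat \<Rightarrow> real)
    \<Rightarrow> (nat \<Rightarrow> nat) \<Rightarrow> (nat \<Rightarrow> nat \<Rightarrow> nat \<Rightarrow> nat \<Rightarrow> real) \<Rightarrow> (nat \<Rightarrow> nat \<Rightarrow> nat \<Rightarrow> real)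
    \<Rightarrow> (nat \<Rightarrow> nat \<Rightarrow> real) \<Rightarrow> nat \<Rightarrow> (nat \<Rightarrow> nat \<Rightarrow> real) \<Rightarrow> (nat \<Rightarrow> nat \<Rightarrow> real)" where
  "sc_step N n a nu b alpha beta m H y d k P = (\<lambda>i c.
     let l = coord n k;
         x = (\<lambda>j. P j l);
         C = (\<lambda>i j. nu i j * b i j * ln (real k));
         z = (\<lambda>j i. x j + b j i * d j k);
         shat = (\<lambda>j i. if \<bar>z j i\<bar> > C j i then (if z j i > 0 then 1 else - 1) else (0::real));
         G = (\<lambda>i j v. lap_cdf ((v - C i j) / b i j) - lap_cdf ((- v - C i j) / b i j));
         chk = P i c + (if c = l then
                 (\<Sum>j\<in>nbrs N a i. alpha i j k * a i j * (shat j i - G i j (x i))) else 0)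
     in chk + beta i k * (\<Sum>r<m i. H i k r c * (y i k r - (\<Sum>c'<n. H i k r c' * P i c'))))"

primrec sc_est :: "nat \<Rightarrow> nat \<Rightarrow> (nat \<Rightarrow> nat \<Rightarrow> real) \<Rightarrow> (nat \<Rightarrow> nat \<Rightarrow> real)
    \<Rightarrow> (nat \<Rightarrow> nat \<Rightarrow> real) \<Rightarrow> (nat \<Rightarrow> nat \<Rightarrow> nat \<Rightarrow> real) \<Rightarrow> (nat \<Rightarrow> nat \<Rightarrow> real)
    \<Rightarrow> (nat \<Rightarrow> nat) \<Rightarrow> (nat \<Rightarrow> nat \<Rightarrow> nat \<Rightarrow> nat \<Rightarrow> real) \<Rightarrow> (nat \<Rightarrow> nat \<Rightarrow> nat \<Rightarrow> real)
    \<Rightarrow> (nat \<Rightarrow> nat \<Rightarrow> real) \<Rightarrow> (nat \<Rightarrow> nat \<Rightarrow> real) \<Rightarrow> nat \<Rightarrow> (nat \<Rightarrow> nat \<Rightarrow> real)" where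
  "sc_est N n a nu b alpha beta m H y d th0 0 = th0"
| "sc_est N n a nu b alpha beta m H y d th0 (Suc k) =
     sc_step N n a nu b alpha beta m H y d (Suc k) (sc_est N n a nu b alpha beta m H y d th0 k)"

text \<open>zeta_{ij}(t): number of bits sensor i sends to j at time t >= 1.\<close>
definition sc_bits :: "nat \<Rightarrow> nat \<Rightarrow> (nat \<Rightarrow> nat \<Rightarrow> real) \<Rightarrow> (nat \<Rightarrow> nat \<Rightarrow> real)
    \<Rightarrow> (nat \<Rightarrow> nat \<Rightarrow> real) \<Rightarrow> (nat \<Rightarrow> nat \<Rightarrow> nat \<Rightarrow> real) \<Rightarrow> (nat \<Rightarrow> nat \<Rightarrow> real)
    \<Rightarrow> (nat \<Rightarrow> nat) \<Rightarrow> (nat \<Rightarrow> nat \<Rightarrow> nat \<Rightarrow> nat \<Rightarrow> real) \<Rightarrow> (nat \<Rightarrow> nat \<Rightarrow> nat \<Rightarrow> real)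
    \<Rightarrow> (nat \<Rightarrow> nat \<Rightarrow> real) \<Rightarrow> (nat \<Rightarrow> nat \<Rightarrow> real) \<Rightarrow> nat \<Rightarrow> nat \<Rightarrow> nat \<Rightarrow> real" where
  "sc_bits N n a nu b alpha beta m H y d th0 i j t =
     (if \<bar>sc_est N n a nu b alpha beta m H y d th0 (t - 1) i (coord n t) + b i j * d i t\<bar>
           > nu i j * b i j * ln (real t) then 1 else 0)"

definition sc_rate :: "nat \<Rightarrow> nat \<Rightarrow> (nat \<Rightarrow> nat \<Rightarrow> real) \<Rightarrow> (nat \<Rightarrow> nat \<Rightarrow> real)
    \<Rightarrow> (nat \<Rightarrow> nat \<Rightarrow> real) \<Rightarrow> (nat \<Rightarrow> nat \<Rightarrow> nat \<Rightarrow> real) \<Rightarrow> (nat \<Rightarrow> nat \<Rightarrow> real)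
    \<Rightarrow> (nat \<Rightarrow> nat) \<Rightarrow> (nat \<Rightarrow> nat \<Rightarrow> nat \<Rightarrow> nat \<Rightarrow> real) \<Rightarrow> (nat \<Rightarrow> nat \<Rightarrow> nat \<Rightarrow> real)
    \<Rightarrow> (nat \<Rightarrow> nat \<Rightarrow> real) \<Rightarrow> (nat \<Rightarrow> nat \<Rightarrow> real) \<Rightarrow> nat \<Rightarrow> nat \<Rightarrow> nat \<Rightarrow> real" where
  "sc_rate N n a nu b alpha beta m H y d th0 i j k =
     (1 / real k) * (\<Sum>t = 1..k. sc_bits N n a nu b alpha beta m H y d th0 i j t)"

definition gen_alg :: "'a measure \<Rightarrow> ('a \<Rightarrow> real) set \<Rightarrow> 'a measure" where
  "gen_alg M X = sigma (space M) (\<Union>f\<in>X. {f -` A \<inter> space M | A. A \<in> sets borel})"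

definition filt_wd :: "'a measure \<Rightarrow> nat \<Rightarrow> (nat \<Rightarrow> nat) \<Rightarrow> (nat \<Rightarrow> nat \<Rightarrow> 'a \<Rightarrow> nat \<Rightarrow> real)
    \<Rightarrow> (nat \<Rightarrow> nat \<Rightarrow> 'a \<Rightarrow> real) \<Rightarrow> nat \<Rightarrow> 'a measure" where
  "filt_wd M N m w d k = gen_alg M
     ({(\<lambda>\<omega>. w i t \<omega> r) | i t r. i < N \<and> 1 \<le> t \<and> t \<le> k \<and> r < m i}
      \<union> {d i t | i t. i < N \<and> 1 \<le> t \<and> t \<le> k})"

definition filt_w :: "'a measure \<Rightarrow> nat \<Rightarrow> (nat \<Rightarrow> nat) \<Rightarrow> (nat \<Rightarrow> nat \<Rightarrow> 'a \<Rightarrow> nat \<Rightarrow> real)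
    \<Rightarrow> nat \<Rightarrow> 'a measure" where
  "filt_w M N m w k = gen_alg M
     {(\<lambda>\<omega>. w i t \<omega> r) | i t r. i < N \<and> 1 \<le> t \<and> t \<le> k \<and> r < m i}"

definition alg_all_w :: "'a measure \<Rightarrow> nat \<Rightarrow> (nat \<Rightarrow> nat) \<Rightarrow> (nat \<Rightarrow> nat \<Rightarrow> 'a \<Rightarrow> nat \<Rightarrow> real)
    \<Rightarrow> 'a measure" where
  "alg_all_w M N m w = gen_alg M
     {(\<lambda>\<omega>. w i t \<omega> r) | i t r. i < N \<and> 1 \<le> t \<and> r < m i}"

definition norm1 :: "nat \<Rightarrow> (nat \<Rightarrow> real) \<Rightarrow> real" where
  "norm1 n theta = (\<Sum>c<n. \<bar>theta c\<bar>)"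

definition h_const :: "nat \<Rightarrow> (nat \<Rightarrow> nat \<Rightarrow> real) \<Rightarrow> (nat \<Rightarrow> nat \<Rightarrow> real) \<Rightarrow> (nat \<Rightarrow> nat \<Rightarrow> real) \<Rightarrow> real" where
  "h_const N a nu gamma = Min {nu i j / 2 + gamma i j | i j. (i, j) \<in> edges N a}"

definition edges' :: "nat \<Rightarrow> (nat \<Rightarrow> nat \<Rightarrow> real) \<Rightarrow> (nat \<Rightarrow> nat \<Rightarrow> real) \<Rightarrow> (nat \<Rightarrow> nat \<Rightarrow> real) \<Rightarrow> (nat \<times> nat) set" where
  "edges' N a nu gamma = {(i, j). (i, j) \<in> edges N a \<and> nu i j + gamma i j = 1}"

definition beta_low :: "nat \<Rightarrow> (nat \<Rightarrow> nat \<Rightarrow> real) \<Rightarrow> real" where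
  "beta_low N beta = Min {beta i 1 | i. i < N}"

definition m'_const :: "nat \<Rightarrow> nat \<Rightarrow> (nat \<Rightarrow> nat \<Rightarrow> real) \<Rightarrow> (nat \<Rightarrow> nat \<Rightarrow> real) \<Rightarrow> (nat \<Rightarrow> nat \<Rightarrow> real)
    \<Rightarrow> (nat \<Rightarrow> nat \<Rightarrow> real) \<Rightarrow> (nat \<Rightarrow> nat \<Rightarrow> nat \<Rightarrow> real) \<Rightarrow> (nat \<Rightarrow> real) \<Rightarrow> real" where
  "m'_const N n a nu gamma b alpha theta =
     Min {alpha i j 1 * exp (- norm1 n theta / b i j) / b i j | i j. (i, j) \<in> edges' N a nu gamma}"

definition a_const :: "nat \<Rightarrow> nat \<Rightarrow> (nat \<Rightarrow> nat \<Rightarrow> real) \<Rightarrow> (nat \<Rightarrow> nat \<Rightarrow> real) \<Rightarrow> (nat \<Rightarrow> nat \<Rightarrow> real)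
    \<Rightarrow> (nat \<Rightarrow> nat \<Rightarrow> real) \<Rightarrow> (nat \<Rightarrow> nat \<Rightarrow> nat \<Rightarrow> real) \<Rightarrow> (nat \<Rightarrow> nat \<Rightarrow> real) \<Rightarrow> (nat \<Rightarrow> real)
    \<Rightarrow> real \<Rightarrow> real \<Rightarrow> real" where
  "a_const N n a nu gamma b alpha beta theta delta Hbar =
     (let bl = beta_low N beta; l2 = lambda2 (laplacian N a);
          mm = m'_const N n a nu gamma b alpha theta
      in if edges' N a nu gamma = {} then delta * bl / real N
         else delta * l2 * bl * mm
              / (2 * real N * real n * Hbar\<^sup>2 * bl + real N * l2 * mm))"

end

theory Submission
  imports Defs "HOL-Real_Asymp.Real_Asymp"
begin

text \<open>The error energy is an almost supermartingale, so the estimates stay bounded almost surely; the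
  conditional probability of sending a bit at time \<open>t\<close> is then at most a constant times
  \<open>t powr - nu\<close>, and exponential moments with Borel--Cantelli carry this over to the number of bits
  actually sent.

  For the refined bound the error is split into a filtered observation noise \<open>eta\<close> of size
  \<open>k powr - s\<close> and a remainder driven only by bounded dithering noise. Subtracting \<open>1 / k\<close> times a
  weighted window of future drift forms from the squared norm of the remainder gives a Lyapunov function
  \<open>Psi\<close> that contracts at the averaged rate provided by persistent excitation and the Poincare
  inequality of the graph. Exponential moments of \<open>k powr (2 * kap) * Psi\<close> grow polynomially, so the
  squared error is \<open>O(ln k / k powr (2 * kap))\<close>. This is used twice: with a crude gain to show that the
  error tends to zero, and then with \<open>kap = h - 1/2\<close> and the asymptotic gain. Since \<open>rho > 2\<close> moments
  are only bounded pathwise, everything is done for a predictably truncated noise, which agrees with the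
  given one on an event of probability arbitrarily close to one.\<close>

section \<open>Laplace dithering\<close>

text \<open>Why exponential moments: the claimed error carries only \<open>sqrt (ln k)\<close>,
  while moments of a fixed order lose a power of \<open>k\<close>. Exponential moments in turn ask
  for bounded noise, hence the filtering; a decay \<open>k powr - s\<close> with
  \<open>s < 1/2\<close> is enough there because the target exponent stays below 1/2. Where
  \<open>h\<close> comes from: at bounded states a message is nonzero with probability of order
  \<open>k powr - nu\<close>, so the dither noise of an edge has conditional variance of order
  \<open>k powr - (2 * gamma + nu)\<close>. Against a contraction of order \<open>1 / k\<close> this
  leaves a squared error of exponent \<open>2 * gamma + nu - 1\<close>, which is
  \<open>2 * (h - 1/2)\<close> for the worst edge. Why a window: one step touches one coordinate and
  one set of regressors, so its drift form is degenerate; the average over \<open>n * p\<close>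
  steps, a multiple of the coordinate cycle and of the excitation length, is positive definite. Why
  two passes: at states of size \<open>X\<close> the slope of the mean message is only known to
  exceed a multiple of \<open>exp (- X / b)\<close>, and the gain \<open>a\<close> uses
  \<open>X = norm1 n theta\<close>, which is legitimate only once convergence is known.\<close>

definition lap_pdf :: "real \<Rightarrow> real" where
  "lap_pdf x = exp (- \<bar>x\<bar>) / 2"

lemma lap_cdf_minus: "lap_cdf (- x) = 1 - lap_cdf x"
proof -
  consider "x < 0" | "x = 0" | "0 < x" by linarith
  thus ?thesis by cases (simp_all add: lap_cdf_def)
qed

lemma lap_cdf_nonneg: "0 \<le> lap_cdf x"
proof (cases "x < 0")
  case False
  hence "exp (- x) \<le> exp 0" by (subst exp_le_cancel_iff) simp
  hence "exp (- x) \<le> 2" by (rule order_trans) simp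
  with False show ?thesis by (simp add: lap_cdf_def)
qed (simp add: lap_cdf_def)

lemma lap_cdf_le_1: "lap_cdf x \<le> 1"
  using lap_cdf_nonneg[of "- x"] unfolding lap_cdf_minus by simp

text \<open>For \<open>x \<ge> 0\<close> the gap is half of the square of \<open>exp x - 1\<close>
  divided by \<open>exp x\<close>. The factor 1/2 is kept because \<open>send_prob_le\<close> adds
  two tails; their sum then has constant 1, which becomes the leading constant of the sharp
  rate.\<close>

lemma lap_cdf_le_exp: "lap_cdf x \<le> exp x / 2"
proof (cases "x < 0")
  case False
  have "0 \<le> (exp x - 1)\<^sup>2" by simp
  hence "2 * exp x \<le> exp x * exp x + 1" by (simp add: power2_eq_square algebra_simps)
  hence "2 - exp (- x) \<le> exp x"
    using exp_gt_zero[of x] by (simp add: exp_minus field_simps)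
  thus ?thesis using False by (simp add: lap_cdf_def field_simps)
qed (simp add: lap_cdf_def)

text \<open>The two branches meet at 0 with the same one-sided derivative 1/2, so the mean value
  theorem is available across 0.\<close>

lemma lap_cdf_has_derivative:
  "(lap_cdf has_real_derivative lap_pdf x) (at x)"
proof -
  consider "x < 0" | "x > 0" | "x = 0" by linarith
  then show ?thesis
  proof cases
    case 1
    have "((\<lambda>x. exp x / 2) has_real_derivative lap_pdf x) (at x)"
      using 1 by (auto intro!: derivative_eq_intros simp: lap_pdf_def)
    thus ?thesis
      by (rule has_field_derivative_transform_within_open[of _ _ _ "{..<0}"]) (use 1 in \<open>auto simp: lap_cdf_def\<close>)
  next
    case 2
    have "((\<lambda>x. 1 - exp (- x) / 2) has_real_derivative lap_pdf x) (at x)"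
      using 2 by (auto intro!: derivative_eq_intros simp: lap_pdf_def)
    thus ?thesis
      by (rule has_field_derivative_transform_within_open[of _ _ _ "{0<..}"]) (use 2 in \<open>auto simp: lap_cdf_def\<close>)
  next
    case 3
    have l: "((\<lambda>x. exp x / 2) has_real_derivative lap_pdf 0) (at 0 within {..0})"
      and r: "((\<lambda>x. 1 - exp (- x) / 2) has_real_derivative lap_pdf 0) (at 0 within {0..})"
      by (auto intro!: derivative_eq_intros simp: lap_pdf_def)
    have "(lap_cdf has_real_derivative lap_pdf 0) (at 0 within {..0})"
      by (rule has_field_derivative_transform_within[OF l, of 1]) (auto simp: lap_cdf_def)
    moreover have "(lap_cdf has_real_derivative lap_pdf 0) (at 0 within {0..})"
      by (rule has_field_derivative_transform_within[OF r, of 1]) (auto simp: lap_cdf_def)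
    ultimately have "(lap_cdf has_real_derivative lap_pdf 0) (at 0 within {..0} \<union> {0..})"
      unfolding has_field_derivative_iff Lim_within_Un by (rule conjI)
    moreover have "{..0} \<union> {0..} = (UNIV :: real set)" by auto
    ultimately show ?thesis unfolding 3 by (simp only:)
  qed
qed

lemma lap_cdf_mono: "x \<le> y \<Longrightarrow> lap_cdf x \<le> lap_cdf y"
proof (rule DERIV_nonneg_imp_nondecreasing[of x y lap_cdf])
  show "\<exists>y. (lap_cdf has_real_derivative y) (at z) \<and> 0 \<le> y" for z
    using lap_cdf_has_derivative[of z] by (auto simp: lap_pdf_def intro!: exI[of _ "lap_pdf z"])
qed

lemma lap_cdf_measurable [measurable]: "lap_cdf \<in> borel_measurable borel"
  unfolding lap_cdf_def[abs_def] by measurable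

text \<open>This is the function \<open>G\<close> of the algorithm: the mean of the ternary message
  of a sensor in state \<open>v\<close>. Its companion \<open>send_prob\<close>, with a plus sign,
  is the second moment, because the message takes the values -1, 0, 1.\<close>

definition msg_mean :: "real \<Rightarrow> real \<Rightarrow> real \<Rightarrow> real" where
  "msg_mean b C v = lap_cdf ((v - C) / b) - lap_cdf ((- v - C) / b)"

definition send_prob :: "real \<Rightarrow> real \<Rightarrow> real \<Rightarrow> real" where
  "send_prob b C v = lap_cdf ((v - C) / b) + lap_cdf ((- v - C) / b)"

lemma msg_mean_measurable [measurable]: "msg_mean b C \<in> borel_measurable borel"
  unfolding msg_mean_def[abs_def] by measurable

lemma send_prob_measurable [measurable]: "send_prob b C \<in> borel_measurable borel"
  unfolding send_prob_def[abs_def] by measurable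

lemma abs_msg_mean_le_1: "\<bar>msg_mean b C v\<bar> \<le> 1"
  using lap_cdf_nonneg[of "(v - C) / b"] lap_cdf_le_1[of "(v - C) / b"]
    lap_cdf_nonneg[of "(- v - C) / b"] lap_cdf_le_1[of "(- v - C) / b"]
  unfolding msg_mean_def by linarith

lemma send_prob_nonneg: "0 \<le> send_prob b C v"
  using lap_cdf_nonneg by (simp add: send_prob_def)

lemma msg_mean_mono: "0 < b \<Longrightarrow> x \<le> y \<Longrightarrow> msg_mean b C x \<le> msg_mean b C y"
  unfolding msg_mean_def by (rule diff_mono; rule lap_cdf_mono; rule divide_right_mono; simp)

lemma send_prob_le:
  assumes "0 < b" "\<bar>v\<bar> \<le> X"
  shows "send_prob b C v \<le> exp (X / b) * exp (- C / b)"
proof -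
  have "exp ((v - C) / b) \<le> exp (X / b) * exp (- C / b)"
    "exp ((- v - C) / b) \<le> exp (X / b) * exp (- C / b)"
    unfolding exp_add[symmetric] add_divide_distrib[symmetric] using assms
    by (auto intro!: divide_right_mono)
  thus ?thesis
    using lap_cdf_le_exp[of "(v - C) / b"] lap_cdf_le_exp[of "(- v - C) / b"]
    by (simp add: send_prob_def)
qed

lemma send_prob_zero: "0 < b \<Longrightarrow> send_prob b 0 v = 1"
  using lap_cdf_minus[of "v / b"] unfolding send_prob_def diff_0_right minus_divide_left by linarith

lemma msg_mean_has_derivative:
  assumes "0 < b"
  shows "(msg_mean b C has_real_derivative (lap_pdf ((v - C) / b) + lap_pdf ((v + C) / b)) / b) (at v)"
proof -
  have "((\<lambda>v. lap_cdf ((v - C) / b) - lap_cdf ((- v - C) / b)) has_real_derivative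
     lap_pdf ((v - C) / b) * (1 / b) - lap_pdf ((- v - C) / b) * (- 1 / b)) (at v)"
    using assms by (intro DERIV_diff DERIV_chain2[OF lap_cdf_has_derivative])
      (auto intro!: derivative_eq_intros simp: field_simps)
  moreover have "lap_pdf ((- v - C) / b) = lap_pdf ((v + C) / b)"
  proof -
    have "(- v - C) / b = - ((v + C) / b)" using assms by (simp add: field_simps)
    thus ?thesis by (simp only: lap_pdf_def abs_minus_cancel)
  qed
  ultimately show ?thesis using assms
    by (simp add: msg_mean_def[abs_def] add_divide_distrib)
qed

text \<open>The distances of \<open>v\<close> from \<open>C\<close> and from \<open>- C\<close> both
  lie between \<open>C - X\<close> and \<open>C + X\<close>, so each density equals
  \<open>exp (- C / b) / 2\<close> up to a factor \<open>exp (X / b)\<close> either way. The common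
  factor \<open>exp (- C / b)\<close> is what turns a slope into a power of time.\<close>

lemma msg_mean_derivative_bounds:
  assumes "0 < b" "0 \<le> C" "\<bar>v\<bar> \<le> X"
  defines "g \<equiv> (lap_pdf ((v - C) / b) + lap_pdf ((v + C) / b)) / b"
  shows "exp (- X / b) * exp (- C / b) / b \<le> g" "g \<le> exp (X / b) * exp (- C / b) / b"
proof -
  have l: "exp (- X / b) * exp (- C / b) / 2 \<le> lap_pdf ((v + s * C) / b)"
    "lap_pdf ((v + s * C) / b) \<le> exp (X / b) * exp (- C / b) / 2" if "s = 1 \<or> s = -1" for s :: real
  proof -
    have "- X - C \<le> - \<bar>v + s * C\<bar>" "- \<bar>v + s * C\<bar> \<le> X - C"
      using assms(1-3) that by auto
    from this[THEN divide_right_mono[where c=b]] assms(1)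
    show "exp (- X / b) * exp (- C / b) / 2 \<le> lap_pdf ((v + s * C) / b)"
      "lap_pdf ((v + s * C) / b) \<le> exp (X / b) * exp (- C / b) / 2"
      by (simp_all add: lap_pdf_def exp_add[symmetric] diff_divide_distrib)
  qed
  show "exp (- X / b) * exp (- C / b) / b \<le> g" "g \<le> exp (X / b) * exp (- C / b) / b"
    unfolding g_def using l[of 1] l[of "-1"] assms
    by (auto intro!: divide_right_mono)
qed

lemma msg_mean_diff:
  assumes "0 < b" "0 \<le> C" "\<bar>x\<bar> \<le> X" "\<bar>y\<bar> \<le> X"
  obtains g where "msg_mean b C x - msg_mean b C y = g * (x - y)"
    "exp (- X / b) * exp (- C / b) / b \<le> g" "g \<le> exp (X / b) * exp (- C / b) / b"
proof -
  have *: "\<exists>g. msg_mean b C v - msg_mean b C u = g * (v - u) \<and>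
    exp (- X / b) * exp (- C / b) / b \<le> g \<and> g \<le> exp (X / b) * exp (- C / b) / b"
    if uv: "u < v" "\<bar>u\<bar> \<le> X" "\<bar>v\<bar> \<le> X" for u v
  proof -
    obtain z where z: "u < z" "z < v" "msg_mean b C v - msg_mean b C u =
      (v - u) * ((lap_pdf ((z - C) / b) + lap_pdf ((z + C) / b)) / b)"
      using MVT2[OF uv(1) msg_mean_has_derivative[OF assms(1)], of C] by blast
    have "\<bar>z\<bar> \<le> X" using z uv by auto
    from msg_mean_derivative_bounds[OF assms(1,2) this] z(3) show ?thesis
      by (metis mult.commute)
  qed
  consider "x < y" | "y < x" | "x = y" by linarith
  then show thesis
  proof cases
    case 1
    from *[OF this assms(3,4)] show thesis
      by (metis that minus_diff_eq mult_minus_right)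
  next
    case 2
    from *[OF this assms(4,3)] that show thesis by blast
  next
    case 3
    \<comment> \<open>At equal arguments every slope satisfies the equation, but the bounds must
      hold as well, so the derivative at the point is taken.\<close>
    from msg_mean_derivative_bounds[OF assms(1,2,3)] 3 show thesis
      by (intro that[of "(lap_pdf ((x - C) / b) + lap_pdf ((x + C) / b)) / b"]) auto
  qed
qed

text \<open>The threshold grows like \<open>ln k\<close> exactly so that the Laplace tail beyond it
  is a power of \<open>k\<close>; the scale \<open>b\<close> cancels.\<close>

lemma powr_eq_exp_threshold:
  assumes "0 < b" "1 \<le> k"
  shows "exp (- (nu * b * ln (real k)) / b) = real k powr - nu"
  using assms by (simp add: powr_def)

lemma lap_tail:
  assumes "0 \<le> t"
  shows "emeasure (density lborel (\<lambda>x. ennreal (exp (- \<bar>x\<bar>) / 2))) {t..} = ennreal (exp (- t) / 2)"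
    "emeasure (density lborel (\<lambda>x. ennreal (exp (- \<bar>x\<bar>) / 2))) {..-t} = ennreal (exp (- t) / 2)"
proof -
  have "(\<integral>\<^sup>+x. ennreal (exp (- x) / 2) * indicator {t..} x \<partial>lborel) = ennreal (0 - (- exp (- t) / 2))"
  proof (rule nn_integral_FTC_atLeast)
    show "((\<lambda>x::real. - exp (- x) / 2) \<longlongrightarrow> 0) at_top"
      by real_asymp
  qed (auto intro!: derivative_eq_intros)
  also have "(\<integral>\<^sup>+x. ennreal (exp (- x) / 2) * indicator {t..} x \<partial>lborel) =
     (\<integral>\<^sup>+x. ennreal (exp (- \<bar>x\<bar>) / 2) * indicator {t..} x \<partial>lborel)"
    using assms by (intro nn_integral_cong) (auto simp: indicator_def)
  finally have *: "(\<integral>\<^sup>+x. ennreal (exp (- \<bar>x\<bar>) / 2) * indicator {t..} x \<partial>lborel) = ennreal (exp (- t) / 2)"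
    by simp
  thus "emeasure (density lborel (\<lambda>x. ennreal (exp (- \<bar>x\<bar>) / 2))) {t..} = ennreal (exp (- t) / 2)"
    by (simp add: emeasure_density)
  have "(\<integral>\<^sup>+x. ennreal (exp (- \<bar>x\<bar>) / 2) * indicator {..-t} x \<partial>lborel) =
     (\<integral>\<^sup>+x. ennreal (exp (- \<bar>x\<bar>) / 2) * indicator {t..} x \<partial>lborel)"
    by (subst nn_integral_real_affine[where c="-1" and t=0])
      (auto intro!: nn_integral_cong simp: indicator_def)
  thus "emeasure (density lborel (\<lambda>x. ennreal (exp (- \<bar>x\<bar>) / 2))) {..-t} = ennreal (exp (- t) / 2)"
    using * by (simp add: emeasure_density)
qed

text \<open>Points have mass 0, so strict and weak inequalities have the same probability. The upper
  tail is expressed at \<open>- t\<close> because this is the shape in which \<open>msg_mean\<close>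
  and \<open>send_prob\<close> contain it.\<close>

lemma (in prob_space) laplace_cdf:
  assumes "distributed M lborel X (\<lambda>x. ennreal (exp (- \<bar>x\<bar>) / 2))"
  shows "measure (distr M borel X) {..t} = lap_cdf t" "measure (distr M borel X) {..<t} = lap_cdf t"
    "measure (distr M borel X) {t<..} = lap_cdf (- t)"
proof -
  have X[measurable]: "X \<in> borel_measurable M" using distributed_measurable[OF assms] by simp
  have D: "distr M borel X = density lborel (\<lambda>x. ennreal (exp (- \<bar>x\<bar>) / 2))"
  proof -
    have "distr M borel X = distr M lborel X" by (rule distr_cong) auto
    thus ?thesis using distributed_distr_eq_density[OF assms] by (rule trans)
  qed
  note ps = prob_space_distr[OF X]
  note fin = prob_space.finite_measure[OF ps]
  have pt: "measure (distr M borel X) {t} = 0" for t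
    unfolding measure_def D by (simp add: emeasure_density nn_integral_cmult_indicator
      nn_integral_indicator_singleton)
  have neg: "measure (distr M borel X) {..t} = lap_cdf t" if "t \<le> 0" for t
    using lap_tail(2)[of "-t"] that unfolding D[symmetric] by (simp add: measure_def lap_cdf_def)
  have *: "measure (distr M borel X) {..t} = measure (distr M borel X) {..<t} + measure (distr M borel X) {t}" for t
    by (subst finite_measure.finite_measure_Union[OF fin, symmetric]) (auto intro!: arg_cong[where f="measure _"])
  have lt: "measure (distr M borel X) {..<t} = measure (distr M borel X) {..t}" for t
    using *[of t] pt[of t] by simp
  have pos: "measure (distr M borel X) {t..} = exp (- t) / 2" if "0 \<le> t" for t
    using lap_tail(1)[of t] that unfolding D[symmetric] by (simp add: measure_def)
  have compl: "measure (distr M borel X) {..<t} = 1 - measure (distr M borel X) {t..}" for t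
    using prob_space.prob_compl[OF ps, of "{t..}"] by (simp add: Compl_eq_Diff_UNIV[symmetric] Compl_atLeast)
  show 1: "measure (distr M borel X) {..t} = lap_cdf t" for t
  proof (cases "t \<le> 0")
    case False
    thus ?thesis using compl[of t] pos[of t] lt[of t] by (simp add: lap_cdf_def)
  qed (rule neg)
  show "measure (distr M borel X) {..<t} = lap_cdf t" using 1 lt by simp
  show "measure (distr M borel X) {t<..} = lap_cdf (- t)"
    using prob_space.prob_compl[OF ps, of "{..t}"] 1[of t] by (simp add: Compl_eq_Diff_UNIV[symmetric] Compl_atMost lap_cdf_minus)
qed

section \<open>The graph Laplacian\<close>

lemma finite_edges: "finite (edges N a)"
  by (rule finite_subset[of _ "{..<N} \<times> {..<N}"]) (auto simp: edges_def)

lemma sum_edges: "(\<Sum>(i, j)\<in>edges N a. f i j) = (\<Sum>i<N. \<Sum>j\<in>nbrs N a i. f i j)"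
proof -
  have "edges N a = Sigma {..<N} (nbrs N a)" by (auto simp: edges_def nbrs_def)
  moreover have "finite (nbrs N a i)" for i
    by (rule finite_subset[of _ "{..<N}"]) (auto simp: nbrs_def edges_def)
  ultimately show ?thesis by (simp add: sum.Sigma)
qed

lemma sum_edges_all:
  assumes "\<And>i j. 0 \<le> a i j"
  shows "(\<Sum>(i, j)\<in>edges N a. a i j * f i j) = (\<Sum>i<N. \<Sum>j<N. a i j * f i j)"
proof -
  have "(\<Sum>(i, j)\<in>edges N a. a i j * f i j) = (\<Sum>(i, j)\<in>{..<N} \<times> {..<N}. a i j * f i j)"
    by (rule sum.mono_neutral_left) (auto simp: edges_def less_le assms)
  thus ?thesis by (simp add: sum.cartesian_product)
qed

context
  fixes N :: nat and a :: "nat \<Rightarrow> nat \<Rightarrow> real"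
  assumes a_sym: "\<And>i j. a i j = a j i" and a_nonneg: "\<And>i j. 0 \<le> a i j"
begin

text \<open>A matrix-free Laplacian on functions of the index, so that the minimisation over a
  sphere can take place in the function space; \<open>laplacian_mult_vec\<close> ties it to the
  matrix.\<close>

definition lap_op :: "(nat \<Rightarrow> real) \<Rightarrow> nat \<Rightarrow> real" where
  "lap_op x i = (\<Sum>j<N. a i j * (x i - x j))"

definition lap_form :: "(nat \<Rightarrow> real) \<Rightarrow> (nat \<Rightarrow> real) \<Rightarrow> real" where
  "lap_form x y = (\<Sum>i<N. lap_op x i * y i)"

lemma lap_form_eq: "2 * lap_form x y = (\<Sum>i<N. \<Sum>j<N. a i j * ((x i - x j) * (y i - y j)))"
proof -
  have 1: "lap_form x y = (\<Sum>i<N. \<Sum>j<N. a i j * (x i - x j) * y i)"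
    by (simp add: lap_form_def lap_op_def sum_distrib_right)
  have 2: "lap_form x y = (\<Sum>i<N. \<Sum>j<N. a i j * (x j - x i) * y j)"
    unfolding 1 by (subst sum.swap) (simp add: a_sym)
  have "2 * lap_form x y = (\<Sum>i<N. \<Sum>j<N. a i j * (x i - x j) * y i) + (\<Sum>i<N. \<Sum>j<N. a i j * (x j - x i) * y j)"
    using 1 2 by simp
  thus ?thesis by (simp add: sum.distrib[symmetric] algebra_simps)
qed

lemma lap_form_sym: "lap_form x y = lap_form y x"
  using lap_form_eq[of x y] lap_form_eq[of y x] by (simp add: mult.commute)

lemma lap_form_nonneg: "0 \<le> lap_form x x"
proof -
  have "0 \<le> 2 * lap_form x x" unfolding lap_form_eq by (intro sum_nonneg) (simp add: a_nonneg)
  thus ?thesis by simp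
qed

lemma sum_lap_op: "(\<Sum>i<N. lap_op x i) = 0"
  using lap_form_eq[of x "\<lambda>_. 1"] by (simp add: lap_form_def)

lemma lap_op_add: "lap_op (\<lambda>i. x i + t * y i) i = lap_op x i + t * lap_op y i"
  unfolding lap_op_def by (simp add: sum_distrib_left sum.distrib[symmetric] algebra_simps)

lemma lap_form_add: "lap_form (\<lambda>i. x i + t * y i) (\<lambda>i. x i + t * y i) =
   lap_form x x + 2 * t * lap_form x y + t\<^sup>2 * lap_form y y"
proof -
  have "lap_form (\<lambda>i. x i + t * y i) (\<lambda>i. x i + t * y i) =
     lap_form x x + t * lap_form x y + t * lap_form y x + t\<^sup>2 * lap_form y y"
    unfolding lap_form_def lap_op_add
    by (simp add: sum_distrib_left sum.distrib[symmetric] algebra_simps power2_eq_square)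
  thus ?thesis using lap_form_sym[of x y] by simp
qed

lemma lap_form_scale: "lap_form (\<lambda>i. t * x i) (\<lambda>i. t * x i) = t\<^sup>2 * lap_form x x"
  using lap_form_add[of "\<lambda>_. 0" t x] by (simp add: lap_form_def lap_op_def)

text \<open>Zero energy forces equal values across every edge, and equality spreads along a
  path.\<close>

lemma lap_form_zero_const:
  assumes "graph_connected N a" "lap_form x x = 0" "i < N" "j < N"
  shows "x i = x j"
proof -
  have "(\<Sum>i<N. \<Sum>j<N. a i j * ((x i - x j) * (x i - x j))) = 0"
    using lap_form_eq[of x x] assms(2) by simp
  hence z: "a i j * ((x i - x j) * (x i - x j)) = 0" if "i < N" "j < N" for i j
    using that by (subst (asm) sum_nonneg_eq_0_iff; (subst (asm) sum_nonneg_eq_0_iff)?)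
      (auto intro!: sum_nonneg simp: a_nonneg)
  have "(\<lambda>x y. (x, y) \<in> edges N a)\<^sup>*\<^sup>* i j" using assms by (simp add: graph_connected_def)
  thus ?thesis
  proof (induction rule: rtranclp_induct)
    case (step y w)
    hence "a y w * ((x y - x w) * (x y - x w)) = 0" "a y w \<noteq> 0"
      using z[of y w] by (auto simp: edges_def)
    hence "x y = x w" unfolding mult_eq_0_iff by simp
    thus ?case using step by simp
  qed simp
qed

text \<open>Coordinates from \<open>N\<close> on are pinned to 0 and the others lie in
  \<open>{-1..1}\<close>, so the set is a closed part of a product of compact sets.\<close>

lemma compact_unit_mean_zero:
  "compact {x :: nat \<Rightarrow> real. (\<forall>i\<ge>N. x i = 0) \<and> (\<Sum>i<N. (x i)\<^sup>2) = 1 \<and> (\<Sum>i<N. x i) = 0}" (is "compact ?K")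
proof -
  define B where "B = PiE UNIV (\<lambda>i::nat. if i < N then {-1..1::real} else {0})"
  have "compactin (product_topology (\<lambda>i. euclidean) UNIV) B"
    unfolding B_def compactin_PiE by (auto simp: compactin_euclidean_iff)
  hence B: "compact B" by (simp add: euclidean_product_topology compactin_euclidean_iff)
  have cont: "continuous_on UNIV (\<lambda>x::nat \<Rightarrow> real. x i)" for i
    by (rule continuous_on_product_coordinates)
  have "closed {x :: nat \<Rightarrow> real. (\<Sum>i<N. (x i)\<^sup>2) = 1}" "closed {x :: nat \<Rightarrow> real. (\<Sum>i<N. x i) = 0}"
    by (intro closed_Collect_eq continuous_intros cont)+
  hence "compact (B \<inter> ({x. (\<Sum>i<N. (x i)\<^sup>2) = 1} \<inter> {x. (\<Sum>i<N. x i) = 0}))"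
    using B by (intro compact_Int_closed closed_Int)
  also have "B \<inter> ({x. (\<Sum>i<N. (x i)\<^sup>2) = 1} \<inter> {x. (\<Sum>i<N. x i) = 0}) = ?K"
  proof -
    have "\<bar>x i\<bar> \<le> 1" if "(\<Sum>i<N. (x i)\<^sup>2) = 1" "i < N" for x :: "nat \<Rightarrow> real" and i
    proof -
      have "(x i)\<^sup>2 \<le> (\<Sum>i<N. (x i)\<^sup>2)" using that by (intro member_le_sum) auto
      thus ?thesis using that by (simp add: abs_square_le_1)
    qed
    note le1 = this
    show ?thesis
    proof (intro equalityI subsetI)
      fix x assume x: "x \<in> B \<inter> ({x. (\<Sum>i<N. (x i)\<^sup>2) = 1} \<inter> {x. (\<Sum>i<N. x i) = 0})"
      have "x i = 0" if "i \<ge> N" for i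
        using x that PiE_mem[of x UNIV "\<lambda>i. if i < N then {-1..1} else {0}" i] by (auto simp: B_def)
      thus "x \<in> ?K" using x by auto
    next
      fix x assume x: "x \<in> ?K"
      have "x i \<in> (if i < N then {-1..1} else {0})" for i
        using x le1[of x i] by (cases "i < N") (auto simp: abs_le_iff)
      thus "x \<in> B \<inter> ({x. (\<Sum>i<N. (x i)\<^sup>2) = 1} \<inter> {x. (\<Sum>i<N. x i) = 0})"
        using x unfolding B_def PiE_def by (auto simp: extensional_def)
    qed
  qed
  finally show ?thesis .
qed

text \<open>Rayleigh quotient on the mean-zero sphere: the minimum is attained by compactness, and
  stationarity makes the minimiser an eigenvector. The mean-zero constraint does no harm because the
  Laplacian maps into mean-zero functions.\<close>

lemma lap_min_eigenvector:
  assumes "2 \<le> N"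
  obtains v mu where "\<And>i. i < N \<Longrightarrow> lap_op v i = mu * v i" "(\<Sum>i<N. (v i)\<^sup>2) = 1" "(\<Sum>i<N. v i) = 0"
    "\<And>x. (\<Sum>i<N. x i) = 0 \<Longrightarrow> mu * (\<Sum>i<N. (x i)\<^sup>2) \<le> lap_form x x"
proof -
  let ?K = "{x :: nat \<Rightarrow> real. (\<forall>i\<ge>N. x i = 0) \<and> (\<Sum>i<N. (x i)\<^sup>2) = 1 \<and> (\<Sum>i<N. x i) = 0}"
  have scal: "\<exists>y\<in>?K. \<forall>i<N. x i = sqrt (\<Sum>i<N. (x i)\<^sup>2) * y i"
    if "(\<Sum>i<N. x i) = 0" "(\<Sum>i<N. (x i)\<^sup>2) \<noteq> 0" for x
  proof -
    let ?s = "\<Sum>i<N. (x i)\<^sup>2"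
    have s: "0 < ?s" using that sum_nonneg[of "{..<N}" "\<lambda>i. (x i)\<^sup>2"] by (auto simp: less_le)
    let ?y = "\<lambda>i. if i < N then x i / sqrt ?s else 0"
    have "(\<Sum>i<N. (?y i)\<^sup>2) = 1" using s by (simp add: power_divide sum_divide_distrib[symmetric])
    moreover have "(\<Sum>i<N. ?y i) = 0" using that by (simp add: sum_divide_distrib[symmetric])
    ultimately have "?y \<in> ?K" by simp
    moreover have "\<forall>i<N. x i = sqrt ?s * ?y i" using s by simp
    ultimately show ?thesis unfolding Bex_def by (intro exI[of _ ?y] conjI)
  qed
  have K_ne: "?K \<noteq> {}"
  proof -
    \<comment> \<open>The difference of the first two unit vectors, once normalised, inhabits the
      constraint set; this is where \<open>N \<ge> 2\<close> enters.\<close>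
    define x :: "nat \<Rightarrow> real" where "x i = (if i = 0 then 1 else if i = 1 then -1 else 0)" for i
    have S: "(\<Sum>i<N. f i) = f 0 + f 1" if "\<And>i. 2 \<le> i \<Longrightarrow> f i = 0" for f :: "nat \<Rightarrow> real"
    proof -
      have "(\<Sum>i<N. f i) = (\<Sum>i\<in>{0,1}. f i)"
        using assms that by (intro sum.mono_neutral_right) (auto simp: numeral_2_eq_2 Suc_le_eq)
      thus ?thesis by simp
    qed
    have "(\<Sum>i<N. x i) = 0" "(\<Sum>i<N. (x i)\<^sup>2) \<noteq> 0"
      by (subst S; simp add: x_def)+
    from scal[OF this] show ?thesis by blast
  qed
  have cont: "continuous_on ?K (\<lambda>x. lap_form x x)"
    unfolding lap_form_def lap_op_def
    by (intro continuous_intros continuous_on_subset[OF continuous_on_product_coordinates]) auto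
  from continuous_attains_inf[OF compact_unit_mean_zero K_ne cont]
  obtain v where v: "v \<in> ?K" and "\<forall>x\<in>?K. lap_form v v \<le> lap_form x x" by (rule bexE)
  from this(2) have min: "lap_form v v \<le> lap_form x x" if "x \<in> ?K" for x using that by (rule bspec)
  define mu where "mu = lap_form v v"
  have cong: "lap_form x x = lap_form y y" if "\<And>i. i < N \<Longrightarrow> x i = y i" for x y
    using that unfolding lap_form_def lap_op_def by (intro sum.cong refl arg_cong2[where f=times]) auto
  have ray: "mu * (\<Sum>i<N. (x i)\<^sup>2) \<le> lap_form x x" if x: "(\<Sum>i<N. x i) = 0" for x
  proof (cases "(\<Sum>i<N. (x i)\<^sup>2) = 0")
    case True
    thus ?thesis using lap_form_nonneg[of x] by simp
  next
    case False
    from scal[OF x False] obtain y where y: "y \<in> ?K" "\<And>i. i < N \<Longrightarrow> x i = sqrt (\<Sum>i<N. (x i)\<^sup>2) * y i" by blast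
    have "lap_form x x = (sqrt (\<Sum>i<N. (x i)\<^sup>2))\<^sup>2 * lap_form y y"
      unfolding lap_form_scale[symmetric] by (rule cong[OF y(2)])
    also have "(sqrt (\<Sum>i<N. (x i)\<^sup>2))\<^sup>2 = (\<Sum>i<N. (x i)\<^sup>2)" by (simp add: sum_nonneg)
    finally have "lap_form x x = lap_form y y * (\<Sum>i<N. (x i)\<^sup>2)" by simp
    thus ?thesis using min[OF y(1)] by (simp only: mu_def mult_right_mono sum_nonneg zero_le_power2)
  qed
  have v1: "(\<Sum>i<N. (v i)\<^sup>2) = 1" "(\<Sum>i<N. v i) = 0" using v by auto
  \<comment> \<open>first variation at the minimiser \<open>v\<close>, in the direction of the residual \<open>lap_op v - mu * v\<close>\<close>
  define w where "w i = lap_op v i - mu * v i" for i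
  have w0: "(\<Sum>i<N. w i) = 0"
    unfolding w_def using sum_lap_op[of v] v1 by (simp add: sum_subtractf sum_distrib_left[symmetric])
  define ww where "ww = (\<Sum>i<N. (w i)\<^sup>2)"
  have vw: "lap_form v w - mu * (\<Sum>i<N. v i * w i) = ww"
    unfolding lap_form_def ww_def w_def
    by (simp add: sum_distrib_left sum_subtractf[symmetric] algebra_simps power2_eq_square)
  have q: "0 \<le> 2 * t * ww + t\<^sup>2 * (lap_form w w - mu * ww)" for t
  proof -
    have "(\<Sum>i<N. v i + t * w i) = 0" using v1 w0 by (simp add: sum.distrib sum_distrib_left[symmetric])
    from ray[OF this] have "mu * (\<Sum>i<N. (v i + t * w i)\<^sup>2) \<le> mu + 2 * t * lap_form v w + t\<^sup>2 * lap_form w w"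
      by (simp add: lap_form_add mu_def)
    moreover have "(\<Sum>i<N. (v i + t * w i)\<^sup>2) = 1 + 2 * t * (\<Sum>i<N. v i * w i) + t\<^sup>2 * ww"
      using v1 by (simp add: power2_sum sum.distrib sum_distrib_left ww_def power_mult_distrib algebra_simps)
    ultimately have "0 \<le> 2 * t * (lap_form v w - mu * (\<Sum>i<N. v i * w i)) + t\<^sup>2 * (lap_form w w - mu * ww)"
      by (simp add: algebra_simps)
    thus ?thesis unfolding vw .
  qed
  have ww0: "0 \<le> ww" unfolding ww_def by (simp add: sum_nonneg)
  have "ww = 0"
  proof (rule ccontr)
    assume "ww \<noteq> 0"
    hence pos: "0 < ww" using ww0 by simp
    \<comment> \<open>\<open>?c\<close> dominates the quadratic coefficient, so at
      \<open>t = - ww / ?c\<close> the expression is at most \<open>- (ww * (ww / ?c))\<close>,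
      which is negative.\<close>
    let ?c = "\<bar>lap_form w w - mu * ww\<bar> + 1"
    let ?t = "- ww / ?c"
    have "?t\<^sup>2 * (lap_form w w - mu * ww) \<le> ?t\<^sup>2 * ?c" by (intro mult_left_mono) auto
    also have "\<dots> = ww * (ww / ?c)" by (simp add: power2_eq_square)
    finally have "2 * ?t * ww + ?t\<^sup>2 * (lap_form w w - mu * ww) \<le> - (ww * (ww / ?c))" by simp
    moreover have "0 < ww * (ww / ?c)" using pos by simp
    ultimately show False using q[of ?t] by linarith
  qed
  hence "w i = 0" if "i < N" for i
    using that unfolding ww_def by (subst (asm) sum_nonneg_eq_0_iff) auto
  hence "lap_op v i = mu * v i" if "i < N" for i using that by (simp add: w_def)
  from that[OF this v1 ray] show thesis by this
qed

lemma laplacian_carrier: "laplacian N a \<in> carrier_mat N N"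
  by (simp add: laplacian_def)

lemma laplacian_entry:
  assumes "i < N" "j < N"
  shows "laplacian N a $$ (i, j) = (if i = j then (\<Sum>l<N. a i l) else 0) - a i j"
proof -
  have "(\<Sum>l\<in>nbrs N a i. a i l) = (\<Sum>l<N. a i l)"
    by (rule sum.mono_neutral_left)
      (use assms a_nonneg in \<open>auto simp: nbrs_def edges_def not_less intro: antisym\<close>)
  thus ?thesis using assms by (auto simp: laplacian_def)
qed

lemma laplacian_mult_vec:
  assumes "i < N" "x \<in> carrier_vec N"
  shows "(laplacian N a *\<^sub>v x) $ i = lap_op (\<lambda>i. x $ i) i"
proof -
  have "(laplacian N a *\<^sub>v x) $ i = (\<Sum>j<N. laplacian N a $$ (i, j) * x $ j)"
    using assms laplacian_carrier
    by (auto simp: scalar_prod_def lessThan_atLeast0 intro!: sum.cong)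
  also have "\<dots> = (\<Sum>j<N. (if i = j then (\<Sum>l<N. a i l) * x $ i else 0) - a i j * x $ j)"
    using assms by (intro sum.cong refl) (auto simp: laplacian_entry algebra_simps)
  also have "\<dots> = (\<Sum>l<N. a i l) * x $ i - (\<Sum>j<N. a i j * x $ j)"
    using assms by (simp add: sum_subtractf)
  finally show ?thesis by (simp add: lap_op_def right_diff_distrib sum_subtractf sum_distrib_right)
qed

text \<open>The usual argument for symmetric matrices: the Hermitian form at an eigenvector equals
  its own conjugate and is also \<open>z\<close> times a nonzero real.\<close>

lemma complex_eigenvalue_laplacian_real:
  assumes "eigenvalue (map_mat complex_of_real (laplacian N a)) z"
  shows "Im z = 0"
proof -
  let ?L = "map_mat complex_of_real (laplacian N a)"
  obtain v where v: "v \<in> carrier_vec N" "v \<noteq> 0\<^sub>v N" "?L *\<^sub>v v = z \<cdot>\<^sub>v v"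
    using assms laplacian_carrier unfolding eigenvalue_def eigenvector_def by auto
  have ev: "(\<Sum>j<N. complex_of_real (laplacian N a $$ (i, j)) * v $ j) = z * v $ i" if "i < N" for i
  proof -
    have "(?L *\<^sub>v v) $ i = (\<Sum>j<N. complex_of_real (laplacian N a $$ (i, j)) * v $ j)"
      using that v(1) laplacian_carrier
      by (auto simp: scalar_prod_def lessThan_atLeast0 intro!: sum.cong)
    thus ?thesis using that v by simp
  qed
  have sym: "laplacian N a $$ (i, j) = laplacian N a $$ (j, i)" if "i < N" "j < N" for i j
    using that by (auto simp: laplacian_entry a_sym)
  let ?S = "\<Sum>i<N. (norm (v $ i))\<^sup>2"
  let ?q = "\<Sum>i<N. cnj (v $ i) * (\<Sum>j<N. complex_of_real (laplacian N a $$ (i, j)) * v $ j)"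
  have q1: "?q = z * of_real ?S"
  proof -
    have "?q = (\<Sum>i<N. cnj (v $ i) * (z * v $ i))" by (intro sum.cong refl) (simp add: ev)
    also have "\<dots> = (\<Sum>i<N. z * of_real ((norm (v $ i))\<^sup>2))"
      unfolding complex_norm_square by (intro sum.cong refl) (simp add: algebra_simps)
    finally show ?thesis by (simp add: sum_distrib_left)
  qed
  have "cnj ?q = (\<Sum>i<N. \<Sum>j<N. v $ i * (complex_of_real (laplacian N a $$ (i, j)) * cnj (v $ j)))"
    by (simp add: sum_distrib_left)
  also have "\<dots> = (\<Sum>j<N. \<Sum>i<N. v $ i * (complex_of_real (laplacian N a $$ (i, j)) * cnj (v $ j)))"
    by (rule sum.swap)
  also have "\<dots> = ?q"
    by (auto simp: sum_distrib_left sym algebra_simps intro!: sum.cong)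
  finally have "cnj (z * of_real ?S) = z * of_real ?S" unfolding q1 .
  moreover have "?S \<noteq> 0"
  proof
    assume "?S = 0"
    hence "v $ i = 0" if "i < N" for i using that by (subst (asm) sum_nonneg_eq_0_iff) auto
    thus False using v by (auto intro!: eq_vecI)
  qed
  ultimately have "cnj z = z" by (simp del: of_real_sum)
  thus ?thesis by (simp add: complex_eq_iff)
qed

text \<open>This makes the choice in \<open>sorted_eigenvalues\<close> well founded. The polynomial
  factors over the complex numbers with real roots, and the factorisation is pulled back along the
  embedding of the reals.\<close>

lemma laplacian_char_poly_splits:
  "\<exists>xs. sorted xs \<and> char_poly (laplacian N a) = (\<Prod>x\<leftarrow>xs. [:- x, 1:])"
proof -
  let ?L = "map_mat complex_of_real (laplacian N a)"
  have c: "?L \<in> carrier_mat N N" using laplacian_carrier by simp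
  obtain zs where zs: "char_poly ?L = (\<Prod>z\<leftarrow>zs. [:- z, 1:])"
    using char_poly_factorized[OF c] by blast
  have "Im z = 0" if "z \<in> set zs" for z
  proof -
    have "poly (char_poly ?L) z = 0" unfolding zs using that by (simp add: poly_prod_list prod_list_zero_iff image_iff) 
    thus ?thesis using eigenvalue_root_char_poly[OF c] complex_eigenvalue_laplacian_real by blast
  qed
  hence re: "map (complex_of_real \<circ> Re) zs = zs" by (auto intro!: map_idI simp: complex_eq_iff)
  have "map_poly complex_of_real (char_poly (laplacian N a)) = char_poly ?L"
    by (rule of_real_hom.char_poly_hom[OF laplacian_carrier, symmetric])
  also have "\<dots> = (\<Prod>z\<leftarrow>map (complex_of_real \<circ> Re) zs. [:- z, 1:])" unfolding zs re ..
  also have "\<dots> = map_poly complex_of_real (\<Prod>x\<leftarrow>map Re zs. [:- x, 1:])"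
  proof (induction zs)
    case (Cons z zs)
    have "map_poly complex_of_real ([:- Re z, 1:] * p) =
      [:- complex_of_real (Re z), 1:] * map_poly complex_of_real p" for p
      by (simp add: poly_eq_iff coeff_map_poly coeff_pCons split: nat.split)
    with Cons show ?case by simp
  qed simp
  finally have "char_poly (laplacian N a) = (\<Prod>x\<leftarrow>map Re zs. [:- x, 1:])"
    by (simp add: poly_eq_iff coeff_map_poly)
  also have "\<dots> = (\<Prod>x\<leftarrow>sort (map Re zs). [:- x, 1:])"
    by (metis (no_types, lifting) mset_map mset_sort prod_mset_prod_list)
  finally show ?thesis by (intro exI[of _ "sort (map Re zs)"]) simp
qed

text \<open>Every eigenvalue is a Rayleigh quotient, hence nonnegative. For the inequality: constant
  vectors contribute the eigenvalue 0, and the variational eigenvalue \<open>mu\<close> is positive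
  by connectedness. In the sorted list \<open>mu\<close> therefore cannot stand first, so the entry
  at index 1 is at most \<open>mu\<close>.\<close>

lemma lambda2_props:
  assumes conn: "graph_connected N a" and N: "2 \<le> N"
  shows "0 \<le> lambda2 (laplacian N a)"
    and "(\<Sum>i<N. x i) = 0 \<Longrightarrow> lambda2 (laplacian N a) * (\<Sum>i<N. (x i)\<^sup>2) \<le> lap_form x x"
proof -
  define xs where "xs = sorted_eigenvalues (laplacian N a)"
  have xs: "sorted xs" "char_poly (laplacian N a) = (\<Prod>x\<leftarrow>xs. [:- x, 1:])"
    using someI_ex[OF laplacian_char_poly_splits] unfolding xs_def sorted_eigenvalues_def by auto
  have ev: "eigenvalue (laplacian N a) k \<longleftrightarrow> k \<in> set xs" for k
    unfolding eigenvalue_root_char_poly[OF laplacian_carrier] xs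
    by (auto simp: poly_prod_list prod_list_zero_iff image_iff)
  have evI: "k \<in> set xs" if "\<And>i. i < N \<Longrightarrow> lap_op v i = k * v i" "i < N" "v i \<noteq> 0" for k v i
  proof -
    let ?v = "Matrix.vec N v"
    have "lap_op (\<lambda>i. ?v $ i) i = lap_op v i" if "i < N" for i
      unfolding lap_op_def using that by (intro sum.cong) auto
    hence "laplacian N a *\<^sub>v ?v = k \<cdot>\<^sub>v ?v"
      using that laplacian_carrier laplacian_mult_vec[of _ ?v]
      by (intro eq_vecI) (auto simp del: index_mult_mat_vec)
    moreover have "?v \<noteq> 0\<^sub>v N" using that by (metis index_vec index_zero_vec(1))
    ultimately have "eigenvector (laplacian N a) ?v k"
      using laplacian_carrier by (auto simp: eigenvector_def)
    thus ?thesis using ev eigenvalue_def by blast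
  qed
  have len: "length xs = N"
    using degree_monic_char_poly[OF laplacian_carrier] degree_linear_factors[of uminus xs] unfolding xs by simp
  have "lambda2 (laplacian N a) \<in> set xs" using len N by (simp add: lambda2_def xs_def[symmetric])
  hence "eigenvalue (laplacian N a) (lambda2 (laplacian N a))" using ev by blast
  then obtain v where v: "v \<in> carrier_vec N" "v \<noteq> 0\<^sub>v N" "laplacian N a *\<^sub>v v = lambda2 (laplacian N a) \<cdot>\<^sub>v v"
    using laplacian_carrier unfolding eigenvalue_def eigenvector_def by auto
  have "lap_op (\<lambda>i. v $ i) i = lambda2 (laplacian N a) * v $ i" if "i < N" for i
    using laplacian_mult_vec[OF that v(1)] that v by simp
  hence "lap_form (\<lambda>i. v $ i) (\<lambda>i. v $ i) = lambda2 (laplacian N a) * (\<Sum>i<N. (v $ i)\<^sup>2)"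
    by (simp add: lap_form_def sum_distrib_left power2_eq_square mult.assoc)
  moreover have "0 < (\<Sum>i<N. (v $ i)\<^sup>2)"
  proof -
    have "(\<Sum>i<N. (v $ i)\<^sup>2) \<noteq> 0"
    proof
      assume "(\<Sum>i<N. (v $ i)\<^sup>2) = 0"
      hence "v $ i = 0" if "i < N" for i using that by (subst (asm) sum_nonneg_eq_0_iff) auto
      thus False using v by (auto intro!: eq_vecI)
    qed
    thus ?thesis using sum_nonneg[of "{..<N}" "\<lambda>i. (v $ i)\<^sup>2"] by (auto simp: less_le)
  qed
  ultimately show "0 \<le> lambda2 (laplacian N a)"
    using lap_form_nonneg[of "\<lambda>i. v $ i"] by (simp add: zero_le_mult_iff)
  assume x: "(\<Sum>i<N. x i) = 0"
  obtain v mu where v: "\<And>i. i < N \<Longrightarrow> lap_op v i = mu * v i" "(\<Sum>i<N. (v i)\<^sup>2) = 1" "(\<Sum>i<N. v i) = 0"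
    "\<And>x. (\<Sum>i<N. x i) = 0 \<Longrightarrow> mu * (\<Sum>i<N. (x i)\<^sup>2) \<le> lap_form x x"
    using lap_min_eigenvector[OF N] by metis
  have "\<exists>i<N. v i \<noteq> 0" using v(2) by (metis (mono_tags, lifting) lessThan_iff power_zero_numeral sum.neutral zero_neq_one)
  then obtain i0 where i0: "i0 < N" "v i0 \<noteq> 0" by blast
  have mu: "mu \<in> set xs" using evI[OF v(1) i0] .
  have zero: "0 \<in> set xs" by (rule evI[of "\<lambda>_. 1" _ 0]) (use N in \<open>auto simp: lap_op_def\<close>)
  have vv: "lap_form v v = mu" using v(1,2)
    by (simp add: lap_form_def mult.assoc sum_distrib_left[symmetric] power2_eq_square[symmetric])
  have "mu \<noteq> 0"
  proof
    assume "mu = 0"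
    hence "v i = v i0" if "i < N" for i using lap_form_zero_const[OF conn _ that i0(1), of v] vv by simp
    hence "(\<Sum>i<N. v i) = (\<Sum>i<N. v i0)" by (intro sum.cong) auto
    thus False using v(3) i0 by simp
  qed
  hence mu_pos: "0 < mu" using vv lap_form_nonneg[of v] by simp
  obtain p where p: "p < length xs" "xs ! p = mu" using mu by (auto simp: in_set_conv_nth)
  obtain q where q: "q < length xs" "xs ! q = 0" using zero by (auto simp: in_set_conv_nth)
  have "p \<noteq> 0"
  proof
    assume "p = 0"
    hence "xs ! p \<le> xs ! q" using xs(1) q by (intro sorted_nth_mono) auto
    thus False using p q mu_pos by simp
  qed
  hence "xs ! 1 \<le> xs ! p" using xs(1) p by (intro sorted_nth_mono) auto
  hence "lambda2 (laplacian N a) \<le> mu" using p by (simp add: lambda2_def xs_def)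
  hence "lambda2 (laplacian N a) * (\<Sum>i<N. (x i)\<^sup>2) \<le> mu * (\<Sum>i<N. (x i)\<^sup>2)"
    by (intro mult_right_mono) (auto intro: sum_nonneg)
  also have "\<dots> \<le> lap_form x x" by (rule v(4)[OF x])
  finally show "lambda2 (laplacian N a) * (\<Sum>i<N. (x i)\<^sup>2) \<le> lap_form x x" .
qed

text \<open>The factor 2 appears because the edge set lists every edge in both orientations.\<close>

lemma lambda2_poincare:
  fixes x :: "nat \<Rightarrow> real"
  assumes conn: "graph_connected N a" and N: "2 \<le> N"
  defines "xb \<equiv> (\<Sum>i<N. x i) / real N"
  shows "2 * lambda2 (laplacian N a) * (\<Sum>i<N. (x i - xb)\<^sup>2) \<le> (\<Sum>(i, j)\<in>edges N a. a i j * (x i - x j)\<^sup>2)"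
proof -
  have "(\<Sum>i<N. x i - xb) = 0" using N by (simp add: xb_def sum_subtractf)
  from lambda2_props(2)[OF conn N this]
  have "2 * lambda2 (laplacian N a) * (\<Sum>i<N. (x i - xb)\<^sup>2) \<le> 2 * lap_form (\<lambda>i. x i - xb) (\<lambda>i. x i - xb)" by simp
  also have "\<dots> = (\<Sum>(i, j)\<in>edges N a. a i j * (x i - x j)\<^sup>2)"
    unfolding lap_form_eq sum_edges_all[OF a_nonneg] by (simp add: power2_eq_square)
  finally show ?thesis .
qed

end

section \<open>Almost supermartingales and exponential moments\<close>

text \<open>Each factor \<open>1 + b\<close> is at most \<open>exp b\<close>. The bound is uniform
  in \<open>k\<close> as soon as \<open>b\<close> and \<open>c\<close> are summable.\<close>

lemma discrete_gronwall:
  fixes s b c :: "nat \<Rightarrow> real"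
  assumes "\<And>k. s (Suc k) \<le> (1 + b k) * s k + c k"
    and b: "\<And>k. 0 \<le> b k" and c: "\<And>k. 0 \<le> c k" and s: "0 \<le> s 0"
  shows "s k \<le> exp (\<Sum>t<k. b t) * (s 0 + (\<Sum>t<k. c t))"
proof (induction k)
  case (Suc k)
  let ?B = "\<Sum>t<k. b t" and ?C = "\<Sum>t<k. c t"
  have nn: "0 \<le> ?C" "0 \<le> ?B" using b c by (auto intro: sum_nonneg)
  have "s (Suc k) \<le> (1 + b k) * s k + c k" by fact
  also have "\<dots> \<le> exp (b k) * (exp ?B * (s 0 + ?C)) + exp (b k + ?B) * c k"
  proof (rule add_mono)
    have "(1 + b k) * s k \<le> (1 + b k) * (exp ?B * (s 0 + ?C))"
      using b[of k] Suc.IH by (intro mult_left_mono) auto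
    also have "\<dots> \<le> exp (b k) * (exp ?B * (s 0 + ?C))"
      using nn s by (intro mult_right_mono exp_ge_add_one_self) auto
    finally show "(1 + b k) * s k \<le> exp (b k) * (exp ?B * (s 0 + ?C))" .
    have "1 \<le> exp (b k + ?B)" using b[of k] nn by simp
    thus "c k \<le> exp (b k + ?B) * c k" using c[of k] mult_right_mono by fastforce
  qed
  also have "\<dots> = exp (\<Sum>t<Suc k. b t) * (s 0 + (\<Sum>t<Suc k. c t))"
    by (simp add: exp_add algebra_simps)
  finally show ?case .
qed simp

locale filtered_prob_space = prob_space M for M :: "'a measure" +
  fixes F :: "nat \<Rightarrow> 'a measure"
  assumes subalg: "\<And>k. subalgebra M (F k)"
    and filtration_mono: "\<And>k. sets (F k) \<subseteq> sets (F (Suc k))"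
begin

lemma space_F: "space (F k) = space M"
  using subalg by (simp add: subalgebra_def)

lemma sets_F_sub: "A \<in> sets (F k) \<Longrightarrow> A \<in> sets M"
  using subalg by (auto simp: subalgebra_def)

lemma meas_F_M: "f \<in> borel_measurable (F k) \<Longrightarrow> f \<in> borel_measurable M"
  using subalg measurable_from_subalg by blast

lemma sets_F_mono: "j \<le> k \<Longrightarrow> sets (F j) \<subseteq> sets (F k)"
  by (rule lift_Suc_mono_le[of "\<lambda>k. sets (F k)"]) (use filtration_mono in auto)

lemma meas_F_mono: "f \<in> borel_measurable (F j) \<Longrightarrow> j \<le> k \<Longrightarrow> f \<in> borel_measurable (F k)"
  using sets_F_mono[of j k] by (auto simp: measurable_def space_F)

text \<open>A maximal inequality. The one-step hypothesis is the conditional inequality in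
  integrated form, over all events of the past. Freezing the process when it first exceeds
  \<open>L\<close> shows that it ever does so with probability at most \<open>K / L\<close>; then
  \<open>L\<close> tends to infinity.\<close>

lemma almost_supermartingale_AE_bounded:
  fixes Y :: "nat \<Rightarrow> 'a \<Rightarrow> real" and b c :: "nat \<Rightarrow> real"
  assumes Y0: "\<And>k \<omega>. 0 \<le> Y k \<omega>"
    and Ym: "\<And>k. Y k \<in> borel_measurable (F k)"
    and Yi: "\<And>k. integrable M (Y k)"
    and step: "\<And>k A. A \<in> sets (F k) \<Longrightarrow>
      (\<integral>\<omega>. indicator A \<omega> * Y (Suc k) \<omega> \<partial>M) \<le> (1 + b k) * (\<integral>\<omega>. indicator A \<omega> * Y k \<omega> \<partial>M) + c k"
    and b: "\<And>k. 0 \<le> b k" "summable b" and c: "\<And>k. 0 \<le> c k" "summable c"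
  shows "AE \<omega> in M. \<exists>C. \<forall>k. Y k \<omega> \<le> C"
proof -
  define A where "A L k = {\<omega> \<in> space M. \<forall>t\<le>k. Y t \<omega> \<le> L}" for L :: real and k
  have AF: "A L k \<in> sets (F k)" for L k
  proof -
    have "{\<omega> \<in> space (F k). Y t \<omega> \<le> L} \<in> sets (F k)" if "t \<le> k" for t
      using meas_F_mono[OF Ym that] by measurable
    hence "(\<Inter>t\<in>{..k}. {\<omega> \<in> space (F k). Y t \<omega> \<le> L}) \<in> sets (F k)"
      by (intro sets.finite_INT) auto
    also have "(\<Inter>t\<in>{..k}. {\<omega> \<in> space (F k). Y t \<omega> \<le> L}) = A L k"
      by (auto simp: A_def space_F)
    finally show ?thesis .
  qed
  have A[measurable]: "A L k \<in> sets M" for L k using AF sets_F_sub by blast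
  have YM[measurable]: "Y k \<in> borel_measurable M" for k using Ym meas_F_M by blast
  have int: "integrable M (\<lambda>\<omega>. indicator B \<omega> * Y k \<omega>)" if "B \<in> sets M" for B k
    using integrable_mult_indicator[OF that Yi[of k]] by simp
  have ii: "integrable M (indicator B :: 'a \<Rightarrow> real)" if "B \<in> sets M" for B
    using that by (simp add: emeasure_eq_measure)
  define K where "K = exp (\<Sum>t. b t) * ((\<integral>\<omega>. Y 0 \<omega> \<partial>M) + (\<Sum>t. c t))"
  have bound: "L * prob (space M - A L k) \<le> K" if L: "0 < L" for L k
  proof -
    \<comment> \<open>Mean of the process stopped on exceeding \<open>L\<close>, with the stopped
      value replaced by \<open>L\<close>; it obeys the same recursion.\<close>
    define s where "s k = (\<integral>\<omega>. indicator (A L k) \<omega> * Y k \<omega> \<partial>M) + L * prob (space M - A L k)" for k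
    have s_step: "s (Suc k) \<le> (1 + b k) * s k + c k" for k
    proof -
      let ?D = "A L k - A L (Suc k)"
      have sub: "A L (Suc k) \<subseteq> A L k" by (auto simp: A_def)
      have "prob (space M - A L (Suc k)) = prob (?D \<union> (space M - A L k))"
        using sub sets.sets_into_space[OF A] by (intro arg_cong[where f=prob]) auto
      also have "\<dots> = prob ?D + prob (space M - A L k)"
        by (rule finite_measure_Union) auto
      finally have 1: "prob (space M - A L (Suc k)) = prob ?D + prob (space M - A L k)" .
      have "(\<integral>\<omega>. indicator (A L (Suc k)) \<omega> * Y (Suc k) \<omega> \<partial>M) + L * prob ?D
        = (\<integral>\<omega>. indicator (A L (Suc k)) \<omega> * Y (Suc k) \<omega> + L * indicator ?D \<omega> \<partial>M)"
        by (subst Bochner_Integration.integral_add) (auto intro!: int ii)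
      \<comment> \<open>On the part that is left at this very step the new value exceeds
        \<open>L\<close>.\<close>
      also have "\<dots> \<le> (\<integral>\<omega>. indicator (A L k) \<omega> * Y (Suc k) \<omega> \<partial>M)"
      proof (rule integral_mono)
        fix \<omega> assume "\<omega> \<in> space M"
        thus "indicator (A L (Suc k)) \<omega> * Y (Suc k) \<omega> + L * indicator ?D \<omega> \<le> indicator (A L k) \<omega> * Y (Suc k) \<omega>"
          using sub by (auto simp: A_def indicator_def le_Suc_eq)
      qed (auto intro!: int ii Bochner_Integration.integrable_add)
      also have "\<dots> \<le> (1 + b k) * (\<integral>\<omega>. indicator (A L k) \<omega> * Y k \<omega> \<partial>M) + c k"
        by (rule step[OF AF])
      finally have "s (Suc k) \<le> (1 + b k) * (\<integral>\<omega>. indicator (A L k) \<omega> * Y k \<omega> \<partial>M) + c k + L * prob (space M - A L k)"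
        unfolding s_def 1 by (simp add: algebra_simps)
      moreover have "L * prob (space M - A L k) \<le> (1 + b k) * (L * prob (space M - A L k))"
        using b(1)[of k] L by (simp add: algebra_simps)
      ultimately show ?thesis unfolding s_def by (simp add: algebra_simps)
    qed
    have s0: "0 \<le> s 0" unfolding s_def using L Y0 by (auto intro!: add_nonneg_nonneg)
    have "s 0 = (\<integral>\<omega>. indicator (A L 0) \<omega> * Y 0 \<omega> + L * indicator (space M - A L 0) \<omega> \<partial>M)"
      unfolding s_def by (subst Bochner_Integration.integral_add) (auto intro!: int ii)
    also have "\<dots> \<le> (\<integral>\<omega>. Y 0 \<omega> \<partial>M)"
      by (rule integral_mono) (auto intro!: int ii Yi Bochner_Integration.integrable_add simp: A_def[of L 0] split: split_indicator)
    finally have s0': "s 0 \<le> (\<integral>\<omega>. Y 0 \<omega> \<partial>M)" .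
    have "L * prob (space M - A L k) \<le> s k"
      unfolding s_def using Y0 by (auto intro!: integral_nonneg_AE)
    also have "\<dots> \<le> exp (\<Sum>t<k. b t) * (s 0 + (\<Sum>t<k. c t))"
      by (rule discrete_gronwall) (use s_step b c s0 in auto)
    also have "\<dots> \<le> K" unfolding K_def
      using s0 s0' b c by (intro mult_mono add_mono) (auto intro!: sum_le_suminf sum_nonneg add_nonneg_nonneg)
    finally show ?thesis .
  qed
  have "K \<ge> 0" unfolding K_def using Y0 c by (auto intro!: mult_nonneg_nonneg add_nonneg_nonneg suminf_nonneg)
  define N where "N L = (\<Union>k. space M - A L k)" for L
  have N[measurable]: "N L \<in> sets M" for L unfolding N_def by measurable
  have NL: "prob (N L) \<le> K / L" if "0 < L" for L
  proof -
    have "(\<lambda>k. prob (space M - A L k)) \<longlonglongrightarrow> prob (N L)"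
      unfolding N_def by (rule finite_Lim_measure_incseq) (auto simp: incseq_def A_def)
    moreover have "prob (space M - A L k) \<le> K / L" for k
      using bound[OF that, of k] that by (simp add: field_simps)
    ultimately show ?thesis by (meson LIMSEQ_le_const2)
  qed
  define Z where "Z = (\<Inter>j. N (real (Suc j)))"
  have Z[measurable]: "Z \<in> sets M" unfolding Z_def by measurable
  have "prob Z \<le> K / real (Suc j)" for j
  proof -
    have "prob Z \<le> prob (N (real (Suc j)))" by (rule finite_measure_mono) (auto simp: Z_def)
    thus ?thesis using NL[of "real (Suc j)"] by simp
  qed
  moreover have "(\<lambda>j. K / real (Suc j)) \<longlonglongrightarrow> 0" by real_asymp
  ultimately have "prob Z \<le> 0" by (intro LIMSEQ_le_const) auto
  hence "prob Z = 0" using measure_nonneg[of M Z] by linarith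
  hence "Z \<in> null_sets M" by (simp add: null_sets_def emeasure_eq_measure)
  hence "AE \<omega> in M. \<omega> \<notin> Z" by (rule AE_not_in)
  thus ?thesis
  proof (rule AE_mp, intro AE_I2 impI)
    fix \<omega> assume "\<omega> \<in> space M" "\<omega> \<notin> Z"
    then obtain j where "\<forall>k. \<omega> \<in> A (real (Suc j)) k" by (auto simp: Z_def N_def)
    thus "\<exists>C. \<forall>k. Y k \<omega> \<le> C" by (auto simp: A_def)
  qed
qed

end

text \<open>Markov's inequality and Borel-Cantelli. Polynomial growth of the moment only affects the
  constant in front of \<open>ln k\<close>. The events \<open>G k\<close> localise: the conclusion
  concerns the paths that stay in all of them.\<close>

lemma (in prob_space) exp_moment_imp_log_bound:
  fixes U :: "nat \<Rightarrow> 'a \<Rightarrow> real" and G :: "nat \<Rightarrow> 'a set"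
  assumes [measurable]: "\<And>k. U k \<in> borel_measurable M" "\<And>k. G k \<in> sets M"
    and int: "\<And>k. k0 \<le> k \<Longrightarrow> integrable M (\<lambda>\<omega>. indicator (G k) \<omega> * exp (U k \<omega>))"
    and bound: "\<And>k. k0 \<le> k \<Longrightarrow> (\<integral>\<omega>. indicator (G k) \<omega> * exp (U k \<omega>) \<partial>M) \<le> K * real k powr q"
  shows "AE \<omega> in M. (\<forall>k\<ge>k0. \<omega> \<in> G k) \<longrightarrow> (\<exists>C>0. \<forall>k\<ge>2. U k \<omega> \<le> C * ln (real k))"
proof -
  \<comment> \<open>At level \<open>q + 2\<close> the moment costs \<open>k powr q\<close>, so
    probabilities of order \<open>k powr - 2\<close> remain, and these are summable.\<close>
  define B where "B k = {\<omega> \<in> space M. \<omega> \<in> G k \<and> (q + 2) * ln (real k) < U k \<omega>}" for k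
  have [measurable]: "B k \<in> sets M" for k unfolding B_def by measurable
  have PB: "prob (B k) \<le> K * real k powr - 2" if k: "max 1 k0 \<le> k" for k
  proof -
    have "real k powr (q + 2) * prob (B k) = (\<integral>\<omega>. real k powr (q + 2) * indicator (B k) \<omega> \<partial>M)"
      by simp
    also have "\<dots> \<le> (\<integral>\<omega>. indicator (G k) \<omega> * exp (U k \<omega>) \<partial>M)"
    proof (rule integral_mono)
      fix \<omega> assume "\<omega> \<in> space M"
      have "real k powr (q + 2) = exp ((q + 2) * ln (real k))" using k by (simp add: powr_def)
      thus "real k powr (q + 2) * indicator (B k) \<omega> \<le> indicator (G k) \<omega> * exp (U k \<omega>)"
        by (auto simp: B_def indicator_def)
    qed (use int k in \<open>auto simp: emeasure_eq_measure\<close>)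
    also have "(\<integral>\<omega>. indicator (G k) \<omega> * exp (U k \<omega>) \<partial>M) \<le> K * real k powr q" using bound k by auto
    finally have "real k powr - (q + 2) * (real k powr (q + 2) * prob (B k)) \<le> real k powr - (q + 2) * (K * real k powr q)"
      by (rule mult_left_mono) simp
    thus ?thesis using k by (simp add: mult.assoc[symmetric] powr_add[symmetric] mult.commute[of _ K])
         (simp add: mult.assoc powr_add[symmetric])
  qed
  have K0: "0 \<le> K"
  proof -
    let ?k = "max 1 k0"
    have "0 \<le> (\<integral>\<omega>. indicator (G ?k) \<omega> * exp (U ?k \<omega>) \<partial>M)" by (rule integral_nonneg_AE) auto
    also have "\<dots> \<le> K * real ?k powr q" by (rule bound) simp
    finally show ?thesis by (auto simp: zero_le_mult_iff)
  qed
  have "summable (\<lambda>k. prob (B k))"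
  proof (rule summable_comparison_test_ev)
    show "eventually (\<lambda>k. norm (prob (B k)) \<le> K * real k powr - 2) sequentially"
      using PB by (auto simp: eventually_sequentially intro!: exI[of _ "max 1 k0"])
    show "summable (\<lambda>k. K * real k powr - 2)"
      by (intro summable_mult) (simp add: summable_real_powr_iff)
  qed
  hence "AE \<omega> in M. eventually (\<lambda>k. \<omega> \<in> space M - B k) sequentially"
    by (intro borel_cantelli_AE1) (auto simp: emeasure_eq_measure)
  thus ?thesis
  proof (rule AE_mp, intro AE_I2 impI)
    fix \<omega> assume w: "\<omega> \<in> space M" and ev: "eventually (\<lambda>k. \<omega> \<in> space M - B k) sequentially"
      and G: "\<forall>k\<ge>k0. \<omega> \<in> G k"
    from ev obtain k1 where k1: "\<And>k. k \<ge> k1 \<Longrightarrow> \<omega> \<notin> B k" by (auto simp: eventually_sequentially)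
    define k2 where "k2 = max k0 k1"
    \<comment> \<open>The finitely many indices up to \<open>k2\<close> are absorbed into the
      constant; dividing by \<open>ln k\<close> is legitimate from \<open>k = 2\<close> on.\<close>
    define C where "C = \<bar>q + 2\<bar> + (\<Sum>k\<in>{2..k2}. \<bar>U k \<omega>\<bar> / ln (real k)) + 1"
    have S0: "0 \<le> (\<Sum>k\<in>{2..k2}. \<bar>U k \<omega>\<bar> / ln (real k))" by (intro sum_nonneg) auto
    have "U k \<omega> \<le> C * ln (real k)" if k: "2 \<le> k" for k
    proof (cases "k \<le> k2")
      case True
      have "\<bar>U k \<omega>\<bar> / ln (real k) \<le> (\<Sum>k\<in>{2..k2}. \<bar>U k \<omega>\<bar> / ln (real k))"
        using True k by (intro member_le_sum) auto
      also have "\<dots> \<le> C" by (simp add: C_def)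
      finally have "\<bar>U k \<omega>\<bar> \<le> C * ln (real k)" using k by (simp add: field_simps)
      thus ?thesis by simp
    next
      case False
      hence "U k \<omega> \<le> (q + 2) * ln (real k)" using k1[of k] G w by (force simp: B_def k2_def)
      also have "\<dots> \<le> C * ln (real k)" using k S0 by (intro mult_right_mono) (auto simp: C_def)
      finally show ?thesis .
    qed
    moreover have "C > 0" using S0 by (simp add: C_def)
    ultimately show "\<exists>C>0. \<forall>k\<ge>2. U k \<omega> \<le> C * ln (real k)" by blast
  qed
qed

text \<open>As \<open>X\<close> is independent of \<open>G\<close>, the pair formed by the sample
  point, observed through \<open>G\<close>, and \<open>X\<close> has a product law. Fubini then
  integrates \<open>X\<close> out while \<open>c\<close> and \<open>Y\<close> are held
  fixed.\<close>

lemma (in prob_space) indep_laplace_freeze: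
  fixes c Y X :: "'a \<Rightarrow> real"
  assumes sub: "subalgebra M G"
    and X: "distributed M lborel X (\<lambda>x. ennreal (exp (- \<bar>x\<bar>) / 2))"
    and ind: "\<And>A B. A \<in> sets G \<Longrightarrow> B \<in> sets borel \<Longrightarrow>
       prob (A \<inter> (X -` B \<inter> space M)) = prob A * prob (X -` B \<inter> space M)"
    and c: "c \<in> borel_measurable G" and Y: "Y \<in> borel_measurable G" and Yi: "integrable M Y"
  shows "(\<integral>\<omega>. Y \<omega> * of_bool (c \<omega> < X \<omega>) \<partial>M) = (\<integral>\<omega>. Y \<omega> * lap_cdf (- c \<omega>) \<partial>M)"
    and "(\<integral>\<omega>. Y \<omega> * of_bool (X \<omega> < c \<omega>) \<partial>M) = (\<integral>\<omega>. Y \<omega> * lap_cdf (c \<omega>) \<partial>M)"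
proof -
  have Xm[measurable]: "X \<in> borel_measurable M" using distributed_measurable[OF X] by simp
  define L where "L = distr M borel X"
  define R where "R = restr_to_subalg M G"
  have setsR: "sets R = sets G" and spaceR: "space R = space M"
    using sub by (auto simp: R_def sets_restr_to_subalg space_restr_to_subalg)
  have idm: "(\<lambda>x. x) \<in> measurable M R"
    using sub setsR spaceR by (auto simp: measurable_def subalgebra_def dest: sets.sets_into_space)
  interpret R: prob_space R unfolding R_def by (rule prob_space_restr_to_subalg[OF sub prob_space_axioms])
  interpret L: prob_space L unfolding L_def by (rule prob_space_distr[OF Xm])
  interpret RL: pair_prob_space R L ..
  have pair: "(\<lambda>\<omega>. (\<omega>, X \<omega>)) \<in> measurable M (R \<Otimes>\<^sub>M L)"
    using idm Xm by (auto simp: L_def intro!: measurable_Pair)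
  \<comment> \<open>It suffices to compare rectangles, and there the claim is the independence
    hypothesis.\<close>
  have eq: "R \<Otimes>\<^sub>M L = distr M (R \<Otimes>\<^sub>M L) (\<lambda>\<omega>. (\<omega>, X \<omega>))"
  proof (rule pair_measure_eqI)
    show "sigma_finite_measure R" "sigma_finite_measure L" by unfold_locales
    fix A B assume AB: "A \<in> sets R" "B \<in> sets L"
    hence A: "A \<in> sets G" "A \<in> sets M" and B: "B \<in> sets borel"
      using setsR sub by (auto simp: L_def subalgebra_def)
    have "emeasure (distr M (R \<Otimes>\<^sub>M L) (\<lambda>\<omega>. (\<omega>, X \<omega>))) (A \<times> B) =
       emeasure M (A \<inter> (X -` B \<inter> space M))"
      using AB pair sets.sets_into_space[OF A(2)]
      by (subst emeasure_distr) (auto intro!: arg_cong[where f="emeasure M"])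
    also have "\<dots> = ennreal (prob A * prob (X -` B \<inter> space M))"
      using ind[OF A(1) B] by (simp add: emeasure_eq_measure)
    also have "\<dots> = emeasure R A * emeasure L B"
      using A B sub by (simp add: R_def L_def emeasure_restr_to_subalg emeasure_distr emeasure_eq_measure ennreal_mult)
    finally show "emeasure R A * emeasure L B = emeasure (distr M (R \<Otimes>\<^sub>M L) (\<lambda>\<omega>. (\<omega>, X \<omega>))) (A \<times> B)" ..
  qed simp
  have YR[measurable]: "Y \<in> borel_measurable R" and cR[measurable]: "c \<in> borel_measurable R"
    using Y c setsR spaceR sub by (auto simp: measurable_def subalgebra_def)
  have YRi: "integrable R Y" unfolding R_def using integrable_in_subalg[OF sub Y Yi] .
  have main: "(\<integral>\<omega>. Y \<omega> * of_bool (P (c \<omega>) (X \<omega>)) \<partial>M) = (\<integral>\<omega>. Y \<omega> * q (c \<omega>) \<partial>M)"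
    if P: "{z \<in> space (borel \<Otimes>\<^sub>M borel). P (fst z) (snd z)} \<in> sets (borel \<Otimes>\<^sub>M borel)"
      and q: "\<And>t. measure L {x. P t x} = q t" and qm: "q \<in> borel_measurable borel"
      and Pt: "\<And>t. {x. P t x} \<in> sets borel" for P :: "real \<Rightarrow> real \<Rightarrow> bool" and q
  proof -
    have m1: "(\<lambda>z. of_bool (P (fst z) (snd z)) :: real) \<in> borel_measurable (borel \<Otimes>\<^sub>M borel)"
    proof -
      have "(\<lambda>z. of_bool (P (fst z) (snd z)) :: real) = indicator {z. P (fst z) (snd z)}"
        by (auto simp: indicator_def)
      thus ?thesis using P by (auto simp: space_pair_measure)
    qed
    have sL: "sets L = sets borel" by (simp add: L_def)
    have "snd \<in> measurable (R \<Otimes>\<^sub>M L) borel"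
      using measurable_snd[of R L] measurable_cong_sets[OF refl sL] by blast
    hence "(\<lambda>z. (c (fst z), snd z)) \<in> measurable (R \<Otimes>\<^sub>M L) (borel \<Otimes>\<^sub>M borel)"
      by measurable
    from measurable_compose[OF this m1]
    have m2[measurable]: "(\<lambda>z. of_bool (P (c (fst z)) (snd z)) :: real) \<in> borel_measurable (R \<Otimes>\<^sub>M L)"
      by simp
    have Yp: "integrable (R \<Otimes>\<^sub>M L) (\<lambda>z. Y (fst z))"
    proof -
      have "integrable (distr (R \<Otimes>\<^sub>M L) R fst) Y" using YRi L.distr_pair_fst[of R] by simp
      thus ?thesis by (subst (asm) integrable_distr_eq) auto
    qed
    have int: "integrable (R \<Otimes>\<^sub>M L) (\<lambda>z. Y (fst z) * of_bool (P (c (fst z)) (snd z)))"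
      by (rule Bochner_Integration.integrable_bound[OF Yp]) (auto split: if_splits)
    have "(\<integral>\<omega>. Y \<omega> * of_bool (P (c \<omega>) (X \<omega>)) \<partial>M) =
       (\<integral>z. Y (fst z) * of_bool (P (c (fst z)) (snd z)) \<partial>(R \<Otimes>\<^sub>M L))"
      by (subst eq, subst integral_distr[OF pair]) auto
    also have "\<dots> = (\<integral>\<omega>. (\<integral>x. Y \<omega> * of_bool (P (c \<omega>) x) \<partial>L) \<partial>R)"
      using RL.integral_fst'[OF int] by simp
    also have "\<dots> = (\<integral>\<omega>. Y \<omega> * q (c \<omega>) \<partial>R)"
    proof (rule Bochner_Integration.integral_cong[OF refl])
      fix \<omega>
      have "(\<lambda>x. of_bool (P (c \<omega>) x) :: real) = indicator {x. P (c \<omega>) x}" by (auto simp: indicator_def)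
      hence "(\<integral>x. of_bool (P (c \<omega>) x) \<partial>L) = q (c \<omega>)"
        using q[of "c \<omega>"] Pt[of "c \<omega>"] by (simp add: sL sets_eq_imp_space_eq[OF sL])
      thus "(\<integral>x. Y \<omega> * of_bool (P (c \<omega>) x) \<partial>L) = Y \<omega> * q (c \<omega>)" by simp
    qed
    also have "\<dots> = (\<integral>\<omega>. Y \<omega> * q (c \<omega>) \<partial>M)"
      unfolding R_def by (rule integral_subalgebra2[OF sub]) (use Y c qm in measurable)
    finally show ?thesis .
  qed
  note cdf = laplace_cdf[OF X, folded L_def]
  show "(\<integral>\<omega>. Y \<omega> * of_bool (c \<omega> < X \<omega>) \<partial>M) = (\<integral>\<omega>. Y \<omega> * lap_cdf (- c \<omega>) \<partial>M)"
    by (rule main) (use cdf(3) in \<open>auto simp: greaterThan_def\<close>)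
  show "(\<integral>\<omega>. Y \<omega> * of_bool (X \<omega> < c \<omega>) \<partial>M) = (\<integral>\<omega>. Y \<omega> * lap_cdf (c \<omega>) \<partial>M)"
    by (rule main) (use cdf(2) in \<open>auto simp: lessThan_def\<close>)
qed

section \<open>The algorithm as a stochastic recursion\<close>

lemma sum_sq_le_card: 
  fixes f :: "'b \<Rightarrow> real"
  shows "(\<Sum>i\<in>I. f i)\<^sup>2 \<le> real (card I) * (\<Sum>i\<in>I. (f i)\<^sup>2)"
  using Cauchy_Schwarz_ineq_sum[of "\<lambda>_. 1" f I] by simp

text \<open>A matrix and its transpose have the same operator norm: pairing \<open>u\<close> with
  the image of \<open>y\<close> under \<open>A\<close>, Cauchy-Schwarz gives \<open>Y * Y\<close> at
  most a multiple of \<open>U * Y\<close>, and one factor \<open>Y\<close> cancels.\<close>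

lemma transpose_bound:
  fixes A :: "nat \<Rightarrow> nat \<Rightarrow> real"
  assumes A: "\<And>x. (\<Sum>r<m. (\<Sum>c<n. A r c * x c)\<^sup>2) \<le> h\<^sup>2 * (\<Sum>c<n. (x c)\<^sup>2)"
  shows "(\<Sum>c<n. (\<Sum>r<m. A r c * u r)\<^sup>2) \<le> h\<^sup>2 * (\<Sum>r<m. (u r)\<^sup>2)"
proof -
  define y where "y c = (\<Sum>r<m. A r c * u r)" for c
  define Y where "Y = (\<Sum>c<n. (y c)\<^sup>2)"
  define U where "U = (\<Sum>r<m. (u r)\<^sup>2)"
  have nn: "0 \<le> Y" "0 \<le> U" by (auto simp: Y_def U_def sum_nonneg)
  have "Y = (\<Sum>c<n. \<Sum>r<m. u r * (A r c * y c))"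
    unfolding Y_def by (intro sum.cong refl) (simp add: y_def[of _] power2_eq_square sum_distrib_left sum_distrib_right mult.commute mult.left_commute)
  also have "\<dots> = (\<Sum>r<m. u r * (\<Sum>c<n. A r c * y c))"
    by (subst sum.swap) (simp add: sum_distrib_left)
  finally have "Y\<^sup>2 \<le> U * (\<Sum>r<m. (\<Sum>c<n. A r c * y c)\<^sup>2)"
    using Cauchy_Schwarz_ineq_sum[of u "\<lambda>r. \<Sum>c<n. A r c * y c" "{..<m}"] by (simp add: U_def)
  also have "\<dots> \<le> U * (h\<^sup>2 * Y)" unfolding Y_def using nn A by (intro mult_left_mono) auto
  finally have "Y * Y \<le> (h\<^sup>2 * U) * Y" by (simp add: power2_eq_square algebra_simps)
  hence "Y \<le> h\<^sup>2 * U" using nn by (cases "Y = 0") (auto simp: mult_le_cancel_right)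
  thus ?thesis by (simp add: Y_def U_def y_def)
qed

definition (in prob_space) L2 :: "('a \<Rightarrow> real) \<Rightarrow> bool" where
  "L2 f \<longleftrightarrow> f \<in> borel_measurable M \<and> integrable M (\<lambda>\<omega>. (f \<omega>)\<^sup>2)"

context prob_space begin

lemma L2_bounded:
  assumes "f \<in> borel_measurable M" "\<And>\<omega>. \<bar>f \<omega>\<bar> \<le> K"
  shows "L2 f"
  unfolding L2_def
proof (intro conjI assms(1) integrable_const_bound[where B="K\<^sup>2"] AE_I2)
  fix \<omega> show "norm ((f \<omega>)\<^sup>2) \<le> K\<^sup>2" using power_mono[OF assms(2)[of \<omega>], of 2] by simp
qed (use assms(1) in measurable)

lemma L2_const: "L2 (\<lambda>_. c)" by (simp add: L2_def)

lemma L2_add: assumes "L2 f" "L2 g" shows "L2 (\<lambda>\<omega>. f \<omega> + g \<omega>)"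
proof -
  have [measurable]: "f \<in> borel_measurable M" "g \<in> borel_measurable M" using assms by (auto simp: L2_def)
  have "integrable M (\<lambda>\<omega>. (f \<omega> + g \<omega>)\<^sup>2)"
  proof (rule Bochner_Integration.integrable_bound)
    show "integrable M (\<lambda>\<omega>. 2 * (f \<omega>)\<^sup>2 + 2 * (g \<omega>)\<^sup>2)" using assms by (auto simp: L2_def)
    have "(x + y)\<^sup>2 \<le> 2 * x\<^sup>2 + 2 * y\<^sup>2" for x y :: real
      using zero_le_power2[of "x - y"] by (simp add: power2_eq_square algebra_simps)
    thus "AE \<omega> in M. norm ((f \<omega> + g \<omega>)\<^sup>2) \<le> norm (2 * (f \<omega>)\<^sup>2 + 2 * (g \<omega>)\<^sup>2)"
      by (intro AE_I2) (auto intro: order_trans)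
  qed auto
  thus ?thesis by (simp add: L2_def)
qed

lemma L2_cmult: "L2 f \<Longrightarrow> L2 (\<lambda>\<omega>. c * f \<omega>)"
  by (auto simp: L2_def power_mult_distrib)

lemma L2_minus: "L2 f \<Longrightarrow> L2 g \<Longrightarrow> L2 (\<lambda>\<omega>. f \<omega> - g \<omega>)"
  using L2_add[of f "\<lambda>\<omega>. -1 * g \<omega>"] L2_cmult[of g "-1"] by simp

lemma L2_sum: "(\<And>i. i \<in> I \<Longrightarrow> L2 (f i)) \<Longrightarrow> L2 (\<lambda>\<omega>. \<Sum>i\<in>I. f i \<omega>)"
  by (induction I rule: infinite_finite_induct) (auto intro: L2_add L2_const)

lemma L2_indicator_mult:
  assumes "L2 f" "A \<in> sets M" shows "L2 (\<lambda>\<omega>. indicator A \<omega> * f \<omega>)"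
proof -
  have "(\<lambda>\<omega>. (indicator A \<omega> * f \<omega>)\<^sup>2) = (\<lambda>\<omega>. indicator A \<omega> *\<^sub>R (f \<omega>)\<^sup>2)"
    by (auto simp: indicator_def)
  moreover have "integrable M (\<lambda>\<omega>. indicator A \<omega> *\<^sub>R (f \<omega>)\<^sup>2)"
    using assms by (intro integrable_mult_indicator) (auto simp: L2_def)
  ultimately show ?thesis using assms by (auto simp: L2_def)
qed

lemma L2_mult_integrable:
  assumes "L2 f" "L2 g" shows "integrable M (\<lambda>\<omega>. f \<omega> * g \<omega>)"
proof (rule Bochner_Integration.integrable_bound)
  show "integrable M (\<lambda>\<omega>. (f \<omega>)\<^sup>2 + (g \<omega>)\<^sup>2)" using assms by (auto simp: L2_def)
  have "\<bar>x * y\<bar> \<le> x\<^sup>2 + y\<^sup>2" for x y :: real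
  proof -
    have "0 \<le> (\<bar>x\<bar> - \<bar>y\<bar>)\<^sup>2" by simp
    hence "2 * (\<bar>x\<bar> * \<bar>y\<bar>) \<le> x\<^sup>2 + y\<^sup>2" by (simp add: power2_diff)
    moreover have "0 \<le> \<bar>x\<bar> * \<bar>y\<bar>" by simp
    ultimately show ?thesis unfolding abs_mult by linarith
  qed
  thus "AE \<omega> in M. norm (f \<omega> * g \<omega>) \<le> norm ((f \<omega>)\<^sup>2 + (g \<omega>)\<^sup>2)"
    by (intro AE_I2) (auto intro: order_trans)
qed (use assms in \<open>auto simp: L2_def\<close>)

lemma L2_measurable: "L2 f \<Longrightarrow> f \<in> borel_measurable M" by (simp add: L2_def)

lemma L2_integrable: "L2 f \<Longrightarrow> integrable M f"
  using L2_mult_integrable[OF _ L2_const[of 1]] by simp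

end

text \<open>The filtration is left abstract and the observation noise is only required to be a martingale
  difference sequence bounded in mean square; conditionally bounded noise is brought into this form
  by truncation.\<close>

locale sc_system = filtered_prob_space M F for M :: "'a measure" and F +
  fixes N n :: nat
    and a nu b :: "nat \<Rightarrow> nat \<Rightarrow> real"
    and alpha :: "nat \<Rightarrow> nat \<Rightarrow> nat \<Rightarrow> real"
    and beta :: "nat \<Rightarrow> nat \<Rightarrow> real"
    and m :: "nat \<Rightarrow> nat"
    and H :: "nat \<Rightarrow> nat \<Rightarrow> nat \<Rightarrow> nat \<Rightarrow> real"
    and theta :: "nat \<Rightarrow> real"
    and th0 :: "nat \<Rightarrow> nat \<Rightarrow> real"
    and w :: "nat \<Rightarrow> nat \<Rightarrow> 'a \<Rightarrow> nat \<Rightarrow> real"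
    and d :: "nat \<Rightarrow> nat \<Rightarrow> 'a \<Rightarrow> real"
    and Hbar Kw :: real
  assumes n_pos: "0 < n"
    and a_sym: "\<And>i j. a i j = a j i" and a_nonneg: "\<And>i j. 0 \<le> a i j"
    and H_bound: "\<And>i k x. i < N \<Longrightarrow> 1 \<le> k \<Longrightarrow>
        (\<Sum>r<m i. (\<Sum>c<n. H i k r c * x c)\<^sup>2) \<le> Hbar\<^sup>2 * (\<Sum>c<n. (x c)\<^sup>2)"
    and w_meas: "\<And>i k r. i < N \<Longrightarrow> r < m i \<Longrightarrow> (\<lambda>\<omega>. w i (Suc k) \<omega> r) \<in> borel_measurable (F (Suc k))"
    and w_sq: "\<And>i k r. i < N \<Longrightarrow> r < m i \<Longrightarrow> integrable M (\<lambda>\<omega>. (w i (Suc k) \<omega> r)\<^sup>2)"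
    and w_var: "\<And>i k. i < N \<Longrightarrow> (\<integral>\<omega>. (\<Sum>r<m i. (w i (Suc k) \<omega> r)\<^sup>2) \<partial>M) \<le> Kw"
    and w_mds: "\<And>i k r. i < N \<Longrightarrow> r < m i \<Longrightarrow>
        AE \<omega> in M. real_cond_exp M (F k) (\<lambda>\<omega>. w i (Suc k) \<omega> r) \<omega> = 0"
    and d_meas: "\<And>i k. i < N \<Longrightarrow> d i (Suc k) \<in> borel_measurable (F (Suc k))"
    and d_dist: "\<And>i k. i < N \<Longrightarrow> distributed M lborel (d i (Suc k)) (\<lambda>x. ennreal (exp (- \<bar>x\<bar>) / 2))"
    and d_indep: "\<And>i k A B. i < N \<Longrightarrow> A \<in> sets (F k) \<Longrightarrow> B \<in> sets borel \<Longrightarrow>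
        prob (A \<inter> (d i (Suc k) -` B \<inter> space M)) = prob A * prob (d i (Suc k) -` B \<inter> space M)"
    and nu_sym: "\<And>i j. nu i j = nu j i" and nu_nonneg: "\<And>i j. 0 \<le> nu i j"
    and b_sym: "\<And>i j. b i j = b j i" and b_pos: "\<And>i j. (i, j) \<in> edges N a \<Longrightarrow> 0 < b i j"
    and alpha_sym: "\<And>i j k. alpha i j k = alpha j i k"
    and alpha_pos: "\<And>i j k. (i, j) \<in> edges N a \<Longrightarrow> 1 \<le> k \<Longrightarrow> 0 < alpha i j k"
    and beta_pos: "\<And>i k. i < N \<Longrightarrow> 1 \<le> k \<Longrightarrow> 0 < beta i k"
begin

section \<open>Error process, messages and dither noise\<close>

abbreviation "E \<equiv> edges N a"

definition est :: "nat \<Rightarrow> 'a \<Rightarrow> nat \<Rightarrow> nat \<Rightarrow> real" where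
  "est k \<omega> = sc_est N n a nu b alpha beta m H (obs n H theta (\<lambda>i k. w i k \<omega>)) (\<lambda>i k. d i k \<omega>) th0 k"

definition er :: "nat \<Rightarrow> 'a \<Rightarrow> nat \<Rightarrow> nat \<Rightarrow> real" where
  "er k \<omega> i c = est k \<omega> i c - theta c"

definition thr :: "nat \<Rightarrow> nat \<Rightarrow> nat \<Rightarrow> real" where
  "thr i j k = nu i j * b i j * ln (real k)"

text \<open>Index convention: a quantity with index \<open>k\<close> describes step
  \<open>Suc k\<close>, which starts from the state after \<open>k\<close> steps. So
  \<open>xx k\<close> is known at time \<open>k\<close>, while the dither inside
  \<open>msg i j k\<close> is \<open>d i (Suc k)\<close>.\<close>

definition xx :: "nat \<Rightarrow> 'a \<Rightarrow> nat \<Rightarrow> real" where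
  "xx k \<omega> i = est k \<omega> i (coord n (Suc k))"

definition msg :: "nat \<Rightarrow> nat \<Rightarrow> nat \<Rightarrow> 'a \<Rightarrow> real" where
  "msg i j k \<omega> = (let z = xx k \<omega> i + b i j * d i (Suc k) \<omega> in
     if \<bar>z\<bar> > thr i j (Suc k) then (if z > 0 then 1 else - 1) else 0)"

definition bit :: "nat \<Rightarrow> nat \<Rightarrow> nat \<Rightarrow> 'a \<Rightarrow> real" where
  "bit i j k \<omega> = (if \<bar>xx k \<omega> i + b i j * d i (Suc k) \<omega>\<bar> > thr i j (Suc k) then 1 else 0)"

definition Gm :: "nat \<Rightarrow> nat \<Rightarrow> nat \<Rightarrow> real \<Rightarrow> real" where
  "Gm i j k = msg_mean (b i j) (thr i j (Suc k))"

text \<open>The message is centred with the state of its sender \<open>j\<close>, whereas the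
  algorithm subtracts the value at the receiver \<open>i\<close>; the difference of the two is the
  deterministic coupling \<open>coup\<close>.\<close>

definition noise :: "nat \<Rightarrow> nat \<Rightarrow> nat \<Rightarrow> 'a \<Rightarrow> real" where
  "noise i j k \<omega> = alpha i j (Suc k) * a i j * (msg j i k \<omega> - Gm i j k (xx k \<omega> j))"

definition coup :: "nat \<Rightarrow> (nat \<Rightarrow> real) \<Rightarrow> nat \<Rightarrow> real" where
  "coup k x i = (\<Sum>j\<in>nbrs N a i. alpha i j (Suc k) * a i j * (Gm i j k (x j) - Gm i j k (x i)))"

definition Hv :: "nat \<Rightarrow> nat \<Rightarrow> (nat \<Rightarrow> real) \<Rightarrow> nat \<Rightarrow> real" where
  "Hv i k v r = (\<Sum>c<n. H i k r c * v c)"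

definition Ht :: "nat \<Rightarrow> nat \<Rightarrow> (nat \<Rightarrow> real) \<Rightarrow> nat \<Rightarrow> real" where
  "Ht i k u c = (\<Sum>r<m i. H i k r c * u r)"

lemma coord_less: "coord n k < n" using n_pos by (simp add: coord_def)

lemma Gm_sym: "Gm i j k = Gm j i k"
  by (simp add: Gm_def thr_def b_sym[of i j] nu_sym[of i j])

lemma card_nbrs_le: "card (nbrs N a i) \<le> N"
  using card_mono[of "{..<N}" "nbrs N a i"] by (auto simp: nbrs_def edges_def)

lemma edge_sym: "(i, j) \<in> E \<Longrightarrow> (j, i) \<in> E"
  using a_sym by (auto simp: edges_def)

lemma sum_edges_swap: "(\<Sum>(i, j)\<in>E. f i j) = (\<Sum>(i, j)\<in>E. f j i)"
  by (rule sum.reindex_bij_witness[of _ "\<lambda>(i, j). (j, i)" "\<lambda>(i, j). (j, i)"]) (auto simp: edge_sym)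

text \<open>Adding and subtracting the mean message of the sender turns the update into an error
  recursion made of coupling, dither noise, regression drift and observation noise.\<close>

lemma er_Suc:
  "er (Suc k) \<omega> i c = er k \<omega> i c
     + (if c = coord n (Suc k) then coup k (xx k \<omega>) i + (\<Sum>j\<in>nbrs N a i. noise i j k \<omega>) else 0)
     - beta i (Suc k) * Ht i (Suc k) (Hv i (Suc k) (er k \<omega> i)) c
     + beta i (Suc k) * Ht i (Suc k) (w i (Suc k) \<omega>) c"
proof -
  let ?l = "coord n (Suc k)"
  have 1: "(\<Sum>j\<in>nbrs N a i. alpha i j (Suc k) * a i j * (msg j i k \<omega> - Gm i j k (xx k \<omega> i)))
     = coup k (xx k \<omega>) i + (\<Sum>j\<in>nbrs N a i. noise i j k \<omega>)"
    unfolding coup_def noise_def sum.distrib[symmetric] by (intro sum.cong refl) (simp add: algebra_simps)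
  have 2: "est (Suc k) \<omega> i c = est k \<omega> i c
     + (if c = ?l then (\<Sum>j\<in>nbrs N a i. alpha i j (Suc k) * a i j * (msg j i k \<omega> - Gm i j k (xx k \<omega> i))) else 0)
     + beta i (Suc k) * (\<Sum>r<m i. H i (Suc k) r c * ((\<Sum>c<n. H i (Suc k) r c * theta c) + w i (Suc k) \<omega> r
         - (\<Sum>c'<n. H i (Suc k) r c' * est k \<omega> i c')))"
    unfolding est_def sc_est.simps sc_step_def Let_def obs_def msg_def Gm_def msg_mean_def thr_def xx_def ..
  have 3: "(\<Sum>r<m i. H i (Suc k) r c * ((\<Sum>c<n. H i (Suc k) r c * theta c) + w i (Suc k) \<omega> r
         - (\<Sum>c'<n. H i (Suc k) r c' * est k \<omega> i c')))
     = Ht i (Suc k) (w i (Suc k) \<omega>) c - Ht i (Suc k) (Hv i (Suc k) (er k \<omega> i)) c"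
    unfolding Ht_def Hv_def er_def sum_subtractf[symmetric] right_diff_distrib
    by (intro sum.cong refl) (simp add: algebra_simps sum_subtractf)
  show ?thesis unfolding er_def[of "Suc k"] er_def[of k \<omega> i c] 2 3 1 by (simp add: algebra_simps)
qed

lemma thr_nonneg: "(i, j) \<in> E \<Longrightarrow> 0 \<le> thr i j (Suc k)"
  using nu_nonneg[of i j] b_pos[of i j] by (simp add: thr_def)

text \<open>Messages in terms of comparisons of the fresh dither with levels known at time
  \<open>k\<close>, the shape that \<open>indep_laplace_freeze\<close> accepts. The two events are
  disjoint because the threshold is nonnegative.\<close>

lemma msg_bit_eq:
  fixes k :: nat
  assumes "(i, j) \<in> E"
  defines "c1 \<equiv> \<lambda>\<omega>. (thr i j (Suc k) - xx k \<omega> i) / b i j"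
    and "c2 \<equiv> \<lambda>\<omega>. (- thr i j (Suc k) - xx k \<omega> i) / b i j"
  shows "msg i j k \<omega> = of_bool (c1 \<omega> < d i (Suc k) \<omega>) - of_bool (d i (Suc k) \<omega> < c2 \<omega>)"
    "bit i j k \<omega> = of_bool (c1 \<omega> < d i (Suc k) \<omega>) + of_bool (d i (Suc k) \<omega> < c2 \<omega>)"
proof -
  let ?z = "xx k \<omega> i + b i j * d i (Suc k) \<omega>" and ?t = "thr i j (Suc k)"
  have 1: "c1 \<omega> < d i (Suc k) \<omega> \<longleftrightarrow> ?t < ?z" and 2: "d i (Suc k) \<omega> < c2 \<omega> \<longleftrightarrow> ?z < - ?t"
    using b_pos[OF assms(1)] by (auto simp: c1_def c2_def field_simps)
  show "msg i j k \<omega> = of_bool (c1 \<omega> < d i (Suc k) \<omega>) - of_bool (d i (Suc k) \<omega> < c2 \<omega>)"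
    "bit i j k \<omega> = of_bool (c1 \<omega> < d i (Suc k) \<omega>) + of_bool (d i (Suc k) \<omega> < c2 \<omega>)"
    using thr_nonneg[OF assms(1), of k] unfolding 1 2 msg_def bit_def Let_def by auto
qed

lemma bit_eq_msg_sq: "bit i j k \<omega> = (msg i j k \<omega>)\<^sup>2"
  by (auto simp: bit_def msg_def Let_def)

lemma msg_abs_le: "\<bar>msg i j k \<omega>\<bar> \<le> 1"
  by (auto simp: msg_def Let_def)

lemma noise_abs_le: "(i, j) \<in> E \<Longrightarrow> \<bar>noise i j k \<omega>\<bar> \<le> 2 * (alpha i j (Suc k) * a i j)"
proof -
  assume "(i, j) \<in> E"
  hence "0 \<le> alpha i j (Suc k) * a i j" using alpha_pos[of i j "Suc k"] a_nonneg[of i j] by simp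
  moreover have "\<bar>msg j i k \<omega> - Gm i j k (xx k \<omega> j)\<bar> \<le> 2"
    using msg_abs_le[of j i k \<omega>] abs_msg_mean_le_1[of "b i j" "thr i j (Suc k)" "xx k \<omega> j"]
    unfolding Gm_def by linarith
  ultimately show ?thesis unfolding noise_def abs_mult
    by (metis abs_of_nonneg mult.commute mult_left_mono abs_mult)
qed

lemma est_measurable: "i < N \<Longrightarrow> c < n \<Longrightarrow> (\<lambda>\<omega>. est k \<omega> i c) \<in> borel_measurable (F k)"
proof (induction k arbitrary: i c)
  case 0
  thus ?case by (simp add: est_def)
next
  case (Suc k)
  have e[measurable]: "(\<lambda>\<omega>. est k \<omega> i c) \<in> borel_measurable (F (Suc k))" if "i < N" "c < n" for i c
    using Suc.IH[OF that] meas_F_mono[of _ k "Suc k"] by simp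
  have x[measurable]: "(\<lambda>\<omega>. xx k \<omega> i) \<in> borel_measurable (F (Suc k))" if "i < N" for i
    unfolding xx_def using e[OF that coord_less] .
  have [measurable]: "d i (Suc k) \<in> borel_measurable (F (Suc k))" if "i < N" for i using d_meas that by blast
  have nb: "j < N" if "j \<in> nbrs N a i" for i j using that by (auto simp: nbrs_def edges_def)
  have ms[measurable]: "(\<lambda>\<omega>. msg j i k \<omega>) \<in> borel_measurable (F (Suc k))" if "j < N" for i j
    unfolding msg_def Let_def using that by measurable
  have g[measurable]: "(\<lambda>\<omega>. Gm i j k (xx k \<omega> l)) \<in> borel_measurable (F (Suc k))" if "l < N" for i j l
    unfolding Gm_def using that by measurable
  have c1: "(\<lambda>\<omega>. coup k (xx k \<omega>) i) \<in> borel_measurable (F (Suc k))"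
    unfolding coup_def using Suc.prems nb
    by (intro borel_measurable_sum borel_measurable_times borel_measurable_diff borel_measurable_const g) auto
  have c2: "(\<lambda>\<omega>. \<Sum>j\<in>nbrs N a i. noise i j k \<omega>) \<in> borel_measurable (F (Suc k))"
    unfolding noise_def using Suc.prems nb
    by (intro borel_measurable_sum borel_measurable_times borel_measurable_diff borel_measurable_const g ms) auto
  have c3: "(\<lambda>\<omega>. Ht i (Suc k) (Hv i (Suc k) (er k \<omega> i)) c) \<in> borel_measurable (F (Suc k))"
    unfolding Ht_def Hv_def er_def using Suc.prems
    by (intro borel_measurable_sum borel_measurable_times borel_measurable_diff borel_measurable_const e) auto
  have c4: "(\<lambda>\<omega>. Ht i (Suc k) (w i (Suc k) \<omega>) c) \<in> borel_measurable (F (Suc k))"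
    unfolding Ht_def using Suc.prems w_meas
    by (intro borel_measurable_sum borel_measurable_times borel_measurable_const) auto
  have "(\<lambda>\<omega>. er (Suc k) \<omega> i c) \<in> borel_measurable (F (Suc k))"
    unfolding er_Suc using c1 c2 c3 c4 e[OF Suc.prems] unfolding er_def by (cases "c = coord n (Suc k)") simp_all
  hence "(\<lambda>\<omega>. er (Suc k) \<omega> i c + theta c) \<in> borel_measurable (F (Suc k))" by measurable
  thus ?case by (simp add: er_def)
qed

lemma er_measurable: "i < N \<Longrightarrow> c < n \<Longrightarrow> (\<lambda>\<omega>. er k \<omega> i c) \<in> borel_measurable (F k)"
  unfolding er_def using est_measurable by measurable

lemma xx_measurable: "i < N \<Longrightarrow> (\<lambda>\<omega>. xx k \<omega> i) \<in> borel_measurable (F k)"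
  unfolding xx_def using est_measurable coord_less by blast

lemma msg_measurable: "i < N \<Longrightarrow> msg i j k \<in> borel_measurable (F (Suc k))"
proof -
  assume "i < N"
  hence [measurable]: "d i (Suc k) \<in> borel_measurable (F (Suc k))" "(\<lambda>\<omega>. xx k \<omega> i) \<in> borel_measurable (F (Suc k))"
    using d_meas meas_F_mono[OF xx_measurable] by auto
  show ?thesis unfolding msg_def[abs_def] Let_def by measurable
qed

lemma bit_measurable: "i < N \<Longrightarrow> bit i j k \<in> borel_measurable (F (Suc k))"
proof -
  assume "i < N"
  hence [measurable]: "msg i j k \<in> borel_measurable (F (Suc k))" by (rule msg_measurable)
  show ?thesis unfolding bit_eq_msg_sq[abs_def] by measurable
qed

lemma noise_measurable: "(i, j) \<in> E \<Longrightarrow> noise i j k \<in> borel_measurable (F (Suc k))"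
proof -
  assume "(i, j) \<in> E"
  hence "j < N" by (simp add: edges_def)
  hence [measurable]: "msg j i k \<in> borel_measurable (F (Suc k))" "(\<lambda>\<omega>. xx k \<omega> j) \<in> borel_measurable (F (Suc k))"
    using msg_measurable meas_F_mono[OF xx_measurable] by auto
  show ?thesis unfolding noise_def[abs_def] Gm_def by measurable
qed

text \<open>Conditional first and second moments of a message, written as integrals against an
  arbitrary weight \<open>Y\<close> from the past. This weighted form takes the place of conditional
  expectations in the sequel.\<close>

lemma bit_integral:
  assumes E: "(i, j) \<in> E" and Y: "Y \<in> borel_measurable (F k)" "integrable M Y"
  shows "(\<integral>\<omega>. Y \<omega> * msg i j k \<omega> \<partial>M) = (\<integral>\<omega>. Y \<omega> * Gm i j k (xx k \<omega> i) \<partial>M)"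
    and "(\<integral>\<omega>. Y \<omega> * bit i j k \<omega> \<partial>M) = (\<integral>\<omega>. Y \<omega> * send_prob (b i j) (thr i j (Suc k)) (xx k \<omega> i) \<partial>M)"
proof -
  define c1 where "c1 \<omega> = (thr i j (Suc k) - xx k \<omega> i) / b i j" for \<omega>
  define c2 where "c2 \<omega> = (- thr i j (Suc k) - xx k \<omega> i) / b i j" for \<omega>
  have i: "i < N" using E by (simp add: edges_def)
  note [measurable] = xx_measurable[OF i, of k] Y(1)
  have c[measurable]: "c1 \<in> borel_measurable (F k)" "c2 \<in> borel_measurable (F k)"
    unfolding c1_def[abs_def] c2_def[abs_def] by measurable
  note [measurable] = meas_F_M[OF c(1)] meas_F_M[OF c(2)] meas_F_M[OF Y(1)] meas_F_M[OF d_meas[OF i, of k]]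
  note fr = indep_laplace_freeze[OF subalg d_dist[OF i] d_indep[OF i]]
  have 1: "(\<integral>\<omega>. Y \<omega> * of_bool (c1 \<omega> < d i (Suc k) \<omega>) \<partial>M) = (\<integral>\<omega>. Y \<omega> * lap_cdf (- c1 \<omega>) \<partial>M)"
    by (rule fr(1)) (use c Y in auto)
  have 2: "(\<integral>\<omega>. Y \<omega> * of_bool (d i (Suc k) \<omega> < c2 \<omega>) \<partial>M) = (\<integral>\<omega>. Y \<omega> * lap_cdf (c2 \<omega>) \<partial>M)"
    by (rule fr(2)) (use c Y in auto)
  have ib: "integrable M (\<lambda>\<omega>. Y \<omega> * f \<omega>)" if [measurable]: "f \<in> borel_measurable M" and "\<And>\<omega>. \<bar>f \<omega>\<bar> \<le> 1" for f
    by (rule Bochner_Integration.integrable_bound[OF Y(2)]) (use that(2) in \<open>auto simp: abs_mult intro!: mult_left_le\<close>)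
  have cdf1: "\<bar>lap_cdf t\<bar> \<le> 1" for t using lap_cdf_nonneg[of t] lap_cdf_le_1[of t] by simp
  have i1: "integrable M (\<lambda>\<omega>. Y \<omega> * of_bool (c1 \<omega> < d i (Suc k) \<omega>))"
    "integrable M (\<lambda>\<omega>. Y \<omega> * of_bool (d i (Suc k) \<omega> < c2 \<omega>))"
    by (rule ib; auto)+
  have i2: "integrable M (\<lambda>\<omega>. Y \<omega> * lap_cdf (- c1 \<omega>))" "integrable M (\<lambda>\<omega>. Y \<omega> * lap_cdf (c2 \<omega>))"
    by (rule ib; use cdf1 in auto)+
  have m: "- c1 \<omega> = (xx k \<omega> i - thr i j (Suc k)) / b i j" "c2 \<omega> = (- xx k \<omega> i - thr i j (Suc k)) / b i j" for \<omega>
    by (auto simp: c1_def c2_def minus_divide_left algebra_simps)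
  have "(\<integral>\<omega>. Y \<omega> * msg i j k \<omega> \<partial>M) = (\<integral>\<omega>. Y \<omega> * of_bool (c1 \<omega> < d i (Suc k) \<omega>) - Y \<omega> * of_bool (d i (Suc k) \<omega> < c2 \<omega>) \<partial>M)"
    unfolding msg_bit_eq(1)[OF E] c1_def c2_def right_diff_distrib ..
  also have "\<dots> = (\<integral>\<omega>. Y \<omega> * lap_cdf (- c1 \<omega>) \<partial>M) - (\<integral>\<omega>. Y \<omega> * lap_cdf (c2 \<omega>) \<partial>M)"
    unfolding Bochner_Integration.integral_diff[OF i1] 1 2 ..
  also have "\<dots> = (\<integral>\<omega>. Y \<omega> * Gm i j k (xx k \<omega> i) \<partial>M)"
    unfolding Gm_def msg_mean_def m[symmetric] right_diff_distrib Bochner_Integration.integral_diff[OF i2] ..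
  finally show "(\<integral>\<omega>. Y \<omega> * msg i j k \<omega> \<partial>M) = (\<integral>\<omega>. Y \<omega> * Gm i j k (xx k \<omega> i) \<partial>M)" .
  have "(\<integral>\<omega>. Y \<omega> * bit i j k \<omega> \<partial>M) = (\<integral>\<omega>. Y \<omega> * of_bool (c1 \<omega> < d i (Suc k) \<omega>) + Y \<omega> * of_bool (d i (Suc k) \<omega> < c2 \<omega>) \<partial>M)"
    unfolding msg_bit_eq(2)[OF E] c1_def c2_def distrib_left ..
  also have "\<dots> = (\<integral>\<omega>. Y \<omega> * lap_cdf (- c1 \<omega>) \<partial>M) + (\<integral>\<omega>. Y \<omega> * lap_cdf (c2 \<omega>) \<partial>M)"
    unfolding Bochner_Integration.integral_add[OF i1] 1 2 ..
  also have "\<dots> = (\<integral>\<omega>. Y \<omega> * send_prob (b i j) (thr i j (Suc k)) (xx k \<omega> i) \<partial>M)"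
    unfolding send_prob_def m[symmetric] distrib_left Bochner_Integration.integral_add[OF i2] ..
  finally show "(\<integral>\<omega>. Y \<omega> * bit i j k \<omega> \<partial>M) = (\<integral>\<omega>. Y \<omega> * send_prob (b i j) (thr i j (Suc k)) (xx k \<omega> i) \<partial>M)" .
qed

lemma integrable_mult_bounded:
  fixes Y f :: "'a \<Rightarrow> real"
  assumes "integrable M Y" "f \<in> borel_measurable M" "\<And>\<omega>. \<bar>f \<omega>\<bar> \<le> K"
  shows "integrable M (\<lambda>\<omega>. Y \<omega> * f \<omega>)"
proof (rule Bochner_Integration.integrable_bound)
  show "integrable M (\<lambda>\<omega>. K * Y \<omega>)" using assms by simp
  show "AE \<omega> in M. norm (Y \<omega> * f \<omega>) \<le> norm (K * Y \<omega>)"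
  proof (rule AE_I2)
    fix \<omega>
    have "\<bar>f \<omega>\<bar> * \<bar>Y \<omega>\<bar> \<le> \<bar>K\<bar> * \<bar>Y \<omega>\<bar>"
      using assms(3)[of \<omega>] by (intro mult_right_mono) auto
    thus "norm (Y \<omega> * f \<omega>) \<le> norm (K * Y \<omega>)" by (simp add: abs_mult mult.commute)
  qed
qed (use assms borel_measurable_integrable in measurable)

lemma noise_mean:
  assumes E: "(i, j) \<in> E" and Y: "Y \<in> borel_measurable (F k)" "integrable M Y"
  shows "(\<integral>\<omega>. Y \<omega> * noise i j k \<omega> \<partial>M) = 0"
proof -
  have j: "j < N" using E by (simp add: edges_def)
  have mM: "msg j i k \<in> borel_measurable M" using meas_F_M[OF msg_measurable[OF j]] .
  have gM: "(\<lambda>\<omega>. Gm i j k (xx k \<omega> j)) \<in> borel_measurable M"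
    unfolding Gm_def using meas_F_M[OF xx_measurable[OF j]] by measurable
  have i1: "integrable M (\<lambda>\<omega>. Y \<omega> * msg j i k \<omega>)"
    by (rule integrable_mult_bounded[OF Y(2) mM msg_abs_le])
  have i2: "integrable M (\<lambda>\<omega>. Y \<omega> * Gm i j k (xx k \<omega> j))"
    by (rule integrable_mult_bounded[OF Y(2) gM, of 1]) (simp add: Gm_def abs_msg_mean_le_1)
  have "(\<integral>\<omega>. Y \<omega> * noise i j k \<omega> \<partial>M) =
    (\<integral>\<omega>. (alpha i j (Suc k) * a i j) * (Y \<omega> * msg j i k \<omega> - Y \<omega> * Gm i j k (xx k \<omega> j)) \<partial>M)"
    by (intro Bochner_Integration.integral_cong refl) (simp add: noise_def algebra_simps)
  also have "\<dots> = 0"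
    using bit_integral(1)[OF edge_sym[OF E] Y] i1 i2 by (simp add: Gm_sym[of i j])
  finally show ?thesis .
qed

text \<open>The variance of a message is at most its second moment, the sending probability. The
  factor \<open>k powr - nu\<close> gained over the trivial bound is what puts \<open>nu / 2\<close>
  into \<open>h\<close>. The weight \<open>Y\<close> vanishes wherever the state of the sender
  exceeds \<open>X\<close>, which localises the estimate.\<close>

lemma noise_sq:
  assumes E: "(i, j) \<in> E" and Y: "Y \<in> borel_measurable (F k)" "integrable M Y" "\<And>\<omega>. 0 \<le> Y \<omega>"
    and X: "\<And>\<omega>. Y \<omega> \<noteq> 0 \<Longrightarrow> \<bar>xx k \<omega> j\<bar> \<le> X"
  shows "(\<integral>\<omega>. Y \<omega> * (noise i j k \<omega>)\<^sup>2 \<partial>M) \<le>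
     (alpha i j (Suc k) * a i j)\<^sup>2 * (exp (X / b i j) * real (Suc k) powr - nu i j) * (\<integral>\<omega>. Y \<omega> \<partial>M)"
proof -
  let ?A = "alpha i j (Suc k) * a i j" and ?p = "\<lambda>\<omega>. send_prob (b i j) (thr i j (Suc k)) (xx k \<omega> j)"
  have j: "j < N" using E by (simp add: edges_def)
  note [measurable] = meas_F_M[OF msg_measurable[OF j, of i k]] meas_F_M[OF xx_measurable[OF j, of k]] Y(1)
    meas_F_M[OF Y(1)] xx_measurable[OF j, of k]
  have gM[measurable]: "(\<lambda>\<omega>. Gm i j k (xx k \<omega> j)) \<in> borel_measurable (F k)"
    unfolding Gm_def by measurable
  note [measurable] = meas_F_M[OF gM] meas_F_M[OF bit_measurable[OF j, of i k]]
  have G1: "\<bar>Gm i j k x\<bar> \<le> 1" for x by (simp add: Gm_def abs_msg_mean_le_1)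
  let ?YG = "\<lambda>\<omega>. Y \<omega> * Gm i j k (xx k \<omega> j)"
  have YGi: "integrable M ?YG" by (rule integrable_mult_bounded[OF Y(2) _ G1]) simp
  have YG: "?YG \<in> borel_measurable (F k)" by measurable
  have i1: "integrable M (\<lambda>\<omega>. Y \<omega> * bit j i k \<omega>)"
  proof (rule integrable_mult_bounded[OF Y(2), of _ 1])
    show "\<bar>bit j i k \<omega>\<bar> \<le> 1" for \<omega> by (simp add: bit_def)
  qed simp
  have i2: "integrable M (\<lambda>\<omega>. ?YG \<omega> * msg j i k \<omega>)"
    by (rule integrable_mult_bounded[OF YGi _ msg_abs_le]) simp
  have i3: "integrable M (\<lambda>\<omega>. ?YG \<omega> * Gm i j k (xx k \<omega> j))"
    by (rule integrable_mult_bounded[OF YGi _ G1]) simp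
  have bs: "(\<integral>\<omega>. Y \<omega> * bit j i k \<omega> \<partial>M) = (\<integral>\<omega>. Y \<omega> * ?p \<omega> \<partial>M)"
    using bit_integral(2)[OF edge_sym[OF E] Y(1,2)] by (simp add: b_sym[of j i] thr_def nu_sym[of j i])
  have ms: "(\<integral>\<omega>. ?YG \<omega> * msg j i k \<omega> \<partial>M) = (\<integral>\<omega>. ?YG \<omega> * Gm i j k (xx k \<omega> j) \<partial>M)"
    using bit_integral(1)[OF edge_sym[OF E] YG YGi] by (simp add: Gm_sym[of j i])
  have ip: "integrable M (\<lambda>\<omega>. Y \<omega> * ?p \<omega>)"
  proof (rule integrable_mult_bounded[OF Y(2), of _ 2])
    show "\<bar>?p \<omega>\<bar> \<le> 2" for \<omega>
      using lap_cdf_le_1[of "(xx k \<omega> j - thr i j (Suc k)) / b i j"]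
        lap_cdf_le_1[of "(- xx k \<omega> j - thr i j (Suc k)) / b i j"]
        send_prob_nonneg[of "b i j" "thr i j (Suc k)" "xx k \<omega> j"]
      unfolding send_prob_def by linarith
  qed simp
  have "(\<integral>\<omega>. Y \<omega> * (noise i j k \<omega>)\<^sup>2 \<partial>M) =
    (\<integral>\<omega>. ?A\<^sup>2 * (Y \<omega> * bit j i k \<omega> - 2 * (?YG \<omega> * msg j i k \<omega>) + ?YG \<omega> * Gm i j k (xx k \<omega> j)) \<partial>M)"
    by (intro Bochner_Integration.integral_cong refl)
      (simp add: noise_def bit_eq_msg_sq power_mult_distrib power2_diff algebra_simps power2_eq_square)
  \<comment> \<open>The mixed term integrates to the squared mean, so the squared mean survives once
    with a minus sign and can then be dropped.\<close>
  also have "\<dots> = ?A\<^sup>2 * ((\<integral>\<omega>. Y \<omega> * ?p \<omega> \<partial>M) - (\<integral>\<omega>. ?YG \<omega> * Gm i j k (xx k \<omega> j) \<partial>M))"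
    using i1 i2 i3 ms bs by simp
  also have "\<dots> \<le> ?A\<^sup>2 * (\<integral>\<omega>. Y \<omega> * ?p \<omega> \<partial>M)"
  proof (intro mult_left_mono)
    have "0 \<le> (\<integral>\<omega>. ?YG \<omega> * Gm i j k (xx k \<omega> j) \<partial>M)"
      using Y(3) by (intro integral_nonneg_AE AE_I2) (simp add: mult.assoc)
    thus "(\<integral>\<omega>. Y \<omega> * ?p \<omega> \<partial>M) - (\<integral>\<omega>. ?YG \<omega> * Gm i j k (xx k \<omega> j) \<partial>M) \<le> (\<integral>\<omega>. Y \<omega> * ?p \<omega> \<partial>M)" by simp
  qed simp
  also have "\<dots> \<le> ?A\<^sup>2 * (\<integral>\<omega>. (exp (X / b i j) * real (Suc k) powr - nu i j) * Y \<omega> \<partial>M)"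
  proof (intro mult_left_mono integral_mono ip)
    fix \<omega>
    show "Y \<omega> * ?p \<omega> \<le> (exp (X / b i j) * real (Suc k) powr - nu i j) * Y \<omega>"
    proof (cases "Y \<omega> = 0")
      case False
      have "?p \<omega> \<le> exp (X / b i j) * exp (- thr i j (Suc k) / b i j)"
        by (rule send_prob_le[OF b_pos[OF E] X[OF False]])
      also have "exp (- thr i j (Suc k) / b i j) = real (Suc k) powr - nu i j"
        unfolding thr_def by (rule powr_eq_exp_threshold[OF b_pos[OF E]]) simp
      finally show ?thesis using Y(3)[of \<omega>] by (simp add: mult_left_mono mult.commute)
    qed simp
  qed (use Y in auto)
  finally show ?thesis by (simp add: mult.assoc)
qed

lemma w_L2: "i < N \<Longrightarrow> r < m i \<Longrightarrow> L2 (\<lambda>\<omega>. w i (Suc k) \<omega> r)"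
  unfolding L2_def using meas_F_M[OF w_meas] w_sq by blast

text \<open>Square integrability of \<open>Y\<close> makes the product with the noise integrable, as
  pulling \<open>Y\<close> out of the conditional expectation requires.\<close>

lemma w_orth:
  assumes "i < N" "r < m i" and Y: "Y \<in> borel_measurable (F k)" "L2 Y"
  shows "(\<integral>\<omega>. Y \<omega> * w i (Suc k) \<omega> r \<partial>M) = 0"
proof -
  interpret sigma_finite_subalgebra M "F k"
    by (rule finite_measure_subalgebra_is_sigma_finite)
      (simp add: finite_measure_subalgebra_def finite_measure_subalgebra_axioms_def subalg finite_measure_axioms)
  have "(\<integral>\<omega>. Y \<omega> * w i (Suc k) \<omega> r \<partial>M) = (\<integral>\<omega>. Y \<omega> * real_cond_exp M (F k) (\<lambda>\<omega>. w i (Suc k) \<omega> r) \<omega> \<partial>M)"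
    by (rule real_cond_exp_intg(2)[symmetric])
      (use Y w_L2[OF assms(1,2)] L2_mult_integrable L2_measurable in auto)
  also have "\<dots> = (\<integral>\<omega>. 0 \<partial>M)"
    by (rule integral_cong_AE) (use Y L2_measurable w_mds[OF assms(1,2), of k] in auto)
  finally show ?thesis by simp
qed

text \<open>Summation by parts on the symmetric graph. If \<open>y\<close> is \<open>x\<close> up to
  a common shift, monotonicity of the mean message makes the right side nonpositive, so to first
  order the coupling never increases the total squared error.\<close>

lemma coup_sum:
  "(\<Sum>i<N. y i * coup k x i) =
    - (\<Sum>(i, j)\<in>E. alpha i j (Suc k) * a i j * ((y i - y j) * (Gm i j k (x i) - Gm i j k (x j)))) / 2"
proof -
  let ?f = "\<lambda>i j. y i * (alpha i j (Suc k) * a i j * (Gm i j k (x j) - Gm i j k (x i)))"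
  have "(\<Sum>i<N. y i * coup k x i) = (\<Sum>(i, j)\<in>E. ?f i j)"
    unfolding sum_edges coup_def by (simp add: sum_distrib_left)
  moreover have "(\<Sum>(i, j)\<in>E. ?f i j) = (\<Sum>(i, j)\<in>E. ?f j i)" by (rule sum_edges_swap)
  ultimately have "2 * (\<Sum>i<N. y i * coup k x i) = (\<Sum>(i, j)\<in>E. ?f i j + ?f j i)"
    by (simp add: sum.distrib case_prod_beta')
  also have "\<dots> = (\<Sum>(i, j)\<in>E. - (alpha i j (Suc k) * a i j * ((y i - y j) * (Gm i j k (x i) - Gm i j k (x j)))))"
    by (intro sum.cong refl) (auto simp: alpha_sym[of _ _ "Suc k"] a_sym Gm_sym algebra_simps)
  finally show ?thesis by (simp add: sum_negf case_prod_beta')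
qed

end

section \<open>Boundedness of the estimates\<close>

text \<open>Comparison with an integral, one mean value step per index. The exact constant matters:
  with \<open>s = nu\<close> it becomes the factor \<open>1 / (1 - nu)\<close> of the sharp
  rate.\<close>

lemma sum_powr_le:
  assumes "0 \<le> s" "s < 1"
  shows "(\<Sum>t<k. real (Suc t) powr - s) \<le> real k powr (1 - s) / (1 - s)"
proof (induction k)
  case (Suc k)
  have step: "real (Suc k) powr - s \<le> (real (Suc k) powr (1 - s) - real k powr (1 - s)) / (1 - s)"
  proof (cases "k = 0")
    case True
    thus ?thesis using assms by (simp add: field_simps)
  next
    case False
    have "\<exists>z. real k < z \<and> z < real (Suc k) \<and>
      real (Suc k) powr (1 - s) - real k powr (1 - s) = (real (Suc k) - real k) * ((1 - s) * z powr (1 - s - 1))"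
      using False by (intro MVT2) (auto intro!: derivative_eq_intros)
    then obtain z where z: "real k < z" "z < real (Suc k)"
      "real (Suc k) powr (1 - s) - real k powr (1 - s) = (1 - s) * z powr - s" by auto
    have "real (Suc k) powr - s \<le> z powr - s"
      using z assms False by (intro powr_mono2') auto
    thus ?thesis unfolding z(3) using assms by simp
  qed
  have "(\<Sum>t<Suc k. real (Suc t) powr - s) \<le> real k powr (1 - s) / (1 - s) + real (Suc k) powr - s"
    using Suc.IH by simp
  also have "\<dots> \<le> real (Suc k) powr (1 - s) / (1 - s)" using step by (simp add: diff_divide_distrib)
  finally show ?case .
qed simp

context sc_system begin

lemma Ht_adj: "(\<Sum>c<n. e c * Ht i k u c) = (\<Sum>r<m i. Hv i k e r * u r)"
proof -
  have "(\<Sum>c<n. e c * Ht i k u c) = (\<Sum>c<n. \<Sum>r<m i. e c * (H i k r c * u r))"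
    by (simp add: Ht_def sum_distrib_left)
  also have "\<dots> = (\<Sum>r<m i. \<Sum>c<n. e c * (H i k r c * u r))" by (rule sum.swap)
  also have "\<dots> = (\<Sum>r<m i. Hv i k e r * u r)"
    unfolding Hv_def sum_distrib_right by (intro sum.cong refl) (simp add: mult_ac)
  finally show ?thesis .
qed

lemma Hv_bound: "i < N \<Longrightarrow> 1 \<le> k \<Longrightarrow> (\<Sum>r<m i. (Hv i k v r)\<^sup>2) \<le> Hbar\<^sup>2 * (\<Sum>c<n. (v c)\<^sup>2)"
  unfolding Hv_def by (rule H_bound)

lemma Ht_bound: "i < N \<Longrightarrow> 1 \<le> k \<Longrightarrow> (\<Sum>c<n. (Ht i k u c)\<^sup>2) \<le> Hbar\<^sup>2 * (\<Sum>r<m i. (u r)\<^sup>2)"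
  unfolding Ht_def by (rule transpose_bound[OF H_bound])

lemma HtHv_bound:
  assumes "i < N" "1 \<le> k"
  shows "(\<Sum>c<n. (Ht i k (Hv i k v) c)\<^sup>2) \<le> Hbar ^ 4 * (\<Sum>c<n. (v c)\<^sup>2)"
proof -
  have "(\<Sum>c<n. (Ht i k (Hv i k v) c)\<^sup>2) \<le> Hbar\<^sup>2 * (\<Sum>r<m i. (Hv i k v r)\<^sup>2)" by (rule Ht_bound[OF assms])
  also have "\<dots> \<le> Hbar\<^sup>2 * (Hbar\<^sup>2 * (\<Sum>c<n. (v c)\<^sup>2))" by (intro mult_left_mono Hv_bound assms) simp
  finally show ?thesis by (simp add: power_numeral_reduce mult.assoc)
qed

text \<open>Recombined, every summand is a message minus a mean message, both of modulus at most 1.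
  The bound thus holds for all states, which allows the boundedness proof to start without any
  control of the estimates.\<close>

lemma coup_noise_bound:
  assumes "i < N"
  shows "(coup k (xx k \<omega>) i + (\<Sum>j\<in>nbrs N a i. noise i j k \<omega>))\<^sup>2
     \<le> 4 * real N * (\<Sum>j\<in>nbrs N a i. (alpha i j (Suc k) * a i j)\<^sup>2)"
proof -
  have 1: "coup k (xx k \<omega>) i + (\<Sum>j\<in>nbrs N a i. noise i j k \<omega>) =
     (\<Sum>j\<in>nbrs N a i. alpha i j (Suc k) * a i j * (msg j i k \<omega> - Gm i j k (xx k \<omega> i)))"
    unfolding coup_def noise_def sum.distrib[symmetric] by (intro sum.cong refl) (simp add: algebra_simps)
  have "(coup k (xx k \<omega>) i + (\<Sum>j\<in>nbrs N a i. noise i j k \<omega>))\<^sup>2 \<le> real (card (nbrs N a i)) *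
     (\<Sum>j\<in>nbrs N a i. (alpha i j (Suc k) * a i j * (msg j i k \<omega> - Gm i j k (xx k \<omega> i)))\<^sup>2)"
    unfolding 1 by (rule sum_sq_le_card)
  also have "\<dots> \<le> real N * (\<Sum>j\<in>nbrs N a i. 4 * (alpha i j (Suc k) * a i j)\<^sup>2)"
  proof (intro mult_mono sum_mono)
    fix j
    have "\<bar>msg j i k \<omega> - Gm i j k (xx k \<omega> i)\<bar> \<le> 2"
      using msg_abs_le[of j i k \<omega>] abs_msg_mean_le_1[of "b i j" "thr i j (Suc k)" "xx k \<omega> i"]
      unfolding Gm_def by linarith
    hence "(msg j i k \<omega> - Gm i j k (xx k \<omega> i))\<^sup>2 \<le> 2\<^sup>2"
      using power_mono[of "\<bar>msg j i k \<omega> - Gm i j k (xx k \<omega> i)\<bar>" 2 2] by simp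
    thus "(alpha i j (Suc k) * a i j * (msg j i k \<omega> - Gm i j k (xx k \<omega> i)))\<^sup>2 \<le> 4 * (alpha i j (Suc k) * a i j)\<^sup>2"
      unfolding power_mult_distrib[of _ "msg j i k \<omega> - Gm i j k (xx k \<omega> i)"]
      using mult_left_mono[of "(msg j i k \<omega> - Gm i j k (xx k \<omega> i))\<^sup>2" 4 "(alpha i j (Suc k) * a i j)\<^sup>2"] by simp
  qed (use card_nbrs_le in \<open>auto intro: sum_nonneg\<close>)
  finally show ?thesis by (simp add: sum_distrib_left mult_ac)
qed

definition V :: "nat \<Rightarrow> 'a \<Rightarrow> real" where
  "V k \<omega> = (\<Sum>i<N. \<Sum>c<n. (er k \<omega> i c)\<^sup>2)"

definition SA :: "nat \<Rightarrow> real" where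
  "SA k = (\<Sum>(i, j)\<in>E. (alpha i j (Suc k) * a i j)\<^sup>2)"

definition SB :: "nat \<Rightarrow> real" where
  "SB k = (\<Sum>i<N. (beta i (Suc k))\<^sup>2)"

text \<open>The square is expanded. Both first-order drift terms are nonpositive and discarded: the
  coupling by monotonicity, the regression term because it is a sum of squares. What remains are two
  martingale terms and second-order terms of the size of squared step sizes. The factor 3 counts the
  three increments, and 12 is 3 times the 4 of \<open>coup_noise_bound\<close>.\<close>

lemma V_step:
  "V (Suc k) \<omega> \<le> V k \<omega>
     + 2 * (\<Sum>(i, j)\<in>E. er k \<omega> i (coord n (Suc k)) * noise i j k \<omega>)
     + 2 * (\<Sum>i<N. \<Sum>r<m i. (beta i (Suc k) * Hv i (Suc k) (er k \<omega> i) r) * w i (Suc k) \<omega> r)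
     + 12 * real N * SA k + 3 * Hbar ^ 4 * SB k * V k \<omega>
     + 3 * Hbar\<^sup>2 * (\<Sum>i<N. (beta i (Suc k))\<^sup>2 * (\<Sum>r<m i. (w i (Suc k) \<omega> r)\<^sup>2))"
proof -
  let ?l = "coord n (Suc k)"
  let ?T = "\<lambda>i. coup k (xx k \<omega>) i + (\<Sum>j\<in>nbrs N a i. noise i j k \<omega>)"
  have one: "(\<Sum>c<n. (er (Suc k) \<omega> i c)\<^sup>2) \<le> (\<Sum>c<n. (er k \<omega> i c)\<^sup>2) + 2 * (er k \<omega> i ?l * ?T i)
     + 2 * (\<Sum>r<m i. (beta i (Suc k) * Hv i (Suc k) (er k \<omega> i) r) * w i (Suc k) \<omega> r)
     + 12 * real N * (\<Sum>j\<in>nbrs N a i. (alpha i j (Suc k) * a i j)\<^sup>2)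
     + 3 * Hbar ^ 4 * ((beta i (Suc k))\<^sup>2 * (\<Sum>c<n. (er k \<omega> i c)\<^sup>2))
     + 3 * Hbar\<^sup>2 * ((beta i (Suc k))\<^sup>2 * (\<Sum>r<m i. (w i (Suc k) \<omega> r)\<^sup>2))" if i: "i < N" for i
  proof -
    let ?e = "er k \<omega> i" and ?\<beta> = "beta i (Suc k)"
    define p where "p c = (if c = ?l then ?T i else 0)" for c
    define q where "q c = ?\<beta> * Ht i (Suc k) (Hv i (Suc k) ?e) c" for c
    define u where "u c = ?\<beta> * Ht i (Suc k) (w i (Suc k) \<omega>) c" for c
    have "(er (Suc k) \<omega> i c)\<^sup>2 \<le> (?e c)\<^sup>2 + 2 * (?e c * p c) - 2 * (?e c * q c) + 2 * (?e c * u c)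
       + 3 * (p c)\<^sup>2 + 3 * (q c)\<^sup>2 + 3 * (u c)\<^sup>2" for c
    proof -
      \<comment> \<open>These three squares add up to exactly the gap between three times the sum of
        the squares of \<open>p c\<close>, \<open>q c\<close>, \<open>u c\<close> and the square of
        \<open>p c - q c + u c\<close>.\<close>
      have "0 \<le> (p c + q c)\<^sup>2 + (p c - u c)\<^sup>2 + (q c + u c)\<^sup>2" by simp
      moreover have eq: "er (Suc k) \<omega> i c = ?e c + p c - q c + u c" unfolding er_Suc p_def q_def u_def ..
      ultimately show ?thesis unfolding eq by (simp add: power2_eq_square algebra_simps)
    qed
    hence "(\<Sum>c<n. (er (Suc k) \<omega> i c)\<^sup>2) \<le> (\<Sum>c<n. (?e c)\<^sup>2 + 2 * (?e c * p c) - 2 * (?e c * q c) + 2 * (?e c * u c)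
       + 3 * (p c)\<^sup>2 + 3 * (q c)\<^sup>2 + 3 * (u c)\<^sup>2)" by (intro sum_mono)
    also have "\<dots> = (\<Sum>c<n. (?e c)\<^sup>2) + 2 * (\<Sum>c<n. ?e c * p c) - 2 * (\<Sum>c<n. ?e c * q c) + 2 * (\<Sum>c<n. ?e c * u c)
       + 3 * (\<Sum>c<n. (p c)\<^sup>2) + 3 * (\<Sum>c<n. (q c)\<^sup>2) + 3 * (\<Sum>c<n. (u c)\<^sup>2)"
      by (simp add: sum.distrib sum_subtractf sum_distrib_left)
    finally have main: "(\<Sum>c<n. (er (Suc k) \<omega> i c)\<^sup>2) \<le> \<dots>" .
    have 1: "(\<Sum>c<n. ?e c * p c) = ?e ?l * ?T i"
      using coord_less[of "Suc k"] by (simp add: p_def if_distrib cong: if_cong)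
    have "(\<Sum>c<n. ?e c * q c) = ?\<beta> * (\<Sum>c<n. ?e c * Ht i (Suc k) (Hv i (Suc k) ?e) c)"
      by (simp add: q_def sum_distrib_left algebra_simps)
    hence 2: "0 \<le> (\<Sum>c<n. ?e c * q c)"
      using beta_pos[OF i, of "Suc k"] by (simp add: Ht_adj sum_nonneg)
    have "(\<Sum>c<n. ?e c * u c) = ?\<beta> * (\<Sum>c<n. ?e c * Ht i (Suc k) (w i (Suc k) \<omega>) c)"
      by (simp add: u_def sum_distrib_left algebra_simps)
    hence 3: "(\<Sum>c<n. ?e c * u c) = (\<Sum>r<m i. (?\<beta> * Hv i (Suc k) ?e r) * w i (Suc k) \<omega> r)"
      by (simp add: Ht_adj sum_distrib_left mult.assoc)
    have "(\<Sum>c<n. (p c)\<^sup>2) = (\<Sum>c<n. if c = ?l then (?T i)\<^sup>2 else 0)"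
      by (intro sum.cong) (auto simp: p_def)
    also have "\<dots> = (?T i)\<^sup>2" using coord_less[of "Suc k"] by simp
    finally have "(\<Sum>c<n. (p c)\<^sup>2) = (?T i)\<^sup>2" .
    hence 4: "(\<Sum>c<n. (p c)\<^sup>2) \<le> 4 * real N * (\<Sum>j\<in>nbrs N a i. (alpha i j (Suc k) * a i j)\<^sup>2)"
      using coup_noise_bound[OF i] by simp
    have 5: "(\<Sum>c<n. (q c)\<^sup>2) \<le> ?\<beta>\<^sup>2 * (Hbar ^ 4 * (\<Sum>c<n. (?e c)\<^sup>2))"
      unfolding q_def power_mult_distrib sum_distrib_left[symmetric]
      by (intro mult_left_mono HtHv_bound i) auto
    have 6: "(\<Sum>c<n. (u c)\<^sup>2) \<le> ?\<beta>\<^sup>2 * (Hbar\<^sup>2 * (\<Sum>r<m i. (w i (Suc k) \<omega> r)\<^sup>2))"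
      unfolding u_def power_mult_distrib sum_distrib_left[symmetric]
      by (intro mult_left_mono Ht_bound i) auto
    show ?thesis using main 1 2 3 4 5 6 by (simp add: algebra_simps)
  qed
  have cpl: "(\<Sum>i<N. er k \<omega> i ?l * coup k (xx k \<omega>) i) \<le> 0"
  proof -
    have "0 \<le> (\<Sum>(i, j)\<in>E. alpha i j (Suc k) * a i j *
       ((er k \<omega> i ?l - er k \<omega> j ?l) * (Gm i j k (xx k \<omega> i) - Gm i j k (xx k \<omega> j))))"
    proof (rule sum_nonneg, safe)
      fix i j assume ij: "(i, j) \<in> E"
      \<comment> \<open>The true parameter is common to all sensors, so differences of errors are
        differences of states.\<close>
      have "er k \<omega> i ?l - er k \<omega> j ?l = xx k \<omega> i - xx k \<omega> j" by (simp add: er_def xx_def)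
      moreover have "0 \<le> (xx k \<omega> i - xx k \<omega> j) * (Gm i j k (xx k \<omega> i) - Gm i j k (xx k \<omega> j))"
        using msg_mean_mono[OF b_pos[OF ij], of "xx k \<omega> i" "xx k \<omega> j" "thr i j (Suc k)"]
          msg_mean_mono[OF b_pos[OF ij], of "xx k \<omega> j" "xx k \<omega> i" "thr i j (Suc k)"]
        unfolding Gm_def zero_le_mult_iff by linarith
      ultimately show "0 \<le> alpha i j (Suc k) * a i j *
         ((er k \<omega> i ?l - er k \<omega> j ?l) * (Gm i j k (xx k \<omega> i) - Gm i j k (xx k \<omega> j)))"
        using alpha_pos[OF ij, of "Suc k"] a_nonneg[of i j] by simp
    qed
    thus ?thesis unfolding coup_sum by simp
  qed
  have "(\<Sum>i<N. er k \<omega> i ?l * ?T i) = (\<Sum>i<N. er k \<omega> i ?l * coup k (xx k \<omega>) i)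
     + (\<Sum>(i, j)\<in>E. er k \<omega> i ?l * noise i j k \<omega>)"
    unfolding sum_edges by (simp add: distrib_left sum.distrib sum_distrib_left)
  hence T: "(\<Sum>i<N. er k \<omega> i ?l * ?T i) \<le> (\<Sum>(i, j)\<in>E. er k \<omega> i ?l * noise i j k \<omega>)" using cpl by simp
  have B: "(\<Sum>i<N. (beta i (Suc k))\<^sup>2 * (\<Sum>c<n. (er k \<omega> i c)\<^sup>2)) \<le> SB k * V k \<omega>"
  proof -
    have "(\<Sum>i<N. (beta i (Suc k))\<^sup>2 * (\<Sum>c<n. (er k \<omega> i c)\<^sup>2)) \<le> (\<Sum>i<N. SB k * (\<Sum>c<n. (er k \<omega> i c)\<^sup>2))"
      unfolding SB_def by (intro sum_mono mult_right_mono member_le_sum sum_nonneg) auto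
    thus ?thesis by (simp add: V_def sum_distrib_left)
  qed
  have B': "3 * Hbar ^ 4 * (\<Sum>i<N. (beta i (Suc k))\<^sup>2 * (\<Sum>c<n. (er k \<omega> i c)\<^sup>2)) \<le> 3 * Hbar ^ 4 * (SB k * V k \<omega>)"
    using B by (intro mult_left_mono) auto
  have "V (Suc k) \<omega> \<le> (\<Sum>i<N. (\<Sum>c<n. (er k \<omega> i c)\<^sup>2) + 2 * (er k \<omega> i ?l * ?T i)
     + 2 * (\<Sum>r<m i. (beta i (Suc k) * Hv i (Suc k) (er k \<omega> i) r) * w i (Suc k) \<omega> r)
     + 12 * real N * (\<Sum>j\<in>nbrs N a i. (alpha i j (Suc k) * a i j)\<^sup>2)
     + 3 * Hbar ^ 4 * ((beta i (Suc k))\<^sup>2 * (\<Sum>c<n. (er k \<omega> i c)\<^sup>2))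
     + 3 * Hbar\<^sup>2 * ((beta i (Suc k))\<^sup>2 * (\<Sum>r<m i. (w i (Suc k) \<omega> r)\<^sup>2)))"
    unfolding V_def[of "Suc k"] using one by (intro sum_mono) auto
  also have "\<dots> = V k \<omega> + 2 * (\<Sum>i<N. er k \<omega> i ?l * ?T i)
     + 2 * (\<Sum>i<N. \<Sum>r<m i. (beta i (Suc k) * Hv i (Suc k) (er k \<omega> i) r) * w i (Suc k) \<omega> r)
     + 12 * real N * SA k
     + 3 * Hbar ^ 4 * (\<Sum>i<N. (beta i (Suc k))\<^sup>2 * (\<Sum>c<n. (er k \<omega> i c)\<^sup>2))
     + 3 * Hbar\<^sup>2 * (\<Sum>i<N. (beta i (Suc k))\<^sup>2 * (\<Sum>r<m i. (w i (Suc k) \<omega> r)\<^sup>2))"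
    unfolding SA_def sum_edges V_def sum.distrib sum_distrib_left ..
  finally show ?thesis using T B' by linarith
qed

lemma noise_L2: "(i, j) \<in> E \<Longrightarrow> L2 (noise i j k)"
  by (rule L2_bounded[OF meas_F_M[OF noise_measurable] noise_abs_le])

lemma coup_xx_measurable: "i < N \<Longrightarrow> (\<lambda>\<omega>. coup k (xx k \<omega>) i) \<in> borel_measurable (F k)"
proof -
  assume i: "i < N"
  have g: "(\<lambda>\<omega>. Gm i j k (xx k \<omega> l)) \<in> borel_measurable (F k)" if "l < N" for j l
    unfolding Gm_def using xx_measurable[OF that, of k] by measurable
  have nb: "j < N" if "j \<in> nbrs N a i" for i j using that by (auto simp: nbrs_def edges_def)
  show ?thesis unfolding coup_def using i nb
    by (intro borel_measurable_sum borel_measurable_times borel_measurable_diff borel_measurable_const g) auto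
qed

text \<open>Coupling and dither noise are bounded outright, and the rest of the step is linear in
  the old error and the observation noise, so square integrability propagates.\<close>

lemma er_L2: "i < N \<Longrightarrow> c < n \<Longrightarrow> L2 (\<lambda>\<omega>. er k \<omega> i c)"
proof (induction k arbitrary: i c)
  case 0
  thus ?case by (simp add: er_def est_def L2_const)
next
  case (Suc k)
  have nbE: "(i, j) \<in> E" if "j \<in> nbrs N a i" for j using that by (simp add: nbrs_def)
  have c1: "L2 (\<lambda>\<omega>. coup k (xx k \<omega>) i)"
  proof (rule L2_bounded[OF meas_F_M[OF coup_xx_measurable[OF Suc.prems(1)]]])
    fix \<omega>
    show "\<bar>coup k (xx k \<omega>) i\<bar> \<le> (\<Sum>j\<in>nbrs N a i. \<bar>alpha i j (Suc k) * a i j\<bar> * 2)"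
      unfolding coup_def
    proof (rule order_trans[OF sum_abs], intro sum_mono)
      fix j
      have "\<bar>Gm i j k (xx k \<omega> j) - Gm i j k (xx k \<omega> i)\<bar> \<le> 2"
        using abs_msg_mean_le_1[of "b i j" "thr i j (Suc k)" "xx k \<omega> j"]
          abs_msg_mean_le_1[of "b i j" "thr i j (Suc k)" "xx k \<omega> i"] unfolding Gm_def by linarith
      thus "\<bar>alpha i j (Suc k) * a i j * (Gm i j k (xx k \<omega> j) - Gm i j k (xx k \<omega> i))\<bar> \<le> \<bar>alpha i j (Suc k) * a i j\<bar> * 2"
        unfolding abs_mult[of _ "Gm i j k (xx k \<omega> j) - Gm i j k (xx k \<omega> i)"] by (intro mult_left_mono) auto
    qed
  qed
  have c2: "L2 (\<lambda>\<omega>. \<Sum>j\<in>nbrs N a i. noise i j k \<omega>)"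
    using nbE by (intro L2_sum noise_L2) auto
  have c3: "L2 (\<lambda>\<omega>. Ht i (Suc k) (Hv i (Suc k) (er k \<omega> i)) c)"
    unfolding Ht_def Hv_def by (intro L2_sum L2_cmult Suc.IH) (use Suc.prems in auto)
  have c4: "L2 (\<lambda>\<omega>. Ht i (Suc k) (w i (Suc k) \<omega>) c)"
    unfolding Ht_def by (intro L2_sum L2_cmult w_L2) (use Suc.prems in auto)
  have c5: "L2 (\<lambda>\<omega>. if c = coord n (Suc k) then coup k (xx k \<omega>) i + (\<Sum>j\<in>nbrs N a i. noise i j k \<omega>) else 0)"
    using c1 c2 by (cases "c = coord n (Suc k)") (auto intro: L2_add L2_const)
  show ?case unfolding er_Suc
    by (intro L2_add[OF L2_minus[OF L2_add[OF Suc.IH c5]]] L2_cmult c3 c4) (use Suc.prems in auto)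
qed

lemma V_integrable: "integrable M (V k)"
  unfolding V_def[abs_def] using er_L2 by (intro Bochner_Integration.integrable_sum) (auto simp: L2_def)

lemma V_measurable: "V k \<in> borel_measurable (F k)"
  unfolding V_def[abs_def] by (intro borel_measurable_sum borel_measurable_power er_measurable) auto

lemma V_nonneg: "0 \<le> V k \<omega>" by (simp add: V_def sum_nonneg)

lemma Kw_var: "i < N \<Longrightarrow> A \<in> sets M \<Longrightarrow> (\<integral>\<omega>. indicator A \<omega> * (\<Sum>r<m i. (w i (Suc k) \<omega> r)\<^sup>2) \<partial>M) \<le> Kw"
proof -
  assume i: "i < N" and A: "A \<in> sets M"
  have int: "integrable M (\<lambda>\<omega>. \<Sum>r<m i. (w i (Suc k) \<omega> r)\<^sup>2)"
    using w_sq[OF i] by (intro Bochner_Integration.integrable_sum) auto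
  have "(\<integral>\<omega>. indicator A \<omega> * (\<Sum>r<m i. (w i (Suc k) \<omega> r)\<^sup>2) \<partial>M) \<le> (\<integral>\<omega>. (\<Sum>r<m i. (w i (Suc k) \<omega> r)\<^sup>2) \<partial>M)"
    using integrable_mult_indicator[OF A int] int
    by (intro integral_mono) (auto simp: indicator_def sum_nonneg)
  also have "\<dots> \<le> Kw" by (rule w_var[OF i])
  finally show ?thesis .
qed

text \<open>Integrated over an event of the past both martingale terms vanish, by
  \<open>noise_mean\<close> and \<open>w_orth\<close>. The result is the hypothesis of
  \<open>almost_supermartingale_AE_bounded\<close>.\<close>

lemma V_expectation_step:
  assumes A: "A \<in> sets (F k)"
  shows "(\<integral>\<omega>. indicator A \<omega> * V (Suc k) \<omega> \<partial>M) \<le> (1 + 3 * Hbar ^ 4 * SB k) * (\<integral>\<omega>. indicator A \<omega> * V k \<omega> \<partial>M)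
     + (12 * real N * SA k + 3 * Hbar\<^sup>2 * SB k * Kw)"
proof -
  let ?l = "coord n (Suc k)" and ?I = "\<lambda>\<omega>. indicator A \<omega> :: real"
  have AM: "A \<in> sets M" using A sets_F_sub by blast
  define X1 where "X1 i j \<omega> = (?I \<omega> * er k \<omega> i ?l) * noise i j k \<omega>" for i j \<omega>
  define X2 where "X2 i r \<omega> = (?I \<omega> * (beta i (Suc k) * Hv i (Suc k) (er k \<omega> i) r)) * w i (Suc k) \<omega> r" for i r \<omega>
  define X3 where "X3 i \<omega> = ?I \<omega> * (\<Sum>r<m i. (w i (Suc k) \<omega> r)\<^sup>2)" for i \<omega>
  have HvL2: "L2 (\<lambda>\<omega>. beta i (Suc k) * Hv i (Suc k) (er k \<omega> i) r)" if "i < N" for i r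
    unfolding Hv_def using that by (intro L2_cmult L2_sum er_L2) auto
  have HvF: "(\<lambda>\<omega>. beta i (Suc k) * Hv i (Suc k) (er k \<omega> i) r) \<in> borel_measurable (F k)" if "i < N" for i r
    unfolding Hv_def using that
    by (intro borel_measurable_times borel_measurable_sum borel_measurable_const er_measurable) auto
  have IF: "?I \<in> borel_measurable (F k)" using A by measurable
  have x1: "integrable M (X1 i j)" "(\<integral>\<omega>. X1 i j \<omega> \<partial>M) = 0" if ij: "(i, j) \<in> E" for i j
  proof -
    have i: "i < N" using ij by (simp add: edges_def)
    have l2: "L2 (\<lambda>\<omega>. ?I \<omega> * er k \<omega> i ?l)" by (intro L2_indicator_mult er_L2 i coord_less AM)
    show "integrable M (X1 i j)" unfolding X1_def by (intro L2_mult_integrable l2 noise_L2 ij)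
    show "(\<integral>\<omega>. X1 i j \<omega> \<partial>M) = 0" unfolding X1_def
      by (rule noise_mean[OF ij borel_measurable_times[OF IF er_measurable[OF i coord_less]] L2_integrable[OF l2]])
  qed
  have x2: "integrable M (X2 i r)" "(\<integral>\<omega>. X2 i r \<omega> \<partial>M) = 0" if "i < N" "r < m i" for i r
  proof -
    have l2: "L2 (\<lambda>\<omega>. ?I \<omega> * (beta i (Suc k) * Hv i (Suc k) (er k \<omega> i) r))"
      by (intro L2_indicator_mult HvL2 that AM)
    show "integrable M (X2 i r)" unfolding X2_def by (intro L2_mult_integrable l2 w_L2 that)
    show "(\<integral>\<omega>. X2 i r \<omega> \<partial>M) = 0" unfolding X2_def
      by (rule w_orth[OF that borel_measurable_times[OF IF HvF[OF that(1)]] l2])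
  qed
  have x3: "integrable M (X3 i)" "(\<integral>\<omega>. X3 i \<omega> \<partial>M) \<le> Kw" if "i < N" for i
  proof -
    have int: "integrable M (\<lambda>\<omega>. \<Sum>r<m i. (w i (Suc k) \<omega> r)\<^sup>2)"
      using w_sq[OF that] by (intro Bochner_Integration.integrable_sum) auto
    show "integrable M (X3 i)" unfolding X3_def using integrable_mult_indicator[OF AM int] by simp
    show "(\<integral>\<omega>. X3 i \<omega> \<partial>M) \<le> Kw" unfolding X3_def by (rule Kw_var[OF that AM])
  qed
  have iV: "integrable M (\<lambda>\<omega>. ?I \<omega> * V k \<omega>)" for k using integrable_mult_indicator[OF AM V_integrable[of k]] by simp
  define c0 where "c0 = 12 * real N * SA k"
  have c0: "0 \<le> c0" by (auto simp: c0_def SA_def intro!: sum_nonneg mult_nonneg_nonneg)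
  have "(\<integral>\<omega>. ?I \<omega> * V (Suc k) \<omega> \<partial>M) \<le> (\<integral>\<omega>. (1 + 3 * Hbar ^ 4 * SB k) * (?I \<omega> * V k \<omega>)
     + 2 * (\<Sum>z\<in>E. X1 (fst z) (snd z) \<omega>) + 2 * (\<Sum>i<N. \<Sum>r<m i. X2 i r \<omega>) + c0
     + 3 * Hbar\<^sup>2 * (\<Sum>i<N. (beta i (Suc k))\<^sup>2 * X3 i \<omega>) \<partial>M)"
  proof (rule integral_mono)
    fix \<omega>
    show "?I \<omega> * V (Suc k) \<omega> \<le> (1 + 3 * Hbar ^ 4 * SB k) * (?I \<omega> * V k \<omega>)
     + 2 * (\<Sum>z\<in>E. X1 (fst z) (snd z) \<omega>) + 2 * (\<Sum>i<N. \<Sum>r<m i. X2 i r \<omega>) + c0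
     + 3 * Hbar\<^sup>2 * (\<Sum>i<N. (beta i (Suc k))\<^sup>2 * X3 i \<omega>)"
      using V_step[of k \<omega>] c0
      by (cases "\<omega> \<in> A") (simp_all add: X1_def X2_def X3_def case_prod_beta' c0_def algebra_simps)
    show "integrable M (\<lambda>\<omega>. (1 + 3 * Hbar ^ 4 * SB k) * (?I \<omega> * V k \<omega>)
     + 2 * (\<Sum>z\<in>E. X1 (fst z) (snd z) \<omega>) + 2 * (\<Sum>i<N. \<Sum>r<m i. X2 i r \<omega>) + c0
     + 3 * Hbar\<^sup>2 * (\<Sum>i<N. (beta i (Suc k))\<^sup>2 * X3 i \<omega>))"
      using iV x1 x2 x3
      by (intro Bochner_Integration.integrable_add integrable_mult_right Bochner_Integration.integrable_sum) auto
  qed (rule iV)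
  also have "\<dots> = (1 + 3 * Hbar ^ 4 * SB k) * (\<integral>\<omega>. ?I \<omega> * V k \<omega> \<partial>M)
     + 2 * (\<Sum>z\<in>E. (\<integral>\<omega>. X1 (fst z) (snd z) \<omega> \<partial>M)) + 2 * (\<Sum>i<N. \<Sum>r<m i. (\<integral>\<omega>. X2 i r \<omega> \<partial>M)) + c0
     + 3 * Hbar\<^sup>2 * (\<Sum>i<N. (beta i (Suc k))\<^sup>2 * (\<integral>\<omega>. X3 i \<omega> \<partial>M))"
  proof -
    have j1: "integrable M (\<lambda>\<omega>. \<Sum>z\<in>E. X1 (fst z) (snd z) \<omega>)"
      using x1 by (intro Bochner_Integration.integrable_sum) auto
    have j2: "integrable M (\<lambda>\<omega>. \<Sum>i<N. \<Sum>r<m i. X2 i r \<omega>)"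
      using x2 by (intro Bochner_Integration.integrable_sum) auto
    have j3: "integrable M (\<lambda>\<omega>. \<Sum>i<N. (beta i (Suc k))\<^sup>2 * X3 i \<omega>)"
      using x3 by (intro Bochner_Integration.integrable_sum integrable_mult_right) auto
    have k1: "(\<integral>\<omega>. (\<Sum>z\<in>E. X1 (fst z) (snd z) \<omega>) \<partial>M) = (\<Sum>z\<in>E. (\<integral>\<omega>. X1 (fst z) (snd z) \<omega> \<partial>M))"
      using x1 by (intro Bochner_Integration.integral_sum) auto
    have "(\<integral>\<omega>. (\<Sum>i<N. \<Sum>r<m i. X2 i r \<omega>) \<partial>M) = (\<Sum>i<N. (\<integral>\<omega>. (\<Sum>r<m i. X2 i r \<omega>) \<partial>M))"
      using x2 by (intro Bochner_Integration.integral_sum) auto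
    also have "\<dots> = (\<Sum>i<N. \<Sum>r<m i. (\<integral>\<omega>. X2 i r \<omega> \<partial>M))"
      using x2 by (intro sum.cong refl Bochner_Integration.integral_sum) auto
    finally have k2: "(\<integral>\<omega>. (\<Sum>i<N. \<Sum>r<m i. X2 i r \<omega>) \<partial>M) = (\<Sum>i<N. \<Sum>r<m i. (\<integral>\<omega>. X2 i r \<omega> \<partial>M))" .
    have "(\<integral>\<omega>. (\<Sum>i<N. (beta i (Suc k))\<^sup>2 * X3 i \<omega>) \<partial>M) = (\<Sum>i<N. (\<integral>\<omega>. (beta i (Suc k))\<^sup>2 * X3 i \<omega> \<partial>M))"
      using x3 by (intro Bochner_Integration.integral_sum) auto
    hence k3: "(\<integral>\<omega>. (\<Sum>i<N. (beta i (Suc k))\<^sup>2 * X3 i \<omega>) \<partial>M) = (\<Sum>i<N. (beta i (Suc k))\<^sup>2 * (\<integral>\<omega>. X3 i \<omega> \<partial>M))"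
      by simp
    show ?thesis
      using iV j1 j2 j3 by (simp add: k1 k2 k3 prob_space)
  qed
  also have "(\<Sum>z\<in>E. (\<integral>\<omega>. X1 (fst z) (snd z) \<omega> \<partial>M)) = 0" using x1 by (intro sum.neutral) auto
  also have "(\<Sum>i<N. \<Sum>r<m i. (\<integral>\<omega>. X2 i r \<omega> \<partial>M)) = 0" using x2 by (intro sum.neutral ballI) auto
  finally have "(\<integral>\<omega>. ?I \<omega> * V (Suc k) \<omega> \<partial>M) \<le> (1 + 3 * Hbar ^ 4 * SB k) * (\<integral>\<omega>. ?I \<omega> * V k \<omega> \<partial>M) + c0
     + 3 * Hbar\<^sup>2 * (\<Sum>i<N. (beta i (Suc k))\<^sup>2 * (\<integral>\<omega>. X3 i \<omega> \<partial>M))" by simp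
  moreover have "3 * Hbar\<^sup>2 * (\<Sum>i<N. (beta i (Suc k))\<^sup>2 * (\<integral>\<omega>. X3 i \<omega> \<partial>M)) \<le> 3 * Hbar\<^sup>2 * (SB k * Kw)"
    unfolding SB_def sum_distrib_right using x3 by (intro mult_left_mono sum_mono) auto
  ultimately show ?thesis by (simp add: c0_def)
qed

lemma V_AE_bounded:
  assumes al: "\<And>i j. (i, j) \<in> E \<Longrightarrow> summable (\<lambda>k. (alpha i j (Suc k))\<^sup>2)"
    and be: "\<And>i. i < N \<Longrightarrow> summable (\<lambda>k. (beta i (Suc k))\<^sup>2)"
  shows "AE \<omega> in M. \<exists>C. \<forall>k. V k \<omega> \<le> C"
proof (cases "N = 0")
  case True
  have "V k \<omega> = 0" for k \<omega> unfolding V_def using True by simp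
  thus ?thesis by auto
next
  case False
  have Kw: "0 \<le> Kw"
  proof -
    have "0 \<le> (\<integral>\<omega>. (\<Sum>r<m 0. (w 0 (Suc 0) \<omega> r)\<^sup>2) \<partial>M)" by (simp add: sum_nonneg)
    also have "\<dots> \<le> Kw" using False by (intro w_var) auto
    finally show ?thesis .
  qed
  have sA: "summable SA" unfolding SA_def[abs_def]
    using al by (intro summable_sum) (auto simp: power_mult_distrib intro!: summable_mult2)
  have sB: "summable SB" unfolding SB_def[abs_def] using be by (intro summable_sum) auto
  have SA0: "0 \<le> SA k" for k by (auto simp: SA_def intro!: sum_nonneg)
  have SB0: "0 \<le> SB k" for k by (auto simp: SB_def intro!: sum_nonneg)
  show ?thesis
    by (rule almost_supermartingale_AE_bounded[OF V_nonneg V_measurable V_integrable V_expectation_step])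
      (use sA sB SA0 SB0 Kw in \<open>auto intro!: summable_add summable_mult summable_mult2\<close>)
qed

lemma er_sq_le_V: "i < N \<Longrightarrow> c < n \<Longrightarrow> (er k \<omega> i c)\<^sup>2 \<le> V k \<omega>"
proof -
  assume "i < N" "c < n"
  hence "(er k \<omega> i c)\<^sup>2 \<le> (\<Sum>c<n. (er k \<omega> i c)\<^sup>2)" by (intro member_le_sum) auto
  also have "\<dots> \<le> V k \<omega>" unfolding V_def using \<open>i < N\<close> by (intro member_le_sum) (auto intro: sum_nonneg)
  finally show ?thesis .
qed

end

section \<open>Counting transmitted bits\<close>

context sc_system begin

lemma sc_rate_eq:
  "sc_rate N n a nu b alpha beta m H (obs n H theta (\<lambda>i k. w i k \<omega>)) (\<lambda>i k. d i k \<omega>) th0 i j k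
     = (\<Sum>t<k. bit i j t \<omega>) / real k"
proof -
  have "(\<Sum>t = 1..k. sc_bits N n a nu b alpha beta m H (obs n H theta (\<lambda>i k. w i k \<omega>)) (\<lambda>i k. d i k \<omega>) th0 i j t)
     = (\<Sum>t<k. bit i j t \<omega>)"
    by (rule sum.reindex_bij_witness[of _ Suc "\<lambda>t. t - 1"])
      (auto simp: sc_bits_def bit_def xx_def est_def thr_def)
  thus ?thesis by (simp add: sc_rate_def)
qed

definition pr :: "nat \<Rightarrow> nat \<Rightarrow> nat \<Rightarrow> 'a \<Rightarrow> real" where
  "pr i j k \<omega> = send_prob (b i j) (thr i j (Suc k)) (xx k \<omega> i)"

lemma pr_nonneg: "0 \<le> pr i j k \<omega>" by (simp add: pr_def send_prob_nonneg)

lemma pr_measurable: "i < N \<Longrightarrow> pr i j k \<in> borel_measurable (F k)"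
  unfolding pr_def[abs_def] using xx_measurable[of i k] by measurable

lemma pr_le:
  assumes "(i, j) \<in> E" "\<bar>xx k \<omega> i\<bar> \<le> X"
  shows "pr i j k \<omega> \<le> exp (X / b i j) * real (Suc k) powr - nu i j"
proof -
  have "pr i j k \<omega> \<le> exp (X / b i j) * exp (- thr i j (Suc k) / b i j)"
    unfolding pr_def by (rule send_prob_le[OF b_pos[OF assms(1)] assms(2)])
  also have "exp (- thr i j (Suc k) / b i j) = real (Suc k) powr - nu i j"
    unfolding thr_def by (rule powr_eq_exp_threshold[OF b_pos[OF assms(1)]]) simp
  finally show ?thesis .
qed

lemma bit_cases: "bit i j k \<omega> = 0 \<or> bit i j k \<omega> = 1" by (simp add: bit_def)

text \<open>An exponential supermartingale: a bit takes the values 0 and 1, so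
  \<open>exp (s * bit)\<close> is affine in the bit and has conditional mean
  \<open>1 + (exp s - 1) * pr\<close>, which is at most
  \<open>exp ((exp s - 1) * pr)\<close>.\<close>

lemma bits_exp_moment:
  fixes s :: real
  assumes ij: "(i, j) \<in> E" and s: "0 \<le> s"
  defines "U \<equiv> \<lambda>k \<omega>. s * (\<Sum>t<k. bit i j t \<omega>) - (exp s - 1) * (\<Sum>t<k. pr i j t \<omega>)"
  shows "U k \<in> borel_measurable (F k) \<and> integrable M (\<lambda>\<omega>. exp (U k \<omega>)) \<and> (\<integral>\<omega>. exp (U k \<omega>) \<partial>M) \<le> 1"
proof -
  have i: "i < N" using ij by (simp add: edges_def)
  have es: "0 \<le> exp s - 1" using s by simp
  have UF: "U k \<in> borel_measurable (F k)" for k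
  proof -
    have "(\<lambda>\<omega>. bit i j t \<omega>) \<in> borel_measurable (F k)" "(\<lambda>\<omega>. pr i j t \<omega>) \<in> borel_measurable (F k)" if "t < k" for t
      using that meas_F_mono[OF bit_measurable[OF i], of t k j] meas_F_mono[OF pr_measurable[OF i], of t k j] by auto
    thus ?thesis unfolding U_def
      by (intro borel_measurable_diff borel_measurable_times borel_measurable_const borel_measurable_sum) auto
  qed
  have Ule: "U k \<omega> \<le> s * real k" for k \<omega>
  proof -
    have "(\<Sum>t<k. bit i j t \<omega>) \<le> (\<Sum>t<k. 1)" by (intro sum_mono) (simp add: bit_def)
    hence "s * (\<Sum>t<k. bit i j t \<omega>) \<le> s * real k" using s by (intro mult_left_mono) auto
    moreover have "0 \<le> (exp s - 1) * (\<Sum>t<k. pr i j t \<omega>)"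
      using es by (intro mult_nonneg_nonneg sum_nonneg pr_nonneg) auto
    ultimately show ?thesis by (simp add: U_def)
  qed
  have int: "integrable M (\<lambda>\<omega>. exp (U k \<omega>))" for k
  proof (rule integrable_const_bound[where B="exp (s * real k)"])
    show "AE \<omega> in M. norm (exp (U k \<omega>)) \<le> exp (s * real k)" using Ule by auto
  qed (use meas_F_M[OF UF] in measurable)
  have "(\<integral>\<omega>. exp (U k \<omega>) \<partial>M) \<le> 1" for k
  proof (induction k)
    case 0
    thus ?case by (simp add: U_def prob_space)
  next
    case (Suc k)
    \<comment> \<open>The compensator of the next bit is already subtracted; it is known at time
      \<open>k\<close>, so \<open>Y\<close> is a weight from the past.\<close>
    define Y where "Y \<omega> = exp (U k \<omega> - (exp s - 1) * pr i j k \<omega>)" for \<omega>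
    have YF: "Y \<in> borel_measurable (F k)"
      unfolding Y_def[abs_def] using UF[of k] pr_measurable[OF i, of j k] by measurable
    have Yi: "integrable M Y"
    proof (rule integrable_const_bound[where B="exp (s * real k)"])
      show "AE \<omega> in M. norm (Y \<omega>) \<le> exp (s * real k)"
      proof (rule AE_I2)
        fix \<omega>
        have "0 \<le> (exp s - 1) * pr i j k \<omega>" using es pr_nonneg by simp
        thus "norm (Y \<omega>) \<le> exp (s * real k)" using Ule[of k \<omega>] by (simp add: Y_def)
      qed
    qed (rule meas_F_M[OF YF])
    have b1: "exp (U (Suc k) \<omega>) = Y \<omega> + (exp s - 1) * (Y \<omega> * bit i j k \<omega>)" for \<omega>
    proof -
      have "U (Suc k) \<omega> = (U k \<omega> - (exp s - 1) * pr i j k \<omega>) + s * bit i j k \<omega>"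
        by (simp add: U_def algebra_simps)
      hence "exp (U (Suc k) \<omega>) = Y \<omega> * exp (s * bit i j k \<omega>)" by (simp add: Y_def exp_add[symmetric])
      thus ?thesis using bit_cases[of i j k \<omega>] by (auto simp: algebra_simps)
    qed
    have ib: "integrable M (\<lambda>\<omega>. Y \<omega> * bit i j k \<omega>)"
      by (rule integrable_mult_bounded[OF Yi meas_F_M[OF bit_measurable[OF i]], of _ _ 1]) (simp add: bit_def)
    have ip: "integrable M (\<lambda>\<omega>. Y \<omega> * pr i j k \<omega>)"
    proof (rule integrable_mult_bounded[OF Yi meas_F_M[OF pr_measurable[OF i]], of _ _ 2])
      show "\<bar>pr i j k \<omega>\<bar> \<le> 2" for \<omega>
        using lap_cdf_le_1[of "(xx k \<omega> i - thr i j (Suc k)) / b i j"]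
          lap_cdf_le_1[of "(- xx k \<omega> i - thr i j (Suc k)) / b i j"] pr_nonneg[of i j k \<omega>]
        unfolding pr_def send_prob_def by linarith
    qed
    have "(\<integral>\<omega>. exp (U (Suc k) \<omega>) \<partial>M) = (\<integral>\<omega>. Y \<omega> \<partial>M) + (exp s - 1) * (\<integral>\<omega>. Y \<omega> * bit i j k \<omega> \<partial>M)"
      unfolding b1 using Yi ib by simp
    also have "\<dots> = (\<integral>\<omega>. Y \<omega> \<partial>M) + (exp s - 1) * (\<integral>\<omega>. Y \<omega> * pr i j k \<omega> \<partial>M)"
      unfolding bit_integral(2)[OF ij YF Yi] pr_def ..
    also have "\<dots> = (\<integral>\<omega>. Y \<omega> + (exp s - 1) * (Y \<omega> * pr i j k \<omega>) \<partial>M)" using Yi ip by simp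
    also have "\<dots> \<le> (\<integral>\<omega>. exp (U k \<omega>) \<partial>M)"
    proof (rule integral_mono)
      fix \<omega>
      have "Y \<omega> * (1 + (exp s - 1) * pr i j k \<omega>) \<le> Y \<omega> * exp ((exp s - 1) * pr i j k \<omega>)"
        by (intro mult_left_mono exp_ge_add_one_self) (simp add: Y_def)
      also have "\<dots> = exp (U k \<omega>)" by (simp add: Y_def exp_add[symmetric])
      finally show "Y \<omega> + (exp s - 1) * (Y \<omega> * pr i j k \<omega>) \<le> exp (U k \<omega>)" by (simp add: algebra_simps)
    qed (use Yi ip int in auto)
    finally show ?case using Suc.IH by simp
  qed
  thus ?thesis using UF int by blast
qed

text \<open>\<open>s\<close> may depend on \<open>k\<close>: a constant suffices for the order of
  magnitude, while the sharp leading constant needs \<open>s\<close> tending to 0, at the price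
  \<open>ln k / s\<close>. The factor \<open>1 + s k\<close> comes from the quadratic bound on the
  exponential.\<close>

lemma bits_AE_bound:
  fixes s :: "nat \<Rightarrow> real"
  assumes ij: "(i, j) \<in> E" and s: "\<And>k. 2 \<le> k \<Longrightarrow> 0 < s k \<and> s k \<le> 1"
  shows "AE \<omega> in M. \<exists>C>0. \<forall>k\<ge>2. (\<Sum>t<k. bit i j t \<omega>) \<le> (1 + s k) * (\<Sum>t<k. pr i j t \<omega>) + C * (ln (real k) / s k)"
proof -
  \<comment> \<open>The value 1 for \<open>k < 2\<close> is a filler that makes the moment bound
    available at every index.\<close>
  define s' where "s' k = (if 2 \<le> k then s k else 1)" for k
  have s': "0 < s' k" "s' k \<le> 1" for k using s by (auto simp: s'_def)
  define U where "U k \<omega> = s' k * (\<Sum>t<k. bit i j t \<omega>) - (exp (s' k) - 1) * (\<Sum>t<k. pr i j t \<omega>)" for k \<omega>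
  have U: "U k \<in> borel_measurable (F k) \<and> integrable M (\<lambda>\<omega>. exp (U k \<omega>)) \<and> (\<integral>\<omega>. exp (U k \<omega>) \<partial>M) \<le> 1" for k
    using bits_exp_moment[OF ij less_imp_le[OF s'(1)[of k]], of k] unfolding U_def[abs_def] by simp
  have "AE \<omega> in M. (\<forall>k\<ge>(1::nat). \<omega> \<in> space M) \<longrightarrow> (\<exists>C>0. \<forall>k\<ge>2. U k \<omega> \<le> C * ln (real k))"
  proof (rule exp_moment_imp_log_bound[where K=1 and q=0 and G="\<lambda>_. space M"])
    fix k assume "1 \<le> (k::nat)"
    have eq: "(\<integral>\<omega>. indicator (space M) \<omega> * exp (U k \<omega>) \<partial>M) = (\<integral>\<omega>. exp (U k \<omega>) \<partial>M)"
      by (intro Bochner_Integration.integral_cong) auto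
    show "integrable M (\<lambda>\<omega>. indicator (space M) \<omega> * exp (U k \<omega>))"
      using U[of k] integrable_mult_indicator[of "space M" M "\<lambda>\<omega>. exp (U k \<omega>)"] by simp
    show "(\<integral>\<omega>. indicator (space M) \<omega> * exp (U k \<omega>) \<partial>M) \<le> 1 * real k powr 0"
      unfolding eq using U[of k] \<open>1 \<le> k\<close> by simp
  qed (use U meas_F_M in auto)
  thus ?thesis
  proof (rule AE_mp, intro AE_I2 impI)
    fix \<omega> assume "\<omega> \<in> space M" "(\<forall>k\<ge>(1::nat). \<omega> \<in> space M) \<longrightarrow> (\<exists>C>0. \<forall>k\<ge>2. U k \<omega> \<le> C * ln (real k))"
    then obtain C where C: "C > 0" "\<And>k. k \<ge> 2 \<Longrightarrow> U k \<omega> \<le> C * ln (real k)" by blast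
    have "(\<Sum>t<k. bit i j t \<omega>) \<le> (1 + s k) * (\<Sum>t<k. pr i j t \<omega>) + C * (ln (real k) / s k)" if k: "2 \<le> k" for k
    proof -
      let ?P = "\<Sum>t<k. pr i j t \<omega>"
      have sk: "0 < s k" "s k \<le> 1" using s[OF k] by auto
      have "exp (s k) \<le> 1 + s k + (s k)\<^sup>2" by (rule exp_bound) (use sk in auto)
      hence "(exp (s k) - 1) * ?P \<le> (s k + (s k)\<^sup>2) * ?P"
        by (intro mult_right_mono) (auto intro!: sum_nonneg pr_nonneg)
      hence "s k * (\<Sum>t<k. bit i j t \<omega>) \<le> C * ln (real k) + (s k + (s k)\<^sup>2) * ?P"
        using C(2)[OF k] k by (simp add: U_def s'_def)
      also have "\<dots> = s k * ((1 + s k) * ?P + C * (ln (real k) / s k))"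
        using sk by (simp add: field_simps power2_eq_square)
      finally show ?thesis using sk by simp
    qed
    thus "\<exists>C>0. \<forall>k\<ge>2. (\<Sum>t<k. bit i j t \<omega>) \<le> (1 + s k) * (\<Sum>t<k. pr i j t \<omega>) + C * (ln (real k) / s k)"
      using C(1) by blast
  qed
qed

text \<open>At threshold 0 the two tails add up to 1, so the nonnegative variable
  \<open>1 - bit\<close> has mean 0.\<close>

lemma bits_zero_nu:
  assumes ij: "(i, j) \<in> E" and nu: "nu i j = 0"
  shows "AE \<omega> in M. \<forall>k\<ge>1. (\<Sum>t<k. bit i j t \<omega>) / real k = 1"
proof -
  have i: "i < N" using ij by (simp add: edges_def)
  have "AE \<omega> in M. bit i j k \<omega> = 1" for k
  proof -
    have bi: "integrable M (bit i j k)"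
      by (rule integrable_const_bound[where B=1]) (auto simp: bit_def intro: meas_F_M[OF bit_measurable[OF i]])
    have "(\<integral>\<omega>. 1 * bit i j k \<omega> \<partial>M) = (\<integral>\<omega>. 1 * send_prob (b i j) (thr i j (Suc k)) (xx k \<omega> i) \<partial>M)"
      by (rule bit_integral(2)[OF ij]) auto
    also have "\<dots> = 1" using send_prob_zero[OF b_pos[OF ij]] nu by (simp add: thr_def prob_space)
    finally have "(\<integral>\<omega>. 1 - bit i j k \<omega> \<partial>M) = 0" using bi by (simp add: prob_space)
    moreover have "integrable M (\<lambda>\<omega>. 1 - bit i j k \<omega>)" using bi by simp
    moreover have "AE \<omega> in M. 0 \<le> 1 - bit i j k \<omega>" by (auto simp: bit_def)
    ultimately have "AE \<omega> in M. 1 - bit i j k \<omega> = 0"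
      using integral_nonneg_eq_0_iff_AE[of M "\<lambda>\<omega>. 1 - bit i j k \<omega>"] by blast
    thus ?thesis by eventually_elim simp
  qed
  hence "AE \<omega> in M. \<forall>k. bit i j k \<omega> = 1" by (simp add: AE_all_countable)
  thus ?thesis by eventually_elim simp
qed

text \<open>On a path of bounded energy the states stay below some \<open>X\<close>, so the sum of
  sending probabilities is of order \<open>k powr (1 - nu)\<close>; since \<open>nu < 1\<close>, the
  deviation \<open>ln k\<close> is absorbed.\<close>

lemma rate_O_nu:
  assumes ij: "(i, j) \<in> E" and nu: "nu i j < 1"
    and bd: "AE \<omega> in M. \<exists>C. \<forall>k. V k \<omega> \<le> C"
  shows "AE \<omega> in M. \<exists>C. \<forall>k\<ge>1. \<bar>(\<Sum>t<k. bit i j t \<omega>) / real k\<bar> \<le> C * (1 / real k powr nu i j)"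
proof -
  have i: "i < N" using ij by (simp add: edges_def)
  let ?s = "1 - nu i j"
  have "AE \<omega> in M. \<exists>C>0. \<forall>k\<ge>2. (\<Sum>t<k. bit i j t \<omega>) \<le> (1 + 1) * (\<Sum>t<k. pr i j t \<omega>) + C * (ln (real k) / 1)"
    by (rule bits_AE_bound[OF ij]) simp
  with bd show ?thesis
  proof eventually_elim
    case (elim \<omega>)
    then obtain C0 C1 where C0: "\<And>k. V k \<omega> \<le> C0" and C1: "C1 > 0" "\<And>k. k \<ge> 2 \<Longrightarrow>
      (\<Sum>t<k. bit i j t \<omega>) \<le> 2 * (\<Sum>t<k. pr i j t \<omega>) + C1 * ln (real k)" by auto
    define X where "X = sqrt C0 + (\<Sum>c<n. \<bar>theta c\<bar>)"
    have X: "\<bar>xx k \<omega> i\<bar> \<le> X" for k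
    proof -
      let ?l = "coord n (Suc k)"
      have "(er k \<omega> i ?l)\<^sup>2 \<le> C0" using er_sq_le_V[OF i coord_less] C0 order_trans by blast
      hence "\<bar>er k \<omega> i ?l\<bar> \<le> sqrt C0" using real_le_rsqrt by fastforce
      moreover have "\<bar>theta ?l\<bar> \<le> (\<Sum>c<n. \<bar>theta c\<bar>)" using coord_less by (intro member_le_sum) auto
      moreover have "xx k \<omega> i = er k \<omega> i ?l + theta ?l" by (simp add: xx_def er_def)
      ultimately show ?thesis unfolding X_def by linarith
    qed
    define C where "C = max 1 ((2 * exp (X / b i j) + C1) / ?s)"
    have "\<bar>(\<Sum>t<k. bit i j t \<omega>) / real k\<bar> \<le> C * (1 / real k powr nu i j)" if k: "1 \<le> k" for k
    proof -
      have Z0: "0 \<le> (\<Sum>t<k. bit i j t \<omega>)" by (intro sum_nonneg) (simp add: bit_def)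
      have kk: "real k powr ?s / real k = 1 / real k powr nu i j"
        using k by (simp add: powr_diff)
      have "(\<Sum>t<k. bit i j t \<omega>) \<le> C * real k powr ?s"
      proof (cases "k = 1")
        case True
        have "bit i j 0 \<omega> \<le> 1" "1 \<le> C" by (simp_all add: bit_def C_def)
        thus ?thesis using True by simp
      next
        case False
        hence k2: "2 \<le> k" using k by simp
        have "(\<Sum>t<k. pr i j t \<omega>) \<le> (\<Sum>t<k. exp (X / b i j) * real (Suc t) powr - nu i j)"
          by (intro sum_mono pr_le[OF ij X])
        also have "\<dots> \<le> exp (X / b i j) * (real k powr ?s / ?s)"
          unfolding sum_distrib_left[symmetric] using sum_powr_le[OF nu_nonneg nu] by (intro mult_left_mono) auto
        finally have P: "(\<Sum>t<k. pr i j t \<omega>) \<le> exp (X / b i j) * (real k powr ?s / ?s)" .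
        have L: "ln (real k) \<le> real k powr ?s / ?s" using k nu by (intro ln_powr_bound) auto
        have "(\<Sum>t<k. bit i j t \<omega>) \<le> 2 * (exp (X / b i j) * (real k powr ?s / ?s)) + C1 * (real k powr ?s / ?s)"
          using C1(2)[OF k2] P mult_left_mono[OF L, of C1] C1(1) by linarith
        also have "\<dots> = ((2 * exp (X / b i j) + C1) / ?s) * real k powr ?s"
          by (simp add: add_divide_distrib distrib_right)
        also have "\<dots> \<le> C * real k powr ?s" by (intro mult_right_mono) (auto simp: C_def)
        finally show ?thesis .
      qed
      hence "(\<Sum>t<k. bit i j t \<omega>) / real k \<le> C * (real k powr ?s / real k)"
        using k by (simp add: divide_right_mono)
      thus ?thesis using Z0 unfolding kk by simp
    qed
    thus ?case by blast
  qed
qed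

end

section \<open>Symmetric bilinear forms\<close>

type_synonym pvec = "nat \<Rightarrow> nat \<Rightarrow> real"

text \<open>Vectors are total functions of two indices, of which only \<open>i < N\<close> and
  \<open>c < n\<close> count. The second clause makes a functional blind to all other entries, so
  vectors may be rewritten on the relevant indices alone.\<close>

definition lin_fun :: "nat \<Rightarrow> nat \<Rightarrow> (pvec \<Rightarrow> real) \<Rightarrow> bool" where
  "lin_fun N n L \<longleftrightarrow> (\<forall>u v x. L (\<lambda>i c. u i c + x * v i c) = L u + x * L v)
     \<and> (\<forall>u v. (\<forall>i<N. \<forall>c<n. u i c = v i c) \<longrightarrow> L u = L v)"

definition sym_form :: "nat \<Rightarrow> nat \<Rightarrow> (pvec \<Rightarrow> pvec \<Rightarrow> real) \<Rightarrow> bool" where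
  "sym_form N n B \<longleftrightarrow> (\<forall>u v. B u v = B v u) \<and> (\<forall>w. lin_fun N n (\<lambda>u. B u w))"

lemma lin_funI:
  assumes "\<And>u v x. L (\<lambda>i c. u i c + x * v i c) = L u + x * L v"
    and "\<And>u v. (\<And>i c. i < N \<Longrightarrow> c < n \<Longrightarrow> u i c = v i c) \<Longrightarrow> L u = L v"
  shows "lin_fun N n L"
  unfolding lin_fun_def
proof (intro conjI allI impI)
  show "L (\<lambda>i c. u i c + x * v i c) = L u + x * L v" for u v x using assms(1)[of u x v] .
  show "L u = L v" if "\<forall>i<N. \<forall>c<n. u i c = v i c" for u v
    using assms(2)[of u v] that by blast
qed

lemma lin_fun_add_scaled: "lin_fun N n L \<Longrightarrow> L (\<lambda>i c. u i c + x * v i c) = L u + x * L v"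
  unfolding lin_fun_def by blast

lemma lin_fun_cong: "lin_fun N n L \<Longrightarrow> (\<And>i c. i < N \<Longrightarrow> c < n \<Longrightarrow> u i c = v i c) \<Longrightarrow> L u = L v"
  unfolding lin_fun_def by blast

lemma lin_fun_comb:
  assumes "lin_fun N n L" "lin_fun N n K"
  shows "lin_fun N n (\<lambda>u. y * L u + z * K u)"
proof (rule lin_funI)
  show "y * L (\<lambda>i c. u i c + x * v i c) + z * K (\<lambda>i c. u i c + x * v i c) = y * L u + z * K u + x * (y * L v + z * K v)"
    for u v x unfolding assms[THEN lin_fun_add_scaled] by (simp add: algebra_simps)
  show "y * L u + z * K u = y * L v + z * K v" if "\<And>i c. i < N \<Longrightarrow> c < n \<Longrightarrow> u i c = v i c" for u v
    using lin_fun_cong[OF assms(1), of u v] lin_fun_cong[OF assms(2), of u v] that by simp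
qed

lemma sym_formI: "(\<And>u v. B u v = B v u) \<Longrightarrow> (\<And>w. lin_fun N n (\<lambda>u. B u w)) \<Longrightarrow> sym_form N n B"
  unfolding sym_form_def by blast

lemma sym_form_commute: "sym_form N n B \<Longrightarrow> B u v = B v u"
  unfolding sym_form_def by blast

lemma sym_form_lin: "sym_form N n B \<Longrightarrow> lin_fun N n (\<lambda>u. B u w)"
  unfolding sym_form_def by blast

lemma sym_form_rank1:
  assumes L: "lin_fun N n L" shows "sym_form N n (\<lambda>u v. L u * L v)"
proof (rule sym_formI)
  show "lin_fun N n (\<lambda>u. L u * L w)" for w
  proof (rule lin_funI)
    show "L (\<lambda>i c. u i c + x * v i c) * L w = L u * L w + x * (L v * L w)" for u v x
      unfolding lin_fun_add_scaled[OF L] by (simp add: algebra_simps)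
    show "L u * L w = L v * L w" if "\<And>i c. i < N \<Longrightarrow> c < n \<Longrightarrow> u i c = v i c" for u v
      using lin_fun_cong[OF L, of u v] that by simp
  qed
qed (rule mult.commute)

lemma sym_form_comb:
  assumes "sym_form N n A" "sym_form N n B"
  shows "sym_form N n (\<lambda>u v. y * A u v + z * B u v)"
proof (rule sym_formI)
  show "y * A u v + z * B u v = y * A v u + z * B v u" for u v
    using sym_form_commute[OF assms(1), of u v] sym_form_commute[OF assms(2), of u v] by simp
  show "lin_fun N n (\<lambda>u. y * A u w + z * B u w)" for w
    using lin_fun_comb[OF sym_form_lin[OF assms(1), of w] sym_form_lin[OF assms(2), of w], of y z] .
qed

lemma sym_form_add: "sym_form N n A \<Longrightarrow> sym_form N n B \<Longrightarrow> sym_form N n (\<lambda>u v. A u v + B u v)"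
  using sym_form_comb[of N n A B 1 1] by simp

lemma sym_form_diff: "sym_form N n A \<Longrightarrow> sym_form N n B \<Longrightarrow> sym_form N n (\<lambda>u v. A u v - B u v)"
  using sym_form_comb[of N n A B 1 "-1"] by simp

lemma sym_form_cmult: "sym_form N n B \<Longrightarrow> sym_form N n (\<lambda>u v. x * B u v)"
  using sym_form_comb[of N n B B x 0] by simp

lemma sym_form_zero: "sym_form N n (\<lambda>u v. 0)"
  by (rule sym_formI[OF refl]) (rule lin_funI, auto)

lemma sym_form_sum: "(\<And>s. s \<in> S \<Longrightarrow> sym_form N n (B s)) \<Longrightarrow> sym_form N n (\<lambda>u v. \<Sum>s\<in>S. B s u v)"
proof (induction S rule: infinite_finite_induct)
  case (insert s S)
  have "sym_form N n (\<lambda>u v. B s u v + (\<Sum>s\<in>S. B s u v))"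
    using sym_form_add[of N n "B s" "\<lambda>u v. \<Sum>s\<in>S. B s u v"] insert.IH insert.prems by simp
  thus ?case using insert.hyps by simp
qed (simp_all add: sym_form_zero)

lemma sym_form_add_left: "sym_form N n B \<Longrightarrow> B (\<lambda>i c. u i c + x * v i c) w = B u w + x * B v w"
  using lin_fun_add_scaled[OF sym_form_lin[of N n B w], of u x v] .

lemma sym_form_cong:
  assumes "sym_form N n B" "\<And>i c. i < N \<Longrightarrow> c < n \<Longrightarrow> u i c = u' i c" "\<And>i c. i < N \<Longrightarrow> c < n \<Longrightarrow> v i c = v' i c"
  shows "B u v = B u' v'"
proof -
  have l: "B u w = B u' w" if "\<And>i c. i < N \<Longrightarrow> c < n \<Longrightarrow> u i c = u' i c" for u u' w
    using lin_fun_cong[OF sym_form_lin[OF assms(1), of w], of u u'] that by simp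
  have "B u v = B u' v" by (rule l[OF assms(2)])
  also have "\<dots> = B v u'" by (rule sym_form_commute[OF assms(1)])
  also have "\<dots> = B v' u'" by (rule l[OF assms(3)])
  also have "\<dots> = B u' v'" by (rule sym_form_commute[OF assms(1)])
  finally show ?thesis .
qed

lemma sym_form_quad_add:
  assumes "sym_form N n B"
  shows "B (\<lambda>i c. u i c + x * v i c) (\<lambda>i c. u i c + x * v i c) = B u u + 2 * x * B u v + x\<^sup>2 * B v v"
proof -
  let ?w = "\<lambda>i c. u i c + x * v i c"
  have l: "B ?w z = B u z + x * B v z" for z using sym_form_add_left[OF assms, of u x v z] .
  have 1: "B u ?w = B u u + x * B u v"
    using l[of u] sym_form_commute[OF assms, of u ?w] sym_form_commute[OF assms, of v u] by simp
  have 2: "B v ?w = B u v + x * B v v"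
    using l[of v] sym_form_commute[OF assms, of v ?w] by simp
  show ?thesis using l[of ?w] 1 2 by (simp add: power2_eq_square algebra_simps)
qed

text \<open>Positivity at \<open>u + v / t\<close> and at \<open>u - v / t\<close>.\<close>

lemma sym_form_young:
  assumes B: "sym_form N n B" and pos: "\<And>v. 0 \<le> B v v" and t: "0 < t"
  shows "2 * \<bar>B u v\<bar> \<le> t * B u u + B v v / t"
proof -
  have "0 \<le> B u u + 2 * x * B u v + x\<^sup>2 * B v v" for x
    using pos[of "\<lambda>i c. u i c + x * v i c"] sym_form_quad_add[OF B, of u x v] by simp
  from this[of "1 / t"] this[of "- (1 / t)"]
  have "2 * \<bar>B u v\<bar> / t \<le> B u u + B v v / t\<^sup>2" by (auto simp: abs_if power_divide)
  from mult_left_mono[OF this, of t] t show ?thesis by (simp add: algebra_simps power2_eq_square)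
qed

lemma sym_form_cauchy_schwarz:
  assumes B: "sym_form N n B" and pos: "\<And>v. 0 \<le> B v v"
  shows "(B u v)\<^sup>2 \<le> B u u * B v v"
proof -
  have q: "0 \<le> B u u + 2 * x * B u v + x\<^sup>2 * B v v" for x
    using pos[of "\<lambda>i c. u i c + x * v i c"] sym_form_quad_add[OF B, of u x v] by simp
  show ?thesis
  proof (cases "B v v = 0")
    case True
    have "B u v = 0"
    proof (rule ccontr)
      assume "B u v \<noteq> 0"
      \<comment> \<open>The form may be degenerate. If \<open>B v v = 0\<close>, the quadratic is
        affine in \<open>x\<close>, and this choice of \<open>x\<close> gives it the value
        -1.\<close>
      have "2 * (- (B u u + 1) / (2 * B u v)) * B u v = - (B u u + 1)" using \<open>B u v \<noteq> 0\<close> by simp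
      with q[of "- (B u u + 1) / (2 * B u v)"] True show False by simp
    qed
    thus ?thesis using True by simp
  next
    case False
    hence "0 < B v v" using pos[of v] by simp
    thus ?thesis using q[of "- B u v / B v v"] by (simp add: power2_eq_square field_simps)
  qed
qed

lemma sym_form_sum_right:
  assumes B: "sym_form N n B"
  shows "B u (\<lambda>i c. \<Sum>s\<in>S. x s * v s i c) = (\<Sum>s\<in>S. x s * B u (v s))"
proof -
  have z: "B u (\<lambda>i c. 0) = 0"
    using sym_form_add_left[OF B, of "\<lambda>i c. 0" "- 1" "\<lambda>i c. 0" u] sym_form_commute[OF B] by simp
  show ?thesis
  proof (induction S rule: infinite_finite_induct)
    case (insert s S)
    have eq: "(\<lambda>i c. \<Sum>s\<in>insert s S. x s * v s i c) = (\<lambda>i c. (\<Sum>s\<in>S. x s * v s i c) + x s * v s i c)"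
      using insert.hyps by (simp add: add.commute)
    have "B u (\<lambda>i c. (\<Sum>s\<in>S. x s * v s i c) + x s * v s i c) = B (\<lambda>i c. (\<Sum>s\<in>S. x s * v s i c) + x s * v s i c) u"
      by (rule sym_form_commute[OF B])
    also have "\<dots> = B (\<lambda>i c. \<Sum>s\<in>S. x s * v s i c) u + x s * B (v s) u"
      using sym_form_add_left[OF B, of "\<lambda>i c. \<Sum>s\<in>S. x s * v s i c" "x s" "v s" u] .
    also have "\<dots> = (\<Sum>s\<in>S. x s * B u (v s)) + x s * B u (v s)"
      using insert.IH sym_form_commute[OF B, of u] by simp
    finally show ?case unfolding eq using insert.hyps by (simp add: add.commute)
  qed (simp_all add: z)
qed

section \<open>Stacked error vectors and averages over a window\<close>

definition ip :: "nat \<Rightarrow> nat \<Rightarrow> pvec \<Rightarrow> pvec \<Rightarrow> real" where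
  "ip N n u v = (\<Sum>i<N. \<Sum>c<n. u i c * v i c)"

lemma sym_form_ip: "sym_form N n (ip N n)"
proof -
  have "sym_form N n (\<lambda>u v. u i c * v i c)" if "i < N" "c < n" for i c
    by (rule sym_form_rank1, rule lin_funI) (use that in auto)
  thus ?thesis unfolding ip_def[abs_def] by (intro sym_form_sum) auto
qed

lemma ip_nonneg: "0 \<le> ip N n v v" by (auto simp: ip_def intro!: sum_nonneg)

lemma ip_eq_sum_sq: "ip N n v v = (\<Sum>i<N. \<Sum>c<n. (v i c)\<^sup>2)" by (simp add: ip_def power2_eq_square)

lemma sq_le_ip: "i < N \<Longrightarrow> c < n \<Longrightarrow> (v i c)\<^sup>2 \<le> ip N n v v"
proof -
  assume "i < N" "c < n"
  hence "(v i c)\<^sup>2 \<le> (\<Sum>c<n. (v i c)\<^sup>2)" by (intro member_le_sum) auto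
  also have "\<dots> \<le> ip N n v v" unfolding ip_eq_sum_sq using \<open>i < N\<close> by (intro member_le_sum) (auto intro: sum_nonneg)
  finally show ?thesis .
qed

lemma diff_sq_le_ip: "i < N \<Longrightarrow> j < N \<Longrightarrow> c < n \<Longrightarrow> (v i c - v j c)\<^sup>2 \<le> 4 * ip N n v v"
proof -
  assume *: "i < N" "j < N" "c < n"
  have "(v i c - v j c)\<^sup>2 \<le> 2 * (v i c)\<^sup>2 + 2 * (v j c)\<^sup>2"
    using zero_le_power2[of "v i c + v j c"] by (simp add: power2_eq_square algebra_simps)
  thus ?thesis using sq_le_ip[of i N c n v] sq_le_ip[of j N c n v] * by linarith
qed

lemma ip_add_le: "ip N n (\<lambda>i c. u i c + v i c) (\<lambda>i c. u i c + v i c) \<le> 2 * ip N n u u + 2 * ip N n v v"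
proof -
  have "(x + y)\<^sup>2 \<le> 2 * x\<^sup>2 + 2 * y\<^sup>2" for x y :: real
    using zero_le_power2[of "x - y"] by (simp add: power2_eq_square algebra_simps)
  hence "ip N n (\<lambda>i c. u i c + v i c) (\<lambda>i c. u i c + v i c) \<le> (\<Sum>i<N. \<Sum>c<n. 2 * (u i c)\<^sup>2 + 2 * (v i c)\<^sup>2)"
    unfolding ip_eq_sum_sq by (intro sum_mono)
  thus ?thesis by (simp add: ip_eq_sum_sq sum.distrib sum_distrib_left)
qed

text \<open>Abel summation with linearly decreasing weights: moving the window forward by one step
  trades the current term \<open>q t\<close> for the average over the window. The weights of
  \<open>Rf\<close> are chosen for this identity.\<close>

lemma window_shift:
  fixes q :: "nat \<Rightarrow> real"
  assumes "0 < T"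
  shows "(\<Sum>s<T. (real T - 1 - real s) / real T * q (Suc t + s)) + q t =
     (\<Sum>s<T. (real T - 1 - real s) / real T * q (t + s)) + (\<Sum>s<T. q (t + s)) / real T"
proof -
  define g where "g s = (real T - real s) / real T * q (t + s)" for s
  have "(\<Sum>s<T. (real T - 1 - real s) / real T * q (Suc t + s)) = (\<Sum>s<T. g (Suc s))"
    by (intro sum.cong refl) (simp add: g_def algebra_simps)
  moreover have "q t = g 0" using assms by (simp add: g_def)
  moreover have "(\<Sum>s<T. g (Suc s)) + g 0 = (\<Sum>s<Suc T. g s)" unfolding sum.lessThan_Suc_shift by simp
  moreover have "\<dots> = (\<Sum>s<T. g s)" by (simp add: g_def)
  moreover have "(\<Sum>s<T. g s) = (\<Sum>s<T. (real T - 1 - real s) / real T * q (t + s) + q (t + s) / real T)"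
    using assms by (intro sum.cong refl) (simp add: g_def field_simps)
  ultimately show ?thesis by (simp add: sum.distrib sum_divide_distrib)
qed

lemma sum_lessThan_add: "(\<Sum>s<(a::nat) + b. f s :: real) = (\<Sum>s<a. f s) + (\<Sum>s<b. f (a + s))"
  by (induction b) (simp_all add: add.assoc)

lemma mod_add_cong_aux:
  assumes "((a::nat) + x) mod n = (a + y) mod n" "x < n" "y < n"
  shows "x = y"
proof -
  have *: "y = x" if "x \<le> y" "(a + y) mod n = (a + x) mod n" "y < n" for x y
  proof -
    have "n dvd (a + y) - (a + x)" using that by (subst mod_eq_dvd_iff_nat[symmetric]) auto
    hence "n dvd y - x" by simp
    moreover have "y - x < n" using that by simp
    ultimately have "y - x = 0" using nat_dvd_not_less[of "y - x" n] by auto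
    thus ?thesis using that by simp
  qed
  show ?thesis
  proof (cases "x \<le> y")
    case True
    from *[OF True assms(1)[symmetric] assms(3)] show ?thesis by simp
  next
    case False
    from *[OF _ assms(1) assms(2)] False show ?thesis by simp
  qed
qed

text \<open>Adding a constant permutes the residues modulo \<open>n\<close>, so any \<open>n\<close>
  consecutive times visit each coordinate once.\<close>

lemma sum_coord_cycle:
  assumes "0 < n" "1 \<le> t"
  shows "(\<Sum>s<n * p. f (coord n (t + s))) = real p * (\<Sum>l<n. f l :: real)"
proof -
  have one: "(\<Sum>s<n. f (coord n (t + s))) = (\<Sum>l<n. f l)" if "1 \<le> t" for t
  proof -
    let ?g = "\<lambda>s. (t - 1 + s) mod n"
    have inj: "inj_on ?g {..<n}"
    proof (rule inj_onI)
      fix x y assume "x \<in> {..<n}" "y \<in> {..<n}" "(t - 1 + x) mod n = (t - 1 + y) mod n"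
      thus "x = y" using mod_add_cong_aux[of "t - 1" x n y] by blast
    qed
    have "?g ` {..<n} \<subseteq> {..<n}" using assms(1) by auto
    from endo_inj_surj[OF finite_lessThan this inj] have "bij_betw ?g {..<n} {..<n}"
      using inj by (rule bij_betw_imageI[rotated])
    from sum.reindex_bij_betw[OF this, of f]
    have "(\<Sum>s<n. f ((t - 1 + s) mod n)) = (\<Sum>l<n. f l)" .
    moreover have "coord n (t + s) = (t - 1 + s) mod n" for s using that by (simp add: coord_def)
    ultimately show ?thesis by simp
  qed
  show ?thesis
  proof (induction p)
    case (Suc p)
    have "(\<Sum>s<n * Suc p. f (coord n (t + s))) = (\<Sum>s<n * p + n. f (coord n (t + s)))"
      by (simp add: add.commute)
    also have "\<dots> = (\<Sum>s<n * p. f (coord n (t + s))) + (\<Sum>s<n. f (coord n (t + (n * p + s))))"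
      using sum_lessThan_add[of "\<lambda>s. f (coord n (t + s))" "n * p" n] .
    also have "(\<Sum>s<n. f (coord n (t + (n * p + s)))) = (\<Sum>l<n. f l)"
      using one[of "t + n * p"] assms by (simp add: add.assoc)
    finally show ?case using Suc by (simp add: distrib_right)
  qed simp
qed

lemma sum_blocks:
  fixes f :: "nat \<Rightarrow> real"
  shows "(\<Sum>s<n * p. f s) = (\<Sum>q<n. \<Sum>s<p. f (q * p + s))"
proof (induction n)
  case (Suc n)
  have eq: "Suc n * p = n * p + p" by simp
  show ?case unfolding eq sum_lessThan_add[of f "n * p" p] Suc by simp
qed simp

section \<open>Averaged excitation\<close>

text \<open>\<open>lam\<close> is kept as an arbitrary Poincare constant of the graph: it becomes
  \<open>lambda2\<close> when the gain \<open>a\<close> mentions that eigenvalue, and some positive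
  constant otherwise.\<close>

locale sc_poly = sc_system +
  fixes p :: nat and delta :: real and gamma :: "nat \<Rightarrow> nat \<Rightarrow> real" and lam :: real
  assumes N_pos: "0 < N"
    and Hbar_pos: "0 < Hbar" and p_pos: "0 < p" and delta_pos: "0 < delta"
    and pe: "\<And>k x. 1 \<le> k \<Longrightarrow>
        (1 / real p) * (\<Sum>t\<in>{k..k + p - 1}. \<Sum>i<N. \<Sum>r<m i. (\<Sum>c<n. H i t r c * x c)\<^sup>2)
          \<ge> delta * (\<Sum>c<n. (x c)\<^sup>2)"
    and alpha_poly: "\<And>i j k. (i, j) \<in> edges N a \<Longrightarrow> alpha i j (Suc k) = alpha i j 1 / real (Suc k) powr gamma i j"
    and beta_poly: "\<And>i k. i < N \<Longrightarrow> beta i (Suc k) = beta i 1 / real (Suc k)"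
    and gamma_gt: "\<And>i j. (i, j) \<in> edges N a \<Longrightarrow> 1 / 2 < gamma i j"
    and gamma_nu: "\<And>i j. (i, j) \<in> edges N a \<Longrightarrow> nu i j + gamma i j \<le> 1"
    and lam_pos: "0 < lam"
    and poincare: "\<And>x :: nat \<Rightarrow> real. 2 * lam * (\<Sum>i<N. (x i - (\<Sum>i<N. x i) / real N)\<^sup>2)
        \<le> (\<Sum>(i, j)\<in>edges N a. a i j * (x i - x j)\<^sup>2)"
begin

text \<open>The dissipation at time \<open>t\<close> up to the factor \<open>1 / t\<close>:
  \<open>mu\<close> stands for a lower bound on the effective coupling and \<open>bl\<close> for one
  on the regression gain. The half compensates for edges being listed in both orientations.\<close>

definition Qf :: "real \<Rightarrow> real \<Rightarrow> nat \<Rightarrow> pvec \<Rightarrow> pvec \<Rightarrow> real" where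
  "Qf mu bl t u v = mu / 2 * (\<Sum>z\<in>E. a (fst z) (snd z) *
       ((u (fst z) (coord n t) - u (snd z) (coord n t)) * (v (fst z) (coord n t) - v (snd z) (coord n t))))
     + bl * (\<Sum>i<N. \<Sum>r<m i. Hv i t (u i) r * Hv i t (v i) r)"

text \<open>A common multiple of the coordinate cycle \<open>n\<close> and the excitation length
  \<open>p\<close>, so that both averages close up over one window.\<close>

definition Tw :: nat where "Tw = n * p"

definition Rf :: "real \<Rightarrow> real \<Rightarrow> nat \<Rightarrow> pvec \<Rightarrow> pvec \<Rightarrow> real" where
  "Rf mu bl t u v = (\<Sum>s<Tw. (real Tw - 1 - real s) / real Tw * Qf mu bl (t + s) u v)"

lemma Tw_pos: "0 < Tw" using n_pos p_pos by (simp add: Tw_def)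

lemma edge_bounds: "z \<in> E \<Longrightarrow> fst z < N \<and> snd z < N"
  by (auto simp: edges_def)

lemma sym_form_Qf: "sym_form N n (Qf mu bl t)"
proof -
  have 1: "sym_form N n (\<lambda>u v. a (fst z) (snd z) *
     ((u (fst z) (coord n t) - u (snd z) (coord n t)) * (v (fst z) (coord n t) - v (snd z) (coord n t))))"
    if z: "z \<in> E" for z
  proof -
    have "lin_fun N n (\<lambda>u. u (fst z) (coord n t) - u (snd z) (coord n t))"
      by (rule lin_funI) (use coord_less[of t] edge_bounds[OF z] in \<open>auto simp: algebra_simps\<close>)
    from sym_form_cmult[OF sym_form_rank1[OF this], of "a (fst z) (snd z)"] show ?thesis .
  qed
  have 2: "sym_form N n (\<lambda>u v. Hv i t (u i) r * Hv i t (v i) r)" if "i < N" for i r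
  proof -
    have "lin_fun N n (\<lambda>u. Hv i t (u i) r)"
    proof (rule lin_funI)
      show "Hv i t (\<lambda>c. u i c + x * v i c) r = Hv i t (u i) r + x * Hv i t (v i) r" for u v x
        by (simp add: Hv_def sum.distrib sum_distrib_left algebra_simps)
      show "Hv i t (u i) r = Hv i t (v i) r" if "\<And>i c. i < N \<Longrightarrow> c < n \<Longrightarrow> u i c = v i c" for u v
        unfolding Hv_def using that \<open>i < N\<close> by (intro sum.cong) auto
    qed
    from sym_form_rank1[OF this] show ?thesis .
  qed
  have s1: "sym_form N n (\<lambda>u v. \<Sum>z\<in>E. a (fst z) (snd z) *
     ((u (fst z) (coord n t) - u (snd z) (coord n t)) * (v (fst z) (coord n t) - v (snd z) (coord n t))))"
    by (rule sym_form_sum) (rule 1)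
  have s2: "sym_form N n (\<lambda>u v. \<Sum>i<N. \<Sum>r<m i. Hv i t (u i) r * Hv i t (v i) r)"
    by (rule sym_form_sum, rule sym_form_sum) (use 2 in auto)
  from sym_form_comb[OF s1 s2, of "mu / 2" bl] show ?thesis unfolding Qf_def[abs_def] .
qed

lemma sym_form_Rf: "sym_form N n (Rf mu bl t)"
proof -
  have "sym_form N n (\<lambda>u v. \<Sum>s<Tw. (real Tw - 1 - real s) / real Tw * Qf mu bl (t + s) u v)"
  proof (rule sym_form_sum)
    fix s show "sym_form N n (\<lambda>u v. (real Tw - 1 - real s) / real Tw * Qf mu bl (t + s) u v)"
      using sym_form_cmult[OF sym_form_Qf, of "(real Tw - 1 - real s) / real Tw" mu bl "t + s"] .
  qed
  thus ?thesis unfolding Rf_def[abs_def] .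
qed

definition CQ :: "real \<Rightarrow> real \<Rightarrow> real" where
  "CQ mu bl = 2 * mu * (\<Sum>z\<in>E. a (fst z) (snd z)) + bl * Hbar\<^sup>2"

lemma CQ_nonneg: "0 < mu \<Longrightarrow> 0 < bl \<Longrightarrow> 0 \<le> CQ mu bl"
  unfolding CQ_def by (intro add_nonneg_nonneg mult_nonneg_nonneg sum_nonneg a_nonneg) auto

lemma Hv_sq_sum_le:
  assumes "1 \<le> t" shows "(\<Sum>i<N. \<Sum>r<m i. (Hv i t (v i) r)\<^sup>2) \<le> Hbar\<^sup>2 * ip N n v v"
proof -
  have "(\<Sum>i<N. \<Sum>r<m i. (Hv i t (v i) r)\<^sup>2) \<le> (\<Sum>i<N. Hbar\<^sup>2 * (\<Sum>c<n. (v i c)\<^sup>2))"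
    using assms by (intro sum_mono Hv_bound) auto
  thus ?thesis by (simp add: ip_eq_sum_sq sum_distrib_left)
qed

lemma Qf_nonneg: "0 < mu \<Longrightarrow> 0 < bl \<Longrightarrow> 0 \<le> Qf mu bl t v v"
  unfolding Qf_def power2_eq_square[symmetric]
  by (intro add_nonneg_nonneg mult_nonneg_nonneg[of _ "sum _ _"] mult_nonneg_nonneg[of "a _ _"] sum_nonneg a_nonneg) auto

lemma Qf_le:
  assumes "0 < mu" "0 < bl" "1 \<le> t"
  shows "Qf mu bl t v v \<le> CQ mu bl * ip N n v v"
proof -
  let ?l = "coord n t"
  have "(\<Sum>z\<in>E. a (fst z) (snd z) * ((v (fst z) ?l - v (snd z) ?l) * (v (fst z) ?l - v (snd z) ?l)))
     \<le> (\<Sum>z\<in>E. a (fst z) (snd z) * (4 * ip N n v v))"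
    unfolding power2_eq_square[symmetric]
    using edge_bounds coord_less by (intro sum_mono mult_left_mono a_nonneg diff_sq_le_ip) auto
  hence "mu / 2 * (\<Sum>z\<in>E. a (fst z) (snd z) * ((v (fst z) ?l - v (snd z) ?l) * (v (fst z) ?l - v (snd z) ?l)))
     \<le> mu / 2 * ((\<Sum>z\<in>E. a (fst z) (snd z)) * (4 * ip N n v v))"
    using assms by (intro mult_left_mono) (auto simp: sum_distrib_right)
  moreover have "bl * (\<Sum>i<N. \<Sum>r<m i. Hv i t (v i) r * Hv i t (v i) r) \<le> bl * (Hbar\<^sup>2 * ip N n v v)"
    unfolding power2_eq_square[symmetric, of "Hv _ _ _ _"] using assms by (intro mult_left_mono Hv_sq_sum_le) auto
  ultimately show ?thesis unfolding Qf_def CQ_def by (simp add: algebra_simps)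
qed

definition CR :: "real \<Rightarrow> real \<Rightarrow> real" where "CR mu bl = real Tw * CQ mu bl"

lemma Rf_bounds:
  assumes "0 < mu" "0 < bl" "1 \<le> t"
  shows "0 \<le> Rf mu bl t v v" "Rf mu bl t v v \<le> CR mu bl * ip N n v v"
proof -
  have w: "0 \<le> (real Tw - 1 - real s) / real Tw" "(real Tw - 1 - real s) / real Tw \<le> 1" if "s < Tw" for s
  proof -
    have "real s + 1 \<le> real Tw" using that by linarith
    thus "0 \<le> (real Tw - 1 - real s) / real Tw" "(real Tw - 1 - real s) / real Tw \<le> 1"
      using Tw_pos by (auto simp: divide_le_eq)
  qed
  show "0 \<le> Rf mu bl t v v" unfolding Rf_def
    using w assms by (intro sum_nonneg mult_nonneg_nonneg Qf_nonneg) auto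
  have "Rf mu bl t v v \<le> (\<Sum>s<Tw. 1 * (CQ mu bl * ip N n v v))" unfolding Rf_def
    using w assms by (intro sum_mono mult_mono Qf_le Qf_nonneg) auto
  thus "Rf mu bl t v v \<le> CR mu bl * ip N n v v" by (simp add: CR_def mult.assoc)
qed

lemma Rf_shift:
  "Rf mu bl (Suc t) u v + Qf mu bl t u v = Rf mu bl t u v + (\<Sum>s<Tw. Qf mu bl (t + s) u v) / real Tw"
  unfolding Rf_def using window_shift[OF Tw_pos, of "\<lambda>t. Qf mu bl t u v" t] .

text \<open>The averaged contraction rate. With \<open>mu = m'\<close>, \<open>lam = lambda2\<close>
  and \<open>bl = beta_low\<close> it is the constant \<open>a\<close> of the theorem, see
  \<open>gain_eq\<close>; as \<open>mu\<close> grows it tends to \<open>bl * delta / N\<close>, the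
  value of \<open>a\<close> when \<open>edges'\<close> is empty.\<close>

definition c0 :: "real \<Rightarrow> real \<Rightarrow> real" where
  "c0 mu bl = bl * delta / real N * ((lam * mu / real n) / (2 * Hbar\<^sup>2 * bl + lam * mu / real n))"

text \<open>The excitation condition tested on a unit vector. It makes \<open>c0\<close> at most
  half of the edge constant in \<open>avg_Qf_ge\<close>.\<close>

lemma delta_le: "delta \<le> real N * Hbar\<^sup>2"
proof -
  let ?x = "\<lambda>c. if c = 0 then 1 else 0 :: real"
  have x1: "(\<Sum>c<n. (?x c)\<^sup>2) = 1"
  proof -
    have "(\<Sum>c<n. (?x c)\<^sup>2) = (\<Sum>c<n. if c = 0 then 1 else 0)" by (intro sum.cong) auto
    thus ?thesis using n_pos by simp
  qed
  have "delta * (\<Sum>c<n. (?x c)\<^sup>2) \<le> (1 / real p) * (\<Sum>t\<in>{1..1 + p - 1}. \<Sum>i<N. \<Sum>r<m i. (\<Sum>c<n. H i t r c * ?x c)\<^sup>2)"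
    by (rule pe) simp
  also have "\<dots> \<le> (1 / real p) * (\<Sum>t\<in>{1..1 + p - 1}. \<Sum>i<N. Hbar\<^sup>2 * (\<Sum>c<n. (?x c)\<^sup>2))"
    by (intro mult_left_mono sum_mono H_bound) auto
  also have "\<dots> = real N * Hbar\<^sup>2" unfolding x1 using p_pos by simp
  finally show ?thesis unfolding x1 by simp
qed

text \<open>\<open>v\<close> is split into its network mean \<open>vb\<close> and the deviation.
  Over a window every coordinate is visited \<open>p\<close> times, so the Poincare inequality
  controls the deviation. Excitation controls the mean, at the price of a cross term through which
  the deviation re-enters.\<close>

lemma avg_Qf_ge:
  assumes mu: "0 < mu" and bl: "0 < bl" and t: "1 \<le> t"
  shows "c0 mu bl * ip N n v v \<le> (\<Sum>s<Tw. Qf mu bl (t + s) v v) / real Tw"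
proof -
  define q where "q = lam * mu / real n"
  define vb where "vb c = (\<Sum>i<N. v i c) / real N" for c
  define dev where "dev = (\<Sum>i<N. \<Sum>c<n. (v i c - vb c)\<^sup>2)"
  define vv where "vv = (\<Sum>c<n. (vb c)\<^sup>2)"
  have q: "0 < q" using lam_pos mu n_pos by (simp add: q_def)
  have dev0: "0 \<le> dev" and vv0: "0 \<le> vv" by (auto simp: dev_def vv_def intro!: sum_nonneg)
  have decomp: "ip N n v v = real N * vv + dev"
  proof -
    have one: "(\<Sum>i<N. (v i c)\<^sup>2) = real N * (vb c)\<^sup>2 + (\<Sum>i<N. (v i c - vb c)\<^sup>2)" for c
    proof -
      have "(\<Sum>i<N. v i c) = real N * vb c" using N_pos by (simp add: vb_def)
      moreover have "(\<Sum>i<N. (v i c - vb c)\<^sup>2) = (\<Sum>i<N. (v i c)\<^sup>2) - 2 * vb c * (\<Sum>i<N. v i c) + real N * (vb c)\<^sup>2"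
        by (simp add: power2_diff sum.distrib sum_subtractf sum_distrib_left algebra_simps)
      ultimately show ?thesis by (simp add: power2_eq_square)
    qed
    have "ip N n v v = (\<Sum>c<n. \<Sum>i<N. (v i c)\<^sup>2)" unfolding ip_eq_sum_sq by (rule sum.swap)
    also have "\<dots> = real N * vv + (\<Sum>c<n. \<Sum>i<N. (v i c - vb c)\<^sup>2)"
      unfolding one by (simp add: sum.distrib vv_def sum_distrib_left)
    also have "(\<Sum>c<n. \<Sum>i<N. (v i c - vb c)\<^sup>2) = dev" unfolding dev_def by (rule sum.swap)
    finally show ?thesis .
  qed
  define D where "D l = (\<Sum>z\<in>E. a (fst z) (snd z) * ((v (fst z) l - v (snd z) l) * (v (fst z) l - v (snd z) l)))" for l
  define h where "h t = (\<Sum>i<N. \<Sum>r<m i. (Hv i t (v i) r)\<^sup>2)" for t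
  have Qeq: "Qf mu bl t v v = mu / 2 * D (coord n t) + bl * h t" for t
    by (simp add: Qf_def D_def h_def power2_eq_square)
  have Dsum: "2 * lam * dev \<le> (\<Sum>l<n. D l)"
  proof -
    have "2 * lam * (\<Sum>i<N. (v i l - vb l)\<^sup>2) \<le> D l" for l
      using poincare[of "\<lambda>i. v i l"] by (simp add: D_def vb_def power2_eq_square case_prod_beta')
    hence "(\<Sum>l<n. 2 * lam * (\<Sum>i<N. (v i l - vb l)\<^sup>2)) \<le> (\<Sum>l<n. D l)" by (rule sum_mono)
    moreover have "(\<Sum>l<n. 2 * lam * (\<Sum>i<N. (v i l - vb l)\<^sup>2)) = 2 * lam * dev"
    proof -
      have "dev = (\<Sum>l<n. \<Sum>i<N. (v i l - vb l)\<^sup>2)" unfolding dev_def by (rule sum.swap)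
      thus ?thesis by (simp add: sum_distrib_left)
    qed
    ultimately show ?thesis by simp
  qed
  have edge_part: "q * dev \<le> (\<Sum>s<Tw. mu / 2 * D (coord n (t + s))) / real Tw"
  proof -
    have "(\<Sum>s<Tw. mu / 2 * D (coord n (t + s))) = mu / 2 * (real p * (\<Sum>l<n. D l))"
      unfolding Tw_def sum_distrib_left[symmetric] sum_coord_cycle[OF n_pos t] ..
    hence "(\<Sum>s<Tw. mu / 2 * D (coord n (t + s))) / real Tw = mu / 2 * (real p * (\<Sum>l<n. D l)) / real (n * p)"
      by (simp only: Tw_def)
    also have "\<dots> = mu * (\<Sum>l<n. D l) / (2 * real n)"
      using p_pos n_pos by (simp add: field_simps)
    finally have "(\<Sum>s<Tw. mu / 2 * D (coord n (t + s))) / real Tw = mu * (\<Sum>l<n. D l) / (2 * real n)" .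
    moreover have "mu * (2 * lam * dev) / (2 * real n) \<le> mu * (\<Sum>l<n. D l) / (2 * real n)"
      using Dsum mu by (intro divide_right_mono mult_left_mono) auto
    ultimately show ?thesis by (simp add: q_def mult_ac)
  qed
  \<comment> \<open>splitting \<open>v\<close> into mean and deviation with this weight makes the rate constant come out as \<open>c0\<close>\<close>
  define et where "et = 2 * Hbar\<^sup>2 * bl / (2 * Hbar\<^sup>2 * bl + q)"
  have hb0: "0 < 2 * Hbar\<^sup>2 * bl" using Hbar_pos bl by simp
  have et: "0 < et" "et < 1" using hb0 q unfolding et_def by (auto intro!: divide_pos_pos add_pos_pos simp: divide_less_eq add_pos_pos)
  have et1: "1 / et - 1 = q / (2 * Hbar\<^sup>2 * bl)" and et2: "1 - et = q / (2 * Hbar\<^sup>2 * bl + q)"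
  proof -
    define z where "z = 2 * Hbar\<^sup>2 * bl"
    have z: "0 < z" using hb0 by (simp add: z_def)
    show "1 / et - 1 = q / (2 * Hbar\<^sup>2 * bl)" "1 - et = q / (2 * Hbar\<^sup>2 * bl + q)"
      unfolding et_def z_def[symmetric] using z q by (auto simp: field_simps)
  qed
  have young: "(1 - et) * x\<^sup>2 - (1 / et - 1) * y\<^sup>2 \<le> (x + y)\<^sup>2" for x y :: real
  proof -
    have "0 \<le> (et * x + y)\<^sup>2 / et" using et by simp
    also have "\<dots> = et * x\<^sup>2 + 2 * x * y + y\<^sup>2 / et" using et by (simp add: power2_sum power2_eq_square field_simps)
    finally show ?thesis by (simp add: power2_sum algebra_simps)
  qed
  define hb where "hb t = (\<Sum>i<N. \<Sum>r<m i. (Hv i t vb r)\<^sup>2)" for t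
  have hge: "(1 - et) * hb t - (1 / et - 1) * (Hbar\<^sup>2 * dev) \<le> h t" if "1 \<le> t" for t
  proof -
    have "(1 - et) * (Hv i t vb r)\<^sup>2 - (1 / et - 1) * (Hv i t (\<lambda>c. v i c - vb c) r)\<^sup>2 \<le> (Hv i t (v i) r)\<^sup>2" for i r
    proof -
      have "Hv i t (v i) r = Hv i t vb r + Hv i t (\<lambda>c. v i c - vb c) r"
        by (simp add: Hv_def sum.distrib[symmetric] algebra_simps)
      thus ?thesis using young by simp
    qed
    hence "(\<Sum>i<N. \<Sum>r<m i. (1 - et) * (Hv i t vb r)\<^sup>2 - (1 / et - 1) * (Hv i t (\<lambda>c. v i c - vb c) r)\<^sup>2) \<le> h t"
      unfolding h_def by (intro sum_mono)
    hence "(1 - et) * hb t - (1 / et - 1) * (\<Sum>i<N. \<Sum>r<m i. (Hv i t (\<lambda>c. v i c - vb c) r)\<^sup>2) \<le> h t"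
      by (simp add: hb_def sum_subtractf sum_distrib_left)
    moreover have "(1 / et - 1) * (\<Sum>i<N. \<Sum>r<m i. (Hv i t (\<lambda>c. v i c - vb c) r)\<^sup>2) \<le> (1 / et - 1) * (Hbar\<^sup>2 * dev)"
    proof (rule mult_left_mono)
      show "(\<Sum>i<N. \<Sum>r<m i. (Hv i t (\<lambda>c. v i c - vb c) r)\<^sup>2) \<le> Hbar\<^sup>2 * dev"
        using Hv_sq_sum_le[OF that, of "\<lambda>i c. v i c - vb c"] by (simp add: dev_def ip_eq_sum_sq)
      show "0 \<le> 1 / et - 1" unfolding et1 using q bl by simp
    qed
    ultimately show ?thesis by linarith
  qed
  have block: "delta * vv * real p \<le> (\<Sum>s<p. hb (t' + s))" if "1 \<le> t'" for t'
  proof -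
    have "(\<Sum>s<p. hb (t' + s)) = (\<Sum>t\<in>{t'..t' + p - 1}. hb t)"
      by (rule sum.reindex_bij_witness[of _ "\<lambda>t. t - t'" "\<lambda>s. t' + s"]) (use p_pos in auto)
    moreover have "delta * vv \<le> (1 / real p) * (\<Sum>t\<in>{t'..t' + p - 1}. hb t)"
      using pe[OF that, of vb] by (simp add: vv_def hb_def Hv_def)
    ultimately show ?thesis using p_pos by (simp add: field_simps)
  qed
  have hbs: "real n * (delta * vv * real p) \<le> (\<Sum>s<Tw. hb (t + s))"
  proof -
    have "(\<Sum>s<Tw. hb (t + s)) = (\<Sum>q<n. \<Sum>s<p. hb ((t + q * p) + s))"
      unfolding Tw_def using sum_blocks[of "\<lambda>s. hb (t + s)" n p] by (simp add: add.assoc)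
    also have "\<dots> \<ge> (\<Sum>q<n. delta * vv * real p)" using t by (intro sum_mono block) auto
    finally show ?thesis by simp
  qed
  have Hpart: "(1 - et) * (delta * vv) - (1 / et - 1) * (Hbar\<^sup>2 * dev) \<le> (\<Sum>s<Tw. h (t + s)) / real Tw"
  proof -
    have "(\<Sum>s<Tw. (1 - et) * hb (t + s) - (1 / et - 1) * (Hbar\<^sup>2 * dev)) \<le> (\<Sum>s<Tw. h (t + s))"
      using t by (intro sum_mono hge) auto
    hence "(1 - et) * (\<Sum>s<Tw. hb (t + s)) - real Tw * ((1 / et - 1) * (Hbar\<^sup>2 * dev)) \<le> (\<Sum>s<Tw. h (t + s))"
      by (simp add: sum_subtractf sum_distrib_left)
    moreover have "(1 - et) * (real n * (delta * vv * real p)) \<le> (1 - et) * (\<Sum>s<Tw. hb (t + s))"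
      using et hbs by (intro mult_left_mono) auto
    moreover have "(1 - et) * (real n * (delta * vv * real p)) = real Tw * ((1 - et) * (delta * vv))"
      by (simp add: Tw_def)
    ultimately have "real Tw * ((1 - et) * (delta * vv) - (1 / et - 1) * (Hbar\<^sup>2 * dev)) \<le> (\<Sum>s<Tw. h (t + s))"
      by (simp add: right_diff_distrib)
    thus ?thesis using Tw_pos by (simp add: field_simps)
  qed
  have c0eq: "c0 mu bl * real N = bl * ((1 - et) * delta)"
    unfolding c0_def et2 q_def[symmetric] using N_pos by simp
  \<comment> \<open>The edge part offers \<open>q * dev\<close>. One half pays the loss of the Young
    inequality in the regressor part, which is \<open>q / 2\<close> by the choice of
    \<open>et\<close>; the other half has to cover \<open>c0 mu bl * dev\<close>.\<close>
  have c0q: "c0 mu bl \<le> q / 2"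
  proof -
    have "c0 mu bl = bl * (delta / real N) * (1 - et)" unfolding c0_def et2 q_def[symmetric] by simp
    also have "\<dots> \<le> bl * Hbar\<^sup>2 * (1 - et)"
      using delta_le N_pos bl et by (intro mult_right_mono mult_left_mono) (auto simp: field_simps)
    also have "\<dots> = q / 2 * (2 * Hbar\<^sup>2 * bl / (2 * Hbar\<^sup>2 * bl + q))" unfolding et2 by simp
    also have "\<dots> = q / 2 * et" unfolding et_def ..
    also have "\<dots> \<le> q / 2" using et q by simp
    finally show ?thesis .
  qed
  have "c0 mu bl * ip N n v v = bl * ((1 - et) * (delta * vv)) + c0 mu bl * dev"
    unfolding decomp distrib_left mult.assoc[symmetric] c0eq by simp
  also have "\<dots> \<le> bl * ((1 - et) * (delta * vv)) + q / 2 * dev"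
    using c0q dev0 by (intro add_left_mono mult_right_mono)
  also have "q / 2 * dev = q * dev - bl * ((1 / et - 1) * (Hbar\<^sup>2 * dev))"
    unfolding et1 using Hbar_pos bl by (simp add: field_simps)
  finally have "c0 mu bl * ip N n v v \<le> q * dev + bl * ((1 - et) * (delta * vv) - (1 / et - 1) * (Hbar\<^sup>2 * dev))"
    by (simp add: right_diff_distrib)
  also have "\<dots> \<le> (\<Sum>s<Tw. mu / 2 * D (coord n (t + s))) / real Tw + bl * ((\<Sum>s<Tw. h (t + s)) / real Tw)"
    using edge_part Hpart bl by (intro add_mono mult_left_mono) auto
  also have "\<dots> = (\<Sum>s<Tw. Qf mu bl (t + s) v v) / real Tw"
    unfolding Qeq by (simp add: sum.distrib sum_distrib_left[symmetric] add_divide_distrib)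
  finally show ?thesis .
qed

end

section \<open>The Lyapunov function\<close>

text \<open>\<open>X\<close> bounds the estimates and hence the slopes, \<open>mu / k\<close> is the
  resulting coupling strength, and \<open>ep\<close> is the slack spent on Young inequalities.
  \<open>kap\<close> is the decay exponent sought and \<open>kap1\<close> an intermediate one below
  the gain. \<open>s\<close> is the decay of the filtered noise and \<open>g0\<close> a lower bound
  for the coupling exponents. \<open>kap_s\<close> keeps the filtered noise harmless where it enters
  through the coupling, and \<open>kap_noise\<close> makes the scaled dither variance of order
  \<open>1 / k\<close>.\<close>

locale sc_drift = sc_poly +
  fixes mu bl ep X K kap kap1 s g0 :: real
  assumes mu_pos: "0 < mu" and bl_pos: "0 < bl" and bl_le: "\<And>i. i < N \<Longrightarrow> bl \<le> beta i 1"
    and ep: "0 < ep" "ep < 1"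
    and g0: "1 / 2 < g0" "g0 \<le> 1" and g0_le: "\<And>i j. (i, j) \<in> edges N a \<Longrightarrow> g0 \<le> gamma i j + nu i j"
    and mu_ev: "\<exists>k0. \<forall>k\<ge>k0. \<forall>i j. (i, j) \<in> edges N a \<longrightarrow>
      mu / real (Suc k) \<le> alpha i j (Suc k) * (exp (- X / b i j) * real (Suc k) powr - nu i j / b i j)"
    and kap: "0 < kap" "kap < kap1" "2 * kap1 < 2 * (1 - ep) * c0 mu bl - ep"
    and s: "kap \<le> s" "s < 1 / 2"
    and kap_s: "\<And>i j. (i, j) \<in> edges N a \<Longrightarrow> 2 * kap + 1 \<le> gamma i j + nu i j + 2 * s"
    and kap_noise: "\<And>i j. (i, j) \<in> edges N a \<Longrightarrow> 2 * kap + 1 \<le> 2 * gamma i j + nu i j"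
    and K_nonneg: "0 \<le> K"
begin

text \<open>The coefficient of \<open>Rf\<close> is that of \<open>Qf\<close> in
  \<open>drift_inner\<close>, so that shifting the window replaces the degenerate one-step form by
  its average. Because of the factor \<open>1 / Suc k\<close> the correction is eventually dominated
  by the squared norm.\<close>

definition Psi :: "nat \<Rightarrow> pvec \<Rightarrow> pvec \<Rightarrow> real" where
  "Psi k u v = ip N n u v - 2 * (1 - ep) / real (Suc k) * Rf mu bl (Suc k) u v"

text \<open>Predictable increment of the remainder \<open>g\<close> in the presence of the filtered
  noise \<open>h\<close>. The term \<open>rho * h\<close> compensates the shrinking of the filter;
  coupling and regression act on the full error \<open>g + h\<close>.\<close>

definition Dv :: "nat \<Rightarrow> real \<Rightarrow> pvec \<Rightarrow> pvec \<Rightarrow> pvec" where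
  "Dv k rho g h i c = rho * h i c
     + (if c = coord n (Suc k) then coup k (\<lambda>i. theta (coord n (Suc k)) + g i (coord n (Suc k)) + h i (coord n (Suc k))) i else 0)
     - beta i (Suc k) * Ht i (Suc k) (Hv i (Suc k) (\<lambda>c. g i c + h i c)) c"

definition cu :: "nat \<Rightarrow> nat \<Rightarrow> real" where
  "cu i j = alpha i j 1 * a i j * exp (X / b i j) / b i j"

definition Pw :: "nat \<Rightarrow> real" where
  "Pw k = (\<Sum>(i, j)\<in>E. real (Suc k) powr - (gamma i j + nu i j))"

lemma cu_nonneg: "(i, j) \<in> E \<Longrightarrow> 0 \<le> cu i j"
  unfolding cu_def using alpha_pos[of i j 1] a_nonneg[of i j] b_pos[of i j] by simp

lemma Pw_nonneg: "0 \<le> Pw k" unfolding Pw_def by (auto intro!: sum_nonneg)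

lemma sym_form_Psi: "sym_form N n (Psi k)"
  using sym_form_diff[OF sym_form_ip sym_form_cmult[OF sym_form_Rf[of mu bl "Suc k"], of "2 * (1 - ep) / real (Suc k)"]]
  unfolding Psi_def[abs_def] .

text \<open>Linearisation of the mean message between two sensors. The slope \<open>xi\<close>
  depends on the state, hence the two-sided bounds: the lower one feeds the contraction, the upper
  one controls errors.\<close>

lemma edge_gap:
  assumes ij: "(i, j) \<in> E" and x: "\<bar>x i\<bar> \<le> X" "\<bar>x j\<bar> \<le> X"
  obtains xi where "alpha i j (Suc k) * a i j * (Gm i j k (x i) - Gm i j k (x j)) = alpha i j (Suc k) * a i j * xi * (x i - x j)"
    "exp (- X / b i j) * real (Suc k) powr - nu i j / b i j \<le> xi"
    "alpha i j (Suc k) * a i j * xi \<le> cu i j * real (Suc k) powr - (gamma i j + nu i j)"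
    "0 \<le> alpha i j (Suc k) * a i j * xi"
proof -
  let ?T = "real (Suc k)"
  have e: "exp (- thr i j (Suc k) / b i j) = ?T powr - nu i j"
    unfolding thr_def by (rule powr_eq_exp_threshold[OF b_pos[OF ij]]) simp
  obtain xi where xi: "Gm i j k (x i) - Gm i j k (x j) = xi * (x i - x j)"
    "exp (- X / b i j) * ?T powr - nu i j / b i j \<le> xi" "xi \<le> exp (X / b i j) * ?T powr - nu i j / b i j"
    using msg_mean_diff[OF b_pos[OF ij] thr_nonneg[OF ij, of k] x] unfolding e Gm_def by blast
  have A: "0 \<le> alpha i j (Suc k) * a i j" using alpha_pos[OF ij, of "Suc k"] a_nonneg[of i j] by simp
  have xi0: "0 \<le> xi" using xi(2) b_pos[OF ij] by (meson divide_nonneg_pos exp_ge_zero mult_nonneg_nonneg order_trans powr_ge_zero)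
  have "alpha i j (Suc k) * a i j * xi \<le> alpha i j (Suc k) * a i j * (exp (X / b i j) * ?T powr - nu i j / b i j)"
    by (rule mult_left_mono[OF xi(3) A])
  also have "\<dots> = cu i j * (?T powr - gamma i j * ?T powr - nu i j)"
    unfolding alpha_poly[OF ij] cu_def by (simp add: powr_minus field_simps)
  also have "?T powr - gamma i j * ?T powr - nu i j = ?T powr - (gamma i j + nu i j)"
    by (simp add: powr_add[symmetric])
  finally show thesis using xi A xi0 by (intro that[of xi]) auto
qed

definition C1 :: real where
  "C1 = ((\<Sum>(i, j)\<in>E. cu i j) + (\<Sum>i<N. beta i 1) * Hbar\<^sup>2) / ep"

text \<open>The dissipation acts on \<open>g + h\<close> but is paired with \<open>g\<close>, so
  squares appear as \<open>y * (y + z)\<close> with \<open>z\<close> coming from \<open>h\<close>. A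
  fraction \<open>ep\<close> of the dissipation absorbs the mixed product and leaves multiples of
  \<open>ip N n h h\<close>.\<close>

lemma drift_inner:
  fixes g h :: pvec
  defines "x \<equiv> \<lambda>k i. theta (coord n (Suc k)) + g i (coord n (Suc k)) + h i (coord n (Suc k))"
  assumes x: "\<And>i. i < N \<Longrightarrow> \<bar>x k i\<bar> \<le> X"
    and mu: "\<And>i j. (i, j) \<in> E \<Longrightarrow> mu / real (Suc k) \<le> alpha i j (Suc k) * (exp (- X / b i j) * real (Suc k) powr - nu i j / b i j)"
  shows "2 * ip N n g (Dv k rho g h) \<le> - (2 * (1 - ep) / real (Suc k)) * Qf mu bl (Suc k) g g
     + 2 * rho * ip N n g h + C1 * (1 / real (Suc k) + Pw k) * ip N n h h"
proof -
  let ?T = "real (Suc k)" and ?l = "coord n (Suc k)"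
  have young: "(1 - ep) * y\<^sup>2 - z\<^sup>2 / (4 * ep) \<le> y * (y + z)" for y z :: real
  proof -
    have "0 \<le> (2 * ep * y + z)\<^sup>2 / (4 * ep)" using ep by simp
    also have "\<dots> = ep * y\<^sup>2 + y * z + z\<^sup>2 / (4 * ep)" using ep by (simp add: power2_sum power2_eq_square field_simps)
    finally show ?thesis by (simp add: power2_eq_square algebra_simps)
  qed
  have D: "ip N n g (Dv k rho g h) = rho * ip N n g h + (\<Sum>i<N. g i ?l * coup k (x k) i)
     - (\<Sum>i<N. beta i (Suc k) * (\<Sum>r<m i. Hv i (Suc k) (g i) r * (Hv i (Suc k) (g i) r + Hv i (Suc k) (h i) r)))"
  proof -
    have "(\<Sum>c<n. g i c * Dv k rho g h i c) = rho * (\<Sum>c<n. g i c * h i c) + g i ?l * coup k (x k) i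
     - beta i (Suc k) * (\<Sum>r<m i. Hv i (Suc k) (g i) r * (Hv i (Suc k) (g i) r + Hv i (Suc k) (h i) r))" for i
    proof -
      have 1: "(\<Sum>c<n. g i c * (if c = ?l then coup k (x k) i else 0)) = g i ?l * coup k (x k) i"
        using coord_less[of "Suc k"] by (simp add: if_distrib cong: if_cong)
      have hv: "Hv i (Suc k) (\<lambda>c. g i c + h i c) r = Hv i (Suc k) (g i) r + Hv i (Suc k) (h i) r" for r
        by (simp add: Hv_def distrib_left sum.distrib)
      have 2: "(\<Sum>c<n. g i c * Ht i (Suc k) (Hv i (Suc k) (\<lambda>c. g i c + h i c)) c) =
        (\<Sum>r<m i. Hv i (Suc k) (g i) r * (Hv i (Suc k) (g i) r + Hv i (Suc k) (h i) r))"
        unfolding Ht_adj hv ..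
      have "(\<Sum>c<n. g i c * Dv k rho g h i c) = (\<Sum>c<n. rho * (g i c * h i c) + g i c * (if c = ?l then coup k (x k) i else 0)
         - beta i (Suc k) * (g i c * Ht i (Suc k) (Hv i (Suc k) (\<lambda>c. g i c + h i c)) c))"
        unfolding Dv_def x_def by (intro sum.cong refl) (simp add: algebra_simps)
      also have "\<dots> = rho * (\<Sum>c<n. g i c * h i c) + (\<Sum>c<n. g i c * (if c = ?l then coup k (x k) i else 0))
         - beta i (Suc k) * (\<Sum>c<n. g i c * Ht i (Suc k) (Hv i (Suc k) (\<lambda>c. g i c + h i c)) c)"
        by (simp only: sum.distrib sum_subtractf sum_distrib_left)
      finally show ?thesis unfolding 1 2 .
    qed
    thus ?thesis by (simp add: ip_def sum.distrib sum_subtractf sum_distrib_left)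
  qed
  have cpl: "2 * (\<Sum>i<N. g i ?l * coup k (x k) i) \<le>
     - ((1 - ep) * (mu / ?T) * (\<Sum>(i, j)\<in>E. a i j * (g i ?l - g j ?l)\<^sup>2)) + (\<Sum>(i, j)\<in>E. cu i j) * Pw k / ep * ip N n h h"
  proof -
    have each: "- (alpha i j (Suc k) * a i j * ((g i ?l - g j ?l) * (Gm i j k (x k i) - Gm i j k (x k j))))
      \<le> - ((1 - ep) * (mu / ?T) * (a i j * (g i ?l - g j ?l)\<^sup>2)) + cu i j * Pw k / ep * ip N n h h"
      if ij: "(i, j) \<in> E" for i j
    proof -
      have ijN: "i < N" "j < N" using ij by (auto simp: edges_def)
      obtain xi where xi: "alpha i j (Suc k) * a i j * (Gm i j k (x k i) - Gm i j k (x k j)) = alpha i j (Suc k) * a i j * xi * (x k i - x k j)"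
        "exp (- X / b i j) * ?T powr - nu i j / b i j \<le> xi"
        "alpha i j (Suc k) * a i j * xi \<le> cu i j * ?T powr - (gamma i j + nu i j)"
        "0 \<le> alpha i j (Suc k) * a i j * xi"
        using edge_gap[OF ij x[OF ijN(1)] x[OF ijN(2)]] by blast
      let ?A = "alpha i j (Suc k) * a i j * xi" and ?y = "g i ?l - g j ?l" and ?z = "h i ?l - h j ?l"
      have "mu / ?T \<le> alpha i j (Suc k) * xi"
        using mu[OF ij] mult_left_mono[OF xi(2), of "alpha i j (Suc k)"] alpha_pos[OF ij, of "Suc k"] by simp
      from mult_right_mono[OF this a_nonneg[of i j]] have lo: "mu / ?T * a i j \<le> ?A" by (simp add: mult_ac)
      have "?T powr - (gamma i j + nu i j) \<le> Pw k"
        unfolding Pw_def using member_le_sum[OF ij, of "\<lambda>(i, j). ?T powr - (gamma i j + nu i j)"] finite_edges by auto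
      with xi(3) have up: "?A \<le> cu i j * Pw k" using mult_left_mono[OF _ cu_nonneg[OF ij]] order_trans by blast
      have z4: "?z\<^sup>2 / (4 * ep) \<le> ip N n h h / ep"
        using diff_sq_le_ip[OF ijN coord_less, of h "Suc k"] ep by (simp add: field_simps)
      have "alpha i j (Suc k) * a i j * (?y * (Gm i j k (x k i) - Gm i j k (x k j))) =
         ?y * (alpha i j (Suc k) * a i j * (Gm i j k (x k i) - Gm i j k (x k j)))" by (simp only: mult_ac)
      also have "\<dots> = ?A * (?y * (?y + ?z))"
      proof -
        have "x k i - x k j = ?y + ?z" by (simp add: x_def)
        thus ?thesis unfolding xi(1) by (simp only: mult_ac)
      qed
      also have "\<dots> \<ge> ?A * ((1 - ep) * ?y\<^sup>2 - ?z\<^sup>2 / (4 * ep))" by (rule mult_left_mono[OF young xi(4)])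
      finally have "?A * ((1 - ep) * ?y\<^sup>2) - ?A * (?z\<^sup>2 / (4 * ep)) \<le> alpha i j (Suc k) * a i j * (?y * (Gm i j k (x k i) - Gm i j k (x k j)))"
        by (simp add: right_diff_distrib)
      moreover have "mu / ?T * a i j * ((1 - ep) * ?y\<^sup>2) \<le> ?A * ((1 - ep) * ?y\<^sup>2)"
        using ep by (intro mult_right_mono lo) auto
      moreover have "?A * (?z\<^sup>2 / (4 * ep)) \<le> cu i j * Pw k * (ip N n h h / ep)"
        by (rule mult_mono[OF up z4]) (use ep cu_nonneg[OF ij] Pw_nonneg in auto)
      ultimately show ?thesis by (simp add: mult_ac)
    qed
    have "2 * (\<Sum>i<N. g i ?l * coup k (x k) i) = (\<Sum>(i, j)\<in>E. - (alpha i j (Suc k) * a i j * ((g i ?l - g j ?l) * (Gm i j k (x k i) - Gm i j k (x k j)))))"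
      unfolding coup_sum by (simp add: sum_negf case_prod_beta')
    also have "\<dots> \<le> (\<Sum>(i, j)\<in>E. - ((1 - ep) * (mu / ?T) * (a i j * (g i ?l - g j ?l)\<^sup>2)) + cu i j * Pw k / ep * ip N n h h)"
      using each by (intro sum_mono) auto
    also have "\<dots> = - ((1 - ep) * (mu / ?T) * (\<Sum>(i, j)\<in>E. a i j * (g i ?l - g j ?l)\<^sup>2)) + (\<Sum>(i, j)\<in>E. cu i j) * Pw k / ep * ip N n h h"
      by (simp only: case_prod_beta' sum.distrib sum_negf sum_distrib_left sum_distrib_right sum_divide_distrib)
    finally show ?thesis .
  qed
  have hp: "- 2 * (\<Sum>i<N. beta i (Suc k) * (\<Sum>r<m i. Hv i (Suc k) (g i) r * (Hv i (Suc k) (g i) r + Hv i (Suc k) (h i) r)))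
     \<le> - (2 * (1 - ep) / ?T * (bl * (\<Sum>i<N. \<Sum>r<m i. (Hv i (Suc k) (g i) r)\<^sup>2))) + (\<Sum>i<N. beta i 1) * Hbar\<^sup>2 / (ep * ?T) * ip N n h h"
  proof -
    have each: "- 2 * (beta i (Suc k) * (\<Sum>r<m i. Hv i (Suc k) (g i) r * (Hv i (Suc k) (g i) r + Hv i (Suc k) (h i) r)))
      \<le> - (2 * (1 - ep) / ?T * (bl * (\<Sum>r<m i. (Hv i (Suc k) (g i) r)\<^sup>2))) + beta i 1 * Hbar\<^sup>2 / (ep * ?T) * ip N n h h"
      if i: "i < N" for i
    proof -
      let ?G = "\<Sum>r<m i. (Hv i (Suc k) (g i) r)\<^sup>2" and ?Z = "\<Sum>r<m i. (Hv i (Suc k) (h i) r)\<^sup>2"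
      have b0: "0 < beta i 1" "bl \<le> beta i 1" using beta_pos[OF i, of 1] bl_le[OF i] by auto
      have "(1 - ep) * ?G - ?Z / (4 * ep) = (\<Sum>r<m i. (1 - ep) * (Hv i (Suc k) (g i) r)\<^sup>2 - (Hv i (Suc k) (h i) r)\<^sup>2 / (4 * ep))"
        by (simp add: sum_subtractf sum_distrib_left sum_divide_distrib)
      also have "\<dots> \<le> (\<Sum>r<m i. Hv i (Suc k) (g i) r * (Hv i (Suc k) (g i) r + Hv i (Suc k) (h i) r))"
        by (intro sum_mono young)
      finally have 1: "beta i 1 / ?T * ((1 - ep) * ?G - ?Z / (4 * ep)) \<le>
          beta i 1 / ?T * (\<Sum>r<m i. Hv i (Suc k) (g i) r * (Hv i (Suc k) (g i) r + Hv i (Suc k) (h i) r))"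
        using b0 by (intro mult_left_mono) auto
      have "?Z \<le> Hbar\<^sup>2 * (\<Sum>c<n. (h i c)\<^sup>2)" by (rule Hv_bound[OF i]) simp
      also have "\<dots> \<le> Hbar\<^sup>2 * ip N n h h"
        unfolding ip_eq_sum_sq using i by (intro mult_left_mono member_le_sum) (auto intro: sum_nonneg)
      finally have Z: "?Z \<le> Hbar\<^sup>2 * ip N n h h" .
      have Z0: "0 \<le> ?Z" by (intro sum_nonneg) simp
      have 2: "beta i 1 / ?T * (?Z / (4 * ep)) \<le> beta i 1 / ?T * (Hbar\<^sup>2 * ip N n h h / (2 * ep))"
      proof (rule mult_left_mono)
        have "?Z / (4 * ep) \<le> ?Z / (2 * ep)" using Z0 ep by (intro divide_left_mono) auto
        also have "\<dots> \<le> Hbar\<^sup>2 * ip N n h h / (2 * ep)" using Z ep by (intro divide_right_mono) auto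
        finally show "?Z / (4 * ep) \<le> Hbar\<^sup>2 * ip N n h h / (2 * ep)" .
      qed (use b0 in auto)
      have 3: "bl / ?T * ((1 - ep) * ?G) \<le> beta i 1 / ?T * ((1 - ep) * ?G)"
        using b0 ep by (intro mult_right_mono divide_right_mono) (auto intro!: mult_nonneg_nonneg sum_nonneg)
      have "bl / ?T * ((1 - ep) * ?G) - beta i 1 / ?T * (Hbar\<^sup>2 * ip N n h h / (2 * ep))
         \<le> beta i 1 / ?T * (\<Sum>r<m i. Hv i (Suc k) (g i) r * (Hv i (Suc k) (g i) r + Hv i (Suc k) (h i) r))"
        using 1 2 3 unfolding right_diff_distrib by linarith
      moreover have "- 2 * (b1 / t * S) \<le> - (2 * (1 - ep) / t * (bl * G)) + b1 * H2 / (ep * t) * I"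
        if "bl / t * ((1 - ep) * G) - b1 / t * (H2 * I / (2 * ep)) \<le> b1 / t * S" "0 < t" for b1 t S G H2 I :: real
      proof -
        have e: "2 * (1 - ep) / t * (bl * G) = 2 * (bl / t * ((1 - ep) * G))"
          "b1 * H2 / (ep * t) * I = 2 * (b1 / t * (H2 * I / (2 * ep)))" using that(2) ep by (simp_all add: field_simps)
        show ?thesis unfolding e using that(1) by linarith
      qed
      ultimately show ?thesis unfolding beta_poly[OF i] by simp
    qed
    have "- 2 * (\<Sum>i<N. beta i (Suc k) * (\<Sum>r<m i. Hv i (Suc k) (g i) r * (Hv i (Suc k) (g i) r + Hv i (Suc k) (h i) r)))
      = (\<Sum>i<N. - 2 * (beta i (Suc k) * (\<Sum>r<m i. Hv i (Suc k) (g i) r * (Hv i (Suc k) (g i) r + Hv i (Suc k) (h i) r))))"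
      by (simp only: sum_distrib_left)
    also have "\<dots> \<le> (\<Sum>i<N. - (2 * (1 - ep) / ?T * (bl * (\<Sum>r<m i. (Hv i (Suc k) (g i) r)\<^sup>2))) + beta i 1 * Hbar\<^sup>2 / (ep * ?T) * ip N n h h)"
      using each by (intro sum_mono) auto
    also have "\<dots> = - (2 * (1 - ep) / ?T * (bl * (\<Sum>i<N. \<Sum>r<m i. (Hv i (Suc k) (g i) r)\<^sup>2))) + (\<Sum>i<N. beta i 1) * Hbar\<^sup>2 / (ep * ?T) * ip N n h h"
      by (simp only: sum.distrib sum_negf sum_distrib_left sum_distrib_right sum_divide_distrib)
    finally show ?thesis .
  qed
  have Q: "2 * (1 - ep) / ?T * Qf mu bl (Suc k) g g = (1 - ep) * (mu / ?T) * (\<Sum>(i, j)\<in>E. a i j * (g i ?l - g j ?l)\<^sup>2)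
     + 2 * (1 - ep) / ?T * (bl * (\<Sum>i<N. \<Sum>r<m i. (Hv i (Suc k) (g i) r)\<^sup>2))"
  proof -
    have "2 * (1 - ep) / t * (mu / 2 * S + B) = (1 - ep) * (mu / t) * S + 2 * (1 - ep) / t * B" if "0 < t" for t S B
      using that by (simp add: field_simps)
    thus ?thesis unfolding Qf_def power2_eq_square[symmetric] case_prod_beta' by simp
  qed
  have "(\<Sum>(i, j)\<in>E. cu i j) * Pw k / ep * ip N n h h + (\<Sum>i<N. beta i 1) * Hbar\<^sup>2 / (ep * ?T) * ip N n h h
     \<le> C1 * (1 / ?T + Pw k) * ip N n h h"
  proof -
    let ?a = "(\<Sum>(i, j)\<in>E. cu i j) / ep" and ?b = "(\<Sum>i<N. beta i 1) * Hbar\<^sup>2 / ep"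
    have a: "0 \<le> ?a" using ep cu_nonneg by (intro divide_nonneg_nonneg sum_nonneg) auto
    have b: "0 \<le> ?b" using ep beta_pos[of _ 1] by (intro divide_nonneg_nonneg mult_nonneg_nonneg sum_nonneg) (auto intro: less_imp_le)
    have C: "C1 = ?a + ?b" by (simp add: C1_def add_divide_distrib)
    have "?a * Pw k + ?b * (1 / ?T) \<le> C1 * (1 / ?T + Pw k)"
    proof -
      have "u * P + v * (1 / t) \<le> (u + v) * (1 / t + P)" if "0 \<le> u" "0 \<le> v" "0 \<le> P" "0 < t" for u v P t :: real
      proof -
        have "0 \<le> u * (1 / t)" "0 \<le> v * P" using that by auto
        thus ?thesis unfolding distrib_left distrib_right by linarith
      qed
      from this[OF a b Pw_nonneg[of k], of ?T] show ?thesis unfolding C by simp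
    qed
    from mult_right_mono[OF this ip_nonneg[of N n h]]
    have "?a * Pw k * ip N n h h + ?b * (1 / ?T) * ip N n h h \<le> C1 * (1 / ?T + Pw k) * ip N n h h"
      by (simp only: distrib_right)
    moreover have "?b * (1 / ?T) * ip N n h h = (\<Sum>i<N. beta i 1) * Hbar\<^sup>2 / (ep * ?T) * ip N n h h" by simp
    moreover have "?a * Pw k * ip N n h h = (\<Sum>(i, j)\<in>E. cu i j) * Pw k / ep * ip N n h h" by simp
    ultimately show ?thesis by linarith
  qed
  thus ?thesis using D cpl hp Q by (simp add: algebra_simps)
qed

definition C2 :: real where
  "C2 = 3 * (1 + 8 * real N * (\<Sum>(i, j)\<in>E. (cu i j)\<^sup>2) + 2 * Hbar ^ 4 * (\<Sum>i<N. (beta i 1)\<^sup>2))"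

lemma C2_ge: "3 \<le> C2"
proof -
  have "0 \<le> (\<Sum>(i, j)\<in>E. (cu i j)\<^sup>2)" "0 \<le> (\<Sum>i<N. (beta i 1)\<^sup>2)" by (auto intro!: sum_nonneg)
  thus ?thesis unfolding C2_def by simp
qed

text \<open>Each part of the increment is of order \<open>Suc k powr - g0\<close>: the coupling
  because its slopes are, the regression and the filter correction because \<open>1 / Suc k\<close>
  is no larger. Since \<open>g0 > 1/2\<close>, the square is of smaller order than the
  contraction.\<close>

lemma drift_sq:
  fixes g h :: pvec
  defines "x \<equiv> \<lambda>k i. theta (coord n (Suc k)) + g i (coord n (Suc k)) + h i (coord n (Suc k))"
  assumes x: "\<And>i. i < N \<Longrightarrow> \<bar>x k i\<bar> \<le> X" and rho: "0 \<le> rho" "rho \<le> 1 / real (Suc k)"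
  shows "ip N n (Dv k rho g h) (Dv k rho g h) \<le> C2 * (real (Suc k) powr - g0)\<^sup>2 * (ip N n g g + ip N n h h)"
proof -
  define T where "T = real (Suc k)"
  define ta where "ta = T powr - g0"
  have T: "1 \<le> T" by (simp add: T_def)
  have ta: "0 < ta" "1 / T \<le> ta"
  proof -
    have "T powr - 1 \<le> T powr - g0" using T g0 by (intro powr_mono) auto
    thus "1 / T \<le> ta" using T by (simp add: ta_def powr_minus_divide)
  qed (use T in \<open>simp add: ta_def\<close>)
  let ?l = "coord n (Suc k)"
  let ?S = "ip N n g g + ip N n h h"
  have S0: "0 \<le> ?S" using ip_nonneg by simp
  let ?gh = "\<lambda>i c. g i c + h i c"
  have gh: "ip N n ?gh ?gh \<le> 2 * ?S" using ip_add_le[of N n g h] by simp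
  have cp: "(coup k (x k) i)\<^sup>2 \<le> real N * (\<Sum>j\<in>nbrs N a i. (cu i j)\<^sup>2 * (ta\<^sup>2 * (8 * ?S)))" if i: "i < N" for i
  proof -
    have "(coup k (x k) i)\<^sup>2 \<le> real (card (nbrs N a i)) *
        (\<Sum>j\<in>nbrs N a i. (alpha i j (Suc k) * a i j * (Gm i j k (x k j) - Gm i j k (x k i)))\<^sup>2)"
      unfolding coup_def by (rule sum_sq_le_card)
    also have "\<dots> \<le> real N * (\<Sum>j\<in>nbrs N a i. (cu i j)\<^sup>2 * (ta\<^sup>2 * (8 * ?S)))"
    proof (intro mult_mono sum_mono)
      fix j assume "j \<in> nbrs N a i"
      hence ij: "(i, j) \<in> E" by (simp add: nbrs_def)
      hence j: "j < N" by (simp add: edges_def)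
      obtain xi where xi: "alpha i j (Suc k) * a i j * (Gm i j k (x k i) - Gm i j k (x k j)) = alpha i j (Suc k) * a i j * xi * (x k i - x k j)"
        "alpha i j (Suc k) * a i j * xi \<le> cu i j * T powr - (gamma i j + nu i j)"
        "0 \<le> alpha i j (Suc k) * a i j * xi"
        using edge_gap[OF ij x[OF i] x[OF j], of k thesis] unfolding T_def by blast
      have "T powr - (gamma i j + nu i j) \<le> ta" unfolding ta_def using T g0_le[OF ij] by (intro powr_mono) auto
      hence up: "alpha i j (Suc k) * a i j * xi \<le> cu i j * ta"
        using xi(2) mult_left_mono[OF _ cu_nonneg[OF ij]] order_trans by blast
      have "(alpha i j (Suc k) * a i j * (Gm i j k (x k j) - Gm i j k (x k i)))\<^sup>2 =
         (alpha i j (Suc k) * a i j * (Gm i j k (x k i) - Gm i j k (x k j)))\<^sup>2"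
        by (simp add: power_mult_distrib power2_commute)
      also have "\<dots> = (alpha i j (Suc k) * a i j * xi)\<^sup>2 * (x k i - x k j)\<^sup>2" unfolding xi(1) by (rule power_mult_distrib)
      also have "\<dots> \<le> (cu i j * ta)\<^sup>2 * (8 * ?S)"
      proof (rule mult_mono)
        show "(alpha i j (Suc k) * a i j * xi)\<^sup>2 \<le> (cu i j * ta)\<^sup>2" using up xi(3) by (rule power_mono)
        have "x k i - x k j = ?gh i ?l - ?gh j ?l" by (simp add: x_def)
        thus "(x k i - x k j)\<^sup>2 \<le> 8 * ?S"
          using diff_sq_le_ip[OF i j coord_less, of ?gh "Suc k"] gh by simp
      qed auto
      finally show "(alpha i j (Suc k) * a i j * (Gm i j k (x k j) - Gm i j k (x k i)))\<^sup>2 \<le> (cu i j)\<^sup>2 * (ta\<^sup>2 * (8 * ?S))"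
        by (simp add: power_mult_distrib mult.assoc)
    qed (use card_nbrs_le in \<open>auto intro: sum_nonneg\<close>)
    finally show ?thesis .
  qed
  have each: "(\<Sum>c<n. (Dv k rho g h i c)\<^sup>2) \<le> 3 * (ta\<^sup>2 * (\<Sum>c<n. (h i c)\<^sup>2))
     + 3 * (real N * (\<Sum>j\<in>nbrs N a i. (cu i j)\<^sup>2 * (ta\<^sup>2 * (8 * ?S))))
     + 3 * ((beta i 1)\<^sup>2 * ta\<^sup>2 * (Hbar ^ 4 * (\<Sum>c<n. (?gh i c)\<^sup>2)))" if i: "i < N" for i
  proof -
    define p1 where "p1 c = rho * h i c" for c
    define p2 where "p2 c = (if c = ?l then coup k (x k) i else 0)" for c
    define p3 where "p3 c = beta i (Suc k) * Ht i (Suc k) (Hv i (Suc k) (?gh i)) c" for c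
    have "(Dv k rho g h i c)\<^sup>2 \<le> 3 * (p1 c)\<^sup>2 + 3 * (p2 c)\<^sup>2 + 3 * (p3 c)\<^sup>2" for c
    proof -
      have eq: "Dv k rho g h i c = p1 c + p2 c - p3 c" unfolding Dv_def p1_def p2_def p3_def x_def ..
      have "0 \<le> (p1 c - p2 c)\<^sup>2 + (p1 c + p3 c)\<^sup>2 + (p2 c + p3 c)\<^sup>2" by simp
      thus ?thesis unfolding eq by (simp add: power2_eq_square algebra_simps)
    qed
    hence "(\<Sum>c<n. (Dv k rho g h i c)\<^sup>2) \<le> (\<Sum>c<n. 3 * (p1 c)\<^sup>2 + 3 * (p2 c)\<^sup>2 + 3 * (p3 c)\<^sup>2)" by (intro sum_mono)
    also have "\<dots> = 3 * (\<Sum>c<n. (p1 c)\<^sup>2) + 3 * (\<Sum>c<n. (p2 c)\<^sup>2) + 3 * (\<Sum>c<n. (p3 c)\<^sup>2)"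
      by (simp only: sum.distrib sum_distrib_left)
    finally have main: "(\<Sum>c<n. (Dv k rho g h i c)\<^sup>2) \<le> \<dots>" .
    have r2: "rho\<^sup>2 \<le> ta\<^sup>2" using rho ta unfolding T_def by (intro power_mono) auto
    have 1: "(\<Sum>c<n. (p1 c)\<^sup>2) \<le> ta\<^sup>2 * (\<Sum>c<n. (h i c)\<^sup>2)"
      unfolding p1_def power_mult_distrib sum_distrib_left[symmetric] using r2 by (intro mult_right_mono sum_nonneg) auto
    have "(\<Sum>c<n. (p2 c)\<^sup>2) = (\<Sum>c<n. if c = ?l then (coup k (x k) i)\<^sup>2 else 0)" by (intro sum.cong) (auto simp: p2_def)
    hence 2: "(\<Sum>c<n. (p2 c)\<^sup>2) \<le> real N * (\<Sum>j\<in>nbrs N a i. (cu i j)\<^sup>2 * (ta\<^sup>2 * (8 * ?S)))"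
      using cp[OF i] coord_less[of "Suc k"] by simp
    have b2: "(beta i (Suc k))\<^sup>2 \<le> (beta i 1)\<^sup>2 * ta\<^sup>2"
    proof -
      have "0 < beta i 1" using beta_pos[OF i, of 1] by simp
      hence "beta i (Suc k) \<le> beta i 1 * ta" unfolding beta_poly[OF i] T_def[symmetric]
        using ta mult_left_mono[OF ta(2), of "beta i 1"] by simp
      thus ?thesis unfolding power_mult_distrib[symmetric] using beta_pos[OF i, of "Suc k"] by (intro power_mono) auto
    qed
    have "(\<Sum>c<n. (p3 c)\<^sup>2) \<le> (beta i (Suc k))\<^sup>2 * (Hbar ^ 4 * (\<Sum>c<n. (?gh i c)\<^sup>2))"
      unfolding p3_def power_mult_distrib sum_distrib_left[symmetric] by (intro mult_left_mono HtHv_bound i) auto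
    also have "\<dots> \<le> (beta i 1)\<^sup>2 * ta\<^sup>2 * (Hbar ^ 4 * (\<Sum>c<n. (?gh i c)\<^sup>2))"
      using b2 by (intro mult_right_mono) (auto intro!: mult_nonneg_nonneg sum_nonneg)
    finally show ?thesis using main 1 2 by linarith
  qed
  have "ip N n (Dv k rho g h) (Dv k rho g h) \<le> (\<Sum>i<N. 3 * (ta\<^sup>2 * (\<Sum>c<n. (h i c)\<^sup>2))
     + 3 * (real N * (\<Sum>j\<in>nbrs N a i. (cu i j)\<^sup>2 * (ta\<^sup>2 * (8 * ?S))))
     + 3 * ((beta i 1)\<^sup>2 * ta\<^sup>2 * (Hbar ^ 4 * (\<Sum>c<n. (?gh i c)\<^sup>2))))"
    unfolding ip_eq_sum_sq[of N n "Dv k rho g h"] using each by (intro sum_mono) auto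
  also have "\<dots> = 3 * (ta\<^sup>2 * ip N n h h) + 3 * (real N * ((\<Sum>(i, j)\<in>E. (cu i j)\<^sup>2) * (ta\<^sup>2 * (8 * ?S))))
     + 3 * (\<Sum>i<N. (beta i 1)\<^sup>2 * ta\<^sup>2 * (Hbar ^ 4 * (\<Sum>c<n. (?gh i c)\<^sup>2)))"
    unfolding sum_edges ip_eq_sum_sq[of N n h] by (simp only: sum.distrib sum_distrib_left sum_distrib_right)
  also have "(\<Sum>i<N. (beta i 1)\<^sup>2 * ta\<^sup>2 * (Hbar ^ 4 * (\<Sum>c<n. (?gh i c)\<^sup>2))) \<le>
     (\<Sum>i<N. (beta i 1)\<^sup>2 * ta\<^sup>2 * (Hbar ^ 4 * (2 * ?S)))"
  proof (intro sum_mono mult_left_mono)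
    fix i assume "i \<in> {..<N}"
    hence "(\<Sum>c<n. (?gh i c)\<^sup>2) \<le> ip N n ?gh ?gh" unfolding ip_eq_sum_sq by (intro member_le_sum) (auto intro: sum_nonneg)
    thus "(\<Sum>c<n. (?gh i c)\<^sup>2) \<le> 2 * ?S" using gh by linarith
  qed auto
  also have "\<dots> = (\<Sum>i<N. (beta i 1)\<^sup>2) * (ta\<^sup>2 * (Hbar ^ 4 * (2 * ?S)))" by (simp add: sum_distrib_right mult.assoc)
  also have "3 * (ta\<^sup>2 * ip N n h h) \<le> 3 * (ta\<^sup>2 * ?S)" using ip_nonneg[of N n g] by (intro mult_left_mono) auto
  finally have "ip N n (Dv k rho g h) (Dv k rho g h) \<le> 3 * (ta\<^sup>2 * ?S) + 3 * (real N * ((\<Sum>(i, j)\<in>E. (cu i j)\<^sup>2) * (ta\<^sup>2 * (8 * ?S))))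
     + 3 * ((\<Sum>i<N. (beta i 1)\<^sup>2) * (ta\<^sup>2 * (Hbar ^ 4 * (2 * ?S))))" by simp
  also have "\<dots> = C2 * ta\<^sup>2 * ?S"
  proof -
    have "3 * (t * S) + 3 * (nn * (u * (t * (8 * S)))) + 3 * (v * (t * (hh * (2 * S)))) = 3 * (1 + 8 * nn * u + 2 * hh * v) * t * S"
      for t S nn u v hh :: real by (simp add: algebra_simps)
    thus ?thesis unfolding C2_def .
  qed
  finally show ?thesis unfolding ta_def T_def .
qed

end

lemma powr_le_one_plus:
  fixes x q :: real
  assumes "0 \<le> x" "0 \<le> q" "q \<le> 1"
  shows "(1 + x) powr q \<le> 1 + q * x"
proof (cases "x = 0")
  case False
  hence x: "0 < x" using assms by simp
  have "\<exists>z. 1 < z \<and> z < 1 + x \<and> (1 + x) powr q - 1 powr q = (1 + x - 1) * (q * z powr (q - 1))"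
    using x by (intro MVT2) (auto intro!: derivative_eq_intros)
  then obtain z where z: "1 < z" "(1 + x) powr q - 1 = x * (q * z powr (q - 1))" by auto
  have "z powr (q - 1) \<le> z powr 0" using z assms by (intro powr_mono) auto
  hence "x * (q * z powr (q - 1)) \<le> x * (q * 1)" using z x assms by (intro mult_left_mono) auto
  thus ?thesis using z by (simp add: mult.commute)
qed simp

lemma powr_neg_tendsto_0: "0 < q \<Longrightarrow> (\<lambda>k. real (Suc k) powr - q) \<longlonglongrightarrow> 0"
proof -
  assume "0 < q"
  moreover have "filterlim (\<lambda>k. real (Suc k)) at_top sequentially"
    by (rule filterlim_compose[OF filterlim_real_sequentially filterlim_Suc])
  ultimately show ?thesis by (intro tendsto_neg_powr) auto
qed

lemma powr_sq_mult: "1 \<le> (T::real) \<Longrightarrow> T * (T powr - g)\<^sup>2 = T powr - (2 * g - 1)"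
proof -
  assume T: "1 \<le> T"
  have "T powr - (2 * g - 1) = T powr (1 + (- g + - g))" by (simp add: algebra_simps)
  also have "\<dots> = T powr 1 * (T powr - g * T powr - g)" by (simp only: powr_add)
  finally show ?thesis using T by (simp add: power2_eq_square)
qed

section \<open>Contraction of the Lyapunov function along the predictable drift\<close>

context sc_drift begin

definition cc :: real where "cc = 2 * (1 - ep)"

lemma cc_pos: "0 < cc" using ep by (simp add: cc_def)

lemma Psi_eq: "Psi k u v = ip N n u v - cc / real (Suc k) * Rf mu bl (Suc k) u v"
  unfolding Psi_def cc_def ..

abbreviation "R \<equiv> CR mu bl"

definition C3 :: real where "C3 = C1 + 1 / ep + C2 + cc * R * (1 + C2)"

lemma CR_nonneg: "0 \<le> R" unfolding CR_def using CQ_nonneg[OF mu_pos bl_pos] by simp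

lemma C1_nonneg: "0 \<le> C1"
  unfolding C1_def using ep cu_nonneg beta_pos[of _ 1]
  by (intro divide_nonneg_nonneg add_nonneg_nonneg mult_nonneg_nonneg sum_nonneg) (auto intro: less_imp_le)

lemma C3_nonneg: "0 \<le> C3"
  unfolding C3_def using C1_nonneg C2_ge CR_nonneg ep cc_pos by (intro add_nonneg_nonneg mult_nonneg_nonneg) auto

text \<open>The bracket is the averaged rate minus the losses: \<open>ep\<close> for the filter
  correction, the term with \<open>T * ta\<^sup>2\<close> for the squared increment, the term with
  \<open>ta\<close> for the window form at the moved point, and \<open>cc * R / T\<close> for the
  change of the prefactor. Apart from \<open>ep\<close> these losses vanish as \<open>T\<close>
  grows.\<close>

lemma drift_step:
  fixes g h :: pvec
  defines "x \<equiv> \<lambda>k i. theta (coord n (Suc k)) + g i (coord n (Suc k)) + h i (coord n (Suc k))"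
  assumes x: "\<And>i. i < N \<Longrightarrow> \<bar>x k i\<bar> \<le> X"
    and mu: "\<And>i j. (i, j) \<in> E \<Longrightarrow> mu / real (Suc k) \<le> alpha i j (Suc k) * (exp (- X / b i j) * real (Suc k) powr - nu i j / b i j)"
    and rho: "0 \<le> rho" "rho \<le> 1 / real (Suc k)"
  defines "v \<equiv> \<lambda>i c. g i c + Dv k rho g h i c" and "T \<equiv> real (Suc k)" and "ta \<equiv> real (Suc k) powr - g0"
  shows "Psi (Suc k) v v \<le> Psi k g g
     - 1 / T * (cc * c0 mu bl - ep - T * ta\<^sup>2 * C2 - cc * R * (1 + C2) * ta - cc * R / T) * ip N n g g
     + C3 * (1 / T + Pw k) * ip N n h h"
proof -
  let ?D = "Dv k rho g h"
  have T: "1 \<le> T" by (simp add: T_def)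
  have ta: "0 < ta" "ta \<le> 1"
  proof -
    have "T powr - g0 \<le> T powr 0" using T g0 by (intro powr_mono) auto
    thus "ta \<le> 1" using T by (simp add: ta_def T_def)
  qed (simp add: ta_def)
  have ta2: "T * ta\<^sup>2 \<le> 1"
  proof -
    have "T * ta\<^sup>2 = T powr - (2 * g0 - 1)"
      unfolding ta_def T_def[symmetric] by (rule powr_sq_mult[OF T])
    also have "\<dots> \<le> T powr 0" using T g0 by (intro powr_mono) auto
    finally show ?thesis using T by simp
  qed
  define S where "S = ip N n g g"
  define Z where "Z = ip N n h h"
  define I where "I = ip N n g h"
  define Q where "Q = Qf mu bl (Suc k) g g"
  define R1 where "R1 = Rf mu bl (Suc (Suc k)) g g"
  define R0 where "R0 = Rf mu bl (Suc k) g g"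
  define AV where "AV = (\<Sum>s<Tw. Qf mu bl (Suc k + s) g g) / real Tw"
  define DD where "DD = ip N n ?D ?D"
  define gD where "gD = ip N n g ?D"
  define RD where "RD = Rf mu bl (Suc (Suc k)) ?D ?D"
  define RgD where "RgD = Rf mu bl (Suc (Suc k)) g ?D"
  define P where "P = Pw k"
  have nn: "0 \<le> S" "0 \<le> Z" "0 \<le> P" by (auto simp: S_def Z_def P_def ip_nonneg Pw_nonneg)
  note cc = cc_pos
  have f1: "Psi (Suc k) v v = (S + 2 * gD + DD) - cc / (T + 1) * (R1 + 2 * RgD + RD)"
  proof -
    have v: "v = (\<lambda>i c. g i c + 1 * ?D i c)" by (simp add: v_def)
    have 1: "ip N n v v = S + 2 * gD + DD"
      unfolding v using sym_form_quad_add[OF sym_form_ip, of N n g 1 ?D] by (simp add: S_def gD_def DD_def)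
    have 2: "Rf mu bl (Suc (Suc k)) v v = R1 + 2 * RgD + RD"
      unfolding v using sym_form_quad_add[OF sym_form_Rf[of mu bl "Suc (Suc k)"], of g 1 ?D] by (simp add: R1_def RgD_def RD_def)
    have 3: "real (Suc (Suc k)) = T + 1" by (simp add: T_def)
    show ?thesis unfolding Psi_eq 1 2 3 ..
  qed
  have f2: "2 * gD \<le> - (cc / T) * Q + 2 * rho * I + C1 * (1 / T + P) * Z"
    unfolding gD_def T_def Q_def I_def P_def Z_def cc_def
    by (rule drift_inner) (use x mu in \<open>auto simp: x_def\<close>)
  have f3: "DD \<le> C2 * ta\<^sup>2 * (S + Z)"
    unfolding DD_def ta_def S_def Z_def by (rule drift_sq) (use x rho in \<open>auto simp: x_def\<close>)
  \<comment> \<open>The weight \<open>ta\<close> balances the Young inequality: the increment has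
    squared norm of order \<open>ta * ta\<close>, so both terms on the right are of order
    \<open>ta\<close>.\<close>
  have f4: "2 * \<bar>RgD\<bar> \<le> ta * R1 + RD / ta"
    unfolding RgD_def R1_def RD_def
    using sym_form_young[OF sym_form_Rf[of mu bl "Suc (Suc k)"] Rf_bounds(1)[OF mu_pos bl_pos] ta(1)] by simp
  have f5: "0 \<le> R1" "R1 \<le> R * S" "0 \<le> RD" "RD \<le> R * DD"
    unfolding R1_def RD_def S_def DD_def using Rf_bounds[OF mu_pos bl_pos] by auto
  have f6: "R1 + Q = R0 + AV" unfolding R1_def Q_def R0_def AV_def by (rule Rf_shift)
  have f6': "c0 mu bl * S \<le> AV" unfolding S_def AV_def using avg_Qf_ge[OF mu_pos bl_pos, of "Suc k" g] by simp
  have f7: "2 * \<bar>I\<bar> \<le> ep * S + Z / ep"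
    unfolding I_def S_def Z_def using sym_form_young[OF sym_form_ip ip_nonneg ep(1)] .
  have Pk: "Psi k g g = S - cc / T * R0" unfolding Psi_eq S_def T_def R0_def ..
  have "RD / ta \<le> R * (C2 * ta\<^sup>2 * (S + Z)) / ta"
    using f5(4) mult_left_mono[OF f3 CR_nonneg] ta by (intro divide_right_mono) auto
  also have "\<dots> = R * C2 * ta * (S + Z)" using ta by (simp add: power2_eq_square)
  finally have RDt: "RD / ta \<le> R * C2 * ta * (S + Z)" .
  have "ta * R1 \<le> ta * (R * (S + Z))"
  proof (rule mult_left_mono)
    have "R * S \<le> R * (S + Z)" using nn CR_nonneg by (intro mult_left_mono) auto
    thus "R1 \<le> R * (S + Z)" using f5 by linarith
  qed (use ta in auto)
  hence W: "- (2 * RgD + RD) \<le> R * (1 + C2) * ta * (S + Z)"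
    using f4 RDt f5(3) by (simp add: algebra_simps)
  define w where "w = R * (1 + C2) * ta * (S + Z)"
  have w0: "0 \<le> w" unfolding w_def using CR_nonneg C2_ge ta nn by (intro mult_nonneg_nonneg) auto
  have c1: "cc / (T + 1) \<le> cc / T" using T cc by (intro divide_left_mono) auto
  \<comment> \<open>The prefactor decreases from \<open>cc / T\<close> to
    \<open>cc / (T + 1)\<close>, a change of second order only.\<close>
  have c2: "cc / T - cc / (T + 1) \<le> cc / T * (1 / T)"
  proof -
    have "cc / T - cc / (T + 1) = cc / (T * (T + 1))" using T by (simp add: field_simps)
    also have "\<dots> \<le> cc / (T * T)" using T cc by (intro divide_left_mono mult_left_mono mult_pos_pos) auto
    finally show ?thesis by simp
  qed
  have "- (cc / (T + 1) * (R1 + 2 * RgD + RD)) = cc / (T + 1) * (- (2 * RgD + RD)) + (cc / T - cc / (T + 1)) * R1 - cc / T * R1"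
  proof -
    have "- (d * (R1 + 2 * RgD + RD)) = d * (- (2 * RgD + RD)) + (e - d) * R1 - e * R1" for d e by (simp add: algebra_simps)
    thus ?thesis .
  qed
  also have "\<dots> \<le> cc / T * w + cc / T * (1 / T) * (R * S) - cc / T * R1"
  proof -
    have "cc / (T + 1) * (- (2 * RgD + RD)) \<le> cc / (T + 1) * w"
      using W cc T unfolding w_def by (intro mult_left_mono) auto
    also have "\<dots> \<le> cc / T * w" using c1 w0 by (intro mult_right_mono)
    finally have 1: "cc / (T + 1) * (- (2 * RgD + RD)) \<le> cc / T * w" .
    have "(cc / T - cc / (T + 1)) * R1 \<le> cc / T * (1 / T) * R1" using c2 f5 by (intro mult_right_mono) auto
    also have "\<dots> \<le> cc / T * (1 / T) * (R * S)" using f5 cc T by (intro mult_left_mono) auto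
    finally show ?thesis using 1 by linarith
  qed
  finally have g1: "- (cc / (T + 1) * (R1 + 2 * RgD + RD)) \<le> cc / T * w + cc / T * (1 / T) * (R * S) - cc / T * R1" .
  have g2: "2 * rho * I \<le> 1 / T * (ep * S + Z / ep)"
  proof -
    have "2 * rho * I \<le> rho * (2 * \<bar>I\<bar>)" using rho(1) by (simp add: mult_left_mono)
    also have "\<dots> \<le> 1 / T * (ep * S + Z / ep)" using f7 rho unfolding T_def by (intro mult_mono) auto
    finally show ?thesis .
  qed
  \<comment> \<open>Here the window pays off: by \<open>f6\<close> the one-step form plus the new
    correction equals the old correction plus the window average.\<close>
  have g3: "- (cc / T) * Q - cc / T * R1 \<le> - (cc / T * R0) - cc / T * (c0 mu bl * S)"
  proof -
    have "- d * Q - d * R1 = - (d * R0) - d * AV" for d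
    proof -
      have "- d * Q - d * R1 = - d * (R1 + Q)" by (simp add: algebra_simps)
      also have "\<dots> = - (d * R0) - d * AV" unfolding f6 by (simp add: algebra_simps)
      finally show ?thesis .
    qed
    from this[of "cc / T"] have "- (cc / T) * Q - cc / T * R1 = - (cc / T * R0) - cc / T * AV" .
    moreover have "cc / T * (c0 mu bl * S) \<le> cc / T * AV" using f6' cc T by (intro mult_left_mono) auto
    ultimately show ?thesis by linarith
  qed
  have tot: "Psi (Suc k) v v \<le> Psi k g g - cc / T * (c0 mu bl * S) + 1 / T * (ep * S + Z / ep)
     + C1 * (1 / T + P) * Z + C2 * ta\<^sup>2 * (S + Z) + cc / T * w + cc / T * (1 / T) * (R * S)"
    unfolding f1 Pk using f2 f3 g1 g2 g3 by linarith
  have zz: "1 / T * (Z / ep) + C2 * ta\<^sup>2 * Z + cc / T * (R * (1 + C2) * ta * Z) \<le> (1 / ep + C2 + cc * R * (1 + C2)) * (1 / T + P) * Z"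
  proof -
    have t1: "ta\<^sup>2 \<le> 1 / T" using ta2 T by (simp add: field_simps)
    have "1 / T * (1 / ep) + C2 * ta\<^sup>2 + cc / T * (R * (1 + C2) * ta) \<le> 1 / T * (1 / ep) + C2 * (1 / T) + cc / T * (R * (1 + C2) * 1)"
      using t1 C2_ge CR_nonneg ta cc T by (intro add_mono mult_left_mono) auto
    also have "\<dots> = (1 / ep + C2 + cc * R * (1 + C2)) * (1 / T)"
    proof -
      have "i * e + C2 * i + (cc * i) * (R * (1 + C2) * 1) = (e + C2 + cc * R * (1 + C2)) * i" for i e
        by (simp add: algebra_simps)
      from this[of "1 / T" "1 / ep"] show ?thesis by simp
    qed
    also have "\<dots> \<le> (1 / ep + C2 + cc * R * (1 + C2)) * (1 / T + P)"
      using nn C2_ge CR_nonneg ep cc by (intro mult_left_mono add_nonneg_nonneg mult_nonneg_nonneg) auto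
    finally have "(1 / T * (1 / ep) + C2 * ta\<^sup>2 + cc / T * (R * (1 + C2) * ta)) * Z \<le> (1 / ep + C2 + cc * R * (1 + C2)) * (1 / T + P) * Z"
      using nn by (intro mult_right_mono)
    thus ?thesis by (simp only: distrib_right mult.assoc times_divide_eq_left times_divide_eq_right mult_1 mult.commute[of Z])
  qed
  have "C1 * (1 / T + P) * Z + (1 / ep + C2 + cc * R * (1 + C2)) * (1 / T + P) * Z = C3 * (1 / T + P) * Z"
    unfolding C3_def by (simp only: distrib_right add.assoc)
  hence zz2: "C1 * (1 / T + P) * Z + (1 / T * (Z / ep) + C2 * ta\<^sup>2 * Z + cc / T * (R * (1 + C2) * ta * Z)) \<le> C3 * (1 / T + P) * Z"
    using zz by linarith
  have ss: "- (cc / T * (c0 mu bl * S)) + 1 / T * (ep * S) + C2 * ta\<^sup>2 * S + cc / T * (R * (1 + C2) * ta * S) + cc / T * (1 / T) * (R * S)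
     = - (1 / T * (cc * c0 mu bl - ep - T * ta\<^sup>2 * C2 - cc * R * (1 + C2) * ta - cc * R / T) * S)"
    using T by (simp add: field_simps)
  have "1 / T * (ep * S + Z / ep) = 1 / T * (ep * S) + 1 / T * (Z / ep)" "C2 * ta\<^sup>2 * (S + Z) = C2 * ta\<^sup>2 * S + C2 * ta\<^sup>2 * Z"
    "cc / T * w = cc / T * (R * (1 + C2) * ta * S) + cc / T * (R * (1 + C2) * ta * Z)"
    by (simp_all only: w_def distrib_left)
  with tot zz2 ss have "Psi (Suc k) v v \<le> Psi k g g
     - 1 / T * (cc * c0 mu bl - ep - T * ta\<^sup>2 * C2 - cc * R * (1 + C2) * ta - cc * R / T) * S
     + C3 * (1 / T + P) * Z" by linarith
  thus ?thesis unfolding S_def P_def Z_def .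
qed

lemma Psi_le: "Psi k v v \<le> ip N n v v"
  unfolding Psi_eq using Rf_bounds(1)[OF mu_pos bl_pos, of "Suc k" v] cc_pos by simp

text \<open>All losses of \<open>drift_step\<close> other than \<open>ep\<close> tend to 0, so from
  some index on the bracket exceeds \<open>2 * kap1\<close>. \<open>Psi_le\<close> converts a
  decrease measured by the squared norm into one measured by \<open>Psi\<close>.\<close>

lemma drift_main:
  obtains k0 where
    "\<And>k v. k0 \<le> k \<Longrightarrow> ip N n v v / 2 \<le> Psi k v v"
    "\<And>k rho g h. k0 \<le> k \<Longrightarrow>
      (\<And>i. i < N \<Longrightarrow> \<bar>theta (coord n (Suc k)) + g i (coord n (Suc k)) + h i (coord n (Suc k))\<bar> \<le> X) \<Longrightarrow>
      0 \<le> rho \<Longrightarrow> rho \<le> 1 / real (Suc k) \<Longrightarrow>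
      Psi (Suc k) (\<lambda>i c. g i c + Dv k rho g h i c) (\<lambda>i c. g i c + Dv k rho g h i c) \<le>
        (1 - 2 * kap1 / real (Suc k)) * Psi k g g + C3 * (1 / real (Suc k) + Pw k) * ip N n h h"
proof -
  define err where "err k = real (Suc k) powr - (2 * g0 - 1) * C2 + cc * R * (1 + C2) * real (Suc k) powr - g0
     + cc * R * real (Suc k) powr - 1" for k
  have "err \<longlonglongrightarrow> 0 * C2 + cc * R * (1 + C2) * 0 + cc * R * 0"
    unfolding err_def using g0 by (intro tendsto_intros powr_neg_tendsto_0) auto
  hence e0: "err \<longlonglongrightarrow> 0" by simp
  have "eventually (\<lambda>k. err k < cc * c0 mu bl - ep - 2 * kap1) sequentially"
    using kap(3) by (intro order_tendstoD(2)[OF e0]) (simp add: cc_def)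
  then obtain ka where ka: "\<And>k. ka \<le> k \<Longrightarrow> err k < cc * c0 mu bl - ep - 2 * kap1"
    unfolding eventually_sequentially by blast
  have "(\<lambda>k. cc * R * real (Suc k) powr - 1) \<longlonglongrightarrow> cc * R * 0"
    by (intro tendsto_intros powr_neg_tendsto_0) auto
  hence "eventually (\<lambda>k. cc * R * real (Suc k) powr - 1 < 1 / 2) sequentially"
    by (intro order_tendstoD(2)[of _ "cc * R * 0"]) auto
  then obtain kb where kb: "\<And>k. kb \<le> k \<Longrightarrow> cc * R * real (Suc k) powr - 1 < 1 / 2"
    unfolding eventually_sequentially by blast
  obtain kc where kc: "\<And>k i j. kc \<le> k \<Longrightarrow> (i, j) \<in> E \<Longrightarrow>
      mu / real (Suc k) \<le> alpha i j (Suc k) * (exp (- X / b i j) * real (Suc k) powr - nu i j / b i j)"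
    using mu_ev by blast
  have pm1: "x powr - 1 = 1 / x" if "0 < x" for x :: real using that by (simp add: powr_minus_divide)
  show thesis
  proof (rule that[of "max ka (max kb kc)"])
    fix k v assume "max ka (max kb kc) \<le> k"
    hence "cc * R / real (Suc k) \<le> 1 / 2" using kb[of k] pm1[of "real (Suc k)"] by simp
    hence "cc * R / real (Suc k) * ip N n v v \<le> 1 / 2 * ip N n v v" by (intro mult_right_mono ip_nonneg)
    moreover have "cc / real (Suc k) * Rf mu bl (Suc k) v v \<le> cc / real (Suc k) * (R * ip N n v v)"
      using Rf_bounds(2)[OF mu_pos bl_pos, of "Suc k" v] cc_pos by (intro mult_left_mono) auto
    moreover have "cc / real (Suc k) * (R * ip N n v v) = cc * R / real (Suc k) * ip N n v v" by simp
    ultimately show "ip N n v v / 2 \<le> Psi k v v" unfolding Psi_eq by linarith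
  next
    fix k rho g h
    assume k: "max ka (max kb kc) \<le> k" and x: "\<And>i. i < N \<Longrightarrow> \<bar>theta (coord n (Suc k)) + g i (coord n (Suc k)) + h i (coord n (Suc k))\<bar> \<le> X"
      and rho: "0 \<le> rho" "rho \<le> 1 / real (Suc k)"
    define T where "T = real (Suc k)"
    have T: "1 \<le> T" by (simp add: T_def)
    note tt = powr_sq_mult[OF T, of g0]
    have "2 * kap1 \<le> cc * c0 mu bl - ep - T * (T powr - g0)\<^sup>2 * C2 - cc * R * (1 + C2) * T powr - g0 - cc * R / T"
      using ka[of k] k pm1[of T] T unfolding err_def T_def[symmetric] tt by simp
    hence "1 / T * (2 * kap1) \<le> 1 / T * (cc * c0 mu bl - ep - T * (T powr - g0)\<^sup>2 * C2 - cc * R * (1 + C2) * T powr - g0 - cc * R / T)"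
      using T by (intro mult_left_mono) auto
    from mult_right_mono[OF this ip_nonneg[of N n g]]
    have "1 / T * (2 * kap1) * Psi k g g \<le> 1 / T * (cc * c0 mu bl - ep - T * (T powr - g0)\<^sup>2 * C2 - cc * R * (1 + C2) * T powr - g0 - cc * R / T) * ip N n g g"
      using mult_left_mono[OF Psi_le[of k g], of "1 / T * (2 * kap1)"] T kap by simp
    moreover have "Psi (Suc k) (\<lambda>i c. g i c + Dv k rho g h i c) (\<lambda>i c. g i c + Dv k rho g h i c) \<le> Psi k g g
     - 1 / T * (cc * c0 mu bl - ep - T * (T powr - g0)\<^sup>2 * C2 - cc * R * (1 + C2) * T powr - g0 - cc * R / T) * ip N n g g
     + C3 * (1 / T + Pw k) * ip N n h h"
      unfolding T_def by (rule drift_step) (use x rho kc k in auto)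
    moreover have "(1 - 2 * kap1 / T) * Psi k g g = Psi k g g - 1 / T * (2 * kap1) * Psi k g g" by (simp add: left_diff_distrib)
    ultimately show "Psi (Suc k) (\<lambda>i c. g i c + Dv k rho g h i c) (\<lambda>i c. g i c + Dv k rho g h i c) \<le>
        (1 - 2 * kap1 / real (Suc k)) * Psi k g g + C3 * (1 / real (Suc k) + Pw k) * ip N n h h"
      unfolding T_def[symmetric] by linarith
  qed
qed

text \<open>Scaling by \<open>k powr (2 * kap)\<close> costs a factor of about
  \<open>1 + 2 * kap / k\<close>, so a net rate close to \<open>2 * (kap1 - kap)\<close> remains;
  half of it is kept and the other half absorbs second-order terms. The forcing is of order
  \<open>1 / k\<close> by \<open>kap \<le> s\<close> and \<open>kap_s\<close>.\<close>

lemma drift_scaled: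
  obtains k0 C where "1 \<le> k0" "0 \<le> C"
    "\<And>k v. k0 \<le> k \<Longrightarrow> ip N n v v / 2 \<le> Psi k v v"
    "\<And>k rho g h. k0 \<le> k \<Longrightarrow>
      (\<And>i. i < N \<Longrightarrow> \<bar>theta (coord n (Suc k)) + g i (coord n (Suc k)) + h i (coord n (Suc k))\<bar> \<le> X) \<Longrightarrow>
      ip N n h h \<le> K * real k powr - (2 * s) \<Longrightarrow> 0 \<le> rho \<Longrightarrow> rho \<le> 1 / real (Suc k) \<Longrightarrow>
      real (Suc k) powr (2 * kap) * Psi (Suc k) (\<lambda>i c. g i c + Dv k rho g h i c) (\<lambda>i c. g i c + Dv k rho g h i c) \<le>
        (1 - (kap1 - kap) / real (Suc k)) * (real k powr (2 * kap) * Psi k g g) + C / real (Suc k)"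
proof (rule drift_main)
  fix k1
  assume low: "\<And>k v. k1 \<le> k \<Longrightarrow> ip N n v v / 2 \<le> Psi k v v"
    and dr: "\<And>k rho g h. k1 \<le> k \<Longrightarrow>
      (\<And>i. i < N \<Longrightarrow> \<bar>theta (coord n (Suc k)) + g i (coord n (Suc k)) + h i (coord n (Suc k))\<bar> \<le> X) \<Longrightarrow>
      0 \<le> rho \<Longrightarrow> rho \<le> 1 / real (Suc k) \<Longrightarrow>
      Psi (Suc k) (\<lambda>i c. g i c + Dv k rho g h i c) (\<lambda>i c. g i c + Dv k rho g h i c) \<le>
        (1 - 2 * kap1 / real (Suc k)) * Psi k g g + C3 * (1 / real (Suc k) + Pw k) * ip N n h h"
  \<comment> \<open>The first bound lets the second-order loss fit into the spare
    \<open>kap1 - kap\<close>; the second makes the contraction factor nonnegative.\<close>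
  obtain k2 :: nat where k2: "2 * kap / (kap1 - kap) \<le> real k2" "2 * kap1 \<le> real k2"
    using real_arch_simple[of "max (2 * kap / (kap1 - kap)) (2 * kap1)"] by auto
  define C where "C = 2 * C3 * (1 + real (card E)) * K"
  show thesis
  proof (rule that[of "max 1 (max k1 k2)" C])
    show "0 \<le> C" unfolding C_def using C3_nonneg K_nonneg by simp
    fix k v assume "max 1 (max k1 k2) \<le> k"
    thus "ip N n v v / 2 \<le> Psi k v v" using low by simp
  next
    fix k rho g h
    assume k: "max 1 (max k1 k2) \<le> k"
      and x: "\<And>i. i < N \<Longrightarrow> \<bar>theta (coord n (Suc k)) + g i (coord n (Suc k)) + h i (coord n (Suc k))\<bar> \<le> X"
      and h: "ip N n h h \<le> K * real k powr - (2 * s)" and rho: "0 \<le> rho" "rho \<le> 1 / real (Suc k)"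
    let ?v = "\<lambda>i c. g i c + Dv k rho g h i c"
    define T where "T = real (Suc k)"
    define kk where "kk = real k"
    have kk: "1 \<le> kk" "T = kk + 1" using k by (auto simp: kk_def T_def)
    have "0 < T" using kk by simp
    have kk2: "real k2 \<le> kk" using k by (simp add: kk_def)
    have Pg: "0 \<le> Psi k g g" using low[of k g] k ip_nonneg[of N n g] by simp
    have fac: "T powr (2 * kap) * (1 - 2 * kap1 / T) \<le> (1 - (kap1 - kap) / T) * kk powr (2 * kap)"
    proof -
      have "T powr (2 * kap) = (1 + 1 / kk) powr (2 * kap) * kk powr (2 * kap)"
      proof -
        have "T = (1 + 1 / kk) * kk" using kk by (simp add: distrib_right)
        thus ?thesis using kk by (simp add: powr_mult)
      qed
      moreover have "(1 + 1 / kk) powr (2 * kap) \<le> 1 + 2 * kap * (1 / kk)"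
        using kk kap s by (intro powr_le_one_plus) auto
      moreover have pos: "0 \<le> 1 - 2 * kap1 / T" using k2(2) kk2 kk by simp
      ultimately have "T powr (2 * kap) * (1 - 2 * kap1 / T) \<le> (1 + 2 * kap * (1 / kk)) * kk powr (2 * kap) * (1 - 2 * kap1 / T)"
        by (simp only:) (rule mult_right_mono[OF mult_right_mono], auto)
      also have "\<dots> = ((1 + 2 * kap / kk) * (1 - 2 * kap1 / T)) * kk powr (2 * kap)" by simp
      also have "\<dots> \<le> (1 - (kap1 - kap) / T) * kk powr (2 * kap)"
      proof (rule mult_right_mono)
        have "2 * kap \<le> (kap1 - kap) * kk"
        proof -
          have "2 * kap / (kap1 - kap) \<le> kk" using k2(1) kk2 by linarith
          thus ?thesis using kap by (simp add: field_simps)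
        qed
        hence "2 * kap / kk \<le> kap1 - kap" using kk by (simp add: field_simps)
        hence 1: "2 * kap / kk * (1 / T) \<le> (kap1 - kap) * (1 / T)" using kk by (intro mult_right_mono) auto
        have 2: "2 * kap / kk = 2 * kap / T + 2 * kap / kk * (1 / T)" 
        proof -
          have "2 * kap / T + 2 * kap / kk * (1 / T) = 2 * kap * (kk + 1) / (kk * T)"
            using kk(1) \<open>0 < T\<close> by (simp add: field_simps)
          also have "\<dots> = 2 * kap / kk" unfolding kk(2)[symmetric] using \<open>0 < T\<close> by simp
          finally show ?thesis ..
        qed
        have 3: "0 \<le> 2 * kap / kk * (2 * kap1 / T)" using kk kap by auto
        have "(1 + 2 * kap / kk) * (1 - 2 * kap1 / T) = 1 + 2 * kap / kk - 2 * kap1 / T - 2 * kap / kk * (2 * kap1 / T)"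
          by (simp add: algebra_simps)
        also have "\<dots> \<le> 1 + 2 * kap / T + (kap1 - kap) * (1 / T) - 2 * kap1 / T" using 1 2 3 by linarith
        also have "\<dots> = 1 - (kap1 - kap) / T" by (simp add: field_simps diff_divide_distrib add_divide_distrib)
        finally show "(1 + 2 * kap / kk) * (1 - 2 * kap1 / T) \<le> 1 - (kap1 - kap) / T" .
      qed simp
      finally show ?thesis .
    qed
    \<comment> \<open>Passing from index \<open>k\<close> to \<open>Suc k\<close> costs a factor of
      at most 2, since \<open>k \<ge> T / 2\<close> and \<open>2 * s \<le> 1\<close>.\<close>
    have hT: "ip N n h h \<le> 2 * K * T powr - (2 * s)"
    proof -
      have "kk powr - (2 * s) \<le> (T / 2) powr - (2 * s)" using kk kap s by (intro powr_mono2') auto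
      also have "\<dots> = T powr - (2 * s) * 2 powr (2 * s)" using kk by (simp add: powr_divide powr_minus_divide)
      also have "\<dots> \<le> T powr - (2 * s) * 2 powr 1" using s by (intro mult_left_mono powr_mono) auto
      finally have "K * kk powr - (2 * s) \<le> K * (T powr - (2 * s) * 2)" using K_nonneg by (intro mult_left_mono) auto
      thus ?thesis using h unfolding kk_def by simp
    qed
    have pw: "T powr (2 * kap) * (1 / T + Pw k) * T powr - (2 * s) \<le> (1 + real (card E)) / T"
    proof -
      have le: "T powr q \<le> 1 / T" if "q \<le> - 1" for q
      proof -
        have "T powr q \<le> T powr - 1" using that kk by (intro powr_mono) auto
        thus ?thesis using kk by (simp add: powr_minus_divide)
      qed
      have "T powr (2 * kap) * (1 / T) * T powr - (2 * s) = T powr (2 * kap - 1 - 2 * s)"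
        using kk by (simp add: powr_diff powr_minus_divide)
      also have "\<dots> \<le> 1 / T" using s by (intro le) auto
      finally have 1: "T powr (2 * kap) * (1 / T) * T powr - (2 * s) \<le> 1 / T" .
      have "T powr (2 * kap) * Pw k * T powr - (2 * s) = (\<Sum>(i, j)\<in>E. T powr (2 * kap - (gamma i j + nu i j) - 2 * s))"
        unfolding Pw_def T_def[symmetric] sum_distrib_left sum_distrib_right
        by (intro sum.cong refl) (auto simp: powr_add[symmetric] algebra_simps)
      also have "\<dots> \<le> (\<Sum>z\<in>E. 1 / T)"
        using kap_s by (intro sum_mono) (force intro: le)
      finally have 2: "T powr (2 * kap) * Pw k * T powr - (2 * s) \<le> real (card E) / T" by simp
      show ?thesis using 1 2 by (simp add: distrib_left distrib_right add_divide_distrib)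
    qed
    have "T powr (2 * kap) * Psi (Suc k) ?v ?v \<le> T powr (2 * kap) * ((1 - 2 * kap1 / T) * Psi k g g + C3 * (1 / T + Pw k) * ip N n h h)"
    proof (rule mult_left_mono)
      show "Psi (Suc k) ?v ?v \<le> (1 - 2 * kap1 / T) * Psi k g g + C3 * (1 / T + Pw k) * ip N n h h"
        unfolding T_def by (rule dr) (use k x rho in auto)
    qed simp
    also have "\<dots> = T powr (2 * kap) * (1 - 2 * kap1 / T) * Psi k g g + C3 * (T powr (2 * kap) * (1 / T + Pw k)) * ip N n h h"
    proof -
      have "t * (u * P + C3 * w * I) = t * u * P + C3 * (t * w) * I" for t u P w I :: real by (simp add: algebra_simps)
      thus ?thesis .
    qed
    also have "\<dots> \<le> (1 - (kap1 - kap) / T) * kk powr (2 * kap) * Psi k g g + C3 * (T powr (2 * kap) * (1 / T + Pw k)) * (2 * K * T powr - (2 * s))"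
      using fac Pg hT C3_nonneg kk Pw_nonneg[of k] by (intro add_mono mult_right_mono mult_left_mono mult_nonneg_nonneg) auto
    also have "C3 * (T powr (2 * kap) * (1 / T + Pw k)) * (2 * K * T powr - (2 * s)) = 2 * C3 * K * (T powr (2 * kap) * (1 / T + Pw k) * T powr - (2 * s))"
      by (simp only: mult_ac)
    also have "\<dots> \<le> 2 * C3 * K * ((1 + real (card E)) / T)"
      using pw C3_nonneg K_nonneg by (intro mult_left_mono) auto
    finally have "T powr (2 * kap) * Psi (Suc k) ?v ?v \<le> (1 - (kap1 - kap) / T) * kk powr (2 * kap) * Psi k g g + C / T"
      by (simp add: C_def mult_ac)
    thus "real (Suc k) powr (2 * kap) * Psi (Suc k) ?v ?v \<le>
        (1 - (kap1 - kap) / real (Suc k)) * (real k powr (2 * kap) * Psi k g g) + C / real (Suc k)"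
      unfolding T_def kk_def by (simp only: mult.assoc)
  qed simp
qed

end

section \<open>Filtering the observation noise\<close>

context sc_poly begin

text \<open>\<open>eta\<close> filters the observation noise out of the error: the remainder \<open>ff\<close> obeys a recursion
  whose only noise is the bounded dither noise, so that its exponential moments exist.\<close>

definition yy :: "real \<Rightarrow> nat \<Rightarrow> 'a \<Rightarrow> pvec" where
  "yy s k \<omega> i c = (\<Sum>t<k. real (Suc t) powr (s - 1) * (beta i 1 * Ht i (Suc t) (w i (Suc t) \<omega>) c))"

text \<open>The weights in \<open>yy\<close> and the factor \<open>k powr - s\<close> are matched so
  that fresh noise enters with exactly the step size \<open>beta i (Suc k)\<close> of the algorithm,
  while the old value shrinks by \<open>1 - rho s k\<close>; see \<open>eta_Suc\<close>.\<close>

definition eta :: "real \<Rightarrow> nat \<Rightarrow> 'a \<Rightarrow> pvec" where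
  "eta s k \<omega> i c = yy s k \<omega> i c * real k powr - s"

definition rho :: "real \<Rightarrow> nat \<Rightarrow> real" where
  "rho s k = 1 - (real k / real (Suc k)) powr s"

definition ff :: "real \<Rightarrow> nat \<Rightarrow> 'a \<Rightarrow> pvec" where
  "ff s k \<omega> i c = er k \<omega> i c - eta s k \<omega> i c"

lemma rho_bounds:
  assumes "0 < s" "s \<le> 1"
  shows "0 \<le> rho s k" "rho s k \<le> 1 / real (Suc k)"
proof -
  let ?q = "real k / real (Suc k)"
  have q: "0 \<le> ?q" "?q \<le> 1" by auto
  have "?q powr s \<le> 1 powr s" using q assms by (intro powr_mono2) auto
  thus "0 \<le> rho s k" by (simp add: rho_def)
  have "?q \<le> ?q powr s"
  proof (cases "k = 0")
    case False
    hence "?q powr 1 \<le> ?q powr s" using q assms by (intro powr_mono') auto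
    thus ?thesis using False by simp
  qed simp
  moreover have "1 - ?q = 1 / real (Suc k)" by (simp add: field_simps)
  ultimately show "rho s k \<le> 1 / real (Suc k)" unfolding rho_def by linarith
qed

lemma eta_Suc:
  assumes i: "i < N"
  shows "eta s (Suc k) \<omega> i c = (1 - rho s k) * eta s k \<omega> i c + beta i (Suc k) * Ht i (Suc k) (w i (Suc k) \<omega>) c"
proof -
  define T where "T = real (Suc k)"
  have T: "0 < T" by (simp add: T_def)
  have 1: "T powr (s - 1) * T powr - s = 1 / T"
  proof -
    have "T powr (s - 1) * T powr - s = T powr (s - 1 + - s)" by (rule powr_add[symmetric])
    also have "s - 1 + - s = - 1" by simp
    finally show ?thesis using T by (simp add: powr_minus_divide)
  qed
  have 2: "yy s k \<omega> i c * T powr - s = (1 - rho s k) * eta s k \<omega> i c"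
  proof (cases "k = 0")
    case True
    thus ?thesis by (simp add: yy_def eta_def)
  next
    case False
    hence "(real k / T) powr s * real k powr - s = T powr - s"
      using T by (simp add: powr_divide powr_minus_divide)
    thus ?thesis unfolding rho_def eta_def T_def[symmetric] by (simp add: mult_ac)
  qed
  have "eta s (Suc k) \<omega> i c = yy s k \<omega> i c * T powr - s + (T powr (s - 1) * T powr - s) * (beta i 1 * Ht i (Suc k) (w i (Suc k) \<omega>) c)"
    unfolding eta_def yy_def T_def by (simp add: algebra_simps)
  also have "\<dots> = (1 - rho s k) * eta s k \<omega> i c + beta i (Suc k) * Ht i (Suc k) (w i (Suc k) \<omega>) c"
    unfolding 1 2 unfolding beta_poly[OF i] T_def by simp
  finally show ?thesis .
qed

lemma Ht_w_L2: "i < N \<Longrightarrow> L2 (\<lambda>\<omega>. Ht i (Suc k) (w i (Suc k) \<omega>) c)"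
  unfolding Ht_def by (intro L2_sum L2_cmult w_L2) auto

lemma Ht_w_measurable: "i < N \<Longrightarrow> (\<lambda>\<omega>. Ht i (Suc k) (w i (Suc k) \<omega>) c) \<in> borel_measurable (F (Suc k))"
  unfolding Ht_def using w_meas by (intro borel_measurable_sum borel_measurable_times borel_measurable_const) auto

lemma yy_L2: "i < N \<Longrightarrow> L2 (\<lambda>\<omega>. yy s k \<omega> i c)"
  unfolding yy_def by (intro L2_sum L2_cmult Ht_w_L2)

lemma yy_measurable: "i < N \<Longrightarrow> (\<lambda>\<omega>. yy s k \<omega> i c) \<in> borel_measurable (F k)"
  unfolding yy_def
  by (intro borel_measurable_sum borel_measurable_times borel_measurable_const meas_F_mono[OF Ht_w_measurable]) auto

lemma eta_measurable: "i < N \<Longrightarrow> (\<lambda>\<omega>. eta s k \<omega> i c) \<in> borel_measurable (F k)"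
  unfolding eta_def using yy_measurable by measurable

lemma ff_measurable: "i < N \<Longrightarrow> c < n \<Longrightarrow> (\<lambda>\<omega>. ff s k \<omega> i c) \<in> borel_measurable (F k)"
  unfolding ff_def using er_measurable eta_measurable by measurable

text \<open>A square-integrable martingale with increments of variance of order
  \<open>t powr (2 * s - 2)\<close>. These are summable because \<open>s < 1/2\<close>, so the
  squared norm is an almost supermartingale with \<open>b = 0\<close>.\<close>

lemma yy_AE_bounded:
  assumes s: "s < 1 / 2"
  shows "AE \<omega> in M. \<exists>C. \<forall>k. ip N n (yy s k \<omega>) (yy s k \<omega>) \<le> C"
proof -
  define cK where "cK = (\<Sum>i<N. (beta i 1)\<^sup>2) * Hbar\<^sup>2 * Kw"
  have Kw: "0 \<le> Kw"
  proof -
    have "0 \<le> (\<integral>\<omega>. (\<Sum>r<m 0. (w 0 (Suc 0) \<omega> r)\<^sup>2) \<partial>M)" by (simp add: sum_nonneg)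
    also have "\<dots> \<le> Kw" using N_pos by (intro w_var) auto
    finally show ?thesis .
  qed
  have cK0: "0 \<le> cK" unfolding cK_def using Kw by (intro mult_nonneg_nonneg sum_nonneg) auto
  define Y where "Y k \<omega> = ip N n (yy s k \<omega>) (yy s k \<omega>)" for k \<omega>
  define z where "z k \<omega> i c = real (Suc k) powr (s - 1) * (beta i 1 * Ht i (Suc k) (w i (Suc k) \<omega>) c)" for k \<omega> i c
  have yS: "yy s (Suc k) \<omega> i c = yy s k \<omega> i c + z k \<omega> i c" for k \<omega> i c by (simp add: yy_def z_def)
  have zL2: "L2 (\<lambda>\<omega>. z k \<omega> i c)" if "i < N" for k i c
    unfolding z_def by (intro L2_cmult Ht_w_L2 that)
  have "AE \<omega> in M. \<exists>C. \<forall>k. Y k \<omega> \<le> C"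
  proof (rule almost_supermartingale_AE_bounded[where b="\<lambda>_. 0" and c="\<lambda>k. real (Suc k) powr (2 * s - 2) * cK"])
    show "0 \<le> Y k \<omega>" for k \<omega> by (simp add: Y_def ip_nonneg)
    show "Y k \<in> borel_measurable (F k)" for k
      unfolding Y_def[abs_def] ip_def by (intro borel_measurable_sum borel_measurable_times yy_measurable) auto
    show "integrable M (Y k)" for k
      unfolding Y_def[abs_def] ip_eq_sum_sq using yy_L2 by (intro Bochner_Integration.integrable_sum) (auto simp: L2_def)
    show "summable (\<lambda>k. real (Suc k) powr (2 * s - 2) * cK)"
    proof (rule summable_mult2)
      have "summable (\<lambda>k. real k powr (2 * s - 2))" using s by (simp add: summable_real_powr_iff)
      thus "summable (\<lambda>k. real (Suc k) powr (2 * s - 2))" by (subst summable_Suc_iff)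
    qed
    show "0 \<le> real (Suc k) powr (2 * s - 2) * cK" for k using cK0 by simp
    fix k A assume A: "A \<in> sets (F k)"
    have AM: "A \<in> sets M" using A sets_F_sub by blast
    let ?I = "\<lambda>\<omega>. indicator A \<omega> :: real"
    have orth: "(\<integral>\<omega>. ?I \<omega> * yy s k \<omega> i c * z k \<omega> i c \<partial>M) = 0" if i: "i < N" for i c
    proof -
      have l2: "L2 (\<lambda>\<omega>. ?I \<omega> * yy s k \<omega> i c)" by (intro L2_indicator_mult yy_L2 i AM)
      have mF: "(\<lambda>\<omega>. ?I \<omega> * yy s k \<omega> i c) \<in> borel_measurable (F k)"
        by (intro borel_measurable_times yy_measurable i borel_measurable_indicator A)
      have "?I \<omega> * yy s k \<omega> i c * z k \<omega> i c = (\<Sum>r<m i. (real (Suc k) powr (s - 1) * beta i 1 * H i (Suc k) r c) *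
          ((?I \<omega> * yy s k \<omega> i c) * w i (Suc k) \<omega> r))" for \<omega>
        unfolding z_def Ht_def by (simp add: sum_distrib_left mult_ac)
      hence "(\<integral>\<omega>. ?I \<omega> * yy s k \<omega> i c * z k \<omega> i c \<partial>M) = (\<integral>\<omega>. (\<Sum>r<m i. (real (Suc k) powr (s - 1) * beta i 1 * H i (Suc k) r c) *
          ((?I \<omega> * yy s k \<omega> i c) * w i (Suc k) \<omega> r)) \<partial>M)" by (simp only:)
      also have "\<dots> = (\<Sum>r<m i. (real (Suc k) powr (s - 1) * beta i 1 * H i (Suc k) r c) * (\<integral>\<omega>. (?I \<omega> * yy s k \<omega> i c) * w i (Suc k) \<omega> r \<partial>M))"
        using L2_mult_integrable[OF l2 w_L2[OF i]] by (subst Bochner_Integration.integral_sum) auto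
      also have "\<dots> = 0" using w_orth[OF i _ mF l2] by (intro sum.neutral) auto
      finally show ?thesis .
    qed
    have iy: "integrable M (\<lambda>\<omega>. ?I \<omega> * Y k \<omega>)" for k
    proof -
      have "integrable M (Y k)"
        unfolding Y_def[abs_def] ip_eq_sum_sq using yy_L2 by (intro Bochner_Integration.integrable_sum) (auto simp: L2_def)
      from integrable_mult_indicator[OF AM this] show ?thesis by simp
    qed
    have iyz: "integrable M (\<lambda>\<omega>. ?I \<omega> * yy s k \<omega> i c * z k \<omega> i c)" if "i < N" for i c
      using L2_mult_integrable[OF L2_indicator_mult[OF yy_L2[OF that] AM] zL2[OF that]] .
    let ?W = "\<lambda>i \<omega>. ?I \<omega> * (\<Sum>r<m i. (w i (Suc k) \<omega> r)\<^sup>2)"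
    have iw: "integrable M (?W i)" if "i < N" for i
    proof -
      have "integrable M (\<lambda>\<omega>. \<Sum>r<m i. (w i (Suc k) \<omega> r)\<^sup>2)"
        using w_sq[OF that] by (intro Bochner_Integration.integrable_sum) auto
      from integrable_mult_indicator[OF AM this] show ?thesis by simp
    qed
    let ?t = "real (Suc k) powr (2 * s - 2)"
    have "(\<integral>\<omega>. ?I \<omega> * Y (Suc k) \<omega> \<partial>M) \<le> (\<integral>\<omega>. ?I \<omega> * Y k \<omega> + 2 * (\<Sum>i<N. \<Sum>c<n. ?I \<omega> * yy s k \<omega> i c * z k \<omega> i c)
       + (\<Sum>i<N. ?t * (beta i 1)\<^sup>2 * Hbar\<^sup>2 * ?W i \<omega>) \<partial>M)"
    proof (rule integral_mono)
      fix \<omega>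
      have z2: "(\<Sum>c<n. (z k \<omega> i c)\<^sup>2) \<le> ?t * (beta i 1)\<^sup>2 * Hbar\<^sup>2 * (\<Sum>r<m i. (w i (Suc k) \<omega> r)\<^sup>2)" if "i < N" for i
      proof -
        have tt: "(real (Suc k) powr (s - 1))\<^sup>2 = ?t" by (simp add: power2_eq_square powr_add[symmetric])
        have "(\<Sum>c<n. (z k \<omega> i c)\<^sup>2) = ?t * (beta i 1)\<^sup>2 * (\<Sum>c<n. (Ht i (Suc k) (w i (Suc k) \<omega>) c)\<^sup>2)"
          unfolding z_def power_mult_distrib tt by (simp add: sum_distrib_left mult.assoc)
        also have "\<dots> \<le> ?t * (beta i 1)\<^sup>2 * (Hbar\<^sup>2 * (\<Sum>r<m i. (w i (Suc k) \<omega> r)\<^sup>2))"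
          by (intro mult_left_mono Ht_bound that) auto
        finally show ?thesis by (simp add: mult.assoc)
      qed
      have "Y (Suc k) \<omega> = Y k \<omega> + 2 * (\<Sum>i<N. \<Sum>c<n. yy s k \<omega> i c * z k \<omega> i c) + (\<Sum>i<N. \<Sum>c<n. (z k \<omega> i c)\<^sup>2)"
        unfolding Y_def ip_eq_sum_sq yS by (simp add: power2_sum sum.distrib sum_distrib_left mult.assoc)
      also have "\<dots> \<le> Y k \<omega> + 2 * (\<Sum>i<N. \<Sum>c<n. yy s k \<omega> i c * z k \<omega> i c) + (\<Sum>i<N. ?t * (beta i 1)\<^sup>2 * Hbar\<^sup>2 * (\<Sum>r<m i. (w i (Suc k) \<omega> r)\<^sup>2))"
        using z2 by (intro add_left_mono sum_mono) auto
      finally show "?I \<omega> * Y (Suc k) \<omega> \<le> ?I \<omega> * Y k \<omega> + 2 * (\<Sum>i<N. \<Sum>c<n. ?I \<omega> * yy s k \<omega> i c * z k \<omega> i c)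
       + (\<Sum>i<N. ?t * (beta i 1)\<^sup>2 * Hbar\<^sup>2 * ?W i \<omega>)"
        by (cases "\<omega> \<in> A") simp_all
      show "integrable M (\<lambda>\<omega>. ?I \<omega> * Y k \<omega> + 2 * (\<Sum>i<N. \<Sum>c<n. ?I \<omega> * yy s k \<omega> i c * z k \<omega> i c)
       + (\<Sum>i<N. ?t * (beta i 1)\<^sup>2 * Hbar\<^sup>2 * ?W i \<omega>))"
        using iy iyz iw by (intro Bochner_Integration.integrable_add integrable_mult_right Bochner_Integration.integrable_sum) auto
    qed (rule iy)
    also have "\<dots> = (\<integral>\<omega>. ?I \<omega> * Y k \<omega> \<partial>M) + 2 * (\<Sum>i<N. \<Sum>c<n. (\<integral>\<omega>. ?I \<omega> * yy s k \<omega> i c * z k \<omega> i c \<partial>M))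
       + (\<Sum>i<N. ?t * (beta i 1)\<^sup>2 * Hbar\<^sup>2 * (\<integral>\<omega>. ?W i \<omega> \<partial>M))"
    proof -
      have j1: "integrable M (\<lambda>\<omega>. \<Sum>i<N. \<Sum>c<n. ?I \<omega> * yy s k \<omega> i c * z k \<omega> i c)"
        using iyz by (intro Bochner_Integration.integrable_sum) auto
      have j2: "integrable M (\<lambda>\<omega>. \<Sum>i<N. ?t * (beta i 1)\<^sup>2 * Hbar\<^sup>2 * ?W i \<omega>)"
        using iw by (intro Bochner_Integration.integrable_sum integrable_mult_right) auto
      have "(\<integral>\<omega>. (\<Sum>i<N. \<Sum>c<n. ?I \<omega> * yy s k \<omega> i c * z k \<omega> i c) \<partial>M) = (\<Sum>i<N. (\<integral>\<omega>. (\<Sum>c<n. ?I \<omega> * yy s k \<omega> i c * z k \<omega> i c) \<partial>M))"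
        using iyz by (intro Bochner_Integration.integral_sum) auto
      also have "\<dots> = (\<Sum>i<N. \<Sum>c<n. (\<integral>\<omega>. ?I \<omega> * yy s k \<omega> i c * z k \<omega> i c \<partial>M))"
        using iyz by (intro sum.cong refl Bochner_Integration.integral_sum) auto
      finally have k1: "(\<integral>\<omega>. (\<Sum>i<N. \<Sum>c<n. ?I \<omega> * yy s k \<omega> i c * z k \<omega> i c) \<partial>M) = (\<Sum>i<N. \<Sum>c<n. (\<integral>\<omega>. ?I \<omega> * yy s k \<omega> i c * z k \<omega> i c \<partial>M))" .
      have "(\<integral>\<omega>. (\<Sum>i<N. ?t * (beta i 1)\<^sup>2 * Hbar\<^sup>2 * ?W i \<omega>) \<partial>M) = (\<Sum>i<N. (\<integral>\<omega>. ?t * (beta i 1)\<^sup>2 * Hbar\<^sup>2 * ?W i \<omega> \<partial>M))"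
        using iw by (intro Bochner_Integration.integral_sum) auto
      hence k2: "(\<integral>\<omega>. (\<Sum>i<N. ?t * (beta i 1)\<^sup>2 * Hbar\<^sup>2 * ?W i \<omega>) \<partial>M) = (\<Sum>i<N. ?t * (beta i 1)\<^sup>2 * Hbar\<^sup>2 * (\<integral>\<omega>. ?W i \<omega> \<partial>M))"
        by (simp only: integral_mult_right_zero)
      show ?thesis
        unfolding Bochner_Integration.integral_add[OF Bochner_Integration.integrable_add[OF iy integrable_mult_right[OF j1]] j2]
          Bochner_Integration.integral_add[OF iy integrable_mult_right[OF j1]] integral_mult_right_zero k1 k2 ..
    qed
    also have "(\<Sum>i<N. \<Sum>c<n. (\<integral>\<omega>. ?I \<omega> * yy s k \<omega> i c * z k \<omega> i c \<partial>M)) = 0"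
      using orth by (intro sum.neutral ballI) auto
    also have "(\<Sum>i<N. ?t * (beta i 1)\<^sup>2 * Hbar\<^sup>2 * (\<integral>\<omega>. ?W i \<omega> \<partial>M)) \<le> (\<Sum>i<N. ?t * (beta i 1)\<^sup>2 * Hbar\<^sup>2 * Kw)"
      using AM by (intro sum_mono mult_left_mono Kw_var) auto
    also have "\<dots> = ?t * cK" unfolding cK_def by (simp add: sum_distrib_left sum_distrib_right mult_ac)
    finally show "(\<integral>\<omega>. ?I \<omega> * Y (Suc k) \<omega> \<partial>M) \<le> (1 + 0) * (\<integral>\<omega>. ?I \<omega> * Y k \<omega> \<partial>M) + ?t * cK" by simp
  qed auto
  thus ?thesis unfolding Y_def .
qed

lemma eta_AE_bounded:
  assumes s: "s < 1 / 2"
  shows "AE \<omega> in M. \<exists>C\<ge>0. \<forall>k. ip N n (eta s k \<omega>) (eta s k \<omega>) \<le> C * real k powr - (2 * s)"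
  using yy_AE_bounded[OF s]
proof eventually_elim
  case (elim \<omega>)
  then obtain C where C: "\<And>k. ip N n (yy s k \<omega>) (yy s k \<omega>) \<le> C" by blast
  have "ip N n (eta s k \<omega>) (eta s k \<omega>) = ip N n (yy s k \<omega>) (yy s k \<omega>) * real k powr - (2 * s)" for k
    unfolding ip_eq_sum_sq eta_def power_mult_distrib
    by (simp add: sum_distrib_right[symmetric] power2_eq_square powr_add[symmetric])
  hence "ip N n (eta s k \<omega>) (eta s k \<omega>) \<le> C * real k powr - (2 * s)" for k
    using C[of k] by (simp add: mult_right_mono)
  moreover have "0 \<le> C" using C[of 0] ip_nonneg order_trans by blast
  ultimately show ?case by blast
qed

end

section \<open>Exponential moments of the Lyapunov function\<close>

text \<open>A one-sided hypothesis suffices, so an exponent increment has to be bounded above only.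
  For negative \<open>z\<close> the bound passes through \<open>1 / (1 - z)\<close>.\<close>

lemma exp_le_quadratic:
  fixes z :: real
  assumes "z \<le> 1"
  shows "exp z \<le> 1 + z + z\<^sup>2"
proof (cases "0 \<le> z")
  case True
  thus ?thesis using assms by (rule exp_bound)
next
  case False
  have p: "0 < 1 - z" using False by simp
  have "1 - z \<le> exp (- z)" using exp_ge_add_one_self[of "- z"] by simp
  hence "exp z \<le> 1 / (1 - z)" using p by (simp add: exp_minus field_simps)
  also have "\<dots> \<le> 1 + z + z\<^sup>2"
  proof -
    have "0 \<le> z\<^sup>2 * (- z)" using False by (intro mult_nonneg_nonneg) auto
    hence "1 \<le> (1 + z + z\<^sup>2) * (1 - z)" by (simp add: algebra_simps power2_eq_square)
    thus ?thesis using p by (simp add: field_simps)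
  qed
  finally show ?thesis .
qed

section \<open>Predictable part and dither part of the remainder\<close>

context sc_drift begin

lemma ff_Suc:
  assumes i: "i < N"
  shows "ff s (Suc k) \<omega> i c = ff s k \<omega> i c + Dv k (rho s k) (ff s k \<omega>) (eta s k \<omega>) i c
     + (if c = coord n (Suc k) then (\<Sum>j\<in>nbrs N a i. noise i j k \<omega>) else 0)"
proof -
  have 1: "(\<lambda>c. ff s k \<omega> i c + eta s k \<omega> i c) = er k \<omega> i" for i by (simp add: ff_def fun_eq_iff)
  have 2: "(\<lambda>i. theta (coord n (Suc k)) + ff s k \<omega> i (coord n (Suc k)) + eta s k \<omega> i (coord n (Suc k))) = xx k \<omega>"
    by (simp add: ff_def fun_eq_iff er_def xx_def)
  show ?thesis
    unfolding Dv_def 1 2 unfolding ff_def[of s "Suc k"] er_Suc eta_Suc[OF i] by (simp add: ff_def algebra_simps)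
qed

definition vv :: "nat \<Rightarrow> 'a \<Rightarrow> pvec" where
  "vv k \<omega> i c = ff s k \<omega> i c + Dv k (rho s k) (ff s k \<omega>) (eta s k \<omega>) i c"

definition un :: "nat \<Rightarrow> nat \<Rightarrow> pvec" where
  "un l i' i c = (if i = i' \<and> c = l then 1 else 0)"

definition nv :: "nat \<Rightarrow> 'a \<Rightarrow> pvec" where
  "nv k \<omega> i c = (\<Sum>z\<in>E. noise (fst z) (snd z) k \<omega> * un (coord n (Suc k)) (fst z) i c)"

text \<open>The Lyapunov value after the predictable part of the step; \<open>bb\<close> is the
  coefficient of each edge noise in the expansion around it. Both are known at time
  \<open>k\<close>.\<close>

definition base :: "nat \<Rightarrow> 'a \<Rightarrow> real" where
  "base k \<omega> = Psi (Suc k) (vv k \<omega>) (vv k \<omega>)"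

definition bb :: "nat \<Rightarrow> nat \<times> nat \<Rightarrow> 'a \<Rightarrow> real" where
  "bb k z \<omega> = 2 * Psi (Suc k) (vv k \<omega>) (un (coord n (Suc k)) (fst z))"

definition U :: "nat \<Rightarrow> 'a \<Rightarrow> real" where
  "U k \<omega> = real k powr (2 * kap) * Psi k (ff s k \<omega>) (ff s k \<omega>)"

lemma nv_eq:
  assumes i: "i < N"
  shows "nv k \<omega> i c = (if c = coord n (Suc k) then (\<Sum>j\<in>nbrs N a i. noise i j k \<omega>) else 0)"
proof -
  let ?l = "coord n (Suc k)"
  have "nv k \<omega> i c = (\<Sum>(i', j)\<in>E. noise i' j k \<omega> * un ?l i' i c)" by (simp add: nv_def case_prod_beta')
  also have "\<dots> = (\<Sum>i'<N. \<Sum>j\<in>nbrs N a i'. noise i' j k \<omega> * un ?l i' i c)" by (rule sum_edges)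
  also have "\<dots> = (\<Sum>i'<N. if i' = i then (if c = ?l then (\<Sum>j\<in>nbrs N a i. noise i j k \<omega>) else 0) else 0)"
    by (intro sum.cong refl) (auto simp: un_def)
  also have "\<dots> = (if c = ?l then (\<Sum>j\<in>nbrs N a i. noise i j k \<omega>) else 0)" using i by simp
  finally show ?thesis .
qed

lemma nv_sq: "ip N n (nv k \<omega>) (nv k \<omega>) \<le> real N * (\<Sum>z\<in>E. (noise (fst z) (snd z) k \<omega>)\<^sup>2)"
proof -
  let ?l = "coord n (Suc k)"
  have "ip N n (nv k \<omega>) (nv k \<omega>) = (\<Sum>i<N. \<Sum>c<n. if c = ?l then (\<Sum>j\<in>nbrs N a i. noise i j k \<omega>)\<^sup>2 else 0)"
    unfolding ip_eq_sum_sq by (intro sum.cong refl) (auto simp: nv_eq)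
  also have "\<dots> = (\<Sum>i<N. (\<Sum>j\<in>nbrs N a i. noise i j k \<omega>)\<^sup>2)" using coord_less[of "Suc k"] by simp
  also have "\<dots> \<le> (\<Sum>i<N. real N * (\<Sum>j\<in>nbrs N a i. (noise i j k \<omega>)\<^sup>2))"
  proof (rule sum_mono)
    fix i
    have "(\<Sum>j\<in>nbrs N a i. noise i j k \<omega>)\<^sup>2 \<le> real (card (nbrs N a i)) * (\<Sum>j\<in>nbrs N a i. (noise i j k \<omega>)\<^sup>2)"
      by (rule sum_sq_le_card)
    also have "\<dots> \<le> real N * (\<Sum>j\<in>nbrs N a i. (noise i j k \<omega>)\<^sup>2)"
      using card_nbrs_le by (intro mult_right_mono sum_nonneg) auto
    finally show "(\<Sum>j\<in>nbrs N a i. noise i j k \<omega>)\<^sup>2 \<le> real N * (\<Sum>j\<in>nbrs N a i. (noise i j k \<omega>)\<^sup>2)" .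
  qed
  also have "\<dots> = real N * (\<Sum>(i, j)\<in>E. (noise i j k \<omega>)\<^sup>2)" unfolding sum_edges by (simp add: sum_distrib_left)
  finally show ?thesis by (simp add: case_prod_beta')
qed

lemma Psi_ff_Suc:
  "Psi (Suc k) (ff s (Suc k) \<omega>) (ff s (Suc k) \<omega>) \<le> base k \<omega>
     + (\<Sum>z\<in>E. bb k z \<omega> * noise (fst z) (snd z) k \<omega>) + real N * (\<Sum>z\<in>E. (noise (fst z) (snd z) k \<omega>)\<^sup>2)"
proof -
  let ?B = "Psi (Suc k)"
  let ?u = "\<lambda>i c. vv k \<omega> i c + 1 * nv k \<omega> i c"
  have "?B (ff s (Suc k) \<omega>) (ff s (Suc k) \<omega>) = ?B ?u ?u"
    by (rule sym_form_cong[OF sym_form_Psi]) (simp_all add: ff_Suc vv_def nv_eq)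
  also have "\<dots> = base k \<omega> + 2 * ?B (vv k \<omega>) (nv k \<omega>) + ?B (nv k \<omega>) (nv k \<omega>)"
    using sym_form_quad_add[OF sym_form_Psi, of "Suc k" "vv k \<omega>" 1 "nv k \<omega>"] by (simp add: base_def)
  also have "?B (vv k \<omega>) (nv k \<omega>) = (\<Sum>z\<in>E. noise (fst z) (snd z) k \<omega> * ?B (vv k \<omega>) (un (coord n (Suc k)) (fst z)))"
    using sym_form_sum_right[OF sym_form_Psi, of "Suc k" "vv k \<omega>" "\<lambda>z. noise (fst z) (snd z) k \<omega>" "\<lambda>z. un (coord n (Suc k)) (fst z)" E]
    unfolding nv_def[abs_def] by simp
  also have "2 * \<dots> = (\<Sum>z\<in>E. bb k z \<omega> * noise (fst z) (snd z) k \<omega>)"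
    unfolding sum_distrib_left bb_def by (intro sum.cong refl) simp
  finally show ?thesis using nv_sq[of k \<omega>] Psi_le[of "Suc k" "nv k \<omega>"] by linarith
qed

text \<open>Self-bounding property: by Cauchy-Schwarz, and \<open>Psi_le\<close> at a unit vector,
  the coefficient of the linear noise term is controlled by the Lyapunov value itself. The variance
  of that term is thus proportional to \<open>base\<close> and can be absorbed by the
  contraction.\<close>

lemma bb_sq_le:
  assumes pos: "\<And>v. 0 \<le> Psi (Suc k) v v" and z: "z \<in> E"
  shows "(bb k z \<omega>)\<^sup>2 \<le> 4 * base k \<omega>"
proof -
  let ?u = "un (coord n (Suc k)) (fst z)"
  have "(Psi (Suc k) (vv k \<omega>) ?u)\<^sup>2 \<le> Psi (Suc k) (vv k \<omega>) (vv k \<omega>) * Psi (Suc k) ?u ?u"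
    by (rule sym_form_cauchy_schwarz[OF sym_form_Psi pos])
  also have "\<dots> \<le> Psi (Suc k) (vv k \<omega>) (vv k \<omega>) * 1"
  proof (rule mult_left_mono)
    have "ip N n ?u ?u = (\<Sum>i<N. \<Sum>c<n. if i = fst z then (if c = coord n (Suc k) then 1 else 0) else 0)"
      unfolding ip_def by (intro sum.cong refl) (simp add: un_def)
    also have "\<dots> = (\<Sum>i<N. if i = fst z then 1 else 0)"
      using coord_less[of "Suc k"] by (intro sum.cong refl) simp
    also have "\<dots> = 1" using edge_bounds[OF z] by simp
    finally show "Psi (Suc k) ?u ?u \<le> 1" using Psi_le[of "Suc k" ?u] by simp
  qed (rule pos)
  finally show ?thesis unfolding bb_def base_def by (simp add: power_mult_distrib)
qed

lemma form_measurable: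
  assumes u: "\<And>i c. i < N \<Longrightarrow> c < n \<Longrightarrow> (\<lambda>\<omega>. u \<omega> i c) \<in> borel_measurable (F k)"
    and v: "\<And>i c. i < N \<Longrightarrow> c < n \<Longrightarrow> (\<lambda>\<omega>. v \<omega> i c) \<in> borel_measurable (F k)"
  shows "(\<lambda>\<omega>. Psi t (u \<omega>) (v \<omega>)) \<in> borel_measurable (F k)" "(\<lambda>\<omega>. ip N n (u \<omega>) (v \<omega>)) \<in> borel_measurable (F k)"
proof -
  have hu: "(\<lambda>\<omega>. Hv i q (u \<omega> i) r) \<in> borel_measurable (F k)" "(\<lambda>\<omega>. Hv i q (v \<omega> i) r) \<in> borel_measurable (F k)" if "i < N" for i q r
    unfolding Hv_def using u v that by (auto intro!: borel_measurable_sum borel_measurable_times)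
  have e: "(\<lambda>\<omega>. u \<omega> (fst z) (coord n q)) \<in> borel_measurable (F k)" "(\<lambda>\<omega>. u \<omega> (snd z) (coord n q)) \<in> borel_measurable (F k)"
    "(\<lambda>\<omega>. v \<omega> (fst z) (coord n q)) \<in> borel_measurable (F k)" "(\<lambda>\<omega>. v \<omega> (snd z) (coord n q)) \<in> borel_measurable (F k)" if "z \<in> E" for z q
    using u v edge_bounds[OF that] coord_less by auto
  have Q: "(\<lambda>\<omega>. Qf mu bl q (u \<omega>) (v \<omega>)) \<in> borel_measurable (F k)" for q
    unfolding Qf_def
    by (intro borel_measurable_add borel_measurable_times borel_measurable_const borel_measurable_sum borel_measurable_diff hu e) auto
  show i: "(\<lambda>\<omega>. ip N n (u \<omega>) (v \<omega>)) \<in> borel_measurable (F k)"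
    unfolding ip_def by (intro borel_measurable_times borel_measurable_sum u v) auto
  show "(\<lambda>\<omega>. Psi t (u \<omega>) (v \<omega>)) \<in> borel_measurable (F k)"
    unfolding Psi_def Rf_def by (intro borel_measurable_diff borel_measurable_times borel_measurable_const borel_measurable_sum i Q)
qed

lemma vv_measurable: "i < N \<Longrightarrow> c < n \<Longrightarrow> (\<lambda>\<omega>. vv k \<omega> i c) \<in> borel_measurable (F k)"
proof -
  assume ic: "i < N" "c < n"
  have 1: "(\<lambda>c. ff s k \<omega> i c + eta s k \<omega> i c) = er k \<omega> i" for i \<omega> by (simp add: ff_def fun_eq_iff)
  have 2: "(\<lambda>i. theta (coord n (Suc k)) + ff s k \<omega> i (coord n (Suc k)) + eta s k \<omega> i (coord n (Suc k))) = xx k \<omega>" for \<omega>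
    by (simp add: ff_def fun_eq_iff er_def xx_def)
  have h: "(\<lambda>\<omega>. Ht i (Suc k) (Hv i (Suc k) (er k \<omega> i)) c) \<in> borel_measurable (F k)"
    unfolding Ht_def Hv_def using ic
    by (intro borel_measurable_sum borel_measurable_times borel_measurable_const er_measurable) auto
  have c: "(\<lambda>\<omega>. if c = coord n (Suc k) then coup k (xx k \<omega>) i else 0) \<in> borel_measurable (F k)"
    using coup_xx_measurable[OF ic(1), of k] by (cases "c = coord n (Suc k)") auto
  show ?thesis unfolding vv_def Dv_def 1 2
    by (intro borel_measurable_add borel_measurable_diff borel_measurable_times borel_measurable_const
        ff_measurable eta_measurable ic h c)
qed

lemma base_measurable: "base k \<in> borel_measurable (F k)"
  unfolding base_def[abs_def] by (intro form_measurable vv_measurable)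

lemma bb_measurable: "bb k z \<in> borel_measurable (F k)"
  unfolding bb_def[abs_def] by (intro borel_measurable_times borel_measurable_const form_measurable vv_measurable)

lemma U_measurable: "U k \<in> borel_measurable (F k)"
  unfolding U_def[abs_def] by (intro borel_measurable_times borel_measurable_const form_measurable ff_measurable)

text \<open>Localisation at time \<open>k\<close>: estimates within \<open>X\<close>, bounded
  remainder, filtered noise decaying at its rate. Exponential moments are taken on such events only,
  where the exponents are bounded.\<close>

definition good :: "nat \<Rightarrow> 'a \<Rightarrow> bool" where
  "good k \<omega> \<longleftrightarrow> (\<forall>i<N. \<forall>c<n. \<bar>est k \<omega> i c\<bar> \<le> X) \<and> ip N n (ff s k \<omega>) (ff s k \<omega>) \<le> K
     \<and> ip N n (eta s k \<omega>) (eta s k \<omega>) \<le> K * real k powr - (2 * s)"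

lemma good_sets: "{\<omega> \<in> space M. good k \<omega>} \<in> sets (F k)"
proof -
  have [measurable]: "(\<lambda>\<omega>. ip N n (ff s k \<omega>) (ff s k \<omega>)) \<in> borel_measurable (F k)"
    by (rule form_measurable(2)) (auto intro: ff_measurable)
  have [measurable]: "(\<lambda>\<omega>. ip N n (eta s k \<omega>) (eta s k \<omega>)) \<in> borel_measurable (F k)"
    by (rule form_measurable(2)) (auto intro: eta_measurable)
  have "(\<Inter>i\<in>{..<N}. \<Inter>c\<in>{..<n}. {\<omega> \<in> space (F k). \<bar>est k \<omega> i c\<bar> \<le> X}) \<in> sets (F k)"
  proof (intro sets.finite_INT)
    fix i c assume "i \<in> {..<N}" "c \<in> {..<n}"
    hence [measurable]: "(\<lambda>\<omega>. est k \<omega> i c) \<in> borel_measurable (F k)" using est_measurable by auto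
    show "{\<omega> \<in> space (F k). \<bar>est k \<omega> i c\<bar> \<le> X} \<in> sets (F k)" by measurable
  qed (use N_pos n_pos in auto)
  moreover have "{\<omega> \<in> space (F k). ip N n (ff s k \<omega>) (ff s k \<omega>) \<le> K \<and> ip N n (eta s k \<omega>) (eta s k \<omega>) \<le> K * real k powr - (2 * s)} \<in> sets (F k)"
    by measurable
  ultimately have "(\<Inter>i\<in>{..<N}. \<Inter>c\<in>{..<n}. {\<omega> \<in> space (F k). \<bar>est k \<omega> i c\<bar> \<le> X}) \<inter>
    {\<omega> \<in> space (F k). ip N n (ff s k \<omega>) (ff s k \<omega>) \<le> K \<and> ip N n (eta s k \<omega>) (eta s k \<omega>) \<le> K * real k powr - (2 * s)} \<in> sets (F k)"
    by (rule sets.Int)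
  also have "(\<Inter>i\<in>{..<N}. \<Inter>c\<in>{..<n}. {\<omega> \<in> space (F k). \<bar>est k \<omega> i c\<bar> \<le> X}) \<inter>
    {\<omega> \<in> space (F k). ip N n (ff s k \<omega>) (ff s k \<omega>) \<le> K \<and> ip N n (eta s k \<omega>) (eta s k \<omega>) \<le> K * real k powr - (2 * s)} = {\<omega> \<in> space M. good k \<omega>}"
    using N_pos n_pos by (auto simp: good_def space_F)
  finally show ?thesis .
qed

definition KB :: real where "KB = 2 * K + 4 * C2 * K"

lemma good_bounds:
  assumes k: "1 \<le> k" and g: "good k \<omega>"
  shows "base k \<omega> \<le> KB" "\<And>i. i < N \<Longrightarrow> \<bar>xx k \<omega> i\<bar> \<le> X"
    "\<And>i. i < N \<Longrightarrow> \<bar>theta (coord n (Suc k)) + ff s k \<omega> i (coord n (Suc k)) + eta s k \<omega> i (coord n (Suc k))\<bar> \<le> X"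
proof -
  show x: "\<bar>xx k \<omega> i\<bar> \<le> X" if "i < N" for i using g that coord_less by (simp add: good_def xx_def)
  show x': "\<bar>theta (coord n (Suc k)) + ff s k \<omega> i (coord n (Suc k)) + eta s k \<omega> i (coord n (Suc k))\<bar> \<le> X" if "i < N" for i
    using x[OF that] by (simp add: ff_def er_def xx_def)
  have kp: "real k powr - (2 * s) \<le> 1"
  proof -
    have "real k powr - (2 * s) \<le> real k powr 0" using k kap s by (intro powr_mono) auto
    thus ?thesis using k by simp
  qed
  have f: "ip N n (ff s k \<omega>) (ff s k \<omega>) \<le> K" using g by (simp add: good_def)
  have e: "ip N n (eta s k \<omega>) (eta s k \<omega>) \<le> K"
    using g mult_left_mono[OF kp K_nonneg] by (simp add: good_def)
  have t1: "(real (Suc k) powr - g0)\<^sup>2 \<le> 1"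
  proof -
    have "real (Suc k) powr - g0 \<le> real (Suc k) powr 0" using g0 by (intro powr_mono) auto
    thus ?thesis by (intro power_le_one) auto
  qed
  have "ip N n (Dv k (rho s k) (ff s k \<omega>) (eta s k \<omega>)) (Dv k (rho s k) (ff s k \<omega>) (eta s k \<omega>)) \<le>
     C2 * (real (Suc k) powr - g0)\<^sup>2 * (ip N n (ff s k \<omega>) (ff s k \<omega>) + ip N n (eta s k \<omega>) (eta s k \<omega>))"
    using rho_bounds[of s k] kap s by (intro drift_sq x') auto
  also have "\<dots> \<le> C2 * 1 * (K + K)"
    using t1 C2_ge f e ip_nonneg by (intro mult_mono add_mono mult_left_mono) auto
  finally have D: "ip N n (Dv k (rho s k) (ff s k \<omega>) (eta s k \<omega>)) (Dv k (rho s k) (ff s k \<omega>) (eta s k \<omega>)) \<le> 2 * C2 * K" by simp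
  have "base k \<omega> \<le> ip N n (vv k \<omega>) (vv k \<omega>)" unfolding base_def by (rule Psi_le)
  also have "\<dots> \<le> 2 * ip N n (ff s k \<omega>) (ff s k \<omega>) + 2 * ip N n (Dv k (rho s k) (ff s k \<omega>) (eta s k \<omega>)) (Dv k (rho s k) (ff s k \<omega>) (eta s k \<omega>))"
    unfolding vv_def[abs_def] by (rule ip_add_le)
  finally show "base k \<omega> \<le> KB" using f D unfolding KB_def by linarith
qed

end

section \<open>One step of the exponential moment\<close>

context sc_drift begin

definition A1 :: "nat \<times> nat \<Rightarrow> real" where
  "A1 z = alpha (fst z) (snd z) 1 * a (fst z) (snd z)"

definition cn :: real where "cn = (\<Sum>z\<in>E. (A1 z)\<^sup>2 * exp (X / b (fst z) (snd z)))"

definition cm :: real where "cm = (\<Sum>z\<in>E. 4 * (A1 z)\<^sup>2)"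

text \<open>Upper bound, on a good event, for the noise contribution to \<open>U\<close>:
  \<open>bb\<close> is at most \<open>2 * sqrt KB\<close>, and a scaled noise is at most twice
  \<open>A1\<close>.\<close>

definition Cy :: real where
  "Cy = (\<Sum>z\<in>E. 4 * sqrt KB * A1 z + real N * (4 * (A1 z)\<^sup>2))"

lemma KB_nonneg: "0 \<le> KB" unfolding KB_def using K_nonneg C2_ge by simp

lemma A1_nonneg: "z \<in> E \<Longrightarrow> 0 \<le> A1 z"
  unfolding A1_def using alpha_pos[of "fst z" "snd z" 1] a_nonneg[of "fst z" "snd z"] by (simp add: less_imp_le)

lemma const_nonneg: "0 \<le> cn" "0 \<le> cm" "0 \<le> Cy"
  unfolding cn_def cm_def Cy_def using A1_nonneg KB_nonneg by (auto intro!: sum_nonneg)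

lemma step_coeff:
  assumes z: "z \<in> E"
  shows "alpha (fst z) (snd z) (Suc k) * a (fst z) (snd z) = A1 z * real (Suc k) powr - gamma (fst z) (snd z)"
proof -
  have "(fst z, snd z) \<in> E" using z by simp
  from alpha_poly[OF this, of k] show ?thesis by (simp add: A1_def powr_minus_divide)
qed

text \<open>\<open>kap_noise\<close> together with \<open>nu + gamma \<le> 1\<close> yields
  \<open>2 * kap \<le> gamma\<close>, so a single power of the step size compensates the
  scaling.\<close>

lemma noise_scaled:
  assumes z: "z \<in> E"
  defines "tk \<equiv> \<lambda>k. real (Suc k) powr (2 * kap)"
  shows "tk k * (noise (fst z) (snd z) k \<omega>)\<^sup>2 \<le> 4 * (A1 z)\<^sup>2" "tk k * \<bar>noise (fst z) (snd z) k \<omega>\<bar> \<le> 2 * A1 z"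
proof -
  define T where "T = real (Suc k)"
  have T: "1 \<le> T" by (simp add: T_def)
  let ?g = "gamma (fst z) (snd z)"
  have z': "(fst z, snd z) \<in> E" using z by simp
  have g: "2 * kap \<le> ?g" using kap_noise[OF z'] gamma_nu[OF z'] by linarith
  have g0': "0 \<le> ?g" using gamma_gt[OF z'] by simp
  have nb: "\<bar>noise (fst z) (snd z) k \<omega>\<bar> \<le> 2 * (A1 z * T powr - ?g)"
    using noise_abs_le[OF z', of k \<omega>] unfolding step_coeff[OF z] T_def .
  have t1: "T powr (2 * kap) * T powr - ?g \<le> 1"
  proof -
    have "T powr (2 * kap) * T powr - ?g = T powr (2 * kap - ?g)" by (simp add: powr_add[symmetric])
    also have "\<dots> \<le> T powr 0" using T g by (intro powr_mono) auto
    finally show ?thesis using T by simp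
  qed
  have t2: "T powr - ?g \<le> 1"
  proof -
    have "T powr - ?g \<le> T powr 0" using T g0' by (intro powr_mono) auto
    thus ?thesis using T by simp
  qed
  have A0: "0 \<le> A1 z" by (rule A1_nonneg[OF z])
  have "T powr (2 * kap) * \<bar>noise (fst z) (snd z) k \<omega>\<bar> \<le> T powr (2 * kap) * (2 * (A1 z * T powr - ?g))"
    by (rule mult_left_mono[OF nb]) simp
  also have "\<dots> = 2 * A1 z * (T powr (2 * kap) * T powr - ?g)" by simp
  also have "\<dots> \<le> 2 * A1 z * 1" using t1 A0 by (intro mult_left_mono) auto
  finally show 1: "tk k * \<bar>noise (fst z) (snd z) k \<omega>\<bar> \<le> 2 * A1 z" unfolding tk_def T_def by simp
  have "\<bar>noise (fst z) (snd z) k \<omega>\<bar> \<le> 2 * A1 z"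
    using nb mult_left_mono[OF t2 A0] by simp
  hence "(tk k * \<bar>noise (fst z) (snd z) k \<omega>\<bar>) * \<bar>noise (fst z) (snd z) k \<omega>\<bar> \<le> (2 * A1 z) * (2 * A1 z)"
    by (rule mult_mono[OF 1]) (use A0 in auto)
  thus "tk k * (noise (fst z) (snd z) k \<omega>)\<^sup>2 \<le> 4 * (A1 z)\<^sup>2"
    by (simp add: power2_eq_square mult.assoc abs_mult[symmetric])
qed

text \<open>Here \<open>kap_noise\<close> is consumed: the scaled conditional variance has order
  \<open>1 / k\<close>, the same as the contraction.\<close>

lemma noise_variance:
  assumes z: "z \<in> E" and Y: "Y \<in> borel_measurable (F k)" "integrable M Y" "\<And>\<omega>. 0 \<le> Y \<omega>"
    and X: "\<And>\<omega> i. Y \<omega> \<noteq> 0 \<Longrightarrow> i < N \<Longrightarrow> \<bar>xx k \<omega> i\<bar> \<le> X"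
  shows "real (Suc k) powr (2 * kap) * (\<integral>\<omega>. Y \<omega> * (noise (fst z) (snd z) k \<omega>)\<^sup>2 \<partial>M)
     \<le> (A1 z)\<^sup>2 * exp (X / b (fst z) (snd z)) / real (Suc k) * (\<integral>\<omega>. Y \<omega> \<partial>M)"
proof -
  define T where "T = real (Suc k)"
  have T: "1 \<le> T" by (simp add: T_def)
  let ?g = "gamma (fst z) (snd z)" and ?n = "nu (fst z) (snd z)" and ?e = "exp (X / b (fst z) (snd z))"
  have z': "(fst z, snd z) \<in> E" using z by simp
  have I0: "0 \<le> (\<integral>\<omega>. Y \<omega> \<partial>M)" using Y(3) by (intro integral_nonneg_AE AE_I2)
  have "(\<integral>\<omega>. Y \<omega> * (noise (fst z) (snd z) k \<omega>)\<^sup>2 \<partial>M) \<le> (A1 z * T powr - ?g)\<^sup>2 * (?e * T powr - ?n) * (\<integral>\<omega>. Y \<omega> \<partial>M)"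
    using noise_sq[OF z' Y, of X] X edge_bounds[OF z] unfolding step_coeff[OF z] T_def by blast
  hence "T powr (2 * kap) * (\<integral>\<omega>. Y \<omega> * (noise (fst z) (snd z) k \<omega>)\<^sup>2 \<partial>M) \<le> T powr (2 * kap) * ((A1 z * T powr - ?g)\<^sup>2 * (?e * T powr - ?n) * (\<integral>\<omega>. Y \<omega> \<partial>M))"
    by (rule mult_left_mono) simp
  also have "\<dots> = (A1 z)\<^sup>2 * ?e * (T powr (2 * kap) * (T powr - ?g * T powr - ?g) * T powr - ?n) * (\<integral>\<omega>. Y \<omega> \<partial>M)"
    by (simp add: power2_eq_square)
  also have "T powr (2 * kap) * (T powr - ?g * T powr - ?g) * T powr - ?n = T powr (2 * kap - 2 * ?g - ?n)"
    by (simp add: powr_add[symmetric])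
  also have "(A1 z)\<^sup>2 * ?e * T powr (2 * kap - 2 * ?g - ?n) * (\<integral>\<omega>. Y \<omega> \<partial>M) \<le> (A1 z)\<^sup>2 * ?e * (1 / T) * (\<integral>\<omega>. Y \<omega> \<partial>M)"
  proof (intro mult_right_mono mult_left_mono I0)
    have "T powr (2 * kap - 2 * ?g - ?n) \<le> T powr - 1" using T kap_noise[OF z'] by (intro powr_mono) auto
    thus "T powr (2 * kap - 2 * ?g - ?n) \<le> 1 / T" using T by (simp add: powr_minus_divide)
  qed auto
  finally show ?thesis unfolding T_def by simp
qed

text \<open>\<open>U (Suc k)\<close> is at most the scaled predictable value \<open>B\<close> plus a
  noise part \<open>y\<close> with \<open>lm * y \<le> 1\<close>, so the exponential of the noise is
  bounded by a quadratic polynomial. Its linear part has mean 0 and its quadratic part contributes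
  \<open>cn / T * q\<close>. The portion of \<open>q\<close> proportional to \<open>B\<close> is
  beaten by the contraction when \<open>lm\<close> is small; the constant portion goes into
  \<open>exp (C / T)\<close>.\<close>

lemma exp_step:
  obtains lm k0 C where "0 < lm" "1 \<le> k0" "0 \<le> C" "\<And>k v. k0 \<le> k \<Longrightarrow> ip N n v v / 2 \<le> Psi k v v"
    "\<And>k A. k0 \<le> k \<Longrightarrow> A \<in> sets (F k) \<Longrightarrow> (\<And>\<omega>. \<omega> \<in> A \<Longrightarrow> good k \<omega>) \<Longrightarrow>
      integrable M (\<lambda>\<omega>. indicator A \<omega> * exp (lm * U (Suc k) \<omega>)) \<and>
      (\<integral>\<omega>. indicator A \<omega> * exp (lm * U (Suc k) \<omega>) \<partial>M)
        \<le> exp (C / real (Suc k)) * (\<integral>\<omega>. indicator A \<omega> * exp (lm * U k \<omega>) \<partial>M)"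
proof (rule drift_scaled)
  fix k0 Cd
  assume k0: "1 \<le> k0" and Cd: "0 \<le> Cd" and low: "\<And>k v. k0 \<le> k \<Longrightarrow> ip N n v v / 2 \<le> Psi k v v"
    and dr: "\<And>k rho g h. k0 \<le> k \<Longrightarrow>
      (\<And>i. i < N \<Longrightarrow> \<bar>theta (coord n (Suc k)) + g i (coord n (Suc k)) + h i (coord n (Suc k))\<bar> \<le> X) \<Longrightarrow>
      ip N n h h \<le> K * real k powr - (2 * s) \<Longrightarrow> 0 \<le> rho \<Longrightarrow> rho \<le> 1 / real (Suc k) \<Longrightarrow>
      real (Suc k) powr (2 * kap) * Psi (Suc k) (\<lambda>i c. g i c + Dv k rho g h i c) (\<lambda>i c. g i c + Dv k rho g h i c) \<le>
        (1 - (kap1 - kap) / real (Suc k)) * (real k powr (2 * kap) * Psi k g g) + Cd / real (Suc k)"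
  define mE where "mE = real (card E)"
  define e3 where "e3 = kap1 - kap"
  have e3: "0 < e3" using kap by (simp add: e3_def)
  have mE: "0 \<le> mE" by (simp add: mE_def)
  \<comment> \<open>Small enough for two purposes: the exponent increment stays below 1
    (\<open>lm * Cy \<le> 1\<close>), and the variance term stays below the contraction rate
    (\<open>8 * lm * mE * cn \<le> e3\<close>).\<close>
  define lm where "lm = 1 / (1 + Cy + 8 * mE * cn / e3)"
  have den: "1 \<le> 1 + Cy + 8 * mE * cn / e3" using const_nonneg mE e3 by simp
  have lm: "0 < lm" "lm * Cy \<le> 1" "8 * lm * mE * cn \<le> e3"
  proof -
    show "0 < lm" using den by (simp add: lm_def)
    have "lm * Cy = Cy / (1 + Cy + 8 * mE * cn / e3)" by (simp add: lm_def)
    also have "\<dots> \<le> 1" using den const_nonneg mE e3 by (simp add: divide_le_eq)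
    finally show "lm * Cy \<le> 1" .
    have "8 * lm * mE * cn = 8 * mE * cn / (1 + Cy + 8 * mE * cn / e3)" by (simp add: lm_def)
    also have "\<dots> \<le> e3"
    proof -
      have "8 * mE * cn = (8 * mE * cn / e3) * e3" using e3 by simp
      also have "\<dots> \<le> (1 + Cy + 8 * mE * cn / e3) * e3" using const_nonneg e3 by (intro mult_right_mono) auto
      finally show ?thesis using den by (simp add: divide_le_eq mult.commute)
    qed
    finally show "8 * lm * mE * cn \<le> e3" .
  qed
  define C0 where "C0 = lm * real N + 2 * lm\<^sup>2 * mE * ((real N)\<^sup>2 * cm)"
  define C where "C = cn * C0 + lm * Cd * (1 + e3)"
  have C00: "0 \<le> C0" unfolding C0_def using lm mE const_nonneg by (intro add_nonneg_nonneg mult_nonneg_nonneg) auto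
  have C0': "0 \<le> C" unfolding C_def using C00 const_nonneg lm Cd e3 by (intro add_nonneg_nonneg mult_nonneg_nonneg) auto
  show thesis
  proof (rule that[of lm k0 C])
    show "0 < lm" "1 \<le> k0" "0 \<le> C" using lm k0 C0' by auto
    show "ip N n v v / 2 \<le> Psi k v v" if "k0 \<le> k" for k v using low[OF that] .
    fix k A assume k: "k0 \<le> k" and A: "A \<in> sets (F k)" and gA: "\<And>\<omega>. \<omega> \<in> A \<Longrightarrow> good k \<omega>"
    have AM: "A \<in> sets M" using A sets_F_sub by blast
    have k1: "1 \<le> k" using k k0 by simp
    define T where "T = real (Suc k)"
    have T: "1 \<le> T" by (simp add: T_def)
    define tk where "tk = T powr (2 * kap)"
    have tk: "0 < tk" using T by (simp add: tk_def)
    define B where "B \<omega> = tk * base k \<omega>" for \<omega>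
    \<comment> \<open>Coefficient of the scaled squared noises in the second-order expansion.
      \<open>lm * N\<close> inside \<open>C0\<close> is the quadratic part of \<open>Psi\<close>;
      the rest comes from the square of the exponent, where \<open>bb_sq_le\<close> produces the
      multiple of \<open>B\<close> and \<open>cm\<close> bounds the fourth powers of the
      noise.\<close>
    define q where "q \<omega> = C0 + 8 * lm\<^sup>2 * mE * B \<omega>" for \<omega>
    let ?I = "\<lambda>\<omega>. indicator A \<omega> :: real"
    let ?n = "\<lambda>z \<omega>. noise (fst z) (snd z) k \<omega>"
    have pos: "0 \<le> Psi (Suc k) v v" for v using low[of "Suc k" v] k ip_nonneg[of N n v] by simp
    have B0: "0 \<le> B \<omega>" for \<omega> using pos tk by (simp add: B_def base_def)
    have BK: "B \<omega> \<le> tk * KB" if "\<omega> \<in> A" for \<omega>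
      unfolding B_def using good_bounds(1)[OF k1 gA[OF that]] tk by (intro mult_left_mono) auto
    have U0: "0 \<le> U k \<omega>" for \<omega> unfolding U_def using low[OF k, of "ff s k \<omega>"] ip_nonneg[of N n "ff s k \<omega>"] by simp
    have BU: "B \<omega> \<le> (1 - e3 / T) * U k \<omega> + Cd / T" if "\<omega> \<in> A" for \<omega>
    proof -
      have "real (Suc k) powr (2 * kap) * Psi (Suc k) (\<lambda>i c. ff s k \<omega> i c + Dv k (rho s k) (ff s k \<omega>) (eta s k \<omega>) i c)
          (\<lambda>i c. ff s k \<omega> i c + Dv k (rho s k) (ff s k \<omega>) (eta s k \<omega>) i c) \<le>
        (1 - (kap1 - kap) / real (Suc k)) * (real k powr (2 * kap) * Psi k (ff s k \<omega>) (ff s k \<omega>)) + Cd / real (Suc k)"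
        using gA[OF that] rho_bounds[of s k] kap s good_bounds(3)[OF k1 gA[OF that]]
        by (intro dr k) (auto simp: good_def)
      thus ?thesis unfolding B_def base_def vv_def[abs_def] tk_def T_def U_def e3_def .
    qed
    have bbK: "\<bar>bb k z \<omega>\<bar> \<le> 2 * sqrt KB" if "\<omega> \<in> A" "z \<in> E" for \<omega> z
    proof -
      have "(bb k z \<omega>)\<^sup>2 \<le> 4 * KB" using bb_sq_le[OF pos that(2), of \<omega>] good_bounds(1)[OF k1 gA[OF that(1)]] by simp
      hence "\<bar>bb k z \<omega>\<bar> \<le> sqrt (4 * KB)" by (rule real_le_rsqrt[of "\<bar>bb k z \<omega>\<bar>", unfolded power2_abs])
      thus ?thesis by (simp add: real_sqrt_mult)
    qed
    \<comment> \<open>Weights from the past: \<open>Y0\<close> carries the moment, \<open>Y1\<close>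
      the variance term, and \<open>W\<close> below the linear term of mean 0.\<close>
    define Y0 where "Y0 \<omega> = ?I \<omega> * exp (lm * B \<omega>)" for \<omega>
    define Y1 where "Y1 \<omega> = Y0 \<omega> * q \<omega>" for \<omega>
    have IF: "?I \<in> borel_measurable (F k)" using A by measurable
    have BF: "B \<in> borel_measurable (F k)" unfolding B_def[abs_def] using base_measurable[of k] by measurable
    have Y0F: "Y0 \<in> borel_measurable (F k)" unfolding Y0_def[abs_def] using IF BF by measurable
    have qF: "q \<in> borel_measurable (F k)" unfolding q_def[abs_def] using BF by measurable
    have Y1F: "Y1 \<in> borel_measurable (F k)" unfolding Y1_def[abs_def] using Y0F qF by measurable
    have q0: "0 \<le> q \<omega>" for \<omega> unfolding q_def using C00 B0 mE by (intro add_nonneg_nonneg mult_nonneg_nonneg) auto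
    have Y00: "0 \<le> Y0 \<omega>" for \<omega> by (simp add: Y0_def)
    have Y10: "0 \<le> Y1 \<omega>" for \<omega> unfolding Y1_def using Y00 q0 by simp
    have Y0b: "Y0 \<omega> \<le> exp (lm * (tk * KB))" for \<omega>
      using BK[of \<omega>] lm by (cases "\<omega> \<in> A") (auto simp: Y0_def)
    have Y0i: "integrable M Y0"
    proof (rule integrable_const_bound[OF _ meas_F_M[OF Y0F]])
      show "AE \<omega> in M. norm (Y0 \<omega>) \<le> exp (lm * (tk * KB))"
        by (rule AE_I2) (simp only: real_norm_def abs_of_nonneg[OF Y00] Y0b)
    qed
    have Y1b: "Y1 \<omega> \<le> exp (lm * (tk * KB)) * (C0 + 8 * lm\<^sup>2 * mE * (tk * KB))" for \<omega>
    proof (cases "\<omega> \<in> A")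
      case True
      have "q \<omega> \<le> C0 + 8 * lm\<^sup>2 * mE * (tk * KB)"
        unfolding q_def using BK[OF True] mE by (intro add_left_mono mult_left_mono) auto
      thus ?thesis unfolding Y1_def using Y0b[of \<omega>] Y00 q0 by (intro mult_mono) auto
    next
      case False
      have "0 \<le> exp (lm * (tk * KB)) * (C0 + 8 * lm\<^sup>2 * mE * (tk * KB))"
        using C00 mE tk KB_nonneg by (intro mult_nonneg_nonneg add_nonneg_nonneg) auto
      thus ?thesis using False by (simp add: Y1_def Y0_def)
    qed
    have Y1i: "integrable M Y1"
    proof (rule integrable_const_bound[OF _ meas_F_M[OF Y1F]])
      show "AE \<omega> in M. norm (Y1 \<omega>) \<le> exp (lm * (tk * KB)) * (C0 + 8 * lm\<^sup>2 * mE * (tk * KB))"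
        by (rule AE_I2) (simp only: real_norm_def abs_of_nonneg[OF Y10] Y1b)
    qed
    have nM: "?n z \<in> borel_measurable M" if "z \<in> E" for z
      using meas_F_M[OF noise_measurable, of "fst z" "snd z" k] that by simp
    define W where "W z \<omega> = Y0 \<omega> * bb k z \<omega>" for z \<omega>
    have WF: "W z \<in> borel_measurable (F k)" for z unfolding W_def[abs_def] using Y0F bb_measurable[of k z] by measurable
    have Wi: "integrable M (W z)" if "z \<in> E" for z
    proof (rule integrable_const_bound[where B="exp (lm * (tk * KB)) * (2 * sqrt KB)"])
      show "AE \<omega> in M. norm (W z \<omega>) \<le> exp (lm * (tk * KB)) * (2 * sqrt KB)"
      proof (rule AE_I2)
        fix \<omega>
        show "norm (W z \<omega>) \<le> exp (lm * (tk * KB)) * (2 * sqrt KB)"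
        proof (cases "\<omega> \<in> A")
          case True
          thus ?thesis unfolding W_def real_norm_def abs_mult using Y0b[of \<omega>] Y00[of \<omega>] bbK[OF True that]
            by (intro mult_mono) auto
        qed (use KB_nonneg in \<open>simp add: W_def Y0_def\<close>)
      qed
    qed (rule meas_F_M[OF WF])
    have nb: "\<bar>?n z \<omega>\<bar> \<le> 2 * A1 z" if "z \<in> E" for z \<omega>
    proof -
      have "1 \<le> tk" unfolding tk_def using T kap by (intro ge_one_powr_ge_zero) auto
      hence "1 * \<bar>?n z \<omega>\<bar> \<le> tk * \<bar>?n z \<omega>\<bar>" by (intro mult_right_mono) auto
      thus ?thesis using noise_scaled(2)[OF that, of k \<omega>] unfolding tk_def T_def by simp
    qed
    have Wn: "integrable M (\<lambda>\<omega>. W z \<omega> * ?n z \<omega>)" "(\<integral>\<omega>. W z \<omega> * ?n z \<omega> \<partial>M) = 0" if "z \<in> E" for z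
    proof -
      show "integrable M (\<lambda>\<omega>. W z \<omega> * ?n z \<omega>)" by (rule integrable_mult_bounded[OF Wi[OF that] nM[OF that] nb[OF that]])
      show "(\<integral>\<omega>. W z \<omega> * ?n z \<omega> \<partial>M) = 0" using noise_mean[OF _ WF Wi[OF that], of "fst z" "snd z"] that by simp
    qed
    have Yn: "integrable M (\<lambda>\<omega>. Y1 \<omega> * (?n z \<omega>)\<^sup>2)" if z: "z \<in> E" for z
    proof (rule integrable_mult_bounded[OF Y1i, of _ "(2 * A1 z)\<^sup>2"])
      show "(\<lambda>\<omega>. (?n z \<omega>)\<^sup>2) \<in> borel_measurable M" using nM[OF z] by measurable
      show "\<bar>(?n z \<omega>)\<^sup>2\<bar> \<le> (2 * A1 z)\<^sup>2" for \<omega> using power_mono[OF nb[OF z, of \<omega>], of 2] by simp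
    qed
    have pathwise: "?I \<omega> * exp (lm * U (Suc k) \<omega>) \<le> Y0 \<omega> + lm * tk * (\<Sum>z\<in>E. W z \<omega> * ?n z \<omega>) + (\<Sum>z\<in>E. tk * (Y1 \<omega> * (?n z \<omega>)\<^sup>2))" for \<omega>
    proof (cases "\<omega> \<in> A")
      case True
      define y where "y = tk * ((\<Sum>z\<in>E. bb k z \<omega> * ?n z \<omega>) + real N * (\<Sum>z\<in>E. (?n z \<omega>)\<^sup>2))"
      define sz where "sz z = tk * (bb k z \<omega> * ?n z \<omega> + real N * (?n z \<omega>)\<^sup>2)" for z
      have ysz: "y = (\<Sum>z\<in>E. sz z)" unfolding y_def sz_def by (simp add: sum_distrib_left sum.distrib distrib_left)
      have U': "U (Suc k) \<omega> \<le> B \<omega> + y"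
        using mult_left_mono[OF Psi_ff_Suc[of k \<omega>], of tk] tk
        unfolding U_def B_def y_def tk_def T_def by (simp add: algebra_simps)
      have "sz z \<le> 4 * sqrt KB * A1 z + real N * (4 * (A1 z)\<^sup>2)" if z: "z \<in> E" for z
      proof -
        have "tk * (bb k z \<omega> * ?n z \<omega>) \<le> \<bar>bb k z \<omega>\<bar> * (tk * \<bar>?n z \<omega>\<bar>)"
        proof -
          have "bb k z \<omega> * ?n z \<omega> \<le> \<bar>bb k z \<omega>\<bar> * \<bar>?n z \<omega>\<bar>" by (simp add: abs_mult[symmetric])
          from mult_left_mono[OF this, of tk] tk show ?thesis by (simp add: mult_ac)
        qed
        also have "\<dots> \<le> (2 * sqrt KB) * (2 * A1 z)"
        proof -
          have "tk * \<bar>?n z \<omega>\<bar> \<le> 2 * A1 z" using noise_scaled(2)[OF z, of k \<omega>] unfolding tk_def T_def .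
          from mult_mono[OF bbK[OF True z] this] show ?thesis using tk KB_nonneg by simp
        qed
        finally have 1: "tk * (bb k z \<omega> * ?n z \<omega>) \<le> 4 * sqrt KB * A1 z" by simp
        have "real N * (tk * (?n z \<omega>)\<^sup>2) \<le> real N * (4 * (A1 z)\<^sup>2)"
          using noise_scaled(1)[OF z, of k \<omega>] unfolding tk_def T_def by (intro mult_left_mono) auto
        with 1 show ?thesis unfolding sz_def by (simp add: distrib_left mult_ac)
      qed
      hence "y \<le> Cy" unfolding ysz Cy_def by (rule sum_mono)
      hence "lm * y \<le> lm * Cy" using lm by (intro mult_left_mono) auto
      hence ly: "lm * y \<le> 1" using lm by linarith
      have "(sz z)\<^sup>2 \<le> tk * (2 * (4 * B \<omega> + (real N)\<^sup>2 * cm)) * (?n z \<omega>)\<^sup>2" if z: "z \<in> E" for z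
      proof -
        let ?n2 = "(?n z \<omega>)\<^sup>2"
        have "(p + r)\<^sup>2 \<le> 2 * p\<^sup>2 + 2 * r\<^sup>2" for p r :: real
          using zero_le_power2[of "p - r"] by (simp add: power2_eq_square algebra_simps)
        from this[of "bb k z \<omega> * ?n z \<omega>" "real N * ?n2"]
        have "(sz z)\<^sup>2 \<le> tk\<^sup>2 * (2 * (bb k z \<omega> * ?n z \<omega>)\<^sup>2 + 2 * (real N * ?n2)\<^sup>2)"
          unfolding sz_def power_mult_distrib[of tk] by (intro mult_left_mono) auto
        also have "\<dots> = (tk * ?n2) * (2 * (tk * (bb k z \<omega>)\<^sup>2 + (real N)\<^sup>2 * (tk * ?n2)))"
          by (simp add: power2_eq_square algebra_simps)
        also have "\<dots> \<le> (tk * ?n2) * (2 * (4 * B \<omega> + (real N)\<^sup>2 * cm))"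
        proof -
          have "tk * (bb k z \<omega>)\<^sup>2 \<le> 4 * B \<omega>"
            using mult_left_mono[OF bb_sq_le[OF pos z, of \<omega>], of tk] tk by (simp add: B_def)
          moreover have "tk * ?n2 \<le> cm"
          proof -
            have "tk * ?n2 \<le> 4 * (A1 z)\<^sup>2" using noise_scaled(1)[OF z, of k \<omega>] unfolding tk_def T_def .
            also have "\<dots> \<le> cm" unfolding cm_def using z finite_edges by (intro member_le_sum) auto
            finally show ?thesis .
          qed
          ultimately show ?thesis using tk by (intro mult_left_mono add_mono) auto
        qed
        finally show ?thesis by (simp add: mult_ac)
      qed
      hence "(\<Sum>z\<in>E. (sz z)\<^sup>2) \<le> (\<Sum>z\<in>E. tk * (2 * (4 * B \<omega> + (real N)\<^sup>2 * cm)) * (?n z \<omega>)\<^sup>2)" by (rule sum_mono)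
      hence "mE * (\<Sum>z\<in>E. (sz z)\<^sup>2) \<le> mE * (\<Sum>z\<in>E. tk * (2 * (4 * B \<omega> + (real N)\<^sup>2 * cm)) * (?n z \<omega>)\<^sup>2)" using mE by (rule mult_left_mono)
      moreover have "y\<^sup>2 \<le> mE * (\<Sum>z\<in>E. (sz z)\<^sup>2)" unfolding ysz mE_def by (rule sum_sq_le_card)
      ultimately have y2: "y\<^sup>2 \<le> mE * (\<Sum>z\<in>E. tk * (2 * (4 * B \<omega> + (real N)\<^sup>2 * cm)) * (?n z \<omega>)\<^sup>2)" by (rule order_trans[rotated])
      have "exp (lm * U (Suc k) \<omega>) \<le> exp (lm * B \<omega>) * exp (lm * y)"
        unfolding exp_add[symmetric] distrib_left[symmetric] using U' lm by simp
      also have "\<dots> \<le> exp (lm * B \<omega>) * (1 + lm * y + (lm * y)\<^sup>2)"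
        by (intro mult_left_mono exp_le_quadratic ly) simp
      also have "\<dots> \<le> exp (lm * B \<omega>) * (1 + lm * y + lm\<^sup>2 * (mE * (\<Sum>z\<in>E. tk * (2 * (4 * B \<omega> + (real N)\<^sup>2 * cm)) * (?n z \<omega>)\<^sup>2)))"
        unfolding power_mult_distrib by (intro mult_left_mono add_left_mono y2) auto
      also have "\<dots> = exp (lm * B \<omega>) * (1 + lm * tk * (\<Sum>z\<in>E. bb k z \<omega> * ?n z \<omega>) + (\<Sum>z\<in>E. tk * (q \<omega> * (?n z \<omega>)\<^sup>2)))"
      proof -
        have "lm * y + lm\<^sup>2 * (mE * (\<Sum>z\<in>E. tk * (2 * (4 * B \<omega> + (real N)\<^sup>2 * cm)) * (?n z \<omega>)\<^sup>2))
          = lm * tk * (\<Sum>z\<in>E. bb k z \<omega> * ?n z \<omega>) + q \<omega> * tk * (\<Sum>z\<in>E. (?n z \<omega>)\<^sup>2)"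
        proof -
          have "l * (t * (u + N' * v)) + l\<^sup>2 * (M * (t * (2 * (4 * B' + N'\<^sup>2 * cm)) * v))
            = l * t * u + (l * N' + 2 * l\<^sup>2 * M * (N'\<^sup>2 * cm) + 8 * l\<^sup>2 * M * B') * t * v" for l t u N' v M B' :: real
            by (simp add: algebra_simps)
          thus ?thesis unfolding y_def q_def C0_def sum_distrib_left[symmetric] .
        qed
        moreover have "q \<omega> * tk * (\<Sum>z\<in>E. (?n z \<omega>)\<^sup>2) = (\<Sum>z\<in>E. tk * (q \<omega> * (?n z \<omega>)\<^sup>2))"
          by (simp add: sum_distrib_left mult_ac)
        ultimately show ?thesis by (simp add: add.assoc)
      qed
      also have "\<dots> = Y0 \<omega> + lm * tk * (\<Sum>z\<in>E. W z \<omega> * ?n z \<omega>) + (\<Sum>z\<in>E. tk * (Y1 \<omega> * (?n z \<omega>)\<^sup>2))"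
        using True unfolding W_def Y1_def Y0_def by (simp add: distrib_left sum_distrib_left mult_ac)
      finally show ?thesis using True by simp
    next
      case False
      thus ?thesis by (simp add: Y0_def Y1_def W_def)
    qed
    have iR: "integrable M (\<lambda>\<omega>. Y0 \<omega> + lm * tk * (\<Sum>z\<in>E. W z \<omega> * ?n z \<omega>) + (\<Sum>z\<in>E. tk * (Y1 \<omega> * (?n z \<omega>)\<^sup>2)))"
      using Y0i Wn Yn by (intro Bochner_Integration.integrable_add integrable_mult_right Bochner_Integration.integrable_sum) auto
    have iL: "integrable M (\<lambda>\<omega>. ?I \<omega> * exp (lm * U (Suc k) \<omega>))"
    proof (rule Bochner_Integration.integrable_bound[OF iR])
      show "(\<lambda>\<omega>. ?I \<omega> * exp (lm * U (Suc k) \<omega>)) \<in> borel_measurable M"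
      proof -
        have "(\<lambda>\<omega>. exp (lm * U (Suc k) \<omega>)) \<in> borel_measurable M" using meas_F_M[OF U_measurable[of "Suc k"]] by measurable
        thus ?thesis by (intro borel_measurable_times borel_measurable_indicator AM)
      qed
      show "AE \<omega> in M. norm (?I \<omega> * exp (lm * U (Suc k) \<omega>)) \<le> norm (Y0 \<omega> + lm * tk * (\<Sum>z\<in>E. W z \<omega> * ?n z \<omega>) + (\<Sum>z\<in>E. tk * (Y1 \<omega> * (?n z \<omega>)\<^sup>2)))"
      proof (rule AE_I2)
        fix \<omega>
        have "norm (?I \<omega> * exp (lm * U (Suc k) \<omega>)) = ?I \<omega> * exp (lm * U (Suc k) \<omega>)" by simp
        also note pathwise[of \<omega>]
        finally show "norm (?I \<omega> * exp (lm * U (Suc k) \<omega>)) \<le> norm (Y0 \<omega> + lm * tk * (\<Sum>z\<in>E. W z \<omega> * ?n z \<omega>) + (\<Sum>z\<in>E. tk * (Y1 \<omega> * (?n z \<omega>)\<^sup>2)))"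
          unfolding real_norm_def by (rule order_trans[OF _ abs_ge_self])
      qed
    qed
    have "(\<integral>\<omega>. ?I \<omega> * exp (lm * U (Suc k) \<omega>) \<partial>M) \<le> (\<integral>\<omega>. Y0 \<omega> + lm * tk * (\<Sum>z\<in>E. W z \<omega> * ?n z \<omega>) + (\<Sum>z\<in>E. tk * (Y1 \<omega> * (?n z \<omega>)\<^sup>2)) \<partial>M)"
      by (rule integral_mono[OF iL iR pathwise])
    also have "\<dots> = (\<integral>\<omega>. Y0 \<omega> \<partial>M) + lm * tk * (\<Sum>z\<in>E. (\<integral>\<omega>. W z \<omega> * ?n z \<omega> \<partial>M)) + (\<Sum>z\<in>E. tk * (\<integral>\<omega>. Y1 \<omega> * (?n z \<omega>)\<^sup>2 \<partial>M))"
    proof -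
      have j1: "integrable M (\<lambda>\<omega>. \<Sum>z\<in>E. W z \<omega> * ?n z \<omega>)" using Wn by (intro Bochner_Integration.integrable_sum) auto
      have j2: "integrable M (\<lambda>\<omega>. \<Sum>z\<in>E. tk * (Y1 \<omega> * (?n z \<omega>)\<^sup>2))" using Yn by (intro Bochner_Integration.integrable_sum integrable_mult_right) auto
      have k1: "(\<integral>\<omega>. (\<Sum>z\<in>E. W z \<omega> * ?n z \<omega>) \<partial>M) = (\<Sum>z\<in>E. (\<integral>\<omega>. W z \<omega> * ?n z \<omega> \<partial>M))"
        using Wn by (intro Bochner_Integration.integral_sum) auto
      have "(\<integral>\<omega>. (\<Sum>z\<in>E. tk * (Y1 \<omega> * (?n z \<omega>)\<^sup>2)) \<partial>M) = (\<Sum>z\<in>E. (\<integral>\<omega>. tk * (Y1 \<omega> * (?n z \<omega>)\<^sup>2) \<partial>M))"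
        using Yn by (intro Bochner_Integration.integral_sum) auto
      hence k2: "(\<integral>\<omega>. (\<Sum>z\<in>E. tk * (Y1 \<omega> * (?n z \<omega>)\<^sup>2)) \<partial>M) = (\<Sum>z\<in>E. tk * (\<integral>\<omega>. Y1 \<omega> * (?n z \<omega>)\<^sup>2 \<partial>M))"
        by (simp only: integral_mult_right_zero)
      show ?thesis
        unfolding Bochner_Integration.integral_add[OF Bochner_Integration.integrable_add[OF Y0i integrable_mult_right[OF j1]] j2]
          Bochner_Integration.integral_add[OF Y0i integrable_mult_right[OF j1]] integral_mult_right_zero k1 k2 ..
    qed
    also have "(\<Sum>z\<in>E. (\<integral>\<omega>. W z \<omega> * ?n z \<omega> \<partial>M)) = 0" using Wn by (intro sum.neutral) auto
    also have "(\<Sum>z\<in>E. tk * (\<integral>\<omega>. Y1 \<omega> * (?n z \<omega>)\<^sup>2 \<partial>M)) \<le> (\<Sum>z\<in>E. (A1 z)\<^sup>2 * exp (X / b (fst z) (snd z)) / T * (\<integral>\<omega>. Y1 \<omega> \<partial>M))"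
    proof (rule sum_mono)
      fix z assume z: "z \<in> E"
      have "\<bar>xx k \<omega> i\<bar> \<le> X" if "Y1 \<omega> \<noteq> 0" "i < N" for \<omega> i
      proof -
        have "\<omega> \<in> A" using that(1) by (rule contrapos_np) (simp add: Y1_def Y0_def)
        thus ?thesis using good_bounds(2)[OF k1 gA] that(2) by blast
      qed
      thus "tk * (\<integral>\<omega>. Y1 \<omega> * (?n z \<omega>)\<^sup>2 \<partial>M) \<le> (A1 z)\<^sup>2 * exp (X / b (fst z) (snd z)) / T * (\<integral>\<omega>. Y1 \<omega> \<partial>M)"
        unfolding tk_def T_def by (intro noise_variance z Y1F Y1i Y10)
    qed
    also have "\<dots> = cn / T * (\<integral>\<omega>. Y1 \<omega> \<partial>M)" unfolding cn_def by (simp add: sum_distrib_right sum_divide_distrib)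
    finally have "(\<integral>\<omega>. ?I \<omega> * exp (lm * U (Suc k) \<omega>) \<partial>M) \<le> (\<integral>\<omega>. Y0 \<omega> \<partial>M) + cn / T * (\<integral>\<omega>. Y1 \<omega> \<partial>M)" by simp
    also have "\<dots> = (\<integral>\<omega>. Y0 \<omega> + cn / T * Y1 \<omega> \<partial>M)" using Y0i Y1i by simp
    also have "\<dots> \<le> (\<integral>\<omega>. exp (C / T) * (?I \<omega> * exp (lm * U k \<omega>)) \<partial>M)"
    proof (rule integral_mono)
      show "integrable M (\<lambda>\<omega>. Y0 \<omega> + cn / T * Y1 \<omega>)" using Y0i Y1i by simp
      have "integrable M (\<lambda>\<omega>. ?I \<omega> * exp (lm * U k \<omega>))"
      proof (rule integrable_const_bound[where B="exp (lm * (real k powr (2 * kap) * K))"])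
        show "AE \<omega> in M. norm (?I \<omega> * exp (lm * U k \<omega>)) \<le> exp (lm * (real k powr (2 * kap) * K))"
        proof (rule AE_I2)
          fix \<omega>
          show "norm (?I \<omega> * exp (lm * U k \<omega>)) \<le> exp (lm * (real k powr (2 * kap) * K))"
          proof (cases "\<omega> \<in> A")
            case True
            have "Psi k (ff s k \<omega>) (ff s k \<omega>) \<le> K" using Psi_le[of k "ff s k \<omega>"] gA[OF True] by (simp add: good_def)
            hence "U k \<omega> \<le> real k powr (2 * kap) * K" unfolding U_def by (intro mult_left_mono) auto
            thus ?thesis using True lm by simp
          qed simp
        qed
        have "(\<lambda>\<omega>. exp (lm * U k \<omega>)) \<in> borel_measurable M" using meas_F_M[OF U_measurable[of k]] by measurable
        thus "(\<lambda>\<omega>. ?I \<omega> * exp (lm * U k \<omega>)) \<in> borel_measurable M"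
          by (intro borel_measurable_times borel_measurable_indicator AM)
      qed
      thus "integrable M (\<lambda>\<omega>. exp (C / T) * (?I \<omega> * exp (lm * U k \<omega>)))" by simp
      fix \<omega>
      show "Y0 \<omega> + cn / T * Y1 \<omega> \<le> exp (C / T) * (?I \<omega> * exp (lm * U k \<omega>))"
      proof (cases "\<omega> \<in> A")
        case True
        have "lm * B \<omega> + cn / T * q \<omega> \<le> C / T + lm * U k \<omega>"
        proof -
          define it where "it = 1 / T"
          have it: "0 < it" "it \<le> 1" using T by (auto simp: it_def)
          \<comment> \<open>By the choice of \<open>lm\<close> the variance term takes at most the
            share \<open>e3 / T\<close> of the contraction.\<close>
          have 1: "cn * it * (8 * lm\<^sup>2 * mE * B \<omega>) \<le> lm * (e3 * it) * B \<omega>"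
          proof -
            have "(8 * lm * mE * cn) * (lm * it * B \<omega>) \<le> e3 * (lm * it * B \<omega>)"
              using lm it B0[of \<omega>] by (intro mult_right_mono) auto
            thus ?thesis by (simp add: power2_eq_square mult_ac)
          qed
          \<comment> \<open>Multiplying by \<open>1 + e3 / T\<close> undoes the contraction, as
            \<open>(1 - x) * (1 + x) \<le> 1\<close>, and leaves \<open>e3 / T * B\<close> on the
            left side to pay for the variance.\<close>
          have "B \<omega> * (1 + e3 * it) \<le> ((1 - e3 * it) * U k \<omega> + Cd * it) * (1 + e3 * it)"
            using BU[OF True] e3 it unfolding it_def by (intro mult_right_mono) auto
          also have "\<dots> = U k \<omega> - (e3 * it)\<^sup>2 * U k \<omega> + Cd * it * (1 + e3 * it)" by (simp add: algebra_simps power2_eq_square)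
          also have "\<dots> \<le> U k \<omega> + Cd * it * (1 + e3)"
          proof -
            have "0 \<le> (e3 * it)\<^sup>2 * U k \<omega>" using U0 by simp
            moreover have "Cd * it * (1 + e3 * it) \<le> Cd * it * (1 + e3)"
              using Cd it e3 by (intro mult_left_mono) auto
            ultimately show ?thesis by linarith
          qed
          finally have "lm * (B \<omega> * (1 + e3 * it)) \<le> lm * (U k \<omega> + Cd * it * (1 + e3))" using lm by (intro mult_left_mono) auto
          hence 2: "lm * B \<omega> + lm * (e3 * it) * B \<omega> \<le> lm * U k \<omega> + lm * Cd * (1 + e3) * it"
            by (simp add: algebra_simps)
          have "lm * B \<omega> + cn * it * q \<omega> = lm * B \<omega> + cn * it * (8 * lm\<^sup>2 * mE * B \<omega>) + cn * C0 * it"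
            unfolding q_def by (simp add: algebra_simps)
          hence "lm * B \<omega> + cn * it * q \<omega> \<le> C * it + lm * U k \<omega>" using 1 2 unfolding C_def by (simp add: distrib_right)
          thus ?thesis unfolding it_def by simp
        qed
        hence le: "exp (lm * B \<omega>) * exp (cn / T * q \<omega>) \<le> exp (C / T) * exp (lm * U k \<omega>)"
          unfolding exp_add[symmetric] by simp
        have "Y0 \<omega> + cn / T * Y1 \<omega> = exp (lm * B \<omega>) * (1 + cn / T * q \<omega>)"
          using True by (simp add: Y0_def Y1_def algebra_simps)
        also have "\<dots> \<le> exp (lm * B \<omega>) * exp (cn / T * q \<omega>)" by (intro mult_left_mono exp_ge_add_one_self) simp
        finally show ?thesis using le True by simp
      qed (simp add: Y0_def Y1_def)
    qed
    finally show "integrable M (\<lambda>\<omega>. ?I \<omega> * exp (lm * U (Suc k) \<omega>)) \<and>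
      (\<integral>\<omega>. ?I \<omega> * exp (lm * U (Suc k) \<omega>) \<partial>M) \<le> exp (C / real (Suc k)) * (\<integral>\<omega>. ?I \<omega> * exp (lm * U k \<omega>) \<partial>M)"
      using iL unfolding T_def by simp
  qed
qed

end

section \<open>Iteration of the moment bound\<close>

context sc_drift begin

text \<open>Each application of \<open>exp_step\<close> multiplies the moment by
  \<open>exp (C / t)\<close>, in total at most a power of \<open>k\<close>;
  \<open>exp_moment_imp_log_bound\<close> then bounds \<open>U\<close> by a multiple of
  \<open>ln k\<close>. The filtered noise is added back at the end, its decay \<open>s\<close> being
  at least \<open>kap\<close>.\<close>

lemma rate_log:
  "AE \<omega> in M. (\<forall>k\<ge>k1. good k \<omega>) \<longrightarrow>
     (\<exists>C>0. \<forall>k\<ge>2. ip N n (er k \<omega>) (er k \<omega>) \<le> C * (ln (real k) * real k powr - (2 * kap)))"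
proof (rule exp_step)
  fix lm k0 C
  assume lm: "0 < lm" and k0: "1 \<le> k0" and C: "0 \<le> C" and low: "\<And>k v. k0 \<le> k \<Longrightarrow> ip N n v v / 2 \<le> Psi k v v"
    and step: "\<And>k A. k0 \<le> k \<Longrightarrow> A \<in> sets (F k) \<Longrightarrow> (\<And>\<omega>. \<omega> \<in> A \<Longrightarrow> good k \<omega>) \<Longrightarrow>
      integrable M (\<lambda>\<omega>. indicator A \<omega> * exp (lm * U (Suc k) \<omega>)) \<and>
      (\<integral>\<omega>. indicator A \<omega> * exp (lm * U (Suc k) \<omega>) \<partial>M)
        \<le> exp (C / real (Suc k)) * (\<integral>\<omega>. indicator A \<omega> * exp (lm * U k \<omega>) \<partial>M)"
  define q0 where "q0 = max k0 k1"
  have q0: "k0 \<le> q0" "k1 \<le> q0" "1 \<le> q0" using k0 by (auto simp: q0_def)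
  \<comment> \<open>Good at all times from \<open>q0\<close> up to \<open>k\<close>. The events
    decrease, so the moment at the next time may be taken over the event of the previous one, which
    belongs to the past.\<close>
  define G where "G k = (\<Inter>t\<in>{..k}. if q0 \<le> t then {\<omega> \<in> space M. good t \<omega>} else space M)" for k
  have GF: "G k \<in> sets (F k)" for k
    unfolding G_def
  proof (rule sets.finite_INT)
    fix t assume "t \<in> {..k}"
    hence "{\<omega> \<in> space M. good t \<omega>} \<in> sets (F k)" using good_sets[of t] sets_F_mono[of t k] by auto
    moreover have "space M \<in> sets (F k)" using sets.top[of "F k"] by (simp add: space_F)
    ultimately show "(if q0 \<le> t then {\<omega> \<in> space M. good t \<omega>} else space M) \<in> sets (F k)" by simp
  qed auto
  have GM: "G k \<in> sets M" for k using GF sets_F_sub by blast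
  have Ggood: "good k \<omega>" if "q0 \<le> k" "\<omega> \<in> G k" for k \<omega>
  proof -
    have "\<omega> \<in> (if q0 \<le> k then {\<omega> \<in> space M. good k \<omega>} else space M)" using that(2) unfolding G_def by blast
    thus ?thesis using that(1) by simp
  qed
  have Gdec: "G (Suc k) \<subseteq> G k" for k unfolding G_def by (intro INT_anti_mono) auto
  have UM: "U k \<in> borel_measurable M" for k by (rule meas_F_M[OF U_measurable])
  define mm where "mm k = (\<integral>\<omega>. indicator (G k) \<omega> * exp (lm * U k \<omega>) \<partial>M)" for k
  have Gi: "integrable M (\<lambda>\<omega>. indicator (G k) \<omega> * exp (lm * U k \<omega>))" if "q0 \<le> k" for k
  proof (rule integrable_const_bound[where B="exp (lm * (real k powr (2 * kap) * K))"])
    show "AE \<omega> in M. norm (indicator (G k) \<omega> * exp (lm * U k \<omega>)) \<le> exp (lm * (real k powr (2 * kap) * K))"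
    proof (rule AE_I2)
      fix \<omega>
      show "norm (indicator (G k) \<omega> * exp (lm * U k \<omega>)) \<le> exp (lm * (real k powr (2 * kap) * K))"
      proof (cases "\<omega> \<in> G k")
        case True
        have "Psi k (ff s k \<omega>) (ff s k \<omega>) \<le> K" using Psi_le[of k "ff s k \<omega>"] Ggood[OF that True] by (simp add: good_def)
        hence "U k \<omega> \<le> real k powr (2 * kap) * K" unfolding U_def by (intro mult_left_mono) auto
        thus ?thesis using True lm by simp
      qed simp
    qed
    have "(\<lambda>\<omega>. exp (lm * U k \<omega>)) \<in> borel_measurable M" using UM[of k] by measurable
    thus "(\<lambda>\<omega>. indicator (G k) \<omega> * exp (lm * U k \<omega>)) \<in> borel_measurable M"
      by (intro borel_measurable_times borel_measurable_indicator GM)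
  qed
  have mm0: "0 \<le> mm k" for k unfolding mm_def by (intro integral_nonneg_AE AE_I2) simp
  have mstep: "mm (Suc k) \<le> exp (C / real (Suc k)) * mm k" if k: "q0 \<le> k" for k
  proof -
    have st: "integrable M (\<lambda>\<omega>. indicator (G k) \<omega> * exp (lm * U (Suc k) \<omega>)) \<and>
      (\<integral>\<omega>. indicator (G k) \<omega> * exp (lm * U (Suc k) \<omega>) \<partial>M) \<le> exp (C / real (Suc k)) * mm k"
      unfolding mm_def using k q0 by (intro step GF Ggood) auto
    have "mm (Suc k) \<le> (\<integral>\<omega>. indicator (G k) \<omega> * exp (lm * U (Suc k) \<omega>) \<partial>M)"
      unfolding mm_def
    proof (rule integral_mono)
      show "integrable M (\<lambda>\<omega>. indicator (G (Suc k)) \<omega> * exp (lm * U (Suc k) \<omega>))" using k by (intro Gi) auto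
      show "indicator (G (Suc k)) \<omega> * exp (lm * U (Suc k) \<omega>) \<le> indicator (G k) \<omega> * exp (lm * U (Suc k) \<omega>)" for \<omega>
        using Gdec[of k] by (intro mult_right_mono) (auto simp: indicator_def)
    qed (use st in blast)
    with st show ?thesis by linarith
  qed
  have mbound: "mm k \<le> mm q0 * real k powr C" if "q0 \<le> k" for k
    using that
  proof (induction k rule: dec_induct)
    case base
    have "1 powr C \<le> real q0 powr C" using q0 C by (intro powr_mono2) auto
    from mult_left_mono[OF this mm0[of q0]] show ?case by simp
  next
    case (step k)
    have kp: "0 < real k" using step q0 by simp
    have "exp (C / real (Suc k)) * real k powr C \<le> real (Suc k) powr C"
    proof -
      \<comment> \<open>This is \<open>1 / (k + 1) \<le> ln ((k + 1) / k)\<close>, which makes the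
        factors telescope into a power.\<close>
      have "ln (real k / real (Suc k)) \<le> real k / real (Suc k) - 1" using kp by (intro ln_le_minus_one) auto
      hence "1 / real (Suc k) + ln (real k) \<le> ln (real (Suc k))"
        using kp by (simp add: ln_div field_simps)
      hence "C * (1 / real (Suc k) + ln (real k)) \<le> C * ln (real (Suc k))" using C by (rule mult_left_mono)
      thus ?thesis using kp by (simp add: powr_def exp_add[symmetric] distrib_left)
    qed
    hence "mm q0 * (exp (C / real (Suc k)) * real k powr C) \<le> mm q0 * real (Suc k) powr C" by (rule mult_left_mono[OF _ mm0])
    moreover have "exp (C / real (Suc k)) * mm k \<le> exp (C / real (Suc k)) * (mm q0 * real k powr C)"
      using step.IH by (intro mult_left_mono) auto
    moreover have "exp (C / real (Suc k)) * (mm q0 * real k powr C) = mm q0 * (exp (C / real (Suc k)) * real k powr C)"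
      by (simp only: mult_ac)
    moreover have "mm (Suc k) \<le> exp (C / real (Suc k)) * mm k" using mstep[of k] step by auto
    ultimately show ?case by linarith
  qed
  have "AE \<omega> in M. (\<forall>k\<ge>q0. \<omega> \<in> G k) \<longrightarrow> (\<exists>C>0. \<forall>k\<ge>2. lm * U k \<omega> \<le> C * ln (real k))"
  proof (rule exp_moment_imp_log_bound[where K="mm q0" and q=C])
    show "(\<lambda>\<omega>. lm * U k \<omega>) \<in> borel_measurable M" for k using UM[of k] by measurable
    show "(\<integral>\<omega>. indicator (G k) \<omega> * exp (lm * U k \<omega>) \<partial>M) \<le> mm q0 * real k powr C" if "q0 \<le> k" for k
      using mbound[OF that] by (simp only: mm_def)
  qed (use GM Gi in auto)
  thus ?thesis
  proof (rule AE_mp, intro AE_I2 impI)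
    fix \<omega> assume w: "\<omega> \<in> space M" and imp: "(\<forall>k\<ge>q0. \<omega> \<in> G k) \<longrightarrow> (\<exists>C>0. \<forall>k\<ge>2. lm * U k \<omega> \<le> C * ln (real k))"
      and gd: "\<forall>k\<ge>k1. good k \<omega>"
    have "\<omega> \<in> G k" for k unfolding G_def using w gd q0 by auto
    then obtain C' where C': "0 < C'" "\<And>k. 2 \<le> k \<Longrightarrow> lm * U k \<omega> \<le> C' * ln (real k)" using imp by blast
    \<comment> \<open>The 4 is a factor 2 for the sum \<open>er = ff + eta\<close> times a factor 2
      from \<open>ip / 2 \<le> Psi\<close>; the filtered noise is compared with
      \<open>ln k \<ge> ln 2\<close>.\<close>
    define Ca where "Ca = 4 * C' / lm + 2 * K / ln 2"
    have Ca: "0 < Ca" unfolding Ca_def using C' lm K_nonneg by (intro add_pos_nonneg) auto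
    define e where "e k = ip N n (er k \<omega>) (er k \<omega>)" for k
    define r where "r k = ln (real k) * real k powr - (2 * kap)" for k
    have r0: "0 < r k" if "2 \<le> k" for k unfolding r_def using that by simp
    have big: "e k \<le> Ca * r k" if k: "q0 \<le> k" "2 \<le> k" for k
    proof -
      have g: "good k \<omega>" using gd k q0 by auto
      have kp: "0 < real k" using k by simp
      define t where "t = real k powr - (2 * kap)"
      have t: "0 < t" "t * real k powr (2 * kap) = 1" using kp by (auto simp: t_def powr_add[symmetric])
      have ln2: "ln 2 \<le> ln (real k)" using k by simp
      have "ip N n (ff s k \<omega>) (ff s k \<omega>) \<le> 2 * Psi k (ff s k \<omega>) (ff s k \<omega>)" using low[of k "ff s k \<omega>"] k q0 by simp
      also have "\<dots> = 2 * (t * U k \<omega>)" unfolding U_def using t(2) by (simp add: mult.assoc[symmetric])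
      also have "\<dots> \<le> 2 * (t * (C' / lm * ln (real k)))"
        using C'(2)[OF k(2)] lm t by (intro mult_left_mono) (auto simp: field_simps)
      finally have f: "ip N n (ff s k \<omega>) (ff s k \<omega>) \<le> 2 * C' / lm * (ln (real k) * t)" by (simp add: mult_ac)
      have "ip N n (eta s k \<omega>) (eta s k \<omega>) \<le> K * real k powr - (2 * s)" using g by (simp add: good_def)
      also have "\<dots> \<le> K * t" unfolding t_def using K_nonneg k s by (intro mult_left_mono powr_mono) auto
      also have "\<dots> \<le> K * (ln (real k) / ln 2 * t)"
      proof (rule mult_left_mono[OF _ K_nonneg])
        have "1 \<le> ln (real k) / ln 2" using ln2 by (simp add: divide_simps)
        from mult_right_mono[OF this, of t] t show "t \<le> ln (real k) / ln 2 * t" by simp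
      qed
      finally have h: "ip N n (eta s k \<omega>) (eta s k \<omega>) \<le> K / ln 2 * (ln (real k) * t)" by simp
      have "e k = ip N n (\<lambda>i c. ff s k \<omega> i c + eta s k \<omega> i c) (\<lambda>i c. ff s k \<omega> i c + eta s k \<omega> i c)"
        unfolding e_def by (simp add: ff_def)
      also have "\<dots> \<le> 2 * ip N n (ff s k \<omega>) (ff s k \<omega>) + 2 * ip N n (eta s k \<omega>) (eta s k \<omega>)" by (rule ip_add_le)
      also have "\<dots> \<le> 2 * (2 * C' / lm * (ln (real k) * t)) + 2 * (K / ln 2 * (ln (real k) * t))" using f h by linarith
      also have "\<dots> = Ca * r k" unfolding Ca_def r_def t_def[symmetric] by (simp add: algebra_simps)
      finally show ?thesis .
    qed
    define Cb where "Cb = Ca + (\<Sum>k\<in>{2..q0}. e k / r k)"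
    have sum0: "0 \<le> (\<Sum>k\<in>{2..q0}. e k / r k)"
      using r0 by (intro sum_nonneg divide_nonneg_pos) (auto simp: e_def ip_nonneg)
    have "e k \<le> Cb * r k" if k: "2 \<le> k" for k
    proof (cases "q0 \<le> k")
      case True
      have "Ca * r k \<le> Cb * r k" unfolding Cb_def using sum0 r0[OF k] by (intro mult_right_mono) auto
      thus ?thesis using big[OF True k] by linarith
    next
      case False
      have "e k / r k \<le> (\<Sum>k\<in>{2..q0}. e k / r k)"
        using False k r0 by (intro member_le_sum) (auto simp: e_def intro!: divide_nonneg_pos ip_nonneg)
      also have "\<dots> \<le> Cb" unfolding Cb_def using Ca by simp
      finally show ?thesis using r0[OF k] by (simp add: divide_le_eq)
    qed
    moreover have "0 < Cb" unfolding Cb_def using Ca sum0 by simp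
    ultimately show "\<exists>C>0. \<forall>k\<ge>2. ip N n (er k \<omega>) (er k \<omega>) \<le> C * (ln (real k) * real k powr - (2 * kap))"
      unfolding e_def r_def by blast
  qed
qed

end

section \<open>Convergence rate\<close>

text \<open>Taken directly from the variational eigenpair. It serves the case in which the gain does
  not involve \<open>lambda2\<close>, so that positivity of \<open>lambda2\<close> cannot be read
  off from the gain hypothesis.\<close>

lemma connected_poincare:
  assumes sym: "\<And>i j. a i j = a j i" and nonneg: "\<And>i j. 0 \<le> a i j"
    and conn: "graph_connected N a" and N: "2 \<le> N"
  shows "\<exists>lam>0. \<forall>x :: nat \<Rightarrow> real. 2 * lam * (\<Sum>i<N. (x i - (\<Sum>i<N. x i) / real N)\<^sup>2)
        \<le> (\<Sum>(i, j)\<in>edges N a. a i j * (x i - x j)\<^sup>2)"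
proof -
  obtain v mu where v: "\<And>i. i < N \<Longrightarrow> lap_op N a v i = mu * v i" "(\<Sum>i<N. (v i)\<^sup>2) = 1" "(\<Sum>i<N. v i) = 0"
    and le: "\<And>x. (\<Sum>i<N. x i) = 0 \<Longrightarrow> mu * (\<Sum>i<N. (x i)\<^sup>2) \<le> lap_form N a x x"
    by (rule lap_min_eigenvector[of a N, OF sym nonneg N]) (rule that)
  have "lap_form N a v v = (\<Sum>i<N. mu * (v i)\<^sup>2)"
    unfolding lap_form_def[of a N, OF sym nonneg] using v(1) by (intro sum.cong) (auto simp: power2_eq_square)
  hence mu: "lap_form N a v v = mu" using v(2) by (simp add: sum_distrib_left[symmetric])
  have "mu \<noteq> 0"
  proof
    assume "mu = 0"
    hence z: "lap_form N a v v = 0" using mu by simp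
    have c: "v i = v 0" if "i < N" for i
      by (rule lap_form_zero_const[of a N, OF sym nonneg conn z that]) (use N in simp)
    have "(\<Sum>i<N. v i) = (\<Sum>i<N. v 0)" by (intro sum.cong refl c) simp
    hence v0: "v 0 = 0" using v(3) N by simp
    have "v i = 0" if "i < N" for i using c[OF that] unfolding v0 .
    hence "(\<Sum>i<N. (v i)\<^sup>2) = 0" by simp
    thus False using v(2) by simp
  qed
  moreover have "0 \<le> mu" using lap_form_nonneg[of a N, OF sym nonneg, of v] unfolding mu .
  ultimately have pos: "0 < mu" by simp
  have P: "2 * mu * (\<Sum>i<N. (x i - (\<Sum>i<N. x i) / real N)\<^sup>2) \<le> (\<Sum>(i, j)\<in>edges N a. a i j * (x i - x j)\<^sup>2)" for x :: "nat \<Rightarrow> real"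
  proof -
    define y where "y i = x i - (\<Sum>i<N. x i) / real N" for i
    have "(\<Sum>i<N. y i) = 0" using N by (simp add: y_def sum_subtractf)
    from le[OF this] have "2 * mu * (\<Sum>i<N. (y i)\<^sup>2) \<le> 2 * lap_form N a y y" by simp
    also have "\<dots> = (\<Sum>i<N. \<Sum>j<N. a i j * ((y i - y j) * (y i - y j)))"
      by (rule lap_form_eq[of a N, OF sym nonneg])
    also have "\<dots> = (\<Sum>(i, j)\<in>edges N a. a i j * (x i - x j)\<^sup>2)"
      unfolding sum_edges_all[OF nonneg] by (simp add: power2_eq_square y_def)
    finally show ?thesis by (simp add: y_def)
  qed
  show ?thesis by (intro exI[of _ mu] conjI allI pos P)
qed

lemma exp_le_linear:
  fixes y Y :: real
  assumes "0 \<le> y" "y \<le> Y"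
  shows "exp y \<le> 1 + y * exp Y"
proof -
  have "1 - y \<le> exp (- y)" using exp_ge_add_one_self[of "- y"] by simp
  hence "exp y * (1 - y) \<le> exp y * exp (- y)" by (intro mult_left_mono) auto
  hence "exp y \<le> 1 + y * exp y" by (simp add: exp_minus algebra_simps)
  also have "y * exp y \<le> y * exp Y" using assms by (intro mult_left_mono) auto
  finally show ?thesis by simp
qed

context sc_poly begin

text \<open>On an edge with \<open>nu + gamma < 1\<close> the right side decays more slowly than
  \<open>1 / k\<close>, so every \<open>mu\<close> is eventually admissible; only edges with
  equality constrain \<open>mu\<close>. This is why \<open>m'\<close> is a minimum over
  \<open>edges'\<close>.\<close>

lemma mu_eventually:
  assumes mu: "\<And>i j. (i, j) \<in> E \<Longrightarrow> nu i j + gamma i j = 1 \<Longrightarrow> mu \<le> alpha i j 1 * exp (- X / b i j) / b i j"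
  shows "\<exists>k0. \<forall>k\<ge>k0. \<forall>i j. (i, j) \<in> E \<longrightarrow>
      mu / real (Suc k) \<le> alpha i j (Suc k) * (exp (- X / b i j) * real (Suc k) powr - nu i j / b i j)"
proof -
  have "\<forall>\<^sub>F k in sequentially. mu / real (Suc k) \<le>
      alpha (fst z) (snd z) (Suc k) * (exp (- X / b (fst z) (snd z)) * real (Suc k) powr - nu (fst z) (snd z) / b (fst z) (snd z))"
    if z: "z \<in> E" for z
  proof -
    obtain i j where ij: "z = (i, j)" by (cases z)
    have e: "(i, j) \<in> E" using z ij by simp
    define A where "A = alpha i j 1 * exp (- X / b i j) / b i j"
    define q where "q = 1 - gamma i j - nu i j"
    have A: "0 < A" unfolding A_def using b_pos[OF e] alpha_pos[OF e, of 1] by simp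
    have q: "0 \<le> q" using gamma_nu[OF e] by (simp add: q_def)
    have "\<forall>\<^sub>F k in sequentially. mu \<le> A * real (Suc k) powr q"
    proof (cases "q = 0")
      case True
      hence "mu \<le> A" unfolding A_def using mu[OF e] by (simp add: q_def)
      thus ?thesis using True by simp
    next
      case False
      hence q: "0 < q" using q by simp
      have "filterlim (\<lambda>k. real (Suc k) powr q) at_top sequentially" using q by real_asymp
      hence "filterlim (\<lambda>k. A * real (Suc k) powr q) at_top sequentially"
        by (intro filterlim_tendsto_pos_mult_at_top[OF tendsto_const A])
      thus ?thesis by (simp only: filterlim_at_top)
    qed
    thus ?thesis
    proof eventually_elim
      case (elim k)
      define T where "T = real (Suc k)"
      have T: "0 < T" by (simp add: T_def)
      have "alpha i j (Suc k) * (exp (- X / b i j) * T powr - nu i j / b i j) = A * (T powr - gamma i j * T powr - nu i j)"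
        unfolding alpha_poly[OF e, of k] T_def[symmetric] A_def by (simp add: powr_minus divide_inverse)
      also have "T powr - gamma i j * T powr - nu i j = T powr q / T"
        using T unfolding q_def powr_add[symmetric] by (simp add: powr_diff powr_add powr_minus field_simps)
      finally have "alpha i j (Suc k) * (exp (- X / b i j) * T powr - nu i j / b i j) = A * T powr q / T" by simp
      moreover have "mu / T \<le> A * T powr q / T" using elim T unfolding T_def[symmetric] by (intro divide_right_mono) auto
      ultimately show ?case unfolding ij T_def[symmetric] by simp
    qed
  qed
  hence "\<forall>\<^sub>F k in sequentially. \<forall>z\<in>E. mu / real (Suc k) \<le>
      alpha (fst z) (snd z) (Suc k) * (exp (- X / b (fst z) (snd z)) * real (Suc k) powr - nu (fst z) (snd z) / b (fst z) (snd z))"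
    by (intro eventually_ball_finite finite_edges ballI)
  then obtain k0 where k0: "\<And>k z. k0 \<le> k \<Longrightarrow> z \<in> E \<Longrightarrow> mu / real (Suc k) \<le>
      alpha (fst z) (snd z) (Suc k) * (exp (- X / b (fst z) (snd z)) * real (Suc k) powr - nu (fst z) (snd z) / b (fst z) (snd z))"
    unfolding eventually_sequentially by blast
  show ?thesis
  proof (intro exI[of _ k0] allI impI)
    fix k i j assume "k0 \<le> k" "(i, j) \<in> E"
    from k0[OF this] show "mu / real (Suc k) \<le> alpha i j (Suc k) * (exp (- X / b i j) * real (Suc k) powr - nu i j / b i j)"
      by simp
  qed
qed

lemma c0_positive: "0 < mu \<Longrightarrow> 0 < bl \<Longrightarrow> 0 < c0 mu bl"
  unfolding c0_def using N_pos n_pos lam_pos delta_pos Hbar_pos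
  by (intro mult_pos_pos divide_pos_pos add_pos_pos) auto

context
  fixes kap s g0 :: real
  assumes kap_pos: "0 < kap" and g0: "1 / 2 < g0" "g0 \<le> 1"
    and g0_le: "\<And>i j. (i, j) \<in> edges N a \<Longrightarrow> g0 \<le> gamma i j + nu i j"
    and s: "kap \<le> s" "s < 1 / 2"
    and kap_s: "\<And>i j. (i, j) \<in> edges N a \<Longrightarrow> 2 * kap + 1 \<le> gamma i j + nu i j + 2 * s"
    and kap_noise: "\<And>i j. (i, j) \<in> edges N a \<Longrightarrow> 2 * kap + 1 \<le> 2 * gamma i j + nu i j"
    and bd: "AE \<omega> in M. \<exists>C. \<forall>k. V k \<omega> \<le> C"
begin

text \<open>The bound on remainder and filtered noise and the starting time are random, so
  \<open>rate_log\<close> is applied for all pairs of naturals \<open>K\<close> and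
  \<open>k1\<close>, countably many. On almost every path \<open>bd\<close> and
  \<open>eta_AE_bounded\<close> provide a suitable \<open>K\<close>.\<close>

lemma rate_log_local:
  assumes mu: "0 < mu" and bl: "0 < bl" "\<And>i. i < N \<Longrightarrow> bl \<le> beta i 1"
    and mu_le: "\<And>i j. (i, j) \<in> E \<Longrightarrow> nu i j + gamma i j = 1 \<Longrightarrow> mu \<le> alpha i j 1 * exp (- X / b i j) / b i j"
    and k': "0 < k'" "k' \<le> kap" "k' < c0 mu bl"
  shows "AE \<omega> in M. (\<exists>k1. \<forall>k\<ge>k1. \<forall>i<N. \<forall>c<n. \<bar>est k \<omega> i c\<bar> \<le> X) \<longrightarrow>
     (\<exists>C>0. \<forall>k\<ge>2. ip N n (er k \<omega>) (er k \<omega>) \<le> C * (ln (real k) * real k powr - (2 * k')))"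
proof -
  define c where "c = c0 mu bl"
  have c: "0 < c" using c0_positive[OF mu bl(1)] by (simp add: c_def)
  \<comment> \<open>With \<open>ep = (c - k') / D\<close> the losses use up half of the gap
    \<open>c - k'\<close>, so the midpoint \<open>(k' + c) / 2\<close> still qualifies as
    \<open>kap1\<close>.\<close>
  define D where "D = 2 * (2 * c + 1)"
  define ep where "ep = (c - k') / D"
  have D: "0 < D" using c by (simp add: D_def)
  have epm: "ep * D = c - k'" unfolding ep_def using D by simp
  have ep: "0 < ep" "ep < 1" unfolding ep_def using D c k' by (auto simp: c_def[symmetric] divide_less_eq D_def)
  have AEK: "AE \<omega> in M. (\<forall>k\<ge>k1. (\<forall>i<N. \<forall>c<n. \<bar>est k \<omega> i c\<bar> \<le> X) \<and> ip N n (ff s k \<omega>) (ff s k \<omega>) \<le> real K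
     \<and> ip N n (eta s k \<omega>) (eta s k \<omega>) \<le> real K * real k powr - (2 * s)) \<longrightarrow>
     (\<exists>C>0. \<forall>k\<ge>2. ip N n (er k \<omega>) (er k \<omega>) \<le> C * (ln (real k) * real k powr - (2 * k')))" for K k1 :: nat
  proof -
    interpret R: sc_drift M F N n a nu b alpha beta m H theta th0 w d Hbar Kw p delta gamma lam
      mu bl ep X "real K" k' "(k' + c) / 2" s g0
    proof (unfold_locales)
      show "2 * ((k' + c) / 2) < 2 * (1 - ep) * c0 mu bl - ep"
        proof -
        have "2 * (2 * (1 - ep) * c - ep) = 4 * c - ep * D" by (simp add: algebra_simps D_def)
        moreover have "2 * (k' + c) < 4 * c - ep * D" using k'(3) unfolding epm c_def[symmetric] by (simp add: algebra_simps)
        ultimately have "2 * (k' + c) < 2 * (2 * (1 - ep) * c - ep)" by (simp only:)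
        thus ?thesis by (simp add: c_def)
      qed
      show "\<exists>k0. \<forall>k\<ge>k0. \<forall>i j. (i, j) \<in> E \<longrightarrow>
        mu / real (Suc k) \<le> alpha i j (Suc k) * (exp (- X / b i j) * real (Suc k) powr - nu i j / b i j)"
        by (rule mu_eventually[OF mu_le])
      show "k' < (k' + c) / 2" using k' by (simp add: c_def)
      show "2 * k' + 1 \<le> gamma i j + nu i j + 2 * s" if "(i, j) \<in> E" for i j using kap_s[OF that] k' by linarith
      show "2 * k' + 1 \<le> 2 * gamma i j + nu i j" if "(i, j) \<in> E" for i j using kap_noise[OF that] k' by linarith
    qed (use mu bl ep g0 g0_le k' s in auto)
    show ?thesis using R.rate_log[of k1] unfolding R.good_def .
  qed
  have "AE \<omega> in M. \<forall>K k1 :: nat. (\<forall>k\<ge>k1. (\<forall>i<N. \<forall>c<n. \<bar>est k \<omega> i c\<bar> \<le> X) \<and> ip N n (ff s k \<omega>) (ff s k \<omega>) \<le> real K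
     \<and> ip N n (eta s k \<omega>) (eta s k \<omega>) \<le> real K * real k powr - (2 * s)) \<longrightarrow>
     (\<exists>C>0. \<forall>k\<ge>2. ip N n (er k \<omega>) (er k \<omega>) \<le> C * (ln (real k) * real k powr - (2 * k')))"
    unfolding AE_all_countable by (intro allI AEK)
  with bd eta_AE_bounded[OF s(2)] show ?thesis
  proof eventually_elim
    case (elim \<omega>)
    show ?case
    proof
      assume "\<exists>k1. \<forall>k\<ge>k1. \<forall>i<N. \<forall>c<n. \<bar>est k \<omega> i c\<bar> \<le> X"
      then obtain k1 where k1: "\<And>k. k1 \<le> k \<Longrightarrow> \<forall>i<N. \<forall>c<n. \<bar>est k \<omega> i c\<bar> \<le> X" by blast
      obtain CV where CV: "\<And>k. V k \<omega> \<le> CV" using elim(1) by blast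
      obtain Ce where Ce: "0 \<le> Ce" "\<And>k. ip N n (eta s k \<omega>) (eta s k \<omega>) \<le> Ce * real k powr - (2 * s)" using elim(2) by blast
      obtain K :: nat where K: "2 * CV + 2 * Ce \<le> real K" "Ce \<le> real K"
        using real_arch_simple[of "max (2 * CV + 2 * Ce) Ce"] by auto
      have pw: "real k powr - (2 * s) \<le> 1" for k
      proof (cases "k = 0")
        case False
        have "real k powr - (2 * s) \<le> real k powr 0" using False s kap_pos by (intro powr_mono) auto
        thus ?thesis using False by simp
      qed simp
      have "ip N n (eta s k \<omega>) (eta s k \<omega>) \<le> real K * real k powr - (2 * s)" for k
        using Ce(2)[of k] mult_right_mono[OF K(2), of "real k powr - (2 * s)"] by simp
      moreover have "ip N n (ff s k \<omega>) (ff s k \<omega>) \<le> real K" for k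
      proof -
        have "ip N n (ff s k \<omega>) (ff s k \<omega>) = ip N n (\<lambda>i c. er k \<omega> i c + - eta s k \<omega> i c) (\<lambda>i c. er k \<omega> i c + - eta s k \<omega> i c)"
          by (simp add: ff_def ip_def)
        also have "\<dots> \<le> 2 * ip N n (er k \<omega>) (er k \<omega>) + 2 * ip N n (\<lambda>i c. - eta s k \<omega> i c) (\<lambda>i c. - eta s k \<omega> i c)"
          by (rule ip_add_le)
        also have "ip N n (er k \<omega>) (er k \<omega>) = V k \<omega>" by (simp add: ip_eq_sum_sq V_def)
        also have "ip N n (\<lambda>i c. - eta s k \<omega> i c) (\<lambda>i c. - eta s k \<omega> i c) = ip N n (eta s k \<omega>) (eta s k \<omega>)" by (simp add: ip_def)
        finally have "ip N n (ff s k \<omega>) (ff s k \<omega>) \<le> 2 * V k \<omega> + 2 * ip N n (eta s k \<omega>) (eta s k \<omega>)" .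
        thus ?thesis using CV[of k] Ce(2)[of k] mult_left_mono[OF pw[of k] Ce(1)] K(1) by linarith
      qed
      ultimately show "\<exists>C>0. \<forall>k\<ge>2. ip N n (er k \<omega>) (er k \<omega>) \<le> C * (ln (real k) * real k powr - (2 * k'))"
        using elim(3)[rule_format, of k1 K] k1 by simp
    qed
  qed
qed

text \<open>First pass. For each natural bound \<open>R\<close> on the estimates one positive
  \<open>mu\<close> works for all edges, with a gain that may be tiny; any positive exponent already
  yields convergence, and almost every path admits some \<open>R\<close>.\<close>

lemma er_tendsto_zero:
  assumes E0: "E \<noteq> {}"
  shows "AE \<omega> in M. (\<lambda>k. ip N n (er k \<omega>) (er k \<omega>)) \<longlonglongrightarrow> 0"
proof -
  define bl where "bl = Min ((\<lambda>i. beta i 1) ` {..<N})"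
  have bl: "0 < bl" "\<And>i. i < N \<Longrightarrow> bl \<le> beta i 1"
    unfolding bl_def using N_pos beta_pos by (auto simp: Min_gr_iff lessThan_empty_iff)
  have AER: "AE \<omega> in M. (\<exists>k1. \<forall>k\<ge>k1. \<forall>i<N. \<forall>c<n. \<bar>est k \<omega> i c\<bar> \<le> real R) \<longrightarrow> (\<lambda>k. ip N n (er k \<omega>) (er k \<omega>)) \<longlonglongrightarrow> 0" for R :: nat
  proof -
    define mu where "mu = Min ((\<lambda>(i, j). alpha i j 1 * exp (- real R / b i j) / b i j) ` E)"
    have mu: "0 < mu" unfolding mu_def using E0 finite_edges[of N a] alpha_pos b_pos
      by (subst Min_gr_iff) auto
    have mu_le: "mu \<le> alpha i j 1 * exp (- real R / b i j) / b i j" if "(i, j) \<in> E" for i j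
      unfolding mu_def using that finite_edges[of N a] by (intro Min_le) (auto intro!: image_eqI[where x="(i, j)"])
    define k' where "k' = min kap (c0 mu bl / 2)"
    have k': "0 < k'" "k' \<le> kap" "k' < c0 mu bl"
      using c0_positive[OF mu bl(1)] kap_pos by (auto simp: k'_def)
    have "AE \<omega> in M. (\<exists>k1. \<forall>k\<ge>k1. \<forall>i<N. \<forall>c<n. \<bar>est k \<omega> i c\<bar> \<le> real R) \<longrightarrow>
      (\<exists>C>0. \<forall>k\<ge>2. ip N n (er k \<omega>) (er k \<omega>) \<le> C * (ln (real k) * real k powr - (2 * k')))"
      by (rule rate_log_local[OF mu bl mu_le k'])
    thus ?thesis
    proof eventually_elim
      case (elim \<omega>)
      show ?case
      proof
        assume "\<exists>k1. \<forall>k\<ge>k1. \<forall>i<N. \<forall>c<n. \<bar>est k \<omega> i c\<bar> \<le> real R"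
        then obtain C where C: "\<And>k. 2 \<le> k \<Longrightarrow> ip N n (er k \<omega>) (er k \<omega>) \<le> C * (ln (real k) * real k powr - (2 * k'))"
          using elim by blast
        have "(\<lambda>k. ln (real k) * real k powr - (2 * k')) \<longlonglongrightarrow> 0" using k'(1) by real_asymp
        hence lim: "(\<lambda>k. C * (ln (real k) * real k powr - (2 * k'))) \<longlonglongrightarrow> 0" by (rule tendsto_mult_right_zero)
        show "(\<lambda>k. ip N n (er k \<omega>) (er k \<omega>)) \<longlonglongrightarrow> 0"
        proof (rule tendsto_sandwich[OF _ _ tendsto_const lim])
          show "\<forall>\<^sub>F k in sequentially. 0 \<le> ip N n (er k \<omega>) (er k \<omega>)" by (simp add: ip_nonneg)
          show "\<forall>\<^sub>F k in sequentially. ip N n (er k \<omega>) (er k \<omega>) \<le> C * (ln (real k) * real k powr - (2 * k'))"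
            using C by (intro eventually_sequentiallyI[of 2])
        qed
      qed
    qed
  qed
  have "AE \<omega> in M. \<forall>R::nat. (\<exists>k1. \<forall>k\<ge>k1. \<forall>i<N. \<forall>c<n. \<bar>est k \<omega> i c\<bar> \<le> real R) \<longrightarrow> (\<lambda>k. ip N n (er k \<omega>) (er k \<omega>)) \<longlonglongrightarrow> 0"
    unfolding AE_all_countable by (intro allI AER)
  with bd show ?thesis
  proof eventually_elim
    case (elim \<omega>)
    obtain CV where CV: "\<And>k. V k \<omega> \<le> CV" using elim(1) by blast
    obtain R :: nat where R: "sqrt CV + norm1 n theta \<le> real R" using real_arch_simple by blast
    have "\<bar>est k \<omega> i c\<bar> \<le> real R" if "i < N" "c < n" for i c k
    proof -
      have "(er k \<omega> i c)\<^sup>2 \<le> CV" using er_sq_le_V[OF that] CV order_trans by blast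
      hence "\<bar>er k \<omega> i c\<bar> \<le> sqrt CV" using real_le_rsqrt by fastforce
      moreover have "\<bar>theta c\<bar> \<le> norm1 n theta" unfolding norm1_def using that by (intro member_le_sum) auto
      moreover have "est k \<omega> i c = er k \<omega> i c + theta c" by (simp add: er_def)
      ultimately show ?thesis using R by linarith
    qed
    thus ?case using elim(2) by blast
  qed
qed

text \<open>Second pass. By convergence the estimates eventually stay within
  \<open>norm1 n theta + e1\<close>, so the slopes may be bounded there, and the full exponent
  \<open>kap\<close> is allowed as soon as it lies below the corresponding gain.\<close>

lemma er_log_rate:
  assumes E0: "E \<noteq> {}" and e1: "0 < e1"
    and mu: "0 < mu" and bl: "0 < bl" "\<And>i. i < N \<Longrightarrow> bl \<le> beta i 1"
    and mu_le: "\<And>i j. (i, j) \<in> E \<Longrightarrow> nu i j + gamma i j = 1 \<Longrightarrow>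
        mu \<le> alpha i j 1 * exp (- (norm1 n theta + e1) / b i j) / b i j"
    and c: "kap < c0 mu bl"
  shows "AE \<omega> in M. \<exists>C>0. \<forall>k\<ge>2. ip N n (er k \<omega>) (er k \<omega>) \<le> C * (ln (real k) * real k powr - (2 * kap))"
proof -
  have "AE \<omega> in M. (\<exists>k1. \<forall>k\<ge>k1. \<forall>i<N. \<forall>c<n. \<bar>est k \<omega> i c\<bar> \<le> norm1 n theta + e1) \<longrightarrow>
     (\<exists>C>0. \<forall>k\<ge>2. ip N n (er k \<omega>) (er k \<omega>) \<le> C * (ln (real k) * real k powr - (2 * kap)))"
    by (rule rate_log_local[OF mu bl mu_le kap_pos order_refl c])
  with er_tendsto_zero[OF E0] show ?thesis
  proof eventually_elim
    case (elim \<omega>)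
    have "\<forall>\<^sub>F k in sequentially. ip N n (er k \<omega>) (er k \<omega>) < e1\<^sup>2"
      using elim(1) e1 by (intro order_tendstoD(2)[of _ 0]) auto
    then obtain k1 where k1: "\<And>k. k1 \<le> k \<Longrightarrow> ip N n (er k \<omega>) (er k \<omega>) < e1\<^sup>2" unfolding eventually_sequentially by blast
    have "\<bar>est k \<omega> i c\<bar> \<le> norm1 n theta + e1" if "k1 \<le> k" "i < N" "c < n" for k i c
    proof -
      have "(er k \<omega> i c)\<^sup>2 \<le> e1\<^sup>2" using sq_le_ip[OF that(2,3), of "er k \<omega>"] k1[OF that(1)] by linarith
      hence "\<bar>er k \<omega> i c\<bar> \<le> e1" using e1 by (metis abs_le_square_iff abs_of_pos)
      moreover have "\<bar>theta c\<bar> \<le> norm1 n theta" unfolding norm1_def using that by (intro member_le_sum) auto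
      moreover have "est k \<omega> i c = er k \<omega> i c + theta c" by (simp add: er_def)
      ultimately show ?thesis by linarith
    qed
    thus ?case using elim(2) by blast
  qed
qed

end

end

section \<open>Bit count with the sharp leading constant\<close>

context sc_system begin

text \<open>The sending probability is expanded in the estimation error: order zero sums to the
  leading term, order one to \<open>sqrt (ln k) * k powr (1 - kap - nu)\<close>. The upper bound on
  \<open>kap\<close> says that the fluctuation of the count, of order
  \<open>sqrt (ln k) * k powr (q / 2)\<close> with \<open>q = 1 - nu\<close>, is no larger than
  that.\<close>

lemma refined_rate:
  assumes ij: "(i, j) \<in> E" and nu: "nu i j < 1" and kap: "0 < kap" "kap + nu i j \<le> (1 + nu i j) / 2"
    and bd: "AE \<omega> in M. \<exists>C. \<forall>k. V k \<omega> \<le> C"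
    and er_log: "AE \<omega> in M. \<exists>C>0. \<forall>k\<ge>2. V k \<omega> \<le> C * (ln (real k) * real k powr - (2 * kap))"
  shows "AE \<omega> in M. \<exists>C. \<forall>k\<ge>2. (\<Sum>t<k. bit i j t \<omega>) / real k
     \<le> exp (norm1 n theta / b i j) / ((1 - nu i j) * real k powr nu i j)
       + C * (sqrt (ln (real k)) / real k powr (kap + nu i j))"
proof -
  have i: "i < N" using ij by (simp add: edges_def)
  define q where "q = 1 - nu i j"
  have q: "0 < q" "q \<le> 1" using nu nu_nonneg[of i j] by (auto simp: q_def)
  have kq: "kap + nu i j < 1"   proof -
    have "(1 + nu i j) / 2 < 1" using nu by simp
    thus ?thesis using kap(2) by linarith
  qed
  \<comment> \<open>Balances \<open>sk * k powr q\<close> against \<open>ln k / sk\<close>; the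
    prefactor \<open>sqrt q\<close> keeps the value at most 1.\<close>
  define sk where "sk k = sqrt q * (sqrt (ln (real k)) / real k powr (q / 2))" for k
  have sk: "0 < sk k \<and> sk k \<le> 1" if "2 \<le> k" for k
  proof
    have L: "0 < ln (real k)" using that by simp
    show "0 < sk k" unfolding sk_def using L q that by simp
    have "ln (real k) \<le> real k powr q / q" using that q by (intro ln_powr_bound) auto
    hence "q * ln (real k) \<le> (real k powr (q / 2))\<^sup>2"
      using q that by (simp add: field_simps power2_eq_square powr_add[symmetric])
    hence "sqrt (q * ln (real k)) \<le> real k powr (q / 2)" by (intro real_le_lsqrt) auto
    thus "sk k \<le> 1" unfolding sk_def using that by (simp add: real_sqrt_mult)
  qed
  have "AE \<omega> in M. \<exists>C>0. \<forall>k\<ge>2. (\<Sum>t<k. bit i j t \<omega>) \<le> (1 + sk k) * (\<Sum>t<k. pr i j t \<omega>) + C * (ln (real k) / sk k)"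
    by (rule bits_AE_bound[OF ij sk])
  with bd er_log show ?thesis
  proof eventually_elim
    case (elim \<omega>)
    obtain C0 where C0: "\<And>k. V k \<omega> \<le> C0" using elim(1) by blast
    obtain C1 where C1: "0 < C1" "\<And>k. 2 \<le> k \<Longrightarrow> V k \<omega> \<le> C1 * (ln (real k) * real k powr - (2 * kap))" using elim(2) by blast
    obtain C2 where C2: "0 < C2" "\<And>k. 2 \<le> k \<Longrightarrow> (\<Sum>t<k. bit i j t \<omega>) \<le> (1 + sk k) * (\<Sum>t<k. pr i j t \<omega>) + C2 * (ln (real k) / sk k)"
      using elim(3) by blast
    define e where "e t = sqrt (V t \<omega>)" for t
    define Y where "Y = sqrt C0"
    have V0: "0 \<le> V t \<omega>" for t unfolding V_def by (intro sum_nonneg) auto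
    have e0: "0 \<le> e t" "e t \<le> Y" for t unfolding e_def Y_def using C0 V0 by auto
    have x: "\<bar>xx t \<omega> i\<bar> \<le> norm1 n theta + e t" for t
    proof -
      let ?l = "coord n (Suc t)"
      have "\<bar>er t \<omega> i ?l\<bar> \<le> e t" unfolding e_def using er_sq_le_V[OF i coord_less, of t \<omega> "Suc t"] real_le_rsqrt by fastforce
      moreover have "\<bar>theta ?l\<bar> \<le> norm1 n theta" unfolding norm1_def using coord_less by (intro member_le_sum) auto
      moreover have "xx t \<omega> i = er t \<omega> i ?l + theta ?l" by (simp add: xx_def er_def)
      ultimately show ?thesis by linarith
    qed
    define D where "D = 2 powr kap * (sqrt C1 + Y / sqrt (ln 2))"
    have D0: "0 \<le> D" unfolding D_def using C1 e0[of 0] by (intro mult_nonneg_nonneg add_nonneg_nonneg) auto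
    have eb: "e t \<le> D * sqrt (ln (real k)) * real (Suc t) powr - kap" if k: "2 \<le> k" "t < k" for t k
    proof -
      define L where "L = sqrt (ln (real k))"
      have Lg: "sqrt (ln 2) \<le> L" "0 < L" unfolding L_def using k by auto
      have two: "1 \<le> 2 powr kap * real (Suc t) powr - kap" if "t < 2"
      proof -
        have "real (Suc t) powr kap \<le> 2 powr kap" using that kap by (intro powr_mono2) auto
        thus ?thesis by (simp add: powr_minus divide_simps)
      qed
      show ?thesis
      proof (cases "t < 2")
        case True
        have "e t \<le> Y" by (rule e0)
        also have "Y \<le> Y / sqrt (ln 2) * L" using Lg e0[of 0] mult_left_mono[OF Lg(1), of Y] by (simp add: field_simps)
        also have "\<dots> \<le> (sqrt C1 + Y / sqrt (ln 2)) * L" using C1 Lg by (intro mult_right_mono) auto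
        also have "\<dots> \<le> (sqrt C1 + Y / sqrt (ln 2)) * L * (2 powr kap * real (Suc t) powr - kap)"
        proof -
          have "0 \<le> (sqrt C1 + Y / sqrt (ln 2)) * L" using C1 Lg e0[of 0] by (intro mult_nonneg_nonneg add_nonneg_nonneg) auto
          from mult_left_mono[OF two[OF True] this] show ?thesis by simp
        qed
        finally show ?thesis unfolding D_def L_def by (simp add: mult_ac)
      next
        case False
        hence t: "2 \<le> t" by simp
        have tk: "real t powr - kap \<le> 2 powr kap * real (Suc t) powr - kap"
        proof -
          have "real (Suc t) powr kap \<le> (2 * real t) powr kap" using t kap by (intro powr_mono2) auto
          also have "\<dots> = 2 powr kap * real t powr kap" by (simp add: powr_mult)
          finally show ?thesis using t by (simp add: powr_minus field_simps)
        qed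
        have "e t \<le> sqrt (C1 * (ln (real t) * real t powr - (2 * kap)))" unfolding e_def using C1(2)[OF t] by simp
        also have "\<dots> = sqrt C1 * (sqrt (ln (real t)) * real t powr - kap)"
        proof -
          have "real t powr - (2 * kap) = (real t powr - kap)\<^sup>2" by (simp add: power2_eq_square powr_add[symmetric])
          thus ?thesis by (simp add: real_sqrt_mult)
        qed
        also have "\<dots> \<le> sqrt C1 * (L * (2 powr kap * real (Suc t) powr - kap))"
          unfolding L_def using tk t k C1 by (intro mult_left_mono mult_mono) auto
        also have "\<dots> \<le> (sqrt C1 + Y / sqrt (ln 2)) * (L * (2 powr kap * real (Suc t) powr - kap))"
          using Lg e0[of 0] by (intro mult_right_mono) auto
        finally show ?thesis unfolding D_def L_def by (simp add: mult_ac)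
      qed
    qed
    define En where "En = exp (norm1 n theta / b i j)"
    define B0 where "B0 = En * exp (Y / b i j) / b i j * D"
    have bp: "0 < b i j" by (rule b_pos[OF ij])
    have B0: "0 \<le> B0" unfolding B0_def En_def using bp D0 by simp
    define B1 where "B1 = B0 / (1 - (kap + nu i j))"
    have B1: "0 \<le> B1" unfolding B1_def using B0 kq by simp
    have P: "(\<Sum>t<k. pr i j t \<omega>) \<le> En * (real k powr q / q) + B1 * (sqrt (ln (real k)) * real k powr (1 - (kap + nu i j)))"
      if k: "2 \<le> k" for k
    proof -
      define L where "L = sqrt (ln (real k))"
      have L0: "0 \<le> L" unfolding L_def using k by simp
      have "pr i j t \<omega> \<le> En * real (Suc t) powr - nu i j + B0 * L * real (Suc t) powr - (kap + nu i j)" if t: "t < k" for t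
      proof -
        define T where "T = real (Suc t)"
        have "pr i j t \<omega> \<le> exp ((norm1 n theta + e t) / b i j) * T powr - nu i j"
          unfolding T_def by (rule pr_le[OF ij x])
        also have "exp ((norm1 n theta + e t) / b i j) = En * exp (e t / b i j)"
          by (simp add: En_def add_divide_distrib exp_add)
        \<comment> \<open>\<open>exp_le_linear\<close> with the pathwise bound \<open>Y\<close> on
          the error; only the first-order term then depends on the decay of the error.\<close>
        also have "En * exp (e t / b i j) * T powr - nu i j
            \<le> En * (1 + e t / b i j * exp (Y / b i j)) * T powr - nu i j"
          using e0[of t] bp exp_le_linear[of "e t / b i j" "Y / b i j"]
          by (intro mult_right_mono mult_left_mono) (auto simp: En_def divide_right_mono)
        also have "\<dots> = En * T powr - nu i j + En * exp (Y / b i j) / b i j * e t * T powr - nu i j"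
          by (simp add: algebra_simps)
        also have "En * exp (Y / b i j) / b i j * e t * T powr - nu i j
            \<le> En * exp (Y / b i j) / b i j * (D * L * T powr - kap) * T powr - nu i j"
          unfolding T_def L_def using eb[OF k t] bp by (intro mult_right_mono mult_left_mono) (auto simp: En_def)
        also have "\<dots> = B0 * L * (T powr - kap * T powr - nu i j)" unfolding B0_def by simp
        also have "T powr - kap * T powr - nu i j = T powr - (kap + nu i j)" by (simp add: powr_add[symmetric])
        finally show ?thesis unfolding T_def by simp
      qed
      hence "(\<Sum>t<k. pr i j t \<omega>) \<le> (\<Sum>t<k. En * real (Suc t) powr - nu i j + B0 * L * real (Suc t) powr - (kap + nu i j))"
        by (intro sum_mono) auto
      also have "\<dots> = En * (\<Sum>t<k. real (Suc t) powr - nu i j) + B0 * L * (\<Sum>t<k. real (Suc t) powr - (kap + nu i j))"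
        by (simp only: sum.distrib sum_distrib_left)
      also have "\<dots> \<le> En * (real k powr q / q) + B0 * L * (real k powr (1 - (kap + nu i j)) / (1 - (kap + nu i j)))"
        unfolding q_def
      proof (intro add_mono mult_left_mono sum_powr_le)
        show "0 \<le> B0 * L" using B0 L0 by simp
      qed (use nu nu_nonneg[of i j] kap kq in \<open>auto simp: En_def\<close>)
      finally show ?thesis unfolding B1_def L_def by simp
    qed
    define B where "B = 2 * B1 + sqrt q * En / q + C2 / sqrt q"
    have "(\<Sum>t<k. bit i j t \<omega>) / real k \<le> En / ((1 - nu i j) * real k powr nu i j)
       + B * (sqrt (ln (real k)) / real k powr (kap + nu i j))" if k: "2 \<le> k" for k
    proof -
      define L where "L = sqrt (ln (real k))"
      define Z where "Z = L * real k powr (1 - (kap + nu i j))"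
      have L0: "0 < L" unfolding L_def using k by simp
      have LL: "ln (real k) = L * L" unfolding L_def using k by simp
      have Z0: "0 \<le> Z" unfolding Z_def using L0 by simp
      \<comment> \<open>This amounts to \<open>q / 2 \<le> 1 - (kap + nu)\<close>, the upper bound
        assumed on \<open>kap\<close>.\<close>
      have half: "L * real k powr (q / 2) \<le> Z" unfolding Z_def
        using L0 k kap(2) by (intro mult_left_mono powr_mono) (auto simp: q_def field_simps)
      have s1: "C2 * (ln (real k) / sk k) \<le> C2 / sqrt q * Z"
      proof -
        have "ln (real k) / sk k = (L * real k powr (q / 2)) / sqrt q"
          unfolding sk_def LL L_def[symmetric] using L0 k q by (simp add: field_simps)
        also have "\<dots> \<le> Z / sqrt q" using half q by (intro divide_right_mono) auto
        finally have "C2 * (ln (real k) / sk k) \<le> C2 * (Z / sqrt q)" using C1 C2 by (intro mult_left_mono) auto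
        thus ?thesis by simp
      qed
      have s2: "sk k * (En * (real k powr q / q)) \<le> sqrt q * En / q * Z"
      proof -
        have "real k powr q = real k powr (q / 2) * real k powr (q / 2)" by (simp add: powr_add[symmetric])
        hence "sk k * (En * (real k powr q / q)) = sqrt q * En / q * (L * real k powr (q / 2))"
          unfolding sk_def L_def[symmetric] using k q by (simp add: field_simps)
        also have "\<dots> \<le> sqrt q * En / q * Z" using half q by (intro mult_left_mono) (auto simp: En_def)
        finally show ?thesis .
      qed
      have s3: "sk k * (B1 * Z) \<le> B1 * Z" using sk[OF k] B1 Z0 by (intro mult_left_le_one_le) auto
      have "(\<Sum>t<k. bit i j t \<omega>) \<le> (1 + sk k) * (\<Sum>t<k. pr i j t \<omega>) + C2 * (ln (real k) / sk k)" by (rule C2(2)[OF k])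
      also have "(1 + sk k) * (\<Sum>t<k. pr i j t \<omega>) \<le> (1 + sk k) * (En * (real k powr q / q) + B1 * Z)"
        using P[OF k] sk[OF k] unfolding Z_def L_def by (intro mult_left_mono) auto
      also have "\<dots> = En * (real k powr q / q) + B1 * Z + sk k * (En * (real k powr q / q)) + sk k * (B1 * Z)"
        by (simp only: distrib_left distrib_right mult_1_left add.assoc)
      finally have "(\<Sum>t<k. bit i j t \<omega>) \<le> En * (real k powr q / q) + (B1 * Z + sqrt q * En / q * Z + B1 * Z + C2 / sqrt q * Z)"
        using s1 s2 s3 by linarith
      also have "B1 * Z + sqrt q * En / q * Z + B1 * Z + C2 / sqrt q * Z = B * Z" unfolding B_def by (simp add: algebra_simps)
      finally have "(\<Sum>t<k. bit i j t \<omega>) / real k \<le> (En * (real k powr q / q) + B * Z) / real k"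
        using k by (intro divide_right_mono) auto
      also have "\<dots> = En / q * (real k powr q / real k) + B * (Z / real k)" by (simp add: add_divide_distrib)
      also have "real k powr q / real k = 1 / real k powr nu i j" unfolding q_def using k by (simp add: powr_diff)
      also have "Z / real k = L / real k powr (kap + nu i j)" unfolding Z_def using k by (simp add: powr_diff)
      finally show ?thesis unfolding q_def L_def by simp
    qed
    thus ?case unfolding En_def by blast
  qed
qed

end

context sc_poly begin

text \<open>The exponent is \<open>kap = h - 1/2\<close>. That a filter exponent
  \<open>s < 1/2\<close> meets all constraints rests on \<open>h < 1\<close>, which holds because
  the given edge has \<open>nu > 0\<close>.\<close>

lemma poly_rate:
  assumes ij: "(i0, j0) \<in> E" "0 < nu i0 j0"
    and g1: "\<And>i j. (i, j) \<in> E \<Longrightarrow> gamma i j \<le> 1"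
    and h: "\<And>i j. (i, j) \<in> E \<Longrightarrow> h \<le> nu i j / 2 + gamma i j" "1 / 2 < h"
    and e1: "0 < e1" and mu: "0 < mu" and bl: "0 < bl" "\<And>i. i < N \<Longrightarrow> bl \<le> beta i 1"
    and mu_le: "\<And>i j. (i, j) \<in> E \<Longrightarrow> nu i j + gamma i j = 1 \<Longrightarrow>
        mu \<le> alpha i j 1 * exp (- (norm1 n theta + e1) / b i j) / b i j"
    and c: "h - 1 / 2 < c0 mu bl"
    and bd: "AE \<omega> in M. \<exists>C. \<forall>k. V k \<omega> \<le> C"
  shows "AE \<omega> in M. \<exists>C. \<forall>k\<ge>2. (\<Sum>t<k. bit i0 j0 t \<omega>) / real k
     \<le> exp (norm1 n theta / b i0 j0) / ((1 - nu i0 j0) * real k powr nu i0 j0)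
       + C * (sqrt (ln (real k)) / real k powr (h - 1 / 2 + nu i0 j0))"
proof -
  have E0: "E \<noteq> {}" using ij by auto
  note fin = finite_edges[of N a]
  have h1: "h < 1" using h(1)[OF ij(1)] gamma_nu[OF ij(1)] ij(2) by linarith
  define g0 where "g0 = Min ((\<lambda>(i, j). gamma i j + nu i j) ` E)"
  have g0_le: "g0 \<le> gamma i j + nu i j" if "(i, j) \<in> E" for i j
    unfolding g0_def using that fin by (intro Min_le) (auto intro!: image_eqI[where x="(i, j)"])
  have g0: "1 / 2 < g0" "g0 \<le> 1"
  proof -
    show "1 / 2 < g0" unfolding g0_def
    proof (subst Min_gr_iff)
      show "\<forall>x\<in>(\<lambda>(i, j). gamma i j + nu i j) ` E. 1 / 2 < x"
      proof (safe)
        fix i j assume "(i, j) \<in> E"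
        thus "1 / 2 < gamma i j + nu i j" using gamma_gt[of i j] nu_nonneg[of i j] by simp
      qed
    qed (use fin E0 in auto)
    show "g0 \<le> 1" using g0_le[OF ij(1)] gamma_nu[OF ij(1)] by linarith
  qed
  \<comment> \<open>The smallest exponent that satisfies both \<open>kap \<le> s\<close> and
    \<open>kap_s\<close>.\<close>
  define s where "s = Max (insert (h - 1 / 2) ((\<lambda>(i, j). (2 * h - gamma i j - nu i j) / 2) ` E))"
  have s_ge: "h - 1 / 2 \<le> s" unfolding s_def using fin by (intro Max_ge) auto
  have s_ge': "(2 * h - gamma i j - nu i j) / 2 \<le> s" if "(i, j) \<in> E" for i j
    unfolding s_def using that fin by (intro Max_ge) (auto intro!: image_eqI[where x="(i, j)"])
  have s_lt: "s < 1 / 2" unfolding s_def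
  proof (subst Max_less_iff)
    show "\<forall>x\<in>insert (h - 1 / 2) ((\<lambda>(i, j). (2 * h - gamma i j - nu i j) / 2) ` E). x < 1 / 2"
    proof (safe)
      show "h - 1 / 2 < 1 / 2" using h1 by simp
      fix i j assume e: "(i, j) \<in> E"
      \<comment> \<open>For \<open>gamma = 1\<close> the bound \<open>h < 1\<close> decides; for
        \<open>gamma < 1\<close> the definition of \<open>h\<close> gives
        \<open>2 * h - gamma - nu \<le> gamma\<close>.\<close>
      show "(2 * h - gamma i j - nu i j) / 2 < 1 / 2"
      proof (cases "gamma i j = 1")
        case True
        thus ?thesis using h1 nu_nonneg[of i j] by simp
      next
        case False
        hence "gamma i j < 1" using g1[OF e] by simp
        thus ?thesis using h(1)[OF e] by simp
      qed
    qed
  qed (use fin in auto)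
  have kap: "0 < h - 1 / 2" using h(2) by simp
  have "AE \<omega> in M. \<exists>C>0. \<forall>k\<ge>2. ip N n (er k \<omega>) (er k \<omega>) \<le> C * (ln (real k) * real k powr - (2 * (h - 1 / 2)))"
  proof (rule er_log_rate[OF kap g0 g0_le s_ge s_lt _ _ bd E0 e1 mu bl mu_le c])
    show "2 * (h - 1 / 2) + 1 \<le> gamma i j + nu i j + 2 * s" if "(i, j) \<in> E" for i j using s_ge'[OF that] by simp
    show "2 * (h - 1 / 2) + 1 \<le> 2 * gamma i j + nu i j" if "(i, j) \<in> E" for i j using h(1)[OF that] by simp
  qed
  hence er_log: "AE \<omega> in M. \<exists>C>0. \<forall>k\<ge>2. V k \<omega> \<le> C * (ln (real k) * real k powr - (2 * (h - 1 / 2)))"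
    by (simp only: ip_eq_sum_sq V_def)
  show ?thesis
  proof (rule refined_rate[OF ij(1) _ kap _ bd er_log])
    show "nu i0 j0 < 1" using gamma_nu[OF ij(1)] gamma_gt[OF ij(1)] by linarith
    show "h - 1 / 2 + nu i0 j0 \<le> (1 + nu i0 j0) / 2" using h(1)[OF ij(1)] gamma_nu[OF ij(1)] by simp
  qed
qed

text \<open>The gain inequality is strict and leaves room. Without critical edges \<open>mu\<close>
  is free, and \<open>c0\<close> tends to \<open>bl * delta / N\<close> as it grows. Otherwise
  \<open>m'\<close> is lowered to \<open>t * m'\<close> with \<open>t < 1\<close>, by continuity of
  \<open>c0\<close>, and the factor \<open>t\<close> is traded for a tolerance \<open>e1\<close> in
  the size of the estimates.\<close>

lemma gain_constants:
  assumes bl: "0 < bl"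
    and a: "if edges' N a nu gamma = {} then q < delta * bl / real N
            else q < c0 (m'_const N n a nu gamma b alpha theta) bl"
  obtains mu e1 where "0 < mu" "0 < e1" "q < c0 mu bl"
    "\<And>i j. (i, j) \<in> E \<Longrightarrow> nu i j + gamma i j = 1 \<Longrightarrow>
        mu \<le> alpha i j 1 * exp (- (norm1 n theta + e1) / b i j) / b i j"
proof (cases "edges' N a nu gamma = {}")
  case True
  have q: "q < bl * delta / real N * 1" using a True by (simp add: mult.commute)
  define B where "B = 2 * Hbar\<^sup>2 * bl"
  define r where "r = lam / real n"
  have B: "0 < B" "0 < r" using Hbar_pos bl lam_pos n_pos by (auto simp: B_def r_def)
  have "((\<lambda>mu. r * mu / (B + r * mu)) \<longlongrightarrow> 1) at_top" using B by real_asymp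
  hence "((\<lambda>mu. bl * delta / real N * (r * mu / (B + r * mu))) \<longlongrightarrow> bl * delta / real N * 1) at_top"
    by (intro tendsto_mult tendsto_const)
  hence "\<forall>\<^sub>F mu in at_top. q < bl * delta / real N * (r * mu / (B + r * mu))" using q by (intro order_tendstoD(1))
  hence "\<forall>\<^sub>F mu in at_top. q < bl * delta / real N * (r * mu / (B + r * mu)) \<and> 0 < mu"
    using eventually_gt_at_top[of 0] by (rule eventually_conj)
  then obtain mu where "q < bl * delta / real N * (r * mu / (B + r * mu))" "0 < mu"
    using eventually_happens[of _ "at_top :: real filter"] by (auto simp: trivial_limit_at_top_linorder)
  moreover from this have "q < c0 mu bl" by (simp add: c0_def B_def r_def)
  moreover have "False" if "(i, j) \<in> E" "nu i j + gamma i j = 1" for i j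
    using that True by (auto simp: edges'_def)
  ultimately show ?thesis using that[of mu 1] by auto
next
  case False
  define m' where "m' = m'_const N n a nu gamma b alpha theta"
  have q: "q < c0 m' bl" using a False by (simp add: m'_def)
  have m'_eq: "m' = Min ((\<lambda>(i, j). alpha i j 1 * exp (- norm1 n theta / b i j) / b i j) ` edges' N a nu gamma)"
    unfolding m'_def m'_const_def by (rule arg_cong[of _ _ Min]) force
  have sub: "edges' N a nu gamma \<subseteq> E" by (auto simp: edges'_def)
  have fin: "finite (edges' N a nu gamma)" using sub finite_edges finite_subset by blast
  have m': "0 < m'" unfolding m'_eq
  proof (subst Min_gr_iff)
    show "\<forall>x\<in>(\<lambda>(i, j). alpha i j 1 * exp (- norm1 n theta / b i j) / b i j) ` edges' N a nu gamma. 0 < x"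
      using sub alpha_pos b_pos by auto
  qed (use fin False in auto)
  have m'_le: "m' \<le> alpha i j 1 * exp (- norm1 n theta / b i j) / b i j" if "(i, j) \<in> edges' N a nu gamma" for i j
    unfolding m'_eq using that fin by (intro Min_le) (auto intro!: image_eqI[where x="(i, j)"])
  have nz: "2 * Hbar\<^sup>2 * bl + lam * (1 * m') / real n \<noteq> 0"
  proof -
    have "0 < 2 * Hbar\<^sup>2 * bl" "0 \<le> lam * (1 * m') / real n" using Hbar_pos bl lam_pos m' by auto
    thus ?thesis by linarith
  qed
  have "((\<lambda>t. c0 (t * m') bl) \<longlongrightarrow> c0 (1 * m') bl) (at_left 1)"
    unfolding c0_def using nz n_pos by (intro tendsto_intros) auto
  hence "\<forall>\<^sub>F t in at_left 1. q < c0 (t * m') bl" using q by (intro order_tendstoD(1)) auto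
  moreover have "\<forall>\<^sub>F t in at_left 1. t \<in> {0<..<1::real}" by (rule eventually_at_left_real) simp
  ultimately have "\<forall>\<^sub>F t in at_left (1::real). q < c0 (t * m') bl \<and> t \<in> {0<..<1}" by (rule eventually_conj)
  then obtain t where t: "q < c0 (t * m') bl" "0 < t" "t < 1"
    using eventually_happens[of _ "at_left (1::real)"] by (auto simp: trivial_limit_at_left_real)
  \<comment> \<open>The largest tolerance with \<open>exp (- e1 / b i j) \<ge> t\<close> on every
    critical edge.\<close>
  define e1 where "e1 = Min ((\<lambda>(i, j). - ln t * b i j) ` edges' N a nu gamma)"
  have e1: "0 < e1" unfolding e1_def
  proof (subst Min_gr_iff)
    show "\<forall>x\<in>(\<lambda>(i, j). - ln t * b i j) ` edges' N a nu gamma. 0 < x"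
      using b_pos[OF subsetD[OF sub]] t by (auto intro!: mult_neg_pos)
  qed (use fin False in auto)
  have e1_le: "e1 \<le> - ln t * b i j" if "(i, j) \<in> edges' N a nu gamma" for i j
    unfolding e1_def using that fin by (intro Min_le) (auto intro!: image_eqI[where x="(i, j)"])
  have "t * m' \<le> alpha i j 1 * exp (- (norm1 n theta + e1) / b i j) / b i j"
    if e: "(i, j) \<in> E" and g: "nu i j + gamma i j = 1" for i j
  proof -
    have e': "(i, j) \<in> edges' N a nu gamma" using e g by (simp add: edges'_def)
    have bp: "0 < b i j" by (rule b_pos[OF e])
    have "ln t \<le> - e1 / b i j" using e1_le[OF e'] bp by (simp add: field_simps)
    hence "t \<le> exp (- e1 / b i j)" using t(2) by (metis exp_le_cancel_iff exp_ln)
    hence "t * m' \<le> exp (- e1 / b i j) * (alpha i j 1 * exp (- norm1 n theta / b i j) / b i j)"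
      using m'_le[OF e'] t m' by (intro mult_mono) auto
    also have "\<dots> = alpha i j 1 * exp (- (norm1 n theta + e1) / b i j) / b i j"
      by (simp add: diff_divide_distrib exp_diff exp_minus field_simps)
    finally show ?thesis .
  qed
  thus ?thesis using that[of "t * m'" e1] t m' e1 by auto
qed

end

section \<open>Truncation of the observation noise\<close>

lemma space_gen_alg [simp]: "space (gen_alg M X) = space M"
  unfolding gen_alg_def by (rule space_measure_of) auto

lemma sets_gen_alg:
  "sets (gen_alg M X) = sigma_sets (space M) (\<Union>f\<in>X. {f -` A \<inter> space M | A. A \<in> sets borel})"
  unfolding gen_alg_def by (rule sets_measure_of) auto

lemma gen_alg_least:
  assumes "space A = space M" "\<And>f. f \<in> X \<Longrightarrow> f \<in> borel_measurable A"
  shows "sets (gen_alg M X) \<subseteq> sets A"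
proof -
  have "(\<Union>f\<in>X. {f -` B \<inter> space M | B. B \<in> sets borel}) \<subseteq> sets A"
    using measurable_sets[OF assms(2)] assms(1) by auto
  from sets.sigma_sets_subset[OF this] show ?thesis unfolding sets_gen_alg assms(1) .
qed

lemma gen_alg_measurable:
  assumes "f \<in> X" shows "f \<in> borel_measurable (gen_alg M X)"
proof (rule measurableI)
  fix A :: "real set" assume "A \<in> sets borel"
  hence "f -` A \<inter> space M \<in> (\<Union>f\<in>X. {f -` A \<inter> space M | A. A \<in> sets borel})" using assms by blast
  thus "f -` A \<inter> space (gen_alg M X) \<in> sets (gen_alg M X)" unfolding sets_gen_alg space_gen_alg by (rule sigma_sets.Basic)
qed simp

lemma gen_alg_mono: "X \<subseteq> Y \<Longrightarrow> sets (gen_alg M X) \<subseteq> sets (gen_alg M Y)"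
  by (intro gen_alg_least gen_alg_measurable) auto

lemma filt_w_le_filt_wd:
  assumes "k \<le> l"
  shows "sets (filt_w M N m w k) \<subseteq> sets (filt_wd M N m w d l)"
  unfolding filt_w_def filt_wd_def
proof (intro gen_alg_mono subsetI UnI1)
  fix f assume "f \<in> {(\<lambda>\<omega>. w i t \<omega> r) | i t r. i < N \<and> 1 \<le> t \<and> t \<le> k \<and> r < m i}"
  then obtain i t r where f: "f = (\<lambda>\<omega>. w i t \<omega> r)" "i < N" "1 \<le> t" "t \<le> k" "r < m i" by blast
  show "f \<in> {(\<lambda>\<omega>. w i t \<omega> r) | i t r. i < N \<and> 1 \<le> t \<and> t \<le> l \<and> r < m i}"
    using f assms by (intro CollectI exI[of _ i] exI[of _ t] exI[of _ r] conjI) simp_all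
qed

lemma measurable_gen_alg_mono:
  assumes "f \<in> borel_measurable A" "space A = space B" "sets A \<subseteq> sets B"
  shows "f \<in> measurable B (borel :: 'b::topological_space measure)"
  using assms by (auto simp: measurable_def)

definition w_pow :: "(nat \<Rightarrow> nat) \<Rightarrow> (nat \<Rightarrow> nat \<Rightarrow> 'a \<Rightarrow> nat \<Rightarrow> real) \<Rightarrow> real \<Rightarrow> nat \<Rightarrow> nat \<Rightarrow> 'a \<Rightarrow> ennreal" where
  "w_pow m w rho i k \<omega> = ennreal (sqrt (\<Sum>r<m i. (w i k \<omega> r)\<^sup>2) powr rho)"

text \<open>The cut-off is predictable, so truncation keeps the martingale difference property while
  making the second moments uniformly bounded.\<close>
definition trunc_w :: "'a measure \<Rightarrow> nat \<Rightarrow> (nat \<Rightarrow> nat) \<Rightarrow> (nat \<Rightarrow> nat \<Rightarrow> 'a \<Rightarrow> nat \<Rightarrow> real) \<Rightarrow> real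
    \<Rightarrow> nat \<Rightarrow> nat \<Rightarrow> nat \<Rightarrow> 'a \<Rightarrow> nat \<Rightarrow> real" where
  "trunc_w M N m w rho R i k \<omega> r =
     (if i < N \<and> 1 \<le> k \<and> \<not> nn_cond_exp M (filt_w M N m w (k - 1)) (w_pow m w rho i k) \<omega> \<le> of_nat R
      then 0 else w i k \<omega> r)"

lemma sq_le_one_plus_powr:
  fixes x rho :: real
  assumes "0 \<le> x" "2 < rho" shows "x\<^sup>2 \<le> 1 + x powr rho"
proof (cases "x \<le> 1")
  case True
  hence "x\<^sup>2 \<le> 1" using assms by (simp add: power_le_one)
  thus ?thesis by (simp add: add_increasing2)
next
  case False
  hence "x powr 2 \<le> x powr rho" using assms by (intro powr_mono) auto
  thus ?thesis using False by simp
qed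

context
  fixes M :: "'a measure" and N :: nat and m :: "nat \<Rightarrow> nat"
    and w :: "nat \<Rightarrow> nat \<Rightarrow> 'a \<Rightarrow> nat \<Rightarrow> real" and d :: "nat \<Rightarrow> nat \<Rightarrow> 'a \<Rightarrow> real" and rho :: real
  assumes P: "prob_space M"
    and wm: "\<And>i k r. i < N \<Longrightarrow> 1 \<le> k \<Longrightarrow> r < m i \<Longrightarrow> (\<lambda>\<omega>. w i k \<omega> r) \<in> borel_measurable M"
    and dm: "\<And>i k. i < N \<Longrightarrow> 1 \<le> k \<Longrightarrow> d i k \<in> borel_measurable M"
begin

interpretation prob_space M by (rule P)

lemma subalgebra_filt_wd: "subalgebra M (filt_wd M N m w d k)"
  unfolding subalgebra_def filt_wd_def
proof
  show "sets (gen_alg M ({(\<lambda>\<omega>. w i t \<omega> r) | i t r. i < N \<and> 1 \<le> t \<and> t \<le> k \<and> r < m i}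
      \<union> {d i t | i t. i < N \<and> 1 \<le> t \<and> t \<le> k})) \<subseteq> sets M"
  proof (rule gen_alg_least[OF refl])
    fix f assume "f \<in> {(\<lambda>\<omega>. w i t \<omega> r) | i t r. i < N \<and> 1 \<le> t \<and> t \<le> k \<and> r < m i} \<union> {d i t | i t. i < N \<and> 1 \<le> t \<and> t \<le> k}"
    thus "f \<in> borel_measurable M"
    proof
      assume "f \<in> {(\<lambda>\<omega>. w i t \<omega> r) | i t r. i < N \<and> 1 \<le> t \<and> t \<le> k \<and> r < m i}"
      then obtain i t r where f: "f = (\<lambda>\<omega>. w i t \<omega> r)" "i < N" "1 \<le> t" "r < m i" by blast
      show ?thesis unfolding f(1) by (rule wm[OF f(2-4)])
    next
      assume "f \<in> {d i t | i t. i < N \<and> 1 \<le> t \<and> t \<le> k}"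
      then obtain i t where f: "f = d i t" "i < N" "1 \<le> t" by blast
      show ?thesis unfolding f(1) by (rule dm[OF f(2-3)])
    qed
  qed
qed simp

lemma subalgebra_filt_w: "subalgebra M (filt_w M N m w k)"
proof -
  have "sets (filt_w M N m w k) \<subseteq> sets M"
    using filt_w_le_filt_wd[OF order_refl, of M N m w k d] subalgebra_filt_wd[of k] by (auto simp: subalgebra_def)
  thus ?thesis by (simp add: subalgebra_def filt_w_def)
qed

lemma sigma_finite_subalgebraI: "subalgebra M G \<Longrightarrow> sigma_finite_subalgebra M G"
  by (rule finite_measure_subalgebra_is_sigma_finite)
    (simp add: finite_measure_subalgebra_def finite_measure_subalgebra_axioms_def finite_measure_axioms)

lemma filt_wd_mono: "sets (filt_wd M N m w d k) \<subseteq> sets (filt_wd M N m w d (Suc k))"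
  unfolding filt_wd_def
proof (intro gen_alg_mono Un_mono subsetI)
  fix f assume "f \<in> {(\<lambda>\<omega>. w i t \<omega> r) | i t r. i < N \<and> 1 \<le> t \<and> t \<le> k \<and> r < m i}"
  then obtain i t r where f: "f = (\<lambda>\<omega>. w i t \<omega> r)" "i < N" "1 \<le> t" "t \<le> k" "r < m i" by blast
  show "f \<in> {(\<lambda>\<omega>. w i t \<omega> r) | i t r. i < N \<and> 1 \<le> t \<and> t \<le> Suc k \<and> r < m i}"
    using f by (intro CollectI exI[of _ i] exI[of _ t] exI[of _ r] conjI) simp_all
next
  fix f assume "f \<in> {d i t | i t. i < N \<and> 1 \<le> t \<and> t \<le> k}"
  then obtain i t where f: "f = d i t" "i < N" "1 \<le> t" "t \<le> k" by blast
  show "f \<in> {d i t | i t. i < N \<and> 1 \<le> t \<and> t \<le> Suc k}"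
    using f by (intro CollectI exI[of _ i] exI[of _ t] conjI) simp_all
qed

lemma filt_wd_noise: "i < N \<Longrightarrow> r < m i \<Longrightarrow> (\<lambda>\<omega>. w i (Suc k) \<omega> r) \<in> borel_measurable (filt_wd M N m w d (Suc k))"
  unfolding filt_wd_def
  by (rule gen_alg_measurable, rule UnI1, intro CollectI exI[of _ i] exI[of _ "Suc k"] exI[of _ r] conjI) simp_all

lemma filt_wd_dither: "i < N \<Longrightarrow> d i (Suc k) \<in> borel_measurable (filt_wd M N m w d (Suc k))"
  unfolding filt_wd_def
  by (rule gen_alg_measurable, rule UnI2, intro CollectI exI[of _ i] exI[of _ "Suc k"] conjI) simp_all

abbreviation "cutset R i k \<equiv> {\<omega> \<in> space M. nn_cond_exp M (filt_w M N m w k) (w_pow m w rho i (Suc k)) \<omega> \<le> of_nat R}"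

lemma cut_sets: "cutset R i k \<in> sets (filt_w M N m w k)"
proof -
  have "{\<omega> \<in> space (filt_w M N m w k). nn_cond_exp M (filt_w M N m w k) (w_pow m w rho i (Suc k)) \<omega> \<le> of_nat R} \<in> sets (filt_w M N m w k)"
    by measurable
  thus ?thesis by (simp add: filt_w_def)
qed

lemma cut_sets_F: "k \<le> l \<Longrightarrow> cutset R i k \<in> sets (filt_wd M N m w d l)"
  using cut_sets filt_w_le_filt_wd by blast

lemma cut_events: "cutset R i k \<in> sets M"
  using cut_sets subalgebra_filt_w[of k] by (auto simp: subalgebra_def)

lemma trunc_w_eq:
  "i < N \<Longrightarrow> \<omega> \<in> space M \<Longrightarrow> trunc_w M N m w rho R i (Suc k) \<omega> r = indicator (cutset R i k) \<omega> * w i (Suc k) \<omega> r"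
  by (simp add: trunc_w_def indicator_def)

lemma trunc_w_measurable:
  assumes "i < N" "r < m i"
  shows "(\<lambda>\<omega>. trunc_w M N m w rho R i (Suc k) \<omega> r) \<in> borel_measurable (filt_wd M N m w d (Suc k))"
proof -
  have "(\<lambda>\<omega>. indicator (cutset R i k) \<omega> * w i (Suc k) \<omega> r) \<in> borel_measurable (filt_wd M N m w d (Suc k))"
    using filt_wd_noise[OF assms] cut_sets_F[of k "Suc k" i R]
    by (intro borel_measurable_times borel_measurable_indicator) auto
  moreover have "space (filt_wd M N m w d (Suc k)) = space M" by (simp add: filt_wd_def)
  ultimately show ?thesis using trunc_w_eq[OF assms(1), of _ R k r]
    by (subst measurable_cong[where g="\<lambda>\<omega>. indicator (cutset R i k) \<omega> * w i (Suc k) \<omega> r"]) simp_all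
qed

text \<open>The cut-off event belongs to the past of the noise, so on it the moment of order
  \<open>rho\<close> may be replaced by its conditional expectation, which is at most
  \<open>R\<close> there.\<close>

lemma trunc_w_nn:
  assumes i: "i < N" and rho: "2 < rho"
  shows "(\<integral>\<^sup>+\<omega>. ennreal (\<Sum>r<m i. (trunc_w M N m w rho R i (Suc k) \<omega> r)\<^sup>2) \<partial>M) \<le> ennreal (1 + real R)"
proof -
  interpret G: sigma_finite_subalgebra M "filt_w M N m w k"
    by (rule sigma_finite_subalgebraI[OF subalgebra_filt_w])
  define g where "g \<omega> = sqrt (\<Sum>r<m i. (w i (Suc k) \<omega> r)\<^sup>2)" for \<omega>
  have gm: "g \<in> borel_measurable M" unfolding g_def using wm[OF i, of "Suc k"] by measurable
  have pm: "w_pow m w rho i (Suc k) \<in> borel_measurable M"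
    unfolding w_pow_def[abs_def] g_def[symmetric] using gm by measurable
  let ?A = "cutset R i k"
  let ?n = "nn_cond_exp M (filt_w M N m w k) (w_pow m w rho i (Suc k))"
  have "(\<integral>\<^sup>+\<omega>. ennreal (\<Sum>r<m i. (trunc_w M N m w rho R i (Suc k) \<omega> r)\<^sup>2) \<partial>M)
      \<le> (\<integral>\<^sup>+\<omega>. 1 + indicator ?A \<omega> * w_pow m w rho i (Suc k) \<omega> \<partial>M)"
  proof (rule nn_integral_mono)
    fix \<omega> assume w: "\<omega> \<in> space M"
    have g0: "0 \<le> g \<omega>" "(g \<omega>)\<^sup>2 = (\<Sum>r<m i. (w i (Suc k) \<omega> r)\<^sup>2)" unfolding g_def by (auto simp: sum_nonneg)
    show "ennreal (\<Sum>r<m i. (trunc_w M N m w rho R i (Suc k) \<omega> r)\<^sup>2) \<le> 1 + indicator ?A \<omega> * w_pow m w rho i (Suc k) \<omega>"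
    proof (cases "\<omega> \<in> ?A")
      case True
      have "ennreal (\<Sum>r<m i. (trunc_w M N m w rho R i (Suc k) \<omega> r)\<^sup>2) = ennreal ((g \<omega>)\<^sup>2)"
        using trunc_w_eq[OF i w, of R k] True by (simp add: g0)
      also have "\<dots> \<le> ennreal (1 + g \<omega> powr rho)" using sq_le_one_plus_powr[OF g0(1) rho] by (rule ennreal_leI)
      also have "\<dots> = 1 + w_pow m w rho i (Suc k) \<omega>" by (simp add: w_pow_def g_def ennreal_plus)
      finally show ?thesis using True by simp
    next
      case False
      thus ?thesis using trunc_w_eq[OF i w, of R k] by simp
    qed
  qed
  also have "\<dots> = 1 + (\<integral>\<^sup>+\<omega>. indicator ?A \<omega> * w_pow m w rho i (Suc k) \<omega> \<partial>M)"
    using pm cut_events[of k i R] by (subst nn_integral_add) (auto simp: emeasure_space_1)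
  also have "(\<integral>\<^sup>+\<omega>. indicator ?A \<omega> * w_pow m w rho i (Suc k) \<omega> \<partial>M) = (\<integral>\<^sup>+\<omega>. indicator ?A \<omega> * ?n \<omega> \<partial>M)"
    using pm cut_sets[of k i R] by (intro G.nn_cond_exp_intg[symmetric]) auto
  also have "\<dots> \<le> (\<integral>\<^sup>+\<omega>. of_nat R \<partial>M)"
    by (intro nn_integral_mono) (auto simp: indicator_def)
  also have "\<dots> = of_nat R" by (simp add: emeasure_space_1)
  finally show ?thesis by (simp add: ennreal_plus ennreal_of_nat_eq_real_of_nat add_left_mono)
qed

lemma trunc_w_integrable:
  assumes i: "i < N" and rho: "2 < rho"
  shows "r < m i \<Longrightarrow> integrable M (\<lambda>\<omega>. (trunc_w M N m w rho R i (Suc k) \<omega> r)\<^sup>2)"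
    and "(\<integral>\<omega>. (\<Sum>r<m i. (trunc_w M N m w rho R i (Suc k) \<omega> r)\<^sup>2) \<partial>M) \<le> 1 + real R"
proof -
  have tm: "(\<lambda>\<omega>. trunc_w M N m w rho R i (Suc k) \<omega> r) \<in> borel_measurable M" if "r < m i" for r
    using measurable_from_subalg[OF subalgebra_filt_wd trunc_w_measurable[OF i that]] .
  have sm: "(\<lambda>\<omega>. \<Sum>r<m i. (trunc_w M N m w rho R i (Suc k) \<omega> r)\<^sup>2) \<in> borel_measurable M"
    using tm by (intro borel_measurable_sum borel_measurable_power) auto
  have lt: "(\<integral>\<^sup>+\<omega>. ennreal (\<Sum>r<m i. (trunc_w M N m w rho R i (Suc k) \<omega> r)\<^sup>2) \<partial>M) < \<infinity>"
    using trunc_w_nn[OF i rho, of R k] by (simp add: order.strict_trans1)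
  have int: "integrable M (\<lambda>\<omega>. \<Sum>r<m i. (trunc_w M N m w rho R i (Suc k) \<omega> r)\<^sup>2)"
    using sm lt by (intro integrableI_nonneg AE_I2 sum_nonneg) auto
  show "integrable M (\<lambda>\<omega>. (trunc_w M N m w rho R i (Suc k) \<omega> r)\<^sup>2)" if r: "r < m i"
  proof (rule Bochner_Integration.integrable_bound[OF int])
    show "(\<lambda>\<omega>. (trunc_w M N m w rho R i (Suc k) \<omega> r)\<^sup>2) \<in> borel_measurable M" using tm[OF r] by measurable
    show "AE \<omega> in M. norm ((trunc_w M N m w rho R i (Suc k) \<omega> r)\<^sup>2) \<le> norm (\<Sum>r<m i. (trunc_w M N m w rho R i (Suc k) \<omega> r)\<^sup>2)"
    proof (rule AE_I2)
      fix \<omega>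
      have "(trunc_w M N m w rho R i (Suc k) \<omega> r)\<^sup>2 \<le> (\<Sum>r<m i. (trunc_w M N m w rho R i (Suc k) \<omega> r)\<^sup>2)"
        using r by (intro member_le_sum) auto
      thus "norm ((trunc_w M N m w rho R i (Suc k) \<omega> r)\<^sup>2) \<le> norm (\<Sum>r<m i. (trunc_w M N m w rho R i (Suc k) \<omega> r)\<^sup>2)"
        by (simp add: sum_nonneg)
    qed
  qed
  have "ennreal (\<integral>\<omega>. (\<Sum>r<m i. (trunc_w M N m w rho R i (Suc k) \<omega> r)\<^sup>2) \<partial>M) \<le> ennreal (1 + real R)"
    using trunc_w_nn[OF i rho, of R k] by (subst nn_integral_eq_integral[OF int, symmetric]) (auto simp: sum_nonneg)
  thus "(\<integral>\<omega>. (\<Sum>r<m i. (trunc_w M N m w rho R i (Suc k) \<omega> r)\<^sup>2) \<partial>M) \<le> 1 + real R"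
    by (subst (asm) ennreal_le_iff) auto
qed

text \<open>The indicator of the cut-off event is measurable for the past and factors out of the
  conditional expectation.\<close>

lemma trunc_w_mds:
  assumes i: "i < N" and r: "r < m i" and wi: "integrable M (\<lambda>\<omega>. w i (Suc k) \<omega> r)"
    and mds: "AE \<omega> in M. real_cond_exp M (filt_wd M N m w d k) (\<lambda>\<omega>. w i (Suc k) \<omega> r) \<omega> = 0"
  shows "AE \<omega> in M. real_cond_exp M (filt_wd M N m w d k) (\<lambda>\<omega>. trunc_w M N m w rho R i (Suc k) \<omega> r) \<omega> = 0"
proof -
  interpret G: sigma_finite_subalgebra M "filt_wd M N m w d k"
    by (rule sigma_finite_subalgebraI[OF subalgebra_filt_wd])
  let ?f = "\<lambda>\<omega>. indicator (cutset R i k) \<omega> * w i (Suc k) \<omega> r"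
  have fm: "?f \<in> borel_measurable M"
    using wm[OF i, of "Suc k" r] r cut_events[of k i R] by (intro borel_measurable_times borel_measurable_indicator) auto
  have tm: "(\<lambda>\<omega>. trunc_w M N m w rho R i (Suc k) \<omega> r) \<in> borel_measurable M"
    using measurable_from_subalg[OF subalgebra_filt_wd trunc_w_measurable[OF i r]] .
  have int: "integrable M ?f"
    using wi fm by (rule Bochner_Integration.integrable_bound) (auto simp: indicator_def)
  have "AE \<omega> in M. real_cond_exp M (filt_wd M N m w d k) (\<lambda>\<omega>. trunc_w M N m w rho R i (Suc k) \<omega> r) \<omega>
      = real_cond_exp M (filt_wd M N m w d k) ?f \<omega>"
    by (rule G.real_cond_exp_cong[OF AE_I2 tm fm]) (rule trunc_w_eq[OF i])
  moreover have "AE \<omega> in M. real_cond_exp M (filt_wd M N m w d k) ?f \<omega>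
      = indicator (cutset R i k) \<omega> * real_cond_exp M (filt_wd M N m w d k) (\<lambda>\<omega>. w i (Suc k) \<omega> r) \<omega>"
    using cut_sets_F[of k k i R] int wi by (intro G.real_cond_exp_mult) auto
  ultimately show ?thesis using mds by eventually_elim simp
qed

text \<open>The independent family is regrouped into two blocks: all observation noise with the
  dithers up to time \<open>k\<close>, and the single dither of step \<open>Suc k\<close>. The
  algebra of the past lies inside the first block.\<close>

lemma dither_indep:
  assumes ind: "indep_sets (\<lambda>x. case x of Some (i, k) \<Rightarrow> sets (gen_alg M {d i k}) | None \<Rightarrow> sets (alg_all_w M N m w))
        (Some ` ({..<N} \<times> {1..}) \<union> {None})"
    and i: "i < N" and A: "A \<in> sets (filt_wd M N m w d k)" and B: "B \<in> sets borel"
  shows "prob (A \<inter> (d i (Suc k) -` B \<inter> space M)) = prob A * prob (d i (Suc k) -` B \<inter> space M)"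
proof -
  define Fa where "Fa = (\<lambda>x. case x of Some (i, k) \<Rightarrow> sets (gen_alg M {d i k}) | None \<Rightarrow> sets (alg_all_w M N m w))"
  define Fm where "Fm = (\<lambda>x. case x of Some (i, k) \<Rightarrow> gen_alg M {d i k} | None \<Rightarrow> alg_all_w M N m w)"
  have FaFm: "Fa x = sets (Fm x)" for x by (simp add: Fa_def Fm_def split: option.split prod.split)
  have spFm: "space (Fm x) = space M" for x by (simp add: Fm_def alg_all_w_def split: option.split prod.split)
  \<comment> \<open>\<open>True\<close> indexes the block of the past, \<open>False\<close> the new
    dither.\<close>
  define I where "I j = (if j then insert None (Some ` ({..<N} \<times> {1..k})) else {Some (i, Suc k)})" for j
  have ind2: "indep_sets (\<lambda>j. sigma_sets (space M) (\<Union>x\<in>I j. Fa x)) UNIV"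
  proof (rule indep_sets_collect_sigma)
    show "indep_sets Fa (\<Union>j\<in>UNIV. I j)"
      using ind unfolding Fa_def by (rule indep_sets_mono_index[rotated]) (use i in \<open>auto simp: I_def split: if_splits\<close>)
    show "Int_stable (Fa x)" for x
      unfolding FaFm Int_stable_def by (intro ballI sets.Int)
    show "disjoint_family_on I UNIV" by (auto simp: disjoint_family_on_def I_def split: if_splits)
  qed
  have dB: "d i (Suc k) -` B \<inter> space M \<in> sigma_sets (space M) (\<Union>x\<in>I False. Fa x)"
    using measurable_sets[OF gen_alg_measurable[of "d i (Suc k)" "{d i (Suc k)}" M] B]
    by (intro sigma_sets.Basic) (simp add: I_def Fa_def)
  have sub: "(\<Union>x\<in>I True. Fa x) \<subseteq> Pow (space M)"
    using sets.sets_into_space[of _ "Fm _"] unfolding FaFm spFm by blast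
  define S where "S = sigma (space M) (\<Union>x\<in>I True. Fa x)"
  have S: "space S = space M" "sets S = sigma_sets (space M) (\<Union>x\<in>I True. Fa x)"
    unfolding S_def using sub by (simp_all add: space_measure_of_conv sets_measure_of)
  have FaS: "Fa x \<subseteq> sets S" if "x \<in> I True" for x unfolding S(2) using that by blast
  have "sets (filt_wd M N m w d k) \<subseteq> sets S"
    unfolding filt_wd_def
  proof (rule gen_alg_least[OF S(1)])
    fix f assume "f \<in> {(\<lambda>\<omega>. w i t \<omega> r) | i t r. i < N \<and> 1 \<le> t \<and> t \<le> k \<and> r < m i} \<union> {d i t | i t. i < N \<and> 1 \<le> t \<and> t \<le> k}"
    thus "f \<in> borel_measurable S"
    proof
      assume "f \<in> {(\<lambda>\<omega>. w i t \<omega> r) | i t r. i < N \<and> 1 \<le> t \<and> t \<le> k \<and> r < m i}"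
      hence "f \<in> {(\<lambda>\<omega>. w i t \<omega> r) | i t r. i < N \<and> 1 \<le> t \<and> r < m i}" by blast
      hence "f \<in> borel_measurable (alg_all_w M N m w)" unfolding alg_all_w_def by (rule gen_alg_measurable)
      moreover have "sets (alg_all_w M N m w) \<subseteq> sets S" using FaS[of None] by (simp add: Fa_def I_def)
      ultimately show ?thesis by (intro measurable_gen_alg_mono[of f "alg_all_w M N m w" S]) (auto simp: alg_all_w_def S(1))
    next
      assume "f \<in> {d i t | i t. i < N \<and> 1 \<le> t \<and> t \<le> k}"
      then obtain i' t where f: "f = d i' t" "i' < N" "1 \<le> t" "t \<le> k" by blast
      have "sets (gen_alg M {d i' t}) \<subseteq> sets S" using FaS[of "Some (i', t)"] f by (simp add: Fa_def I_def)
      moreover have "f \<in> borel_measurable (gen_alg M {d i' t})" using f by (intro gen_alg_measurable) simp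
      ultimately show ?thesis by (intro measurable_gen_alg_mono[of f "gen_alg M {d i' t}" S]) (auto simp: S(1))
    qed
  qed
  hence AS: "A \<in> sigma_sets (space M) (\<Union>x\<in>I True. Fa x)" using A S(2) by blast
  define Z where "Z j = (if j then A else d i (Suc k) -` B \<inter> space M)" for j
  have "prob (\<Inter>j\<in>UNIV. Z j) = (\<Prod>j\<in>UNIV. prob (Z j))"
  proof (rule indep_setsD[OF ind2, where J=UNIV and A=Z])
    show "\<forall>j\<in>UNIV. Z j \<in> sigma_sets (space M) (\<Union>x\<in>I j. Fa x)"
    proof
      fix j show "Z j \<in> sigma_sets (space M) (\<Union>x\<in>I j. Fa x)"
        by (cases j) (simp_all only: Z_def if_True if_False dB AS)
    qed
  qed auto
  moreover have "(\<Inter>j\<in>UNIV. Z j) = Z True \<inter> Z False" unfolding UNIV_bool by auto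
  moreover have "(\<Prod>j\<in>UNIV. prob (Z j)) = prob (Z True) * prob (Z False)" unfolding UNIV_bool by simp
  ultimately show ?thesis by (simp only: Z_def if_True if_False)
qed

text \<open>A finite supremum lies below some natural \<open>R\<close>, and at this level nothing is
  cut off along the path. \<open>Q\<close> takes the whole noise path as argument because the
  estimates depend on it.\<close>

lemma truncation_transfer:
  assumes mom: "AE \<omega> in M. (SUP ik\<in>{..<N} \<times> {1..}.
        nn_cond_exp M (filt_w M N m w (snd ik - 1)) (w_pow m w rho (fst ik) (snd ik)) \<omega>) < \<top>"
    and ae: "\<And>R. AE \<omega> in M. Q (\<lambda>i k. trunc_w M N m w rho R i k \<omega>) \<omega>"
  shows "AE \<omega> in M. Q (\<lambda>i k. w i k \<omega>) \<omega>"
proof -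
  have "AE \<omega> in M. \<forall>R. Q (\<lambda>i k. trunc_w M N m w rho R i k \<omega>) \<omega>"
    unfolding AE_all_countable by (intro allI ae)
  with mom show ?thesis
  proof eventually_elim
    case (elim \<omega>)
    let ?S = "SUP ik\<in>{..<N} \<times> {1..}. nn_cond_exp M (filt_w M N m w (snd ik - 1)) (w_pow m w rho (fst ik) (snd ik)) \<omega>"
    obtain R :: nat where R: "?S < of_nat R" using elim(1) ennreal_Ex_less_of_nat by blast
    have "nn_cond_exp M (filt_w M N m w (k - 1)) (w_pow m w rho i k) \<omega> \<le> of_nat R" if "i < N" "1 \<le> k" for i k
    proof -
      have "nn_cond_exp M (filt_w M N m w (snd (i, k) - 1)) (w_pow m w rho (fst (i, k)) (snd (i, k))) \<omega> \<le> ?S"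
        using that by (intro SUP_upper) auto
      thus ?thesis using R by simp
    qed
    \<comment> \<open>For indices outside \<open>i < N\<close> and \<open>1 \<le> k\<close> the
      truncated noise is the original one by definition, which makes this an equality of
      functions.\<close>
    hence "(\<lambda>i k. trunc_w M N m w rho R i k \<omega>) = (\<lambda>i k. w i k \<omega>)" by (intro ext) (auto simp: trunc_w_def)
    thus ?case using elim(2) by metis
  qed
qed

end

text \<open>For \<open>q \<ge> 1\<close> the product of \<open>al k\<close> and
  \<open>Suc k powr - q\<close> is at most the mean of two summable squares, contradicting
  divergence of \<open>z\<close>. The step-size conditions thus force \<open>nu < 1\<close>, on
  which the rate bounds rely.\<close>

lemma exponent_less_one:
  fixes al z :: "nat \<Rightarrow> real"
  assumes sq: "summable (\<lambda>k. (al k)\<^sup>2)" and z: "\<not> summable z" "\<And>k. 0 \<le> z k" "\<And>k. z k \<le> al k / real (Suc k) powr q"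
  shows "q < 1"
proof (rule ccontr)
  assume "\<not> q < 1"
  hence q: "1 \<le> q" by simp
  have "summable (\<lambda>k. real k powr (- 2))" by (simp add: summable_real_powr_iff)
  hence "summable (\<lambda>k. real (Suc k) powr (- 2))" by (subst summable_Suc_iff)
  hence s: "summable (\<lambda>k. ((al k)\<^sup>2 + real (Suc k) powr (- 2)) / 2)" using sq by (intro summable_divide summable_add)
  have "summable z"
  proof (rule summable_comparison_test'[OF s])
    fix k
    define y where "y = real (Suc k) powr - q"
    have "y \<le> real (Suc k) powr - 1" unfolding y_def using q by (intro powr_mono) auto
    hence "y\<^sup>2 \<le> (real (Suc k) powr - 1)\<^sup>2" by (intro power_mono) (auto simp: y_def)
    also have "\<dots> = real (Suc k) powr (- 2)" unfolding power2_eq_square powr_add[symmetric] by simp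
    finally have y: "y\<^sup>2 \<le> real (Suc k) powr (- 2)" .
    have "z k \<le> al k * y" using z(3)[of k] unfolding y_def by (simp add: powr_minus divide_inverse)
    also have "\<dots> \<le> ((al k)\<^sup>2 + y\<^sup>2) / 2" using sum_squares_bound[of "al k" y] by simp
    finally show "norm (z k) \<le> ((al k)\<^sup>2 + real (Suc k) powr (- 2)) / 2" using z(2)[of k] y by simp
  qed
  thus False using z by simp
qed

text \<open>Brings \<open>a_const\<close> into the shape of \<open>c0\<close>; \<open>H\<close>
  stands for the square of the regressor bound.\<close>

lemma gain_eq:
  fixes N n :: real
  assumes "0 < N" "0 < n"
  shows "de * l * bl * mm / (2 * N * n * H * bl + N * l * mm)
     = bl * de / N * ((l * mm / n) / (2 * H * bl + l * mm / n))"
proof -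
  have "2 * N * n * H * bl + N * l * mm = N * (n * (2 * H * bl + l * mm / n))" using assms by (simp add: field_simps)
  thus ?thesis using assms by (simp add: mult_ac)
qed

theorem theorem5p1:
  fixes M :: "'a measure"
    and N n p :: nat
    and a nu b gamma :: "nat \<Rightarrow> nat \<Rightarrow> real"
    and alpha :: "nat \<Rightarrow> nat \<Rightarrow> nat \<Rightarrow> real"
    and beta :: "nat \<Rightarrow> nat \<Rightarrow> real"
    and m :: "nat \<Rightarrow> nat"
    and H :: "nat \<Rightarrow> nat \<Rightarrow> nat \<Rightarrow> nat \<Rightarrow> real"
    and theta :: "nat \<Rightarrow> real"
    and th0 :: "nat \<Rightarrow> nat \<Rightarrow> real"
    and w :: "nat \<Rightarrow> nat \<Rightarrow> 'a \<Rightarrow> nat \<Rightarrow> real"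
    and d :: "nat \<Rightarrow> nat \<Rightarrow> 'a \<Rightarrow> real"
    and Hbar delta rho :: real
  defines "E \<equiv> edges N a"
    and "rate \<equiv> (\<lambda>\<omega>. sc_rate N n a nu b alpha beta m H (obs n H theta (\<lambda>i k. w i k \<omega>))
                    (\<lambda>i k. d i k \<omega>) th0)"
  assumes M: "prob_space M"
    and n_pos: "0 < n"
    \<comment> \<open>network\<close>
    and a_sym: "\<And>i j. a i j = a j i" and a_nonneg: "\<And>i j. 0 \<le> a i j"
    and a_noloop: "\<And>i. a i i = 0"
    \<comment> \<open>(A1)\<close>
    and A1_Hbar: "0 < Hbar"
    and A1_bound: "\<And>i k x. i < N \<Longrightarrow> 1 \<le> k \<Longrightarrow>
        (\<Sum>r<m i. (\<Sum>c<n. H i k r c * x c)\<^sup>2) \<le> Hbar\<^sup>2 * (\<Sum>c<n. (x c)\<^sup>2)"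
    and A1_p: "0 < p" and A1_delta: "0 < delta"
    and A1_pe: "\<And>k x. 1 \<le> k \<Longrightarrow>
        (1 / real p) * (\<Sum>t\<in>{k..k + p - 1}. \<Sum>i<N. \<Sum>r<m i. (\<Sum>c<n. H i t r c * x c)\<^sup>2)
          \<ge> delta * (\<Sum>c<n. (x c)\<^sup>2)"
    \<comment> \<open>(A2)\<close>
    and A2_meas: "\<And>i k r. i < N \<Longrightarrow> 1 \<le> k \<Longrightarrow> r < m i \<Longrightarrow>
        (\<lambda>\<omega>. w i k \<omega> r) \<in> borel_measurable M"
    and A2_int: "\<And>i k r. i < N \<Longrightarrow> 1 \<le> k \<Longrightarrow> r < m i \<Longrightarrow> integrable M (\<lambda>\<omega>. w i k \<omega> r)"
    and A2_mds: "\<And>i k r. i < N \<Longrightarrow> 1 \<le> k \<Longrightarrow> r < m i \<Longrightarrow>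
        AE \<omega> in M. real_cond_exp M (filt_wd M N m w d (k - 1)) (\<lambda>\<omega>. w i k \<omega> r) \<omega> = 0"
    and A2_rho: "2 < rho"
    and A2_mom: "AE \<omega> in M. (SUP ik\<in>{..<N} \<times> {1..}.
        nn_cond_exp M (filt_w M N m w (snd ik - 1))
          (\<lambda>\<omega>'. ennreal (sqrt (\<Sum>r<m (fst ik). (w (fst ik) (snd ik) \<omega>' r)\<^sup>2) powr rho)) \<omega>) < \<top>"
    \<comment> \<open>(A3)\<close>
    and A3: "graph_connected N a"
    \<comment> \<open>(A4)\<close>
    and A4_dist: "\<And>i k. i < N \<Longrightarrow> 1 \<le> k \<Longrightarrow>
        distributed M lborel (d i k) (\<lambda>x. ennreal (exp (- \<bar>x\<bar>) / 2))"
    and A4_indep: "prob_space.indep_sets M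
        (\<lambda>x. case x of Some (i, k) \<Rightarrow> sets (gen_alg M {d i k})
                     | None \<Rightarrow> sets (alg_all_w M N m w))
        (Some ` ({..<N} \<times> {1..}) \<union> {None})"
    \<comment> \<open>algorithm parameters\<close>
    and nu_sym: "\<And>i j. nu i j = nu j i" and nu_nonneg: "\<And>i j. 0 \<le> nu i j"
    and b_sym: "\<And>i j. b i j = b j i" and b_pos: "\<And>i j. (i, j) \<in> E \<Longrightarrow> 0 < b i j"
    and alpha_sym: "\<And>i j k. alpha i j k = alpha j i k"
    and alpha_pos: "\<And>i j k. (i, j) \<in> E \<Longrightarrow> 1 \<le> k \<Longrightarrow> 0 < alpha i j k"
    and beta_pos: "\<And>i k. i < N \<Longrightarrow> 1 \<le> k \<Longrightarrow> 0 < beta i k"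
    \<comment> \<open>step-size conditions (i)-(iii)\<close>
    and step_i: "\<And>i j. (i, j) \<in> E \<Longrightarrow> summable (\<lambda>k. (alpha i j (Suc k))\<^sup>2) \<and>
        (\<exists>C. \<forall>k\<ge>1. alpha i j (k + 1) / alpha i j k \<le> C)"
    and step_ii: "\<And>i. i < N \<Longrightarrow> summable (\<lambda>k. (beta i (Suc k))\<^sup>2) \<and>
        (\<exists>C. \<forall>k\<ge>1. beta i (k + 1) / beta i k \<le> C)"
    and step_iii: "\<not> summable (\<lambda>k. Min ({alpha i j (Suc k) / real (Suc k) powr nu i j | i j. (i, j) \<in> E}
                                       \<union> {beta i (Suc k) | i. i < N}))"
  shows "\<forall>(i, j)\<in>E.
      (AE \<omega> in M. \<exists>C. \<forall>k\<ge>1. \<bar>rate \<omega> i j k\<bar> \<le> C * (1 / real k powr nu i j))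
    \<and> (nu i j = 0 \<longrightarrow> (AE \<omega> in M. \<forall>k\<ge>1. rate \<omega> i j k = 1))
    \<and> ((0 < nu i j
         \<and> (\<forall>(i', j')\<in>E. \<forall>k\<ge>1. alpha i' j' k = alpha i' j' 1 / real k powr gamma i' j')
         \<and> (\<forall>i'<N. \<forall>k\<ge>1. beta i' k = beta i' 1 / real k)
         \<and> (\<forall>(i', j')\<in>E. gamma i' j' = gamma j' i' \<and> 1 / 2 < gamma i' j' \<and> gamma i' j' \<le> 1
                          \<and> nu i' j' + gamma i' j' \<le> 1)
         \<and> a_const N n a nu gamma b alpha beta theta delta Hbar > h_const N a nu gamma - 1 / 2)
       \<longrightarrow> (AE \<omega> in M. \<exists>C. \<forall>k\<ge>2.
              rate \<omega> i j k
                \<le> exp (norm1 n theta / b i j) / ((1 - nu i j) * real k powr nu i j)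
                  + C * (sqrt (ln (real k)) / real k powr (h_const N a nu gamma - 1 / 2 + nu i j))))"
proof -
  have main: "(AE \<omega> in M. \<exists>C. \<forall>k\<ge>1. \<bar>rate \<omega> i j k\<bar> \<le> C * (1 / real k powr nu i j))
    \<and> (nu i j = 0 \<longrightarrow> (AE \<omega> in M. \<forall>k\<ge>1. rate \<omega> i j k = 1))
    \<and> ((0 < nu i j
         \<and> (\<forall>(i', j')\<in>E. \<forall>k\<ge>1. alpha i' j' k = alpha i' j' 1 / real k powr gamma i' j')
         \<and> (\<forall>i'<N. \<forall>k\<ge>1. beta i' k = beta i' 1 / real k)
         \<and> (\<forall>(i', j')\<in>E. gamma i' j' = gamma j' i' \<and> 1 / 2 < gamma i' j' \<and> gamma i' j' \<le> 1
                          \<and> nu i' j' + gamma i' j' \<le> 1)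
         \<and> a_const N n a nu gamma b alpha beta theta delta Hbar > h_const N a nu gamma - 1 / 2)
       \<longrightarrow> (AE \<omega> in M. \<exists>C. \<forall>k\<ge>2.
              rate \<omega> i j k
                \<le> exp (norm1 n theta / b i j) / ((1 - nu i j) * real k powr nu i j)
                  + C * (sqrt (ln (real k)) / real k powr (h_const N a nu gamma - 1 / 2 + nu i j))))"
    if ij': "(i, j) \<in> E" for i j
  proof -
    interpret prob_space M by (rule M)
    note fin = finite_edges[of N a]
    have ij: "(i, j) \<in> edges N a" using ij' by (simp add: E_def)
    have iN: "i < N" "j < N" using ij by (auto simp: edges_def)
    \<comment> \<open>Loops are excluded, so an edge provides two distinct sensors.\<close>
    have "i \<noteq> j" using ij a_noloop[of i] by (auto simp: edges_def)
    hence N2: "2 \<le> N" using iN by linarith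
    have dm: "d i k \<in> borel_measurable M" if "i < N" "1 \<le> k" for i k
      using distributed_measurable[OF A4_dist[OF that]] by simp
    \<comment> \<open>For every level \<open>R\<close> the filtration is the one generated by the
      original noise and the dithers; the truncated noise is adapted to it because the cut-off is
      predictable.\<close>
    define F where "F = filt_wd M N m w d"
    define wt where "wt = trunc_w M N m w rho"
    have sys: "sc_system M F N n a nu b alpha beta m H (wt R) d Hbar (1 + real R)" for R
    proof (unfold_locales)
      show "subalgebra M (F k)" for k unfolding F_def by (rule subalgebra_filt_wd[where w=w and m=m, OF M A2_meas dm])
      show "sets (F k) \<subseteq> sets (F (Suc k))" for k unfolding F_def by (rule filt_wd_mono[where w=w and m=m, OF M A2_meas dm])
      show "(\<lambda>\<omega>. wt R i (Suc k) \<omega> r) \<in> borel_measurable (F (Suc k))" if "i < N" "r < m i" for i k r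
        unfolding F_def wt_def by (rule trunc_w_measurable[where w=w and m=m, OF M A2_meas dm that])
      show "integrable M (\<lambda>\<omega>. (wt R i (Suc k) \<omega> r)\<^sup>2)" if "i < N" "r < m i" for i k r
        unfolding wt_def by (rule trunc_w_integrable(1)[where w=w and m=m, OF M A2_meas dm that(1) A2_rho that(2)])
      show "(\<integral>\<omega>. (\<Sum>r<m i. (wt R i (Suc k) \<omega> r)\<^sup>2) \<partial>M) \<le> 1 + real R" if "i < N" for i k
        unfolding wt_def by (rule trunc_w_integrable(2)[where w=w and m=m, OF M A2_meas dm that A2_rho])
      show "AE \<omega> in M. real_cond_exp M (F k) (\<lambda>\<omega>. wt R i (Suc k) \<omega> r) \<omega> = 0" if "i < N" "r < m i" for i k r
        unfolding F_def wt_def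
      proof (rule trunc_w_mds[where w=w and m=m, OF M A2_meas dm that])
        show "integrable M (\<lambda>\<omega>. w i (Suc k) \<omega> r)" by (rule A2_int) (use that in auto)
        show "AE \<omega> in M. real_cond_exp M (filt_wd M N m w d k) (\<lambda>\<omega>. w i (Suc k) \<omega> r) \<omega> = 0"
          using A2_mds[of i "Suc k" r] that by simp
      qed
      show "d i (Suc k) \<in> borel_measurable (F (Suc k))" if "i < N" for i k
        unfolding F_def by (rule filt_wd_dither[where w=w and m=m, OF M A2_meas dm that])
      show "distributed M lborel (d i (Suc k)) (\<lambda>x. ennreal (exp (- \<bar>x\<bar>) / 2))" if "i < N" for i k
        by (rule A4_dist[OF that]) simp
      show "prob (A \<inter> (d i (Suc k) -` B \<inter> space M)) = prob A * prob (d i (Suc k) -` B \<inter> space M)"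
        if "i < N" "A \<in> sets (F k)" "B \<in> sets borel" for i k A B
        by (rule dither_indep[where w=w and m=m, OF M A2_meas dm A4_indep that(1) that(2)[unfolded F_def] that(3)])
      show "(\<Sum>r<m i. (\<Sum>c<n. H i k r c * x c)\<^sup>2) \<le> Hbar\<^sup>2 * (\<Sum>c<n. (x c)\<^sup>2)" if "i < N" "1 \<le> k" for i k x
        by (rule A1_bound[OF that])
      show "a i j = a j i" for i j by (rule a_sym)
      show "nu i j = nu j i" for i j by (rule nu_sym)
      show "b i j = b j i" for i j by (rule b_sym)
      show "alpha i j k = alpha j i k" for i j k by (rule alpha_sym)
      show "0 < b i j" if "(i, j) \<in> edges N a" for i j using b_pos that by (simp add: E_def)
      show "0 < alpha i j k" if "(i, j) \<in> edges N a" "1 \<le> k" for i j k using alpha_pos that by (simp add: E_def)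
    qed (use n_pos a_nonneg nu_nonneg beta_pos in auto)
    \<comment> \<open>The rate as a function of the noise path, so that
      \<open>truncation_transfer\<close> can exchange the truncated path for the original
      one.\<close>
    define rt where "rt u \<omega> = sc_rate N n a nu b alpha beta m H (obs n H theta u) (\<lambda>i k. d i k \<omega>) th0 i j" for u \<omega>
    have rate_transfer: "AE \<omega> in M. Q (rate \<omega> i j)" if ae: "\<And>R. AE \<omega> in M. Q (rt (\<lambda>i k. wt R i k \<omega>) \<omega>)" for Q
    proof -
      have mom: "AE \<omega> in M. (SUP ik\<in>{..<N} \<times> {1..}.
          nn_cond_exp M (filt_w M N m w (snd ik - 1)) (w_pow m w rho (fst ik) (snd ik)) \<omega>) < \<top>"
        using A2_mom unfolding w_pow_def[abs_def] .
      have "AE \<omega> in M. Q (rt (\<lambda>i k. w i k \<omega>) \<omega>)"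
        by (rule truncation_transfer[where w=w and m=m and Q="\<lambda>u \<omega>. Q (rt u \<omega>)", OF M A2_meas dm mom ae[unfolded wt_def]])
      thus ?thesis by (simp only: rt_def rate_def)
    qed
    have nu1: "nu i j < 1"
    proof (rule exponent_less_one[OF _ step_iii])
      show "summable (\<lambda>k. (alpha i j (Suc k))\<^sup>2)" using step_i[OF ij'] by blast
      fix k
      let ?S = "{alpha i j (Suc k) / real (Suc k) powr nu i j | i j. (i, j) \<in> E} \<union> {beta i (Suc k) | i. i < N}"
      have S: "?S = (\<lambda>(i, j). alpha i j (Suc k) / real (Suc k) powr nu i j) ` E \<union> (\<lambda>i. beta i (Suc k)) ` {..<N}"
        by (auto simp: image_iff split_beta) force+
      have fS: "finite ?S" unfolding S using fin by (simp add: E_def)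
      have mem: "alpha i j (Suc k) / real (Suc k) powr nu i j \<in> ?S" using ij' by blast
      show "Min ?S \<le> alpha i j (Suc k) / real (Suc k) powr nu i j" by (rule Min_le[OF fS mem])
      show "0 \<le> Min ?S"
      proof (subst Min_ge_iff[OF fS])
        show "?S \<noteq> {}" using mem by blast
        show "\<forall>x\<in>?S. 0 \<le> x"
          using alpha_pos beta_pos by (auto intro!: divide_nonneg_nonneg less_imp_le)
      qed
    qed
    have V_bd: "AE \<omega> in M. \<exists>C. \<forall>k. sc_system.V N n a nu b alpha beta m H theta th0 (wt R) d k \<omega> \<le> C" for R
    proof -
      interpret S: sc_system M F N n a nu b alpha beta m H theta th0 "wt R" d Hbar "1 + real R" by (rule sys)
      show ?thesis
      proof (rule S.V_AE_bounded)
        show "summable (\<lambda>k. (alpha i j (Suc k))\<^sup>2)" if "(i, j) \<in> edges N a" for i j using step_i that by (simp add: E_def)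
        show "summable (\<lambda>k. (beta i (Suc k))\<^sup>2)" if "i < N" for i using step_ii that by blast
      qed
    qed
    have part1: "AE \<omega> in M. \<exists>C. \<forall>k\<ge>1. \<bar>rate \<omega> i j k\<bar> \<le> C * (1 / real k powr nu i j)"
    proof (rule rate_transfer[of "\<lambda>f. \<exists>C. \<forall>k\<ge>1. \<bar>f k\<bar> \<le> C * (1 / real k powr nu i j)"])
      fix R
      interpret S: sc_system M F N n a nu b alpha beta m H theta th0 "wt R" d Hbar "1 + real R" by (rule sys)
      have rt: "rt (\<lambda>i k. wt R i k \<omega>) \<omega> k = (\<Sum>t<k. S.bit i j t \<omega>) / real k" for \<omega> k
        unfolding rt_def by (rule S.sc_rate_eq)
      show "AE \<omega> in M. \<exists>C. \<forall>k\<ge>1. \<bar>rt (\<lambda>i k. wt R i k \<omega>) \<omega> k\<bar> \<le> C * (1 / real k powr nu i j)"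
        unfolding rt by (rule S.rate_O_nu[OF ij nu1 V_bd])
    qed
    have part2: "AE \<omega> in M. \<forall>k\<ge>1. rate \<omega> i j k = 1" if nu0: "nu i j = 0"
    proof (rule rate_transfer[of "\<lambda>f. \<forall>k\<ge>1. f k = 1"])
      fix R
      interpret S: sc_system M F N n a nu b alpha beta m H theta th0 "wt R" d Hbar "1 + real R" by (rule sys)
      have rt: "rt (\<lambda>i k. wt R i k \<omega>) \<omega> k = (\<Sum>t<k. S.bit i j t \<omega>) / real k" for \<omega> k
        unfolding rt_def by (rule S.sc_rate_eq)
      show "AE \<omega> in M. \<forall>k\<ge>1. rt (\<lambda>i k. wt R i k \<omega>) \<omega> k = 1"
        unfolding rt by (rule S.bits_zero_nu[OF ij nu0])
    qed
    define h where "h = h_const N a nu gamma"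
    define bl where "bl = beta_low N beta"
    have part3: "AE \<omega> in M. \<exists>C. \<forall>k\<ge>2. rate \<omega> i j k
        \<le> exp (norm1 n theta / b i j) / ((1 - nu i j) * real k powr nu i j)
          + C * (sqrt (ln (real k)) / real k powr (h - 1 / 2 + nu i j))"
      if nu0: "0 < nu i j"
        and al: "\<And>i j k. (i, j) \<in> edges N a \<Longrightarrow> 1 \<le> k \<Longrightarrow> alpha i j k = alpha i j 1 / real k powr gamma i j"
        and be: "\<And>i k. i < N \<Longrightarrow> 1 \<le> k \<Longrightarrow> beta i k = beta i 1 / real k"
        and ga: "\<And>i j. (i, j) \<in> edges N a \<Longrightarrow> 1 / 2 < gamma i j \<and> gamma i j \<le> 1 \<and> nu i j + gamma i j \<le> 1"
        and ac: "h - 1 / 2 < a_const N n a nu gamma b alpha beta theta delta Hbar"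
    proof -
      have hI: "{nu i j / 2 + gamma i j | i j. (i, j) \<in> edges N a} = (\<lambda>(i, j). nu i j / 2 + gamma i j) ` edges N a"
        by force
      have h_eq: "h = Min ((\<lambda>(i, j). nu i j / 2 + gamma i j) ` edges N a)"
        unfolding h_def h_const_def hI ..
      have h_le: "h \<le> nu i j / 2 + gamma i j" if "(i, j) \<in> edges N a" for i j
        unfolding h_eq using that fin by (intro Min_le) (auto intro!: image_eqI[where x="(i, j)"])
      have h_gt: "1 / 2 < h" unfolding h_eq
      proof (subst Min_gr_iff)
        show "\<forall>x\<in>(\<lambda>(i, j). nu i j / 2 + gamma i j) ` edges N a. 1 / 2 < x"
        proof safe
          fix i j assume "(i, j) \<in> edges N a"
          thus "1 / 2 < nu i j / 2 + gamma i j" using ga[of i j] nu_nonneg[of i j] by simp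
        qed
      qed (use fin ij in auto)
      have blI: "{beta i 1 | i. i < N} = (\<lambda>i. beta i 1) ` {..<N}" by auto
      have bl_eq: "bl = Min ((\<lambda>i. beta i 1) ` {..<N})" unfolding bl_def beta_low_def blI ..
      have bl: "0 < bl" "\<And>i. i < N \<Longrightarrow> bl \<le> beta i 1"
        unfolding bl_eq using beta_pos N2 by (auto simp: Min_gr_iff lessThan_empty_iff)
      \<comment> \<open>Without critical edges \<open>a_const\<close> does not mention
        \<open>lambda2\<close> and some Poincare constant is chosen; otherwise it has to be
        \<open>lambda2\<close> for the two gains to agree.\<close>
      define lam where "lam = (if edges' N a nu gamma = {} then
        SOME lam. 0 < lam \<and> (\<forall>x :: nat \<Rightarrow> real. 2 * lam * (\<Sum>i<N. (x i - (\<Sum>i<N. x i) / real N)\<^sup>2)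
          \<le> (\<Sum>(i, j)\<in>edges N a. a i j * (x i - x j)\<^sup>2)) else lambda2 (laplacian N a))"
      have lam: "0 < lam \<and> (\<forall>x :: nat \<Rightarrow> real. 2 * lam * (\<Sum>i<N. (x i - (\<Sum>i<N. x i) / real N)\<^sup>2)
          \<le> (\<Sum>(i, j)\<in>edges N a. a i j * (x i - x j)\<^sup>2))"
      proof (cases "edges' N a nu gamma = {}")
        case True
        thus ?thesis unfolding lam_def using someI_ex[OF connected_poincare[of a N, OF a_sym a_nonneg A3 N2]] by simp
      next
        case False
        \<comment> \<open>Read off from the gain hypothesis: with \<open>lambda2 = 0\<close> the
          constant \<open>a\<close> would be 0, below \<open>h - 1/2 > 0\<close>.\<close>
        have "lambda2 (laplacian N a) \<noteq> 0"
        proof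
          assume "lambda2 (laplacian N a) = 0"
          hence "a_const N n a nu gamma b alpha beta theta delta Hbar = 0" using False by (simp add: a_const_def)
          thus False using ac h_gt by simp
        qed
        moreover have "0 \<le> lambda2 (laplacian N a)" by (rule lambda2_props(1)[of a N, OF a_sym a_nonneg A3 N2])
        ultimately show ?thesis
          using False lambda2_poincare[of a N, OF a_sym a_nonneg A3 N2] by (simp add: lam_def)
      qed
      show ?thesis
      proof (rule rate_transfer[of "\<lambda>f. \<exists>C. \<forall>k\<ge>2. f k
        \<le> exp (norm1 n theta / b i j) / ((1 - nu i j) * real k powr nu i j)
          + C * (sqrt (ln (real k)) / real k powr (h - 1 / 2 + nu i j))"])
        fix R
        interpret S: sc_system M F N n a nu b alpha beta m H theta th0 "wt R" d Hbar "1 + real R" by (rule sys)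
        interpret S: sc_poly M F N n a nu b alpha beta m H theta th0 "wt R" d Hbar "1 + real R" p delta gamma lam
        proof (unfold_locales)
          show "delta * (\<Sum>c<n. (x c)\<^sup>2) \<le> (1 / real p) * (\<Sum>t\<in>{k..k + p - 1}. \<Sum>i<N. \<Sum>r<m i. (\<Sum>c<n. H i t r c * x c)\<^sup>2)"
            if "1 \<le> k" for k x by (rule A1_pe[OF that])
          show "alpha i j (Suc k) = alpha i j 1 / real (Suc k) powr gamma i j" if "(i, j) \<in> edges N a" for i j k
            by (rule al[OF that]) simp
          show "beta i (Suc k) = beta i 1 / real (Suc k)" if "i < N" for i k by (rule be[OF that]) simp
          show "2 * lam * (\<Sum>i<N. (x i - (\<Sum>i<N. x i) / real N)\<^sup>2) \<le> (\<Sum>(i, j)\<in>edges N a. a i j * (x i - x j)\<^sup>2)"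
            for x :: "nat \<Rightarrow> real" using lam by blast
        qed (use N2 A1_Hbar A1_p A1_delta ga lam in auto)
        have gain: "if edges' N a nu gamma = {} then h - 1 / 2 < delta * bl / real N
              else h - 1 / 2 < S.c0 (m'_const N n a nu gamma b alpha theta) bl"
        proof (cases "edges' N a nu gamma = {}")
          case True
          thus ?thesis using ac by (simp add: a_const_def bl_def)
        next
          case False
          have "a_const N n a nu gamma b alpha beta theta delta Hbar = S.c0 (m'_const N n a nu gamma b alpha theta) bl"
            unfolding a_const_def S.c0_def Let_def bl_def[symmetric]
            using False N2 n_pos gain_eq[of "real N" "real n" delta lam bl _ "Hbar\<^sup>2"] by (simp add: lam_def)
          thus ?thesis using ac False by simp
        qed
        obtain mu e1 where mu: "0 < mu" "0 < e1" "h - 1 / 2 < S.c0 mu bl"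
          "\<And>i j. (i, j) \<in> edges N a \<Longrightarrow> nu i j + gamma i j = 1 \<Longrightarrow>
            mu \<le> alpha i j 1 * exp (- (norm1 n theta + e1) / b i j) / b i j"
          by (rule S.gain_constants[OF bl(1) gain]) (rule that)
        have g1: "gamma i j \<le> 1" if "(i, j) \<in> edges N a" for i j using ga[OF that] by blast
        have rt: "rt (\<lambda>i k. wt R i k \<omega>) \<omega> k = (\<Sum>t<k. S.bit i j t \<omega>) / real k" for \<omega> k
          unfolding rt_def by (rule S.sc_rate_eq)
        show "AE \<omega> in M. \<exists>C. \<forall>k\<ge>2. rt (\<lambda>i k. wt R i k \<omega>) \<omega> k
          \<le> exp (norm1 n theta / b i j) / ((1 - nu i j) * real k powr nu i j)
            + C * (sqrt (ln (real k)) / real k powr (h - 1 / 2 + nu i j))"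
          unfolding rt by (rule S.poly_rate[OF ij nu0 g1 h_le h_gt mu(2,1) bl mu(4,3) V_bd])
      qed
    qed
    show ?thesis
    proof (intro conjI impI part1 part2)
      assume hyp: "0 < nu i j
           \<and> (\<forall>(i', j')\<in>E. \<forall>k\<ge>1. alpha i' j' k = alpha i' j' 1 / real k powr gamma i' j')
           \<and> (\<forall>i'<N. \<forall>k\<ge>1. beta i' k = beta i' 1 / real k)
           \<and> (\<forall>(i', j')\<in>E. gamma i' j' = gamma j' i' \<and> 1 / 2 < gamma i' j' \<and> gamma i' j' \<le> 1
                            \<and> nu i' j' + gamma i' j' \<le> 1)
           \<and> a_const N n a nu gamma b alpha beta theta delta Hbar > h_const N a nu gamma - 1 / 2"
      show "AE \<omega> in M. \<exists>C. \<forall>k\<ge>2. rate \<omega> i j k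
        \<le> exp (norm1 n theta / b i j) / ((1 - nu i j) * real k powr nu i j)
          + C * (sqrt (ln (real k)) / real k powr (h_const N a nu gamma - 1 / 2 + nu i j))"
        unfolding h_def[symmetric]
      proof (rule part3)
        show "alpha i j k = alpha i j 1 / real k powr gamma i j" if "(i, j) \<in> edges N a" "1 \<le> k" for i j k
          using hyp that unfolding E_def by blast
        show "beta i k = beta i 1 / real k" if "i < N" "1 \<le> k" for i k using hyp that by blast
        show "1 / 2 < gamma i j \<and> gamma i j \<le> 1 \<and> nu i j + gamma i j \<le> 1" if "(i, j) \<in> edges N a" for i j
          using hyp that unfolding E_def by blast
      qed (use hyp in \<open>simp_all add: h_def\<close>)
    qed
  qed
  show ?thesis by (intro ballI, clarify, rule main)
qed

end
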